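(* For every $x\in X$, the function $G_1(z)\cdot\omega(x;z)$ is invariant under the action of the symmetric group $S_n$ on $z$ by permutation of coordinates, where $$G_1(z)=\prod_{1\le i<j\le n}\frac{1+q^{z_i-z_j}}{1-q^{z_i-z_j-1}}.$$
   Context: Let $k$ be a finite extension of $\mathbb{Q}_p$, $p$ odd, $k'$ its unramified quadratic extension, $a\mapsto a^*$ the conjugation of $k'/k$ and $a^*$ also conjugate transpose. Let $\pi$ be a prime of $k$, $q$ the residue field cardinality, $|\cdot|$ the absolute value on $k$ with $|\pi|=q^{-1}$. Let $n\ge1$, $j_{2n+1}$ the anti-diagonal matrix of $1$'s, $G=\{g\in GL_{2n+1}(k'):g^*j_{2n+1}g=j_{2n+1}\}$, $K=G\cap M_{2n+1}(\mathcal{O}_{k'})$ with normalized Haar measure $dk$, $X=\{x\in G:x^*=x,\ \det(t-xj_{2n+1})=(t^2-1)^n(t-1)\}$, $g\cdot x=gxg^*$. $d_i(y)$ is the determinant of the lower right $i\times i$ block of $y$. $\omega(x;s)=\int_K\prod_{i=1}^n|d_i(k\cdot x)|^{s_i}dk$ (over $k$ with all $d_i(k\cdot x)\ne0$), convergent for $\mathrm{Re}(s_i)\ge0$ and continued as a rational function of $q^{s_1},\dots,q^{s_n}$; $z\in\mathbb{C}^n$ is related to $s$ by $s_i=-z_i+z_{i+1}-1+\frac{\pi\sqrt{-1}}{\log q}$ ($1\le i\le n-1$), $s_n=-z_n-1+\frac{\pi\sqrt{-1}}{2\log q}$, and $\omega(x;z)=\omega(x;s)$. *)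

theory Defs
  imports
    "HOL-Analysis.Analysis"
    "HOL-Algebra.Algebraic_Closure_Type"
    "HOL-Algebra.Embedded_Algebras"
    "HOL-Combinatorics.Permutations"
    "Jordan_Normal_Form.Char_Poly"
begin

section \<open>The fields\<close>

text \<open>
  The field \<open>k'\<close> is the whole type \<open>'a\<close>; \<open>k\<close> is a subset of it, and \<open>\<bbbQ>\<^sub>p\<close> is the topological
  closure of the prime field. The function \<open>nv\<close> is the absolute value of \<open>k\<close>, extended to \<open>k'\<close>.
\<close>

locale nonarch_abs_value =
  fixes nv :: "'a::field_char_0 \<Rightarrow> real"
  assumes nv_nonneg: "0 \<le> nv a"
    and nv_eq_0_iff: "nv a = 0 \<longleftrightarrow> a = 0"
    and nv_mult: "nv (a * b) = nv a * nv b"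
    and nv_ultrametric: "nv (a + b) \<le> max (nv a) (nv b)"

definition nv_dist :: "('a::field_char_0 \<Rightarrow> real) \<Rightarrow> 'a \<Rightarrow> 'a \<Rightarrow> real" where
  "nv_dist nv a b = nv (a - b)"

definition padic_valuation :: "nat \<Rightarrow> rat \<Rightarrow> int" where
  "padic_valuation p r =
     int (multiplicity (int p) (fst (quotient_of r))) - int (multiplicity (int p) (snd (quotient_of r)))"

definition padic_abs :: "nat \<Rightarrow> rat \<Rightarrow> real" where
  "padic_abs p r = (if r = 0 then 0 else real p powi (- padic_valuation p r))"

definition rat_closure :: "('a::field_char_0 \<Rightarrow> real) \<Rightarrow> 'a set" where
  "rat_closure nv = Metric_space.mtopology UNIV (nv_dist nv) closure_of range of_rat"

text \<open>
  \<open>\<bbbQ>\<^sub>p\<close> is the completion of \<open>\<bbbQ>\<close> at the \<open>p\<close>-adic absolute value. The normalisation of \<open>nv\<close> is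
  the one of \<open>k\<close>, so on \<open>\<bbbQ>\<close> it is only a power of the \<open>p\<close>-adic absolute value.
\<close>
definition rat_closure_is_Qp :: "('a::field_char_0 \<Rightarrow> real) \<Rightarrow> nat \<Rightarrow> bool" where
  "rat_closure_is_Qp nv p \<longleftrightarrow>
     (\<exists>c>0. \<forall>r. nv (of_rat r) = padic_abs p r powr c) \<and>
     Metric_space.mcomplete (rat_closure nv) (nv_dist nv)"

definition val_ring :: "('a::field_char_0 \<Rightarrow> real) \<Rightarrow> 'a set \<Rightarrow> 'a set" where
  "val_ring nv F = {a \<in> F. nv a \<le> 1}"

definition max_ideal :: "('a::field_char_0 \<Rightarrow> real) \<Rightarrow> 'a set \<Rightarrow> 'a set" where
  "max_ideal nv F = {a \<in> F. nv a < 1}"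

definition residue_card :: "('a::field_char_0 \<Rightarrow> real) \<Rightarrow> 'a set \<Rightarrow> nat" where
  "residue_card nv F =
     card (val_ring nv F // {(a, b). a \<in> val_ring nv F \<and> b \<in> val_ring nv F \<and> a - b \<in> max_ideal nv F})"

locale unramified_quadratic_extension = nonarch_abs_value nv
  for nv :: "'a::field_char_0 \<Rightarrow> real" +
  fixes p :: nat and k :: "'a set" and prm :: 'a and cj :: "'a \<Rightarrow> 'a"
  assumes p_prime: "Factorial_Ring.prime p" and p_odd: "odd p"
    and Qp: "rat_closure_is_Qp nv p"
    and k_subfield: "subfield k (ring_of_type_algebra :: 'a ring)"
    and k_finite_over_Qp:
      "ring.finite_dimension (ring_of_type_algebra :: 'a ring) (rat_closure nv) k"
    and quadratic: "ring.dimension (ring_of_type_algebra :: 'a ring) 2 k UNIV"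
    and unramified: "nv ` (UNIV - {0}) = nv ` (k - {0})"
    and prm_generates: "prm \<in> k" "max_ideal nv k = (\<lambda>b. prm * b) ` val_ring nv k"
    and nv_prm: "nv prm = 1 / real (residue_card nv k)"
    and cj_add: "cj (a + b) = cj a + cj b"
    and cj_mult: "cj (a * b) = cj a * cj b"
    and cj_fixes: "a \<in> k \<Longrightarrow> cj a = a"
    and cj_nontrivial: "cj \<noteq> id"

section \<open>The groups and the space\<close>

definition conj_transpose :: "('a \<Rightarrow> 'a) \<Rightarrow> 'a mat \<Rightarrow> 'a mat" where
  "conj_transpose cj y = map_mat cj (transpose_mat y)"

definition antidiag :: "nat \<Rightarrow> 'a::zero_neq_one mat" where
  "antidiag N = Matrix.mat N N (\<lambda>(i, j). if i + j + 1 = N then 1 else 0)"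

definition unitary_G :: "('a::field_char_0 \<Rightarrow> 'a) \<Rightarrow> nat \<Rightarrow> 'a mat set" where
  "unitary_G cj n = {g \<in> carrier_mat (2*n+1) (2*n+1). invertible_mat g \<and>
     conj_transpose cj g * antidiag (2*n+1) * g = antidiag (2*n+1)}"

definition unitary_K :: "('a::field_char_0 \<Rightarrow> real) \<Rightarrow> ('a \<Rightarrow> 'a) \<Rightarrow> nat \<Rightarrow> 'a mat set" where
  "unitary_K nv cj n = {g \<in> unitary_G cj n.
     \<forall>i<2*n+1. \<forall>j<2*n+1. g $$ (i, j) \<in> val_ring nv UNIV}"

definition space_X :: "('a::field_char_0 \<Rightarrow> 'a) \<Rightarrow> nat \<Rightarrow> 'a mat set" where
  "space_X cj n = {x \<in> unitary_G cj n. conj_transpose cj x = x \<and>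
     char_poly (x * antidiag (2*n+1)) = ([:0, 1:]\<^sup>2 - 1) ^ n * ([:0, 1:] - 1)}"

definition act :: "('a::field_char_0 \<Rightarrow> 'a) \<Rightarrow> 'a mat \<Rightarrow> 'a mat \<Rightarrow> 'a mat" where
  "act cj g x = g * x * conj_transpose cj g"

definition lower_right_minor :: "nat \<Rightarrow> 'a::comm_ring_1 mat \<Rightarrow> 'a" where
  "lower_right_minor i y = Determinant.det
     (Matrix.mat i i (\<lambda>(a, b). y $$ (dim_row y - i + a, dim_col y - i + b)))"

section \<open>Haar measure\<close>

definition mat_dist :: "('a::field_char_0 \<Rightarrow> real) \<Rightarrow> 'a mat \<Rightarrow> 'a mat \<Rightarrow> real" where
  "mat_dist nv g h =
     (MAX (i, j) \<in> {..<dim_row g} \<times> {..<dim_col g}. nv_dist nv (g $$ (i, j)) (h $$ (i, j)))"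

text \<open>Left invariance suffices, the groups of interest being compact.\<close>
definition normalized_haar ::
    "('a::field_char_0 \<Rightarrow> real) \<Rightarrow> 'a mat set \<Rightarrow> 'a mat measure \<Rightarrow> bool" where
  "normalized_haar nv H M \<longleftrightarrow>
     space M = H \<and>
     sets M = sigma_sets H {U. openin (Metric_space.mtopology H (mat_dist nv)) U} \<and>
     emeasure M H = 1 \<and>
     (\<forall>g\<in>H. \<forall>A\<in>sets M. emeasure M ((\<lambda>h. g * h) ` A) = emeasure M A)"

section \<open>The spherical function\<close>

text \<open>
  Points of \<open>\<complex>\<^sup>n\<close> are functions of type \<open>nat \<Rightarrow> complex\<close> of which only the values on \<open>{1..n}\<close>
  are used.
\<close>

definition omega_integral ::
    "('a::field_char_0 \<Rightarrow> real) \<Rightarrow> ('a \<Rightarrow> 'a) \<Rightarrow> nat \<Rightarrow> 'a mat measure \<Rightarrow> 'a mat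
      \<Rightarrow> (nat \<Rightarrow> complex) \<Rightarrow> complex" where
  "omega_integral nv cj n M x s =
     (LINT g : {g \<in> space M. \<forall>i\<in>{1..n}. lower_right_minor i (act cj g x) \<noteq> 0} | M.
        \<Prod>i=1..n. complex_of_real (nv (lower_right_minor i (act cj g x))) powr s i)"

definition polynomial_fun :: "nat \<Rightarrow> ((nat \<Rightarrow> complex) \<Rightarrow> complex) \<Rightarrow> bool" where
  "polynomial_fun n P \<longleftrightarrow>
     (\<exists>(A :: (nat \<Rightarrow> nat) set) c. finite A \<and> P = (\<lambda>t. \<Sum>e\<in>A. c e * (\<Prod>i=1..n. t i ^ e i)))"

definition q_power :: "nat \<Rightarrow> (nat \<Rightarrow> complex) \<Rightarrow> nat \<Rightarrow> complex" where
  "q_power q s i = of_nat q powr s i"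

definition rational_continuation ::
    "nat \<Rightarrow> nat \<Rightarrow> ((nat \<Rightarrow> complex) \<Rightarrow> complex)
      \<Rightarrow> ((nat \<Rightarrow> complex) \<Rightarrow> complex) \<Rightarrow> ((nat \<Rightarrow> complex) \<Rightarrow> complex) \<Rightarrow> bool" where
  "rational_continuation q n f P Q \<longleftrightarrow>
     polynomial_fun n P \<and> polynomial_fun n Q \<and> (\<exists>t. Q t \<noteq> 0) \<and>
     (\<forall>s. (\<forall>i\<in>{1..n}. 0 \<le> Re (s i)) \<and> Q (q_power q s) \<noteq> 0
        \<longrightarrow> f s = P (q_power q s) / Q (q_power q s))"

text \<open>
  The continuation is a meromorphic function on \<open>\<complex>\<^sup>n\<close>. It is regular at \<open>s\<close> if one of the
  fractions representing it has a nonvanishing denominator there; its value at \<open>s\<close> does not depend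
  on the fraction, since the points \<open>q\<^sup>s\<close> with \<open>Re s\<^sub>i \<ge> 0\<close> are Zariski dense.
\<close>

definition omega_regular ::
    "('a::field_char_0 \<Rightarrow> real) \<Rightarrow> ('a \<Rightarrow> 'a) \<Rightarrow> nat \<Rightarrow> nat \<Rightarrow> 'a mat measure \<Rightarrow> 'a mat
      \<Rightarrow> (nat \<Rightarrow> complex) \<Rightarrow> bool" where
  "omega_regular nv cj q n M x s \<longleftrightarrow>
     (\<exists>P Q. rational_continuation q n (omega_integral nv cj n M x) P Q \<and> Q (q_power q s) \<noteq> 0)"

definition omega ::
    "('a::field_char_0 \<Rightarrow> real) \<Rightarrow> ('a \<Rightarrow> 'a) \<Rightarrow> nat \<Rightarrow> nat \<Rightarrow> 'a mat measure \<Rightarrow> 'a mat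
      \<Rightarrow> (nat \<Rightarrow> complex) \<Rightarrow> complex" where
  "omega nv cj q n M x s =
     (THE w. \<exists>P Q. rational_continuation q n (omega_integral nv cj n M x) P Q \<and>
        Q (q_power q s) \<noteq> 0 \<and> w = P (q_power q s) / Q (q_power q s))"

definition s_of_z :: "nat \<Rightarrow> nat \<Rightarrow> (nat \<Rightarrow> complex) \<Rightarrow> nat \<Rightarrow> complex" where
  "s_of_z q n z i =
     (if i < n then - z i + z (i + 1) - 1 + complex_of_real pi * \<i> / complex_of_real (ln (real q))
      else - z n - 1 + complex_of_real pi * \<i> / (2 * complex_of_real (ln (real q))))"

definition G1_regular :: "nat \<Rightarrow> nat \<Rightarrow> (nat \<Rightarrow> complex) \<Rightarrow> bool" where
  "G1_regular q n z \<longleftrightarrow>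
     (\<forall>i j. 1 \<le> i \<and> i < j \<and> j \<le> n \<longrightarrow> 1 - of_nat q powr (z i - z j - 1) \<noteq> (0 :: complex))"

definition G1 :: "nat \<Rightarrow> nat \<Rightarrow> (nat \<Rightarrow> complex) \<Rightarrow> complex" where
  "G1 q n z = (\<Prod>(i, j) \<in> {(i, j). 1 \<le> i \<and> i < j \<and> j \<le> n}.
     (1 + of_nat q powr (z i - z j)) / (1 - of_nat q powr (z i - z j - 1)))"

end

theory Submission
  imports Defs "HOL-Complex_Analysis.Complex_Analysis"
begin

text \<open>
  It suffices to treat an adjacent transposition of \<open>z\<^sub>i\<close> and \<open>z\<^bsub>i+1\<^esub>\<close>. A copy of \<open>GL\<^sub>2\<close> inside \<open>K\<close> acts on the two rows that
  distinguish \<open>d\<^bsub>i-1\<^esub>\<close>, \<open>d\<^sub>i\<close> and \<open>d\<^bsub>i+1\<^esub>\<close>: it preserves the absolute values of all other minors, and \<open>d\<^sub>i\<close> is the lower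
  right entry of a binary Hermitian form (a Schur complement) of determinant \<open>d\<^bsub>i-1\<^esub> d\<^bsub>i+1\<^esub>\<close>, on which the group acts.
  The distribution of the valuation of that entry over the orbit depends only on the content \<open>e\<close> of the form and the
  valuation \<open>2 e + m\<close> of its determinant. Up to the factor \<open>(q - U) / (1 + U)\<close> with \<open>U = q\<^bsup>z\<^sub>i - z\<^sub>i\<^sub>+\<^sub>1\<^esup>\<close>, which \<open>G\<^sub>1\<close> cancels, its
  generating function is a palindromic polynomial of degree \<open>m\<close> in \<open>U\<close>. Averaging therefore writes the
  integral in \<open>Re s\<^sub>i \<ge> 0\<close> as one that still converges, and satisfies the exchange relation, in a strip that the
  transposition preserves; rational functions of \<open>q\<^sup>s\<close> that agree on an open set agree everywhere.
\<close>

section \<open>Complete discretely valued fields\<close>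

text \<open>Convergence at z requires Re (z_i - z_{i+1}) <= -1, and at the exchanged point Re (z_i -
  z_{i+1}) >= 1, so the two sides of the functional equation are never both convergent integrals.
  The strip between is reached because averaging replaces |d_i|^{s_i}, singular at d_i = 0 for
  negative exponents, by a factor entire in s_i. The price is a power of |d_{i-1} d_{i+1}|, paid by
  large neighbouring exponents. The exchange then fixes the averaged integrand pointwise, since e
  and m belong to the form and not to z. Measurability is an obstacle of its own: the definition of
  the measure gives invariance on measurable sets, but neither measurable translations nor
  measurable minors. The former come from invariance and total mass 1, the latter from a nonzero
  value of the integral; if the continuation vanishes identically, nothing is to be proved.
  Denominators of the continuation may vanish anywhere, so identities are kept cross-multiplied,
  between functions entire along complex lines, until the end.\<close>

context nonarch_abs_value
begin

lemma nv_0 [simp]: "nv 0 = 0"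
  by (simp add: nv_eq_0_iff)

lemma nv_pos_iff: "0 < nv a \<longleftrightarrow> a \<noteq> 0"
  using nv_nonneg[of a] nv_eq_0_iff[of a] by linarith

lemma nv_1 [simp]: "nv 1 = 1"
  using nv_mult[of 1 1] nv_eq_0_iff[of 1] by simp

lemma nv_minus [simp]: "nv (- a) = nv a"
proof -
  have "nv (- a) * nv (- a) = nv a * nv a"
    by (simp flip: nv_mult)
  thus ?thesis
    by (metis nv_nonneg power2_eq_square power2_eq_iff_nonneg)
qed

lemma nv_minus_commute: "nv (a - b) = nv (b - a)"
  by (metis minus_diff_eq nv_minus)

lemma nv_power: "nv (a ^ j) = nv a ^ j"
  by (induction j) (simp_all add: nv_mult)

lemma nv_inverse: "nv (inverse a) = inverse (nv a)"
proof (cases "a = 0")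
  case False
  hence "nv a * nv (inverse a) = 1"
    by (simp flip: nv_mult)
  thus ?thesis
    by (simp add: inverse_unique)
qed simp

lemma nv_divide: "nv (a / b) = nv a / nv b"
  by (simp add: divide_inverse nv_mult nv_inverse)

lemma nv_power_int: "nv (a powi j) = nv a powi j"
  by (simp add: power_int_def nv_power nv_inverse)

lemma nv_add_le: "nv a \<le> r \<Longrightarrow> nv b \<le> r \<Longrightarrow> nv (a + b) \<le> r"
  using nv_ultrametric[of a b] by linarith

lemma nv_add_less: "nv a < r \<Longrightarrow> nv b < r \<Longrightarrow> nv (a + b) < r"
  using nv_ultrametric[of a b] by linarith

lemma nv_diff_le: "nv a \<le> r \<Longrightarrow> nv b \<le> r \<Longrightarrow> nv (a - b) \<le> r"
  using nv_add_le[of a r "- b"] by simp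

lemma nv_diff_less: "nv a < r \<Longrightarrow> nv b < r \<Longrightarrow> nv (a - b) < r"
  using nv_add_less[of a r "- b"] by simp

lemma nv_add_eq: "nv a < nv b \<Longrightarrow> nv (a + b) = nv b"
  using nv_add_le[of a "nv b" b] nv_diff_less[of "a + b" "nv b" a]
  by force

lemma nv_sum_le: "(\<And>i. i \<in> I \<Longrightarrow> nv (f i) \<le> r) \<Longrightarrow> 0 \<le> r \<Longrightarrow> nv (sum f I) \<le> r"
  by (induction I rule: infinite_finite_induct) (auto intro: nv_add_le)

lemma nv_prod: "nv (prod f I) = (\<Prod>i\<in>I. nv (f i))"
  by (induction I rule: infinite_finite_induct) (auto simp: nv_mult)

lemma Metric_space_nv: "Metric_space S (nv_dist nv)"
proof
  fix a b c
  show "nv_dist nv a b = nv_dist nv b a"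
    by (simp add: nv_dist_def nv_minus_commute)
  show "nv_dist nv a b = 0 \<longleftrightarrow> a = b"
    by (simp add: nv_dist_def nv_eq_0_iff)
  show "nv_dist nv a c \<le> nv_dist nv a b + nv_dist nv b c"
    using nv_ultrametric[of "a - b" "b - c"] nv_nonneg[of "a - b"] nv_nonneg[of "b - c"]
    by (simp add: nv_dist_def)
qed (simp add: nv_dist_def nv_nonneg)

definition nv_Cauchy :: "(nat \<Rightarrow> 'a) \<Rightarrow> bool" where
  "nv_Cauchy f \<longleftrightarrow> (\<forall>e>0. \<exists>N. \<forall>i\<ge>N. \<forall>j\<ge>N. nv (f i - f j) < e)"

definition nv_complete :: "'a set \<Rightarrow> bool" where
  "nv_complete S \<longleftrightarrow>
     (\<forall>f. (\<forall>i. f i \<in> S) \<and> nv_Cauchy f \<longrightarrow> (\<exists>l\<in>S. (\<lambda>i. nv (f i - l)) \<longlonglongrightarrow> 0))"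

lemma nv_complete_iff_mcomplete: "Metric_space.mcomplete S (nv_dist nv) \<longleftrightarrow> nv_complete S"
proof -
  interpret Metric_space S "nv_dist nv" by (rule Metric_space_nv)
  have lim: "limitin mtopology f l sequentially \<longleftrightarrow> l \<in> S \<and> (\<lambda>i. nv (f i - l)) \<longlonglongrightarrow> 0"
    if "\<forall>i. f i \<in> S" for f l
    using that by (simp add: limit_metric_sequentially nv_dist_def LIMSEQ_iff nv_nonneg)
  show ?thesis
    unfolding mcomplete_def nv_complete_def MCauchy_def nv_Cauchy_def
    by (simp add: image_subset_iff nv_dist_def imp_conjL lim) (metis lim)
qed

lemma nv_complete_limit_in:
  assumes "nv_complete S" "\<And>e. 0 < e \<Longrightarrow> \<exists>s\<in>S. nv (s - a) < e"
  shows "a \<in> S"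
proof -
  have "\<forall>i. \<exists>s\<in>S. nv (s - a) < 1 / real (Suc i)"
    using assms(2) by simp
  then obtain f where f: "\<And>i. f i \<in> S" "\<And>i. nv (f i - a) < 1 / real (Suc i)"
    by metis
  have "(\<lambda>i. nv (f i - a)) \<longlonglongrightarrow> 0"
  proof (rule tendsto_sandwich[OF _ _ tendsto_const LIMSEQ_Suc[OF lim_1_over_n]])
    show "\<forall>\<^sub>F i in sequentially. nv (f i - a) \<le> 1 / of_nat (Suc i)"
      using f(2) by (simp add: less_imp_le)
  qed (simp add: nv_nonneg)
  hence lim: "\<forall>e>0. \<exists>N. \<forall>i\<ge>N. nv (f i - a) < e"
    by (simp add: LIMSEQ_iff nv_nonneg)
  have "nv_Cauchy f"
    unfolding nv_Cauchy_def
  proof (intro allI impI)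
    fix e :: real assume "e > 0"
    then obtain N where N: "\<And>i. i \<ge> N \<Longrightarrow> nv (f i - a) < e"
      using lim by blast
    show "\<exists>N. \<forall>i\<ge>N. \<forall>j\<ge>N. nv (f i - f j) < e"
      using nv_diff_less[OF N N] by (intro exI[of _ N]) simp
  qed
  then obtain l where l: "l \<in> S" "(\<lambda>i. nv (f i - l)) \<longlonglongrightarrow> 0"
    using assms(1) f(1) unfolding nv_complete_def by blast
  have "a - l = 0"
  proof (rule ccontr)
    assume "a - l \<noteq> 0"
    hence pos: "nv (a - l) > 0"
      by (simp only: nv_pos_iff not_False_eq_True)
    obtain N1 where N1: "\<And>i. i \<ge> N1 \<Longrightarrow> nv (f i - a) < nv (a - l)"
      using lim pos by blast
    obtain N2 where N2: "\<And>i. i \<ge> N2 \<Longrightarrow> nv (f i - l) < nv (a - l)"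
      using l(2) pos by (fastforce simp: LIMSEQ_iff nv_nonneg)
    show False
      using nv_diff_less[OF N2 N1, of "max N1 N2" "max N1 N2"] by simp
  qed
  thus ?thesis using l(1) by simp
qed

text \<open>Completeness makes \<open>E\<close> closed, so \<open>v\<close> has a positive distance
  \<open>r\<close> from it, and scaling by \<open>c\<close> turns that distance into the estimate.
  No local compactness of the scalars is needed.\<close>

lemma nv_dist_complement:
  assumes "nv_complete E" "v \<notin> E"
    and "\<And>c e. c \<in> F \<Longrightarrow> e \<in> E \<Longrightarrow> c * e \<in> E" "\<And>c. c \<in> F \<Longrightarrow> inverse c \<in> F"
    and "\<And>e. e \<in> E \<Longrightarrow> - e \<in> E"
  obtains r where "r > 0" "\<And>c e. c \<in> F \<Longrightarrow> e \<in> E \<Longrightarrow> r * nv c \<le> nv (c * v + e)"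
proof -
  obtain r where r: "r > 0" "\<And>e. e \<in> E \<Longrightarrow> r \<le> nv (e - v)"
    using nv_complete_limit_in[OF assms(1), of v] assms(2) by (meson not_le)
  have "r * nv c \<le> nv (c * v + e)" if "c \<in> F" "e \<in> E" for c e
  proof (cases "c = 0")
    case False
    have "- (inverse c * e) \<in> E"
      using that assms by blast
    hence "r \<le> nv (v + inverse c * e)"
      using r(2)[of "- (inverse c * e)"] nv_minus_commute by fastforce
    hence "r * nv c \<le> nv (v + inverse c * e) * nv c"
      by (simp add: mult_right_mono nv_nonneg)
    also have "\<dots> = nv ((v + inverse c * e) * c)"
      by (simp add: nv_mult)
    also have "(v + inverse c * e) * c = c * v + e"
      using False by (simp add: algebra_simps)
    finally show ?thesis .
  qed (simp add: nv_nonneg)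
  with r(1) that show ?thesis by blast
qed

text \<open>By \<open>nv_dist_complement\<close> the coefficient of \<open>v\<close> is bounded by
  the whole vector, so the coefficients of a Cauchy sequence are Cauchy, and then so are the
  components in \<open>E\<close>. This is the induction step for the completeness of
  finite-dimensional spaces.\<close>

lemma nv_complete_line_extension:
  assumes F: "nv_complete F" and E: "nv_complete E" and v: "v \<notin> E"
    and smult: "\<And>c e. c \<in> F \<Longrightarrow> e \<in> E \<Longrightarrow> c * e \<in> E" and inv: "\<And>c. c \<in> F \<Longrightarrow> inverse c \<in> F"
    and minus: "\<And>e. e \<in> E \<Longrightarrow> - e \<in> E"
    and diffE: "\<And>e e'. e \<in> E \<Longrightarrow> e' \<in> E \<Longrightarrow> e - e' \<in> E"
    and diffF: "\<And>e e'. e \<in> F \<Longrightarrow> e' \<in> F \<Longrightarrow> e - e' \<in> F"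
  shows "nv_complete {c * v + e | c e. c \<in> F \<and> e \<in> E}"
  unfolding nv_complete_def
proof (intro allI impI; elim conjE)
  fix f :: "nat \<Rightarrow> 'a"
  assume "\<forall>i. f i \<in> {c * v + e | c e. c \<in> F \<and> e \<in> E}" and Cauchy: "nv_Cauchy f"
  then obtain a b where ab: "\<And>i. f i = a i * v + b i" "\<And>i. a i \<in> F" "\<And>i. b i \<in> E"
    by (simp add: set_eq_iff) metis
  obtain r where r: "r > 0" "\<And>c e. c \<in> F \<Longrightarrow> e \<in> E \<Longrightarrow> r * nv c \<le> nv (c * v + e)"
    using nv_dist_complement[OF E v smult inv minus] by metis
  have le: "r * nv (a i - a j) \<le> nv (f i - f j)" for i j
    using r(2)[of "a i - a j" "b i - b j"] ab diffE diffF by (simp add: algebra_simps)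
  have cauchy_a: "nv_Cauchy a"
    unfolding nv_Cauchy_def
  proof (intro allI impI)
    fix e :: real assume "e > 0"
    then obtain N where "\<forall>i\<ge>N. \<forall>j\<ge>N. nv (f i - f j) < r * e"
      using Cauchy r(1) unfolding nv_Cauchy_def by (meson mult_pos_pos)
    hence "\<forall>i\<ge>N. \<forall>j\<ge>N. r * nv (a i - a j) < r * e"
      using le le_less_trans by blast
    thus "\<exists>N. \<forall>i\<ge>N. \<forall>j\<ge>N. nv (a i - a j) < e"
      using r(1) by auto
  qed
  then obtain l where l: "l \<in> F" "(\<lambda>i. nv (a i - l)) \<longlonglongrightarrow> 0"
    using F ab(2) unfolding nv_complete_def by blast
  have "nv_Cauchy b"
    unfolding nv_Cauchy_def
  proof (intro allI impI)
    fix e :: real assume "e > 0"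
    then obtain N where N: "\<forall>i\<ge>N. \<forall>j\<ge>N. nv (f i - f j) < e"
      using Cauchy unfolding nv_Cauchy_def by meson
    have "e / (nv v + 1) > 0"
      using \<open>e > 0\<close> nv_nonneg[of v] by simp
    then obtain N' where N': "\<forall>i\<ge>N'. \<forall>j\<ge>N'. nv (a i - a j) < e / (nv v + 1)"
      using cauchy_a unfolding nv_Cauchy_def by meson
    have "nv (b i - b j) < e" if "i \<ge> max N N'" "j \<ge> max N N'" for i j
    proof -
      have "nv ((a i - a j) * v) < e"
      proof -
        have "nv ((a i - a j) * v) \<le> nv (a i - a j) * (nv v + 1)"
          by (simp add: nv_mult mult_left_mono nv_nonneg)
        also have "\<dots> < e"
          using N' that nv_nonneg[of v] by (simp add: pos_less_divide_eq)
        finally show ?thesis .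
      qed
      hence "nv ((f i - f j) - (a i - a j) * v) < e"
        using N that by (intro nv_diff_less[of "f i - f j"]) auto
      thus ?thesis by (simp add: ab algebra_simps)
    qed
    thus "\<exists>N. \<forall>i\<ge>N. \<forall>j\<ge>N. nv (b i - b j) < e" by blast
  qed
  then obtain m where m: "m \<in> E" "(\<lambda>i. nv (b i - m)) \<longlonglongrightarrow> 0"
    using E ab(3) unfolding nv_complete_def by blast
  have "(\<lambda>i. nv (f i - (l * v + m))) \<longlonglongrightarrow> 0"
  proof (rule tendsto_sandwich[OF _ _ tendsto_const])
    show "\<forall>\<^sub>F i in sequentially. nv (f i - (l * v + m)) \<le> nv (a i - l) * nv v + nv (b i - m)"
    proof (intro always_eventually allI)
      fix i
      have "nv (f i - (l * v + m)) = nv ((a i - l) * v + (b i - m))"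
        by (simp add: ab algebra_simps)
      also have "\<dots> \<le> nv (a i - l) * nv v + nv (b i - m)"
        using nv_ultrametric[of "(a i - l) * v" "b i - m"] nv_nonneg[of "b i - m"]
          nv_nonneg[of "(a i - l) * v"] by (simp add: nv_mult)
      finally show "nv (f i - (l * v + m)) \<le> nv (a i - l) * nv v + nv (b i - m)" .
    qed
    show "(\<lambda>i. nv (a i - l) * nv v + nv (b i - m)) \<longlonglongrightarrow> 0"
      using tendsto_add[OF tendsto_mult_right[OF l(2), of "nv v"] m(2)] by simp
  qed (simp add: nv_nonneg)
  thus "\<exists>l\<in>{c * v + e | c e. c \<in> F \<and> e \<in> E}. (\<lambda>i. nv (f i - l)) \<longlonglongrightarrow> 0"
    using l(1) m(1) by blast
qed

lemma rat_closure_iff: "a \<in> rat_closure nv \<longleftrightarrow> (\<forall>e>0. \<exists>r. nv (a - of_rat r) < e)"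
proof -
  interpret Metric_space UNIV "nv_dist nv" by (rule Metric_space_nv)
  show ?thesis
    by (auto simp: rat_closure_def metric_closure_of nv_dist_def)
qed

lemma of_rat_in_rat_closure: "of_rat r \<in> rat_closure nv"
  unfolding rat_closure_iff by (intro allI impI exI[of _ r]) simp

lemma rat_closure_diff:
  assumes "a \<in> rat_closure nv" "b \<in> rat_closure nv"
  shows "a - b \<in> rat_closure nv"
  unfolding rat_closure_iff
proof (intro allI impI)
  fix e :: real assume "e > 0"
  then obtain r s where "nv (a - of_rat r) < e" "nv (b - of_rat s) < e"
    using assms unfolding rat_closure_iff by blast
  thus "\<exists>r. nv (a - b - of_rat r) < e"
    using nv_diff_less[of "a - of_rat r" e "b - of_rat s"]
    by (intro exI[of _ "r - s"]) (simp add: of_rat_diff algebra_simps)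
qed

lemma rat_closure_mult:
  assumes "a \<in> rat_closure nv" "b \<in> rat_closure nv"
  shows "a * b \<in> rat_closure nv"
  unfolding rat_closure_iff
proof (intro allI impI)
  fix e :: real assume e: "e > 0"
  have pos: "e / (nv b + 1) > 0"
    using e nv_nonneg[of b] by simp
  obtain r where r: "nv (a - of_rat r) < e / (nv b + 1)"
    using assms(1) pos unfolding rat_closure_iff by blast
  have pos: "e / (nv (of_rat r) + 1) > 0"
    using e nv_nonneg[of "of_rat r"] by simp
  obtain s where s: "nv (b - of_rat s) < e / (nv (of_rat r) + 1)"
    using assms(2) pos unfolding rat_closure_iff by blast
  have 1: "nv ((a - of_rat r) * b) < e"
  proof -
    have "nv ((a - of_rat r) * b) \<le> nv (a - of_rat r) * (nv b + 1)"
      by (simp add: nv_mult mult_left_mono nv_nonneg)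
    also have "\<dots> < e"
      using r nv_nonneg[of b] by (simp add: pos_less_divide_eq)
    finally show ?thesis .
  qed
  have 2: "nv (of_rat r * (b - of_rat s)) < e"
  proof -
    have "nv (of_rat r * (b - of_rat s)) \<le> nv (b - of_rat s) * (nv (of_rat r) + 1)"
      using mult_right_mono[of "nv (of_rat r)" "nv (of_rat r) + 1" "nv (b - of_rat s)"]
      by (simp add: nv_mult nv_nonneg mult.commute)
    also have "\<dots> < e"
      using s nv_nonneg[of "of_rat r"] by (simp add: pos_less_divide_eq)
    finally show ?thesis .
  qed
  have "a * b - of_rat (r * s) = (a - of_rat r) * b + of_rat r * (b - of_rat s)"
    by (simp add: of_rat_mult algebra_simps)
  thus "\<exists>r. nv (a * b - of_rat r) < e"
    using nv_add_less[OF 1 2] by metis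
qed

lemma rat_closure_inverse:
  assumes "a \<in> rat_closure nv"
  shows "inverse a \<in> rat_closure nv"
proof (cases "a = 0")
  case False
  show ?thesis
    unfolding rat_closure_iff
  proof (intro allI impI)
    fix e :: real assume "e > 0"
    \<comment> \<open>The first bound forces the approximating rational to have the same absolute
      value as \<open>a\<close>; the second then controls the numerator of 1/a - 1/r = (r - a)/(a
      r).\<close>
    define d where "d = min (nv a) (e * nv a * nv a)"
    have "d > 0"
      using False \<open>e > 0\<close> by (simp add: d_def nv_pos_iff)
    then obtain r where r: "nv (a - of_rat r) < d"
      using assms unfolding rat_closure_iff by blast
    have eq: "nv (of_rat r) = nv a"
      using nv_add_eq[of "of_rat r - a" a] r nv_minus_commute[of a] by (simp add: d_def)
    hence nz: "of_rat r \<noteq> (0 :: 'a)"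
      using False nv_eq_0_iff by metis
    have "nv (inverse a - of_rat (inverse r)) = nv ((of_rat r - a) / (a * of_rat r))"
      unfolding of_rat_inverse using False nz by (simp add: divide_simps)
    also have "\<dots> = nv (a - of_rat r) / (nv a * nv a)"
      by (simp add: nv_divide nv_mult eq nv_minus_commute)
    also have "\<dots> < e"
      using r False by (simp add: d_def nv_pos_iff divide_less_eq mult.assoc)
    finally show "\<exists>r. nv (inverse a - of_rat r) < e" by blast
  qed
qed (use assms in simp)

end

lemma line_extension_of_type:
  "ring.line_extension (ring_of_type_algebra :: 'a::comm_ring_1 ring) K v E = {c * v + e | c e. c \<in> K \<and> e \<in> E}"
  using ring.line_extension_mem_iff[OF ring_from_type_algebra, of _ K v E]
  by (auto simp: set_eq_iff ring_of_type_algebra_def)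


section \<open>The quadratic extension: completeness of \<open>k\<close>, an anti-invariant unit,
  and the absolute value in coordinates\<close>

context unramified_quadratic_extension
begin

abbreviation q :: nat where "q \<equiv> residue_card nv k"

lemma k_closed:
  shows k_0 [simp]: "0 \<in> k" and k_1 [simp]: "1 \<in> k"
    and k_add: "a \<in> k \<Longrightarrow> b \<in> k \<Longrightarrow> a + b \<in> k"
    and k_mult: "a \<in> k \<Longrightarrow> b \<in> k \<Longrightarrow> a * b \<in> k"
    and k_minus: "a \<in> k \<Longrightarrow> - a \<in> k"
    and k_inverse: "a \<in> k \<Longrightarrow> inverse a \<in> k"
proof -
  let ?R = "ring_of_type_algebra :: 'a ring"
  interpret R: field ?R by (rule field_from_type_algebra)
  have sub: "subring k ?R"
    using k_subfield by (simp add: subfieldE(1))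
  show "0 \<in> k" "1 \<in> k" "a \<in> k \<Longrightarrow> b \<in> k \<Longrightarrow> a + b \<in> k" "a \<in> k \<Longrightarrow> b \<in> k \<Longrightarrow> a * b \<in> k"
    using subringE[OF sub] by (auto simp: ring_of_type_algebra_def)
  show "- a \<in> k" if "a \<in> k"
  proof -
    have "\<ominus>\<^bsub>?R\<^esub> a \<in> k"
      using subringE(5)[OF sub] that by blast
    moreover have "a + \<ominus>\<^bsub>?R\<^esub> a = 0"
      using R.r_neg[of a] by (simp add: ring_of_type_algebra_def)
    ultimately show ?thesis
      by (metis add.inverse_unique)
  qed
  show "inverse a \<in> k" if "a \<in> k"
  proof (cases "a = 0")
    case False
    hence "inv\<^bsub>?R\<^esub> a \<in> k" "a * inv\<^bsub>?R\<^esub> a = 1"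
      using R.subfield_m_inv[OF k_subfield, of a] that by (auto simp: ring_of_type_algebra_def)
    thus ?thesis by (metis inverse_unique)
  qed (use that in simp)
qed

lemma k_diff: "a \<in> k \<Longrightarrow> b \<in> k \<Longrightarrow> a - b \<in> k"
  using k_add[of a "- b"] k_minus by simp

lemma k_divide: "a \<in> k \<Longrightarrow> b \<in> k \<Longrightarrow> a / b \<in> k"
  by (simp add: divide_inverse k_mult k_inverse)

lemma k_power: "a \<in> k \<Longrightarrow> a ^ j \<in> k"
  by (induction j) (auto intro: k_mult)

lemma k_power_int: "a \<in> k \<Longrightarrow> a powi j \<in> k"
  by (simp add: power_int_def k_power k_inverse)

lemma k_of_nat: "of_nat j \<in> k"
  by (induction j) (auto intro: k_add)

lemma k_numeral: "numeral j \<in> k"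
  using k_of_nat[of "numeral j"] by simp

lemma prm_in_k: "prm \<in> k"
  by (rule prm_generates)

text \<open>The unknown exponent \<open>c\<close> is positive, which is enough to keep p below 1 and
  to leave the p-adic unit 2 at 1. The second fact is where the oddness of p enters; every later
  division by 2 preserves integrality because of it.\<close>

lemma nv_of_rat_p: "nv (of_nat p) < 1" and nv_2 [simp]: "nv 2 = 1"
proof -
  obtain c where c: "c > 0" "\<And>r. nv (of_rat r) = padic_abs p r powr c"
    using Qp unfolding rat_closure_is_Qp_def by blast
  have p2: "p \<ge> 2"
    using p_prime by (simp add: prime_ge_2_nat)
  have primep: "Factorial_Ring.prime (int p)"
    using p_prime by simp
  have "multiplicity (int p) (int p) = 1"
    using p2 by (intro multiplicity_self) (auto simp: zdvd1_eq)
  moreover have "quotient_of (of_nat p) = (int p, 1)"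
    using quotient_of_int[of "int p"] by (simp add: Rat.of_int_def)
  ultimately have "padic_valuation p (of_nat p) = 1"
    by (simp add: padic_valuation_def)
  hence "padic_abs p (of_nat p) = 1 / real p"
    using p2 by (simp add: padic_abs_def power_int_minus field_simps)
  hence "nv (of_rat (of_nat p)) = (1 / real p) powr c"
    using c(2) by metis
  also have "\<dots> < 1 powr c"
    using p2 c(1) by (intro powr_less_mono2) auto
  finally show "nv (of_nat p) < 1" by simp
  have "\<not> int p dvd 2"
    using p2 p_odd by (auto dest!: zdvd_imp_le simp: le_less)
  hence "multiplicity (int p) 2 = 0"
    by (rule not_dvd_imp_multiplicity_0)
  moreover have "quotient_of (numeral Num.One + numeral Num.One) = (2, 1)"
    by simp
  ultimately have "padic_valuation p 2 = 0"
    by (simp add: padic_valuation_def)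
  hence "padic_abs p 2 = 1"
    by (simp add: padic_abs_def)
  hence "nv (of_rat 2) = 1"
    using c(2)[of 2] by (simp only: powr_one_eq_one)
  thus "nv 2 = 1" by simp
qed

text \<open>\<open>card\<close> returns 0 on infinite sets, so \<open>q_pos\<close> is the
  finiteness of the residue field: for q = 0 the normalisation would give \<open>prm\<close>
  absolute value 0. The generator is nonzero because p is a nonzero element of the maximal
  ideal.\<close>

lemma prm_nonzero [simp]: "prm \<noteq> 0" and q_pos: "q > 0"
proof -
  have "of_nat p \<in> max_ideal nv k"
    using nv_of_rat_p by (simp add: max_ideal_def k_of_nat)
  moreover have "of_nat p \<noteq> (0 :: 'a)"
    using p_prime by (auto simp: prime_nat_iff)
  ultimately show "prm \<noteq> 0"
    using prm_generates(2) by auto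
  thus "q > 0"
    using nv_prm nv_eq_0_iff by (cases "q = 0") auto
qed

text \<open>Induction along the chain of line extensions that witnesses finite dimension over the
  closure of the rationals. The closure properties of the intermediate spaces are carried along
  because \<open>nv_complete_line_extension\<close> asks for them.\<close>

lemma nv_complete_k: "nv_complete k"
proof -
  let ?R = "ring_of_type_algebra :: 'a ring"
  interpret R: field ?R by (rule field_from_type_algebra)
  let ?F = "rat_closure nv"
  have F: "nv_complete ?F"
    using Qp by (simp add: rat_closure_is_Qp_def nv_complete_iff_mcomplete)
  obtain d where "ring.dimension ?R d ?F k"
    using k_finite_over_Qp unfolding R.finite_dimension_def by blast
  hence "?F = ?F \<longrightarrow> nv_complete k \<and> 0 \<in> k \<and> (\<forall>a\<in>k. \<forall>b\<in>k. a - b \<in> k) \<and> (\<forall>c\<in>?F. \<forall>a\<in>k. c * a \<in> k)"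
  proof (induction d ?F k rule: R.dimension.induct)
    case zero_dim
    have "nv_complete {0}"
      unfolding nv_complete_def by auto
    thus ?case
      by (auto simp: ring_of_type_algebra_def)
  next
    case (Suc_dim v E n)
    have E: "nv_complete E" "0 \<in> E" "\<And>a b. a \<in> E \<Longrightarrow> b \<in> E \<Longrightarrow> a - b \<in> E"
      "\<And>c a. c \<in> ?F \<Longrightarrow> a \<in> E \<Longrightarrow> c * a \<in> E"
      using Suc_dim by auto
    have minus: "- a \<in> E" if "a \<in> E" for a
      using E(3)[OF E(2) that] by simp
    have "nv_complete {c * v + e | c e. c \<in> ?F \<and> e \<in> E}"
      by (intro nv_complete_line_extension F E Suc_dim rat_closure_diff rat_closure_inverse minus)
    moreover have "0 \<in> {c * v + e | c e. c \<in> ?F \<and> e \<in> E}"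
      using E(2) of_rat_in_rat_closure[of 0] by force
    moreover have "a - b \<in> {c * v + e | c e. c \<in> ?F \<and> e \<in> E}"
      if ab: "a \<in> {c * v + e | c e. c \<in> ?F \<and> e \<in> E}" "b \<in> {c * v + e | c e. c \<in> ?F \<and> e \<in> E}" for a b
    proof -
      obtain c e c' e' where *: "a = c * v + e" "b = c' * v + e'" "c \<in> ?F" "c' \<in> ?F" "e \<in> E" "e' \<in> E"
        using ab by blast
      have "a - b = (c - c') * v + (e - e')"
        by (simp add: * algebra_simps)
      thus ?thesis using * E(3) rat_closure_diff by blast
    qed
    moreover have "s * a \<in> {c * v + e | c e. c \<in> ?F \<and> e \<in> E}"
      if as: "a \<in> {c * v + e | c e. c \<in> ?F \<and> e \<in> E}" "s \<in> ?F" for a s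
    proof -
      obtain c e where *: "a = c * v + e" "c \<in> ?F" "e \<in> E"
        using as by blast
      have "s * a = (s * c) * v + (s * e)"
        by (simp add: * algebra_simps)
      thus ?thesis using * E(4) rat_closure_mult as(2) by blast
    qed
    ultimately show ?case
      unfolding line_extension_of_type by blast
  qed
  thus ?thesis by blast
qed

text \<open>Cramer's rule: 1 and \<open>\<theta>\<close> are written in the spanning pair
  \<open>v1\<close>, \<open>v2\<close> supplied by the dimension, with determinant \<open>D\<close>.
  If \<open>D\<close> vanished, \<open>\<theta>\<close> would be a quotient of elements of
  \<open>k\<close>.\<close>

lemma quadratic_decomposition:
  assumes "\<theta> \<notin> k"
  obtains a b where "a \<in> k" "b \<in> k" "x = a + b * \<theta>"
proof -
  let ?R = "ring_of_type_algebra :: 'a ring"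
  interpret R: field ?R by (rule field_from_type_algebra)
  obtain v1 E where E: "R.dimension 1 k E" "UNIV = R.line_extension k v1 E"
    using R.dimension_backwards[OF k_subfield, of 1 UNIV] quadratic
    by (auto simp: numeral_2_eq_2)
  obtain v2 E' where E': "R.dimension 0 k E'" "E = R.line_extension k v2 E'"
    using R.dimension_backwards[OF k_subfield, of 0 E] E(1) by auto
  have "E' = {0}"
    using R.dimension_zero[OF k_subfield E'(1)] by (simp add: ring_of_type_algebra_def)
  hence "R.line_extension k v1 (R.line_extension k v2 {0}) = UNIV"
    using E(2) E'(2) by simp
  hence "x \<in> R.line_extension k v1 (R.line_extension k v2 {0})" for x
    by blast
  hence span: "\<exists>a\<in>k. \<exists>b\<in>k. x = a * v1 + b * v2" for x
    unfolding line_extension_of_type by simp metis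
  obtain a1 b1 where 1: "a1 \<in> k" "b1 \<in> k" "1 = a1 * v1 + b1 * v2"
    using span by blast
  obtain a2 b2 where 2: "a2 \<in> k" "b2 \<in> k" "\<theta> = a2 * v1 + b2 * v2"
    using span by blast
  obtain c d where cd: "c \<in> k" "d \<in> k" "x = c * v1 + d * v2"
    using span by blast
  define D where "D = a1 * b2 - a2 * b1"
  have D_k: "D \<in> k"
    using 1 2 by (simp add: D_def k_diff k_mult)
  have id1: "b2 - b1 * \<theta> = D * v1"
  proof -
    have "b2 * 1 - b1 * \<theta> = D * v1"
      unfolding 2(3) by (subst 1(3)) (simp add: D_def algebra_simps)
    thus ?thesis by simp
  qed
  have id2: "a1 * \<theta> - a2 = D * v2"
  proof -
    have "a1 * \<theta> - a2 * 1 = D * v2"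
      unfolding 2(3) by (subst 1(3)) (simp add: D_def algebra_simps)
    thus ?thesis by simp
  qed
  have "D \<noteq> 0"
  proof
    assume "D = 0"
    hence eq: "b2 = b1 * \<theta>" "a2 = a1 * \<theta>"
      using id1 id2 by auto
    have "a1 \<noteq> 0 \<or> b1 \<noteq> 0"
      using 1(3) by auto
    hence "\<theta> = a2 / a1 \<or> \<theta> = b2 / b1"
      using eq by auto
    thus False
      using assms 1 2 k_divide by metis
  qed
  have "D * x = c * (b2 - b1 * \<theta>) + d * (a1 * \<theta> - a2)"
    unfolding id1 id2 cd(3) by (simp add: algebra_simps)
  also have "\<dots> = D * ((c * b2 - d * a2) / D + ((d * a1 - c * b1) / D) * \<theta>)"
    using \<open>D \<noteq> 0\<close> by (simp add: distrib_left) (simp add: algebra_simps)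
  finally have "x = (c * b2 - d * a2) / D + ((d * a1 - c * b1) / D) * \<theta>"
    using \<open>D \<noteq> 0\<close> by (simp only: mult_cancel_left simp_thms)
  moreover have "(c * b2 - d * a2) / D \<in> k" "(d * a1 - c * b1) / D \<in> k"
    using 1 2 cd D_k by (auto intro!: k_divide k_diff k_mult)
  ultimately show ?thesis using that by blast
qed

lemma cj_0 [simp]: "cj 0 = 0" and cj_1 [simp]: "cj 1 = 1"
  by (simp_all add: cj_fixes)

lemma cj_minus [simp]: "cj (- a) = - cj a"
  using cj_add[of a "- a"] by (simp add: add_eq_0_iff)

lemma cj_diff: "cj (a - b) = cj a - cj b"
  using cj_add[of a "- b"] by simp

lemma cj_power: "cj (a ^ j) = cj a ^ j"
  by (induction j) (simp_all add: cj_mult)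

lemma cj_sum: "cj (sum f I) = (\<Sum>i\<in>I. cj (f i))"
  by (induction I rule: infinite_finite_induct) (auto simp: cj_add)

text \<open>Completing the square in the quadratic equation of an element moved by \<open>cj\<close>
  gives an anti-invariant element; since the extension is unramified, an element of \<open>k\<close>
  of the same absolute value is available to make it a unit.\<close>

lemma exists_root_nonresidue: "\<exists>d. cj d = - d \<and> nv d = 1"
proof -
  obtain \<theta> where \<theta>: "cj \<theta> \<noteq> \<theta>"
    using cj_nontrivial by (auto simp: fun_eq_iff)
  hence "\<theta> \<notin> k"
    using cj_fixes by blast
  then obtain a b where ab: "a \<in> k" "b \<in> k" "\<theta> * \<theta> = a + b * \<theta>"
    using quadratic_decomposition[of \<theta> "\<theta> * \<theta>"] by blast
  have "cj \<theta> * cj \<theta> = a + b * cj \<theta>"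
    using arg_cong[OF ab(3), of cj] by (simp add: cj_mult cj_add cj_fixes[OF ab(1)] cj_fixes[OF ab(2)])
  with ab(3) have "(\<theta> - cj \<theta>) * (\<theta> + cj \<theta> - b) = 0"
    by (simp add: algebra_simps)
  hence b: "cj \<theta> = b - \<theta>"
    using \<theta> unfolding mult_eq_0_iff by (auto simp: algebra_simps)
  define d where "d = \<theta> - b / 2"
  have b2: "b / 2 \<in> k"
    using ab(2) by (simp add: k_divide k_numeral)
  have cj_d: "cj d = - d"
    by (simp add: d_def cj_diff cj_fixes[OF b2] b)
  have "d \<noteq> 0"
    using \<open>\<theta> \<notin> k\<close> b2 by (auto simp: d_def)
  then obtain c where c: "c \<in> k" "c \<noteq> 0" "nv d = nv c"
    using unramified by blast
  have "cj (d / c) = - (d / c)"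
    using c cj_d by (simp add: divide_inverse cj_mult cj_fixes k_inverse)
  moreover have "nv (d / c) = 1"
    using c by (simp add: nv_divide nv_eq_0_iff)
  ultimately show ?thesis by blast
qed

definition sqr :: 'a where "sqr = (SOME d. cj d = - d \<and> nv d = 1)"

lemma cj_sqr [simp]: "cj sqr = - sqr" and nv_sqr [simp]: "nv sqr = 1"
  using someI_ex[OF exists_root_nonresidue] by (auto simp: sqr_def)

lemma sqr_nonzero [simp]: "sqr \<noteq> 0"
  using nv_sqr nv_eq_0_iff by force

lemma sqr_notin_k: "sqr \<notin> k"
  using cj_fixes[of sqr] by force

lemma k_decomposition:
  obtains a b where "a \<in> k" "b \<in> k" "x = a + b * sqr"
  using quadratic_decomposition[OF sqr_notin_k] by blast

lemma cj_decomposition: "a \<in> k \<Longrightarrow> b \<in> k \<Longrightarrow> cj (a + b * sqr) = a - b * sqr"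
  by (simp add: cj_add cj_mult cj_fixes)

lemma cj_cj [simp]: "cj (cj a) = a"
  by (rule k_decomposition[of a]) (simp add: cj_add cj_diff cj_mult cj_fixes)

lemma cj_eq_iff: "cj a = a \<longleftrightarrow> a \<in> k"
proof
  assume *: "cj a = a"
  obtain b c where bc: "b \<in> k" "c \<in> k" "a = b + c * sqr"
    by (rule k_decomposition)
  hence "c * sqr = 0"
    using * by (simp add: cj_decomposition)
  thus "a \<in> k"
    using bc by simp
qed (rule cj_fixes)

text \<open>Only a crude bound with an unspecified constant: the coefficient of \<open>sqr\<close>
  is controlled by the distance of \<open>sqr\<close> from the complete field \<open>k\<close>.
  \<open>nv_cj_le\<close> removes the constant.\<close>

lemma nv_cj_bounded: obtains C where "\<And>a. nv (cj a) \<le> C * nv a"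
proof -
  obtain r where r: "r > 0" "\<And>c e. c \<in> k \<Longrightarrow> e \<in> k \<Longrightarrow> r * nv c \<le> nv (c * sqr + e)"
    using nv_dist_complement[OF nv_complete_k sqr_notin_k k_mult k_inverse k_minus] by metis
  have "nv (cj a) \<le> (1 + 1 / r) * nv a" for a
  proof -
    obtain b c where bc: "b \<in> k" "c \<in> k" "a = b + c * sqr"
      by (rule k_decomposition)
    have "cj a = a - 2 * c * sqr"
      using bc by (simp add: cj_decomposition)
    hence "nv (cj a) \<le> max (nv a) (nv c)"
      using nv_ultrametric[of a "- (2 * c * sqr)"] by (simp add: nv_mult)
    also have "nv c \<le> nv a / r"
      using r(2)[OF bc(2,1)] r(1) by (simp add: bc(3) pos_le_divide_eq mult.commute add.commute)
    finally show ?thesis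
      using r(1) nv_nonneg[of a] by (simp add: algebra_simps max_def split: if_splits)
         (smt (verit) divide_nonneg_pos)
  qed
  with that show ?thesis by blast
qed

text \<open>If \<open>cj\<close> increased the absolute value of \<open>a\<close>, the ratio for the
  powers a^j would grow geometrically and overtake any constant \<open>C\<close>.\<close>

lemma nv_cj_le: "nv (cj a) \<le> nv a"
proof (rule ccontr)
  assume "\<not> nv (cj a) \<le> nv a"
  hence less: "nv a < nv (cj a)" by simp
  hence pos: "nv a > 0"
    using nv_nonneg[of a] by (cases "a = 0") (auto simp: nv_pos_iff)
  obtain C where C: "\<And>a. nv (cj a) \<le> C * nv a"
    using nv_cj_bounded by blast
  obtain j where "C < (nv (cj a) / nv a) ^ j"
    using less pos real_arch_pow[of "nv (cj a) / nv a" C] by auto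
  hence "C * nv (a ^ j) < nv (cj (a ^ j))"
    using pos by (simp add: nv_power cj_power power_divide pos_less_divide_eq)
  with C[of "a ^ j"] show False by simp
qed

text \<open>The absolute value extends uniquely from the complete field \<open>k\<close>.\<close>
lemma nv_cj [simp]: "nv (cj a) = nv a"
  using nv_cj_le[of a] nv_cj_le[of "cj a"] by simp

text \<open>With x = a + b sqr, the combinations x + cj x = 2 a and x - cj x = 2 b sqr recover both
  coordinates, and 2 and \<open>sqr\<close> are units. So 1, \<open>sqr\<close> is an orthonormal
  basis, and integrality in k' is integrality of coordinates.\<close>

lemma nv_decomposition:
  assumes "a \<in> k" "b \<in> k"
  shows "nv (a + b * sqr) = max (nv a) (nv b)"
proof (rule antisym)
  show "nv (a + b * sqr) \<le> max (nv a) (nv b)"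
    using nv_ultrametric[of a "b * sqr"] by (simp add: nv_mult)
  let ?x = "a + b * sqr"
  have "nv (2 * a) \<le> nv ?x" "nv (2 * b * sqr) \<le> nv ?x"
    using nv_add_le[of ?x "nv ?x" "cj ?x"] nv_diff_le[of ?x "nv ?x" "cj ?x"]
    by (simp_all only: nv_cj, simp_all add: cj_decomposition[OF assms] mult.assoc)
  thus "max (nv a) (nv b) \<le> nv ?x"
    by (simp add: nv_mult)
qed

end

section \<open>Counting solutions of trace and norm equations over the residue fields\<close>

context unramified_quadratic_extension
begin

lemma residue_representatives:
  "\<exists>R. finite R \<and> card R = q \<and> R \<subseteq> val_ring nv k \<and>
     (\<forall>a\<in>val_ring nv k. \<exists>!r. r \<in> R \<and> nv (a - r) < 1)"
proof -
  let ?O = "val_ring nv k"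
  define E where "E = {(a, b). a \<in> ?O \<and> b \<in> ?O \<and> a - b \<in> max_ideal nv k}"
  have E_iff: "(a, b) \<in> E \<longleftrightarrow> a \<in> ?O \<and> b \<in> ?O \<and> nv (a - b) < 1" for a b
    by (auto simp: E_def max_ideal_def val_ring_def k_diff)
  have equiv: "equiv ?O E"
  proof (rule equivI)
    show "E \<subseteq> ?O \<times> ?O" by (auto simp: E_def)
    show "refl_on ?O E" by (auto simp: refl_on_def E_iff)
    show "sym E" by (auto simp: sym_def E_iff nv_minus_commute)
    show "trans E"
    proof (rule transI)
      fix a b c assume "(a, b) \<in> E" "(b, c) \<in> E"
      thus "(a, c) \<in> E"
        using nv_add_less[of "a - b" 1 "b - c"] by (auto simp: E_iff)
    qed
  qed
  have card: "card (?O // E) = q"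
    by (simp add: residue_card_def E_def)
  hence fin: "finite (?O // E)"
    using q_pos card_ge_0_finite by metis
  define f where "f C = (SOME a. a \<in> C)" for C :: "'a set"
  have f: "f C \<in> C" if "C \<in> ?O // E" for C
    using in_quotient_imp_non_empty[OF equiv that] unfolding f_def by (simp add: some_in_eq)
  have f_O: "f C \<in> ?O" if "C \<in> ?O // E" for C
    using f[OF that] in_quotient_imp_subset[OF equiv that] by blast
  have inj: "inj_on f (?O // E)"
  proof (rule inj_onI)
    fix C D assume CD: "C \<in> ?O // E" "D \<in> ?O // E" "f C = f D"
    hence "f C \<in> C \<inter> D" using f by force
    thus "C = D" using quotient_disj[OF equiv CD(1,2)] by blast
  qed
  show ?thesis
  proof (intro exI[of _ "f ` (?O // E)"] conjI ballI)
    show "card (f ` (?O // E)) = q"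
      using inj card by (simp add: card_image)
    fix a assume a: "a \<in> ?O"
    have C: "E `` {a} \<in> ?O // E"
      using a by (rule quotientI)
    show "\<exists>!r. r \<in> f ` (?O // E) \<and> nv (a - r) < 1"
    proof (rule ex1I[of _ "f (E `` {a})"])
      show "f (E `` {a}) \<in> f ` (?O // E) \<and> nv (a - f (E `` {a})) < 1"
        using f[OF C] C by (auto simp: E_iff)
      fix r assume r: "r \<in> f ` (?O // E) \<and> nv (a - r) < 1"
      then obtain D where D: "D \<in> ?O // E" "r = f D" by blast
      have "r \<in> E `` {a} \<inter> D"
        using D f[OF D(1)] f_O[OF D(1)] r a by (auto simp: E_iff)
      hence "D = E `` {a}"
        using quotient_disj[OF equiv C D(1)] by blast
      thus "r = f (E `` {a})" using D by simp
    qed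
  qed (use fin f_O in auto)
qed

definition resk :: "'a set" where
  "resk = (SOME R. finite R \<and> card R = q \<and> R \<subseteq> val_ring nv k \<and>
     (\<forall>a\<in>val_ring nv k. \<exists>!r. r \<in> R \<and> nv (a - r) < 1))"

lemma finite_resk: "finite resk" and card_resk: "card resk = q"
  and resk_subset: "resk \<subseteq> {a \<in> k. nv a \<le> 1}"
  and resk_ex1: "a \<in> {a \<in> k. nv a \<le> 1} \<Longrightarrow> \<exists>!r. r \<in> resk \<and> nv (a - r) < 1"
proof -
  have *: "finite resk \<and> card resk = q \<and> resk \<subseteq> val_ring nv k \<and>
     (\<forall>a\<in>val_ring nv k. \<exists>!r. r \<in> resk \<and> nv (a - r) < 1)"
    unfolding resk_def by (rule someI_ex[OF residue_representatives])
  thus "finite resk" "card resk = q" "resk \<subseteq> {a \<in> k. nv a \<le> 1}"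
    by (auto simp: val_ring_def)
  show "\<exists>!r. r \<in> resk \<and> nv (a - r) < 1" if "a \<in> {a \<in> k. nv a \<le> 1}"
    using * that unfolding val_ring_def by blast
qed

lemma resk_eqI:
  assumes "a \<in> resk" "b \<in> resk" "nv (a - b) < 1"
  shows "a = b"
proof -
  have "\<exists>!r. r \<in> resk \<and> nv (a - r) < 1"
    using assms(1) resk_subset by (intro resk_ex1) blast
  moreover have "nv (a - a) < 1" by simp
  ultimately show ?thesis using assms by blast
qed

text \<open>Representatives of the residue field of k', which has q^2 elements because 1,
  \<open>sqr\<close> reduces to a basis over the residue field of \<open>k\<close>. Congruences are
  written as \<open>nv\<close> being less than 1, so no quotient ring is formed.\<close>

definition res :: "'a set" where
  "res = (\<lambda>(a, b). a + b * sqr) ` (resk \<times> resk)"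

lemma sqr_coeffs_unique:
  assumes "a \<in> k" "b \<in> k" "c \<in> k" "d \<in> k"
  shows "a + b * sqr = c + d * sqr \<longleftrightarrow> a = c \<and> b = d"
proof
  assume "a + b * sqr = c + d * sqr"
  hence "nv ((a - c) + (b - d) * sqr) = 0"
    by (simp add: algebra_simps)
  hence "max (nv (a - c)) (nv (b - d)) = 0"
    using assms by (simp add: nv_decomposition k_diff)
  hence "nv (a - c) \<le> 0 \<and> nv (b - d) \<le> 0"
    by linarith
  thus "a = c \<and> b = d"
    using nv_pos_iff[of "a - c"] nv_pos_iff[of "b - d"] by force
qed simp

lemma finite_res: "finite res"
  by (simp add: res_def finite_resk)

lemma card_res: "card res = q\<^sup>2"
proof -
  have "inj_on (\<lambda>(a, b). a + b * sqr) (resk \<times> resk)"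
    using resk_subset by (auto simp: inj_on_def sqr_coeffs_unique subset_iff)
  thus ?thesis
    by (simp add: res_def card_image card_cartesian_product card_resk power2_eq_square)
qed

lemma nv_res_le: "y \<in> res \<Longrightarrow> nv y \<le> 1"
  using resk_subset by (auto simp: res_def nv_decomposition subset_iff)

lemma res_ex1:
  assumes "nv a \<le> 1"
  shows "\<exists>!r. r \<in> res \<and> nv (a - r) < 1"
proof -
  obtain b c where bc: "b \<in> k" "c \<in> k" "a = b + c * sqr"
    by (rule k_decomposition)
  hence le: "nv b \<le> 1" "nv c \<le> 1"
    using assms by (auto simp: nv_decomposition)
  have *: "nv (a - (r + s * sqr)) < 1 \<longleftrightarrow> nv (b - r) < 1 \<and> nv (c - s) < 1"
    if "r \<in> resk" "s \<in> resk" for r s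
  proof -
    have "a - (r + s * sqr) = (b - r) + (c - s) * sqr"
      by (simp add: bc algebra_simps)
    moreover have "b - r \<in> k" "c - s \<in> k"
      using bc that resk_subset by (auto intro: k_diff)
    ultimately show ?thesis
      by (simp only: nv_decomposition max_less_iff_conj)
  qed
  obtain r where r: "r \<in> resk" "nv (b - r) < 1"
    using resk_ex1[of b] bc le by blast
  obtain s where s: "s \<in> resk" "nv (c - s) < 1"
    using resk_ex1[of c] bc le by blast
  show ?thesis
  proof (rule ex1I[of _ "r + s * sqr"])
    show "r + s * sqr \<in> res \<and> nv (a - (r + s * sqr)) < 1"
      using r s * by (auto simp: res_def)
    fix y assume y: "y \<in> res \<and> nv (a - y) < 1"
    then obtain r' s' where y': "r' \<in> resk" "s' \<in> resk" "y = r' + s' * sqr"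
      by (auto simp: res_def)
    hence "nv (b - r') < 1" "nv (c - s') < 1"
      using y * by auto
    hence "r' = r" "s' = s"
      using y' r s resk_ex1[of b] resk_ex1[of c] bc le by blast+
    thus "y = r + s * sqr" using y' by simp
  qed
qed

text \<open>A map that is injective on residue classes permutes the finitely many classes, hence
  induces a permutation \<open>g\<close> of the representatives, and a condition that depends on the
  class alone is counted equally often. It serves as change of variables for residue counts.\<close>

lemma card_representatives_cong:
  assumes fin: "finite R" and sub: "R \<subseteq> A"
    and ex1: "\<And>a. a \<in> A \<Longrightarrow> \<exists>!r. r \<in> R \<and> nv (a - r) < 1"
    and f: "\<And>a. a \<in> A \<Longrightarrow> f a \<in> A"
    and f_inj: "\<And>a b. a \<in> A \<Longrightarrow> b \<in> A \<Longrightarrow> nv (f a - f b) < 1 \<Longrightarrow> nv (a - b) < 1"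
    and \<phi>: "\<And>a b. a \<in> A \<Longrightarrow> b \<in> A \<Longrightarrow> nv (a - b) < 1 \<Longrightarrow> \<phi> a \<Longrightarrow> \<phi> b"
  shows "card {y \<in> R. \<phi> (f y)} = card {y \<in> R. \<phi> y}"
proof -
  have "\<forall>y\<in>R. \<exists>r. r \<in> R \<and> nv (f y - r) < 1"
    using ex1 f sub by blast
  from bchoice[OF this] obtain g where g: "\<And>y. y \<in> R \<Longrightarrow> g y \<in> R \<and> nv (f y - g y) < 1"
    by blast
  have inj: "inj_on g R"
  proof (rule inj_onI)
    fix a b assume ab: "a \<in> R" "b \<in> R" "g a = g b"
    have "nv (f a - f b) < 1"
      using nv_diff_less[of "f a - g a" 1 "f b - g b"] g[OF ab(1)] g[OF ab(2)] ab(3)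
      by simp
    hence "nv (a - b) < 1"
      using ab sub f_inj by blast
    moreover have "nv (a - a) < 1" by simp
    moreover have "\<exists>!r. r \<in> R \<and> nv (a - r) < 1"
      using ex1 ab sub by blast
    ultimately show "a = b"
      using ab by blast
  qed
  have surj: "g ` R = R"
    using g by (intro endo_inj_surj fin inj) auto
  have iff: "\<phi> (f y) \<longleftrightarrow> \<phi> (g y)" if "y \<in> R" for y
    using \<phi>[of "f y" "g y"] \<phi>[of "g y" "f y"] g[OF that] f[of y] sub that nv_minus_commute[of "g y"]
    by auto
  have "{y \<in> R. \<phi> (f y)} = {y \<in> R. \<phi> (g y)}"
    using iff by blast
  hence "g ` {y \<in> R. \<phi> (f y)} = {y \<in> g ` R. \<phi> y}"
    by blast
  hence "g ` {y \<in> R. \<phi> (f y)} = {y \<in> R. \<phi> y}"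
    by (simp only: surj)
  moreover have "inj_on g {y \<in> R. \<phi> (f y)}"
    using inj by (rule inj_on_subset) auto
  ultimately show ?thesis
    using card_image by metis
qed

lemma card_res_affine:
  assumes "nv a = 1" "nv b \<le> 1"
    and "\<And>x y. nv x \<le> 1 \<Longrightarrow> nv y \<le> 1 \<Longrightarrow> nv (x - y) < 1 \<Longrightarrow> \<phi> x \<Longrightarrow> \<phi> y"
  shows "card {y \<in> res. \<phi> (b + y * a)} = card {y \<in> res. \<phi> y}"
proof (rule card_representatives_cong[where A = "{x. nv x \<le> 1}"])
  fix x y assume "x \<in> {x. nv x \<le> 1}" "y \<in> {x. nv x \<le> 1}" "nv (b + x * a - (b + y * a)) < 1"
  moreover have "b + x * a - (b + y * a) = (x - y) * a"
    by (simp add: algebra_simps)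
  ultimately show "nv (x - y) < 1"
    using assms(1) by (simp add: nv_mult)
qed (use assms res_ex1 nv_res_le in \<open>auto simp: finite_res nv_mult intro: nv_add_le\<close>)

lemma card_res_cj:
  assumes "\<And>x y. nv x \<le> 1 \<Longrightarrow> nv y \<le> 1 \<Longrightarrow> nv (x - y) < 1 \<Longrightarrow> \<phi> x \<Longrightarrow> \<phi> y"
  shows "card {y \<in> res. \<phi> (cj y)} = card {y \<in> res. \<phi> y}"
  by (rule card_representatives_cong[where A = "{x. nv x \<le> 1}"])
     (use assms res_ex1 nv_res_le in \<open>auto simp: finite_res simp flip: cj_diff\<close>)

lemma card_representative_eq_1:
  assumes "\<exists>!r. r \<in> R \<and> nv (a - r) < 1"
  shows "card {r \<in> R. nv (r - a) < 1} = 1"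
proof -
  obtain r where "\<And>s. s \<in> R \<and> nv (a - s) < 1 \<longleftrightarrow> s = r"
    using assms by metis
  hence "{r \<in> R. nv (r - a) < 1} = {r}"
    by (auto simp: nv_minus_commute)
  thus ?thesis by simp
qed

lemma nv_less_1_cong:
  assumes "nv (x - y) < 1" "nv (x - a) < 1" shows "nv (y - a) < 1"
  using nv_diff_less[OF assms(2,1)] by simp

lemma card_res_affine_cj_zero:
  assumes "nv a = 1" "nv b \<le> 1"
  shows "card {y \<in> res. nv (b + cj y * a) < 1} = 1"
proof -
  have "card {y \<in> res. nv (b + cj y * a) < 1} = card {y \<in> res. nv (b + y * a) < 1}"
  proof (rule card_res_cj)
    fix x y assume "nv (x - y) < 1" "nv (b + x * a) < 1"
    hence "nv ((b + x * a) - (x - y) * a) < 1"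
      using assms by (intro nv_diff_less) (auto simp: nv_mult)
    thus "nv (b + y * a) < 1" by (simp add: algebra_simps)
  qed
  also have "\<dots> = card {y \<in> res. nv y < 1}"
    by (rule card_res_affine[OF assms, where \<phi> = "\<lambda>y. nv y < 1"]) (metis nv_less_1_cong diff_zero)
  also have "\<dots> = 1"
    using card_representative_eq_1[OF res_ex1, of 0] by simp
  finally show ?thesis .
qed

text \<open>After the substitution of y b by y, the trace of a + b sqr is 2 a: the equation fixes
  the class of the first coordinate and leaves the second one free.\<close>

lemma card_res_trace:
  assumes "nv b = 1" "c \<in> k" "nv c \<le> 1"
  shows "card {y \<in> res. nv (c + y * b + cj (y * b)) < 1} = q"
proof -
  have "card {y \<in> res. nv (c + y * b + cj (y * b)) < 1} = card {y \<in> res. nv (c + y + cj y) < 1}"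
    using card_res_affine[of b 0 "\<lambda>y. nv (c + y + cj y) < 1"] assms
  proof (simp add: add.assoc, elim meta_mp)
    fix x y assume "nv (x - y) < 1" "nv (c + (x + cj x)) < 1"
    moreover from this have "nv ((x - y) + cj (x - y)) < 1"
      by (intro nv_add_less) (auto simp del: cj_diff)
    ultimately have "nv ((c + (x + cj x)) - ((x - y) + cj (x - y))) < 1"
      by (intro nv_diff_less)
    thus "nv (c + (y + cj y)) < 1" by (simp add: cj_diff algebra_simps)
  qed
  also have "{y \<in> res. nv (c + y + cj y) < 1}
      = (\<lambda>(a, b). a + b * sqr) ` ({a \<in> resk. nv (a - (- c / 2)) < 1} \<times> resk)"
  proof -
    have "nv (c + y + cj y) < 1 \<longleftrightarrow> nv (a - (- c / 2)) < 1"
      if "y = a + b * sqr" "a \<in> resk" "b \<in> resk" for y a b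
    proof -
      have "c + y + cj y = 2 * (a - (- c / 2))"
        using that resk_subset by (auto simp: cj_decomposition subset_iff)
      thus ?thesis by (simp only: nv_mult nv_2 mult_1_left)
    qed
    thus ?thesis by (fastforce simp: res_def)
  qed
  also have "card \<dots> = card ({a \<in> resk. nv (a - (- c / 2)) < 1} \<times> resk)"
    using resk_subset by (intro card_image) (auto simp: inj_on_def sqr_coeffs_unique subset_iff)
  also have "\<dots> = card {a \<in> resk. nv (a - (- c / 2)) < 1} * q"
    by (simp add: card_cartesian_product card_resk)
  also have "card {a \<in> resk. nv (a - (- c / 2)) < 1} = 1"
    using assms by (intro card_representative_eq_1 resk_ex1)
      (auto intro!: k_minus k_divide k_numeral simp: nv_divide)
  finally show ?thesis by simp
qed

definition nrm :: "'a \<Rightarrow> 'a" where "nrm y = y * cj y"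

lemma nv_nrm: "nv (nrm y) = (nv y)\<^sup>2"
  by (simp add: nrm_def nv_mult power2_eq_square)

lemma nrm_in_k: "nrm y \<in> k"
  unfolding cj_eq_iff[symmetric] by (simp add: nrm_def cj_mult mult.commute)

lemma nrm_mult: "nrm (x * y) = nrm x * nrm y"
  by (simp add: nrm_def cj_mult algebra_simps)

lemma nrm_cj [simp]: "nrm (cj y) = nrm y"
  by (simp add: nrm_def mult.commute)

lemma nrm_in_k_eq: "a \<in> k \<Longrightarrow> nrm a = a\<^sup>2"
  by (simp add: nrm_def cj_fixes power2_eq_square)

lemma nrm_decomposition: "a \<in> k \<Longrightarrow> b \<in> k \<Longrightarrow> nrm (a + b * sqr) = a\<^sup>2 - sqr\<^sup>2 * b\<^sup>2"
  by (simp add: nrm_def cj_decomposition algebra_simps power2_eq_square)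

lemma nrm_diff_less:
  assumes "nv x \<le> 1" "nv y \<le> 1" "nv (x - y) < 1"
  shows "nv (nrm x - nrm y) < 1"
proof -
  have "nv ((x - y) * cj x) < 1" "nv (y * cj (x - y)) < 1"
    using assms nv_nonneg[of x] nv_nonneg[of y] nv_nonneg[of "x - y"]
      mult_mono[of "nv (x - y)" "nv (x - y)" "nv x" 1] mult_mono[of "nv y" 1 "nv (x - y)" "nv (x - y)"]
    by (auto simp: nv_mult simp del: cj_diff)
  hence "nv ((x - y) * cj x + y * cj (x - y)) < 1"
    by (rule nv_add_less)
  thus ?thesis
    by (simp add: nrm_def cj_diff algebra_simps)
qed

lemma sqr_squared: "sqr\<^sup>2 \<in> k" "nv (sqr\<^sup>2) = 1"
  by (auto simp: nv_power cj_power simp flip: cj_eq_iff)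

lemma q_ge_2: "q \<ge> 2"
proof -
  obtain r where r: "r \<in> resk" "nv (0 - r) < 1"
    using resk_ex1[of 0] by auto
  obtain s where s: "s \<in> resk" "nv (1 - s) < 1"
    using resk_ex1[of 1] by auto
  have "r \<noteq> s"
  proof
    assume "r = s"
    thus False
      using nv_diff_less[OF s(2) r(2)] by simp
  qed
  hence "card {r, s} = 2" by simp
  thus ?thesis
    using card_mono[OF finite_resk, of "{r, s}"] r s by (simp add: card_resk)
qed

text \<open>Elements with equal image are congruent up to sign, so fibres have at most two points,
  and the fibre through the class of 0 has one. Hence q <= 2 |image| - 1. Two such images inside a
  set of q elements must meet.\<close>

lemma card_image_square_fibres:
  assumes "\<And>a b. a \<in> resk \<Longrightarrow> b \<in> resk \<Longrightarrow> h a = h b \<Longrightarrow> nv (a\<^sup>2 - b\<^sup>2) < 1"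
  shows "q + 1 \<le> 2 * card (h ` resk)"
proof -
  have *: "a = b \<or> nv (- a - b) < 1" if "a \<in> resk" "b \<in> resk" "h a = h b" for a b
  proof -
    have "nv (a - b) * nv (- a - b) < 1"
      using assms[OF that] by (simp flip: nv_mult nv_minus_commute add: power2_eq_square algebra_simps)
    hence "nv (a - b) < 1 \<or> nv (- a - b) < 1"
      using mult_mono[of 1 "nv (a - b)" 1 "nv (- a - b)", unfolded mult_1] nv_nonneg[of "a - b"]
      by (meson not_less mult_1 le_less_trans zero_le_one)
    thus ?thesis using resk_eqI that by blast
  qed
  define F where "F v = {a \<in> resk. h a = v}" for v
  obtain r where r: "r \<in> resk" "nv (0 - r) < 1"
    using resk_ex1[of 0] by auto
  have F2: "card (F v) \<le> 2" if v: "v \<in> h ` resk" for v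
  proof -
    obtain a where a: "a \<in> resk" "v = h a"
      using v by blast
    have "- a \<in> {a \<in> k. nv a \<le> 1}"
      using a resk_subset by (auto intro: k_minus)
    from resk_ex1[OF this] obtain a' where a': "\<And>s. s \<in> resk \<Longrightarrow> nv (- a - s) < 1 \<Longrightarrow> s = a'"
      by blast
    have "F v \<subseteq> {a, a'}"
      using *[OF a(1)] a a' by (fastforce simp: F_def)
    hence "card (F v) \<le> card {a, a'}"
      by (intro card_mono) auto
    also have "\<dots> \<le> 2" by (simp add: card_insert_if)
    finally show ?thesis .
  qed
  have F1: "F (h r) = {r}"
  proof -
    have "b = r" if "b \<in> resk" "h b = h r" for b
    proof (rule ccontr)
      assume "b \<noteq> r"
      hence "nv (- b - r) < 1"
        using *[OF that(1) r(1) that(2)] by blast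
      hence "nv (0 - b) < 1"
        using nv_diff_less[OF r(2), of "- b - r"] by simp
      thus False
        using resk_ex1[of 0] r that \<open>b \<noteq> r\<close> by auto
    qed
    thus ?thesis using r by (auto simp: F_def)
  qed
  have "q = card (\<Union>v\<in>h ` resk. F v)"
    unfolding card_resk[symmetric] by (rule arg_cong[of _ _ card]) (auto simp: F_def)
  also have "\<dots> \<le> (\<Sum>v\<in>h ` resk. card (F v))"
    by (intro card_UN_le finite_imageI finite_resk)
  also have "\<dots> = card (F (h r)) + (\<Sum>v\<in>h ` resk - {h r}. card (F v))"
    using r by (intro sum.remove) (auto simp: finite_resk)
  also have "\<dots> \<le> 1 + (\<Sum>v\<in>h ` resk - {h r}. 2)"
    using F2 by (intro add_mono sum_mono) (auto simp: F1)
  also have "\<dots> = 1 + 2 * (card (h ` resk) - 1)"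
    using r by (simp add: finite_resk card_Diff_singleton)
  finally show ?thesis
    using r finite_resk by (cases "card (h ` resk)") auto
qed

text \<open>The norm of a + b sqr is a^2 - sqr^2 b^2, so the task is to make a^2 congruent to c +
  sqr^2 b^2. Each side takes at least (q + 1)/2 values modulo the maximal ideal, and the pigeonhole
  principle gives a common one.\<close>

lemma nrm_surj_mod:
  assumes "c \<in> k" "nv c = 1"
  obtains y where "nv y = 1" "nv (nrm y - c) < 1"
proof -
  have "\<exists>\<rho>. \<forall>a\<in>{a \<in> k. nv a \<le> 1}. \<rho> a \<in> resk \<and> nv (a - \<rho> a) < 1"
    using resk_ex1 by (intro bchoice) blast
  then obtain \<rho> where \<rho>: "\<And>a. a \<in> k \<Longrightarrow> nv a \<le> 1 \<Longrightarrow> \<rho> a \<in> resk \<and> nv (a - \<rho> a) < 1"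
    by auto
  have \<rho>_eq: "nv (a - b) < 1" if "\<rho> a = \<rho> b" "a \<in> k" "nv a \<le> 1" "b \<in> k" "nv b \<le> 1" for a b
    using nv_diff_less[of "a - \<rho> a" 1 "b - \<rho> b"] \<rho>[of a] \<rho>[of b] that by simp
  define f where "f a = a\<^sup>2" for a :: 'a
  define g where "g a = c + sqr\<^sup>2 * a\<^sup>2" for a
  have f: "f a \<in> k" "nv (f a) \<le> 1" if "a \<in> resk" for a
    using that resk_subset nv_nonneg[of a]
    by (auto simp: f_def nv_power power_le_one intro!: k_power)
  have g: "g a \<in> k" "nv (g a) \<le> 1" if "a \<in> resk" for a
    using that resk_subset assms sqr_squared nv_nonneg[of a]
    by (auto simp: g_def nv_power nv_mult power_le_one intro!: k_power k_add k_mult nv_add_le)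
  have f_card: "q + 1 \<le> 2 * card ((\<rho> \<circ> f) ` resk)"
  proof (rule card_image_square_fibres)
    fix a b assume "a \<in> resk" "b \<in> resk" "(\<rho> \<circ> f) a = (\<rho> \<circ> f) b"
    thus "nv (a\<^sup>2 - b\<^sup>2) < 1"
      using \<rho>_eq[of "f a" "f b"] f by (auto simp: f_def)
  qed
  have g_card: "q + 1 \<le> 2 * card ((\<rho> \<circ> g) ` resk)"
  proof (rule card_image_square_fibres)
    fix a b assume "a \<in> resk" "b \<in> resk" "(\<rho> \<circ> g) a = (\<rho> \<circ> g) b"
    hence "nv (g a - g b) < 1"
      using \<rho>_eq[of "g a" "g b"] g by auto
    also have "g a - g b = sqr\<^sup>2 * (a\<^sup>2 - b\<^sup>2)"
      by (simp add: g_def algebra_simps)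
    finally show "nv (a\<^sup>2 - b\<^sup>2) < 1"
      by (simp add: nv_mult nv_power)
  qed
  have "(\<rho> \<circ> f) ` resk \<inter> (\<rho> \<circ> g) ` resk \<noteq> {}"
  proof
    assume "(\<rho> \<circ> f) ` resk \<inter> (\<rho> \<circ> g) ` resk = {}"
    hence "card ((\<rho> \<circ> f) ` resk) + card ((\<rho> \<circ> g) ` resk) = card ((\<rho> \<circ> f) ` resk \<union> (\<rho> \<circ> g) ` resk)"
      by (simp add: card_Un_disjoint finite_resk)
    also have "\<dots> \<le> card resk"
      using \<rho> f g by (intro card_mono finite_resk) auto
    finally show False
      using f_card g_card card_resk by linarith
  qed
  then obtain a b where ab: "a \<in> resk" "b \<in> resk" "\<rho> (f a) = \<rho> (g b)"
    by auto
  hence less: "nv (f a - g b) < 1"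
    using \<rho>_eq f g by blast
  have "f a - g b = nrm (a + b * sqr) - c"
    using ab resk_subset by (subst nrm_decomposition) (auto simp: f_def g_def)
  hence 1: "nv (nrm (a + b * sqr) - c) < 1"
    using less by simp
  have "nv (nrm (a + b * sqr)) = 1"
    using nv_add_eq[of "nrm (a + b * sqr) - c" c] 1 assms by simp
  hence "nv (a + b * sqr) = 1"
    using nv_nonneg[of "a + b * sqr"] by (simp add: nv_nrm power2_eq_1_iff)
  with 1 that show ?thesis by blast
qed

text \<open>Multiplication by an element of norm c/d carries the fibre of the norm over d to the
  fibre over c, so all unit fibres have equal size; the q^2 - 1 unit classes of k' are shared by the
  q - 1 unit classes of \<open>k\<close>.\<close>

lemma card_res_nrm:
  assumes "c \<in> k" "nv c = 1"
  shows "card {y \<in> res. nv (nrm y - c) < 1} = q + 1"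
proof -
  define N where "N c = card {y \<in> res. nv (nrm y - c) < 1}" for c
  have fibre: "N d = N c" if d: "d \<in> k" "nv d = 1" for d
  proof -
    have "c / d \<in> k" "nv (c / d) = 1"
      using assms d by (auto simp: nv_divide k_divide)
    then obtain y0 where y0: "nv y0 = 1" "nv (nrm y0 - c / d) < 1"
      by (rule nrm_surj_mod)
    have "N c = card {y \<in> res. nv (nrm (0 + y * y0) - c) < 1}"
      unfolding N_def
    proof (rule card_res_affine[symmetric])
      fix x y assume "nv x \<le> 1" "nv y \<le> 1" "nv (x - y) < 1" "nv (nrm x - c) < 1"
      thus "nv (nrm y - c) < 1"
        using nv_less_1_cong nrm_diff_less by blast
    qed (use y0 in auto)
    also have "{y \<in> res. nv (nrm (0 + y * y0) - c) < 1} = {y \<in> res. nv (nrm y - d) < 1}"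
    proof -
      have "nv (nrm (0 + y * y0) - c) < 1 \<longleftrightarrow> nv (nrm y - d) < 1" if y: "y \<in> res" for y
      proof -
        have 1: "nv (nrm y * (nrm y0 - c / d)) < 1"
          using y0(2) nv_res_le[OF y] nv_nonneg[of y] nv_nonneg[of "nrm y0 - c / d"]
            mult_mono[of "(nv y)\<^sup>2" 1 "nv (nrm y0 - c / d)" "nv (nrm y0 - c / d)"]
          by (simp add: nv_mult nv_nrm power_le_one)
        have 2: "nrm (0 + y * y0) - c = nrm y * (nrm y0 - c / d) + (c / d) * (nrm y - d)"
          using d by (auto simp: nrm_mult algebra_simps)
        have 3: "nv ((c / d) * (nrm y - d)) = nv (nrm y - d)"
          using assms d by (simp add: nv_mult nv_divide)
        show ?thesis
          unfolding 2 using nv_add_less[OF 1, of "(c / d) * (nrm y - d)"]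
            nv_diff_less[OF _ 1, of "nrm y * (nrm y0 - c / d) + (c / d) * (nrm y - d)"] 3 by auto
      qed
      thus ?thesis by blast
    qed
    finally show ?thesis by (simp add: N_def)
  qed
  have units: "card {y \<in> R. nv y = 1} = card R - 1"
    if R: "finite R" "\<And>y. y \<in> R \<Longrightarrow> nv y \<le> 1" "\<exists>!r. r \<in> R \<and> nv (0 - r) < 1" for R
  proof -
    have "{y \<in> R. nv y = 1} = R - {y \<in> R. nv (y - 0) < 1}"
      using R(2) by force
    moreover have "card {y \<in> R. nv (y - 0) < 1} = 1"
      using R(3) by (rule card_representative_eq_1)
    ultimately show ?thesis
      using R(1) by (simp add: card_Diff_subset)
  qed
  have "{y \<in> res. nv y = 1} = (\<Union>d\<in>{d \<in> resk. nv d = 1}. {y \<in> res. nv (nrm y - d) < 1})"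
  proof (intro equalityI subsetI)
    fix y assume y: "y \<in> {y \<in> res. nv y = 1}"
    then obtain d where d: "d \<in> resk" "nv (nrm y - d) < 1"
      using resk_ex1[of "nrm y"] by (auto simp: nrm_in_k nv_nrm)
    moreover have "nv d = 1"
      using nv_add_eq[of "d - nrm y" "nrm y"] d y by (simp add: nv_minus_commute nv_nrm)
    ultimately show "y \<in> (\<Union>d\<in>{d \<in> resk. nv d = 1}. {y \<in> res. nv (nrm y - d) < 1})"
      using y by blast
  next
    fix y assume "y \<in> (\<Union>d\<in>{d \<in> resk. nv d = 1}. {y \<in> res. nv (nrm y - d) < 1})"
    then obtain d where d: "y \<in> res" "nv d = 1" "nv (nrm y - d) < 1"
      by blast
    hence "nv (nrm y) = 1"
      using nv_add_eq[of "nrm y - d" d] by simp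
    thus "y \<in> {y \<in> res. nv y = 1}"
      using nv_nonneg[of y] d by (simp add: nv_nrm power2_eq_1_iff)
  qed
  hence "card {y \<in> res. nv y = 1} = (\<Sum>d\<in>{d \<in> resk. nv d = 1}. N d)"
    unfolding N_def
  proof (simp only:, intro card_UN_disjoint ballI impI)
    fix d e assume de: "d \<in> {d \<in> resk. nv d = 1}" "e \<in> {d \<in> resk. nv d = 1}" "d \<noteq> e"
    show "{y \<in> res. nv (nrm y - d) < 1} \<inter> {y \<in> res. nv (nrm y - e) < 1} = {}"
    proof (rule ccontr)
      assume "{y \<in> res. nv (nrm y - d) < 1} \<inter> {y \<in> res. nv (nrm y - e) < 1} \<noteq> {}"
      then obtain y where "nv (nrm y - d) < 1" "nv (nrm y - e) < 1" by blast
      hence "nv (d - e) < 1"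
        using nv_less_1_cong by blast
      thus False
        using resk_eqI de by blast
    qed
  qed (auto simp: finite_resk finite_res)
  also have "\<dots> = (\<Sum>d\<in>{d \<in> resk. nv d = 1}. N c)"
    using resk_subset by (intro sum.cong fibre) auto
  also have "\<dots> = (q - 1) * N c"
    using units[OF finite_resk] resk_subset resk_ex1[of 0] by (auto simp: card_resk)
  also have "card {y \<in> res. nv y = 1} = q\<^sup>2 - 1"
    using units[OF finite_res nv_res_le res_ex1] by (simp add: card_res)
  also have "q\<^sup>2 - 1 = (q - 1) * (q + 1)"
    by (simp add: power2_eq_square algebra_simps)
  finally have "N c = q + 1"
    using q_ge_2 by (subst (asm) mult_cancel1) auto
  thus ?thesis by (simp add: N_def)
qed

lemma card_res_nrm_affine:
  assumes "nv a = 1" "nv b \<le> 1" "c \<in> k" "nv c = 1"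
  shows "card {y \<in> res. nv (nrm (b + cj y * a) + c) < 1} = q + 1"
proof -
  have cong: "nv (nrm y + c) < 1" if "nv x \<le> 1" "nv y \<le> 1" "nv (x - y) < 1" "nv (nrm x + c) < 1" for x y
    using nv_less_1_cong[of "nrm x" "nrm y" "- c"] nrm_diff_less[of x y] that by simp
  have "card {y \<in> res. nv (nrm (b + cj y * a) + c) < 1} = card {y \<in> res. nv (nrm (b + y * a) + c) < 1}"
  proof (rule card_res_cj)
    fix x y assume "nv x \<le> 1" "nv y \<le> 1" "nv (x - y) < 1" "nv (nrm (b + x * a) + c) < 1"
    moreover have "(b + x * a) - (b + y * a) = (x - y) * a"
      by (simp add: algebra_simps)
    ultimately show "nv (nrm (b + y * a) + c) < 1"
      using assms by (rule_tac cong[of "b + x * a"]) (auto simp: nv_mult intro!: nv_add_le)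
  qed
  also have "\<dots> = card {y \<in> res. nv (nrm y + c) < 1}"
    using assms cong by (intro card_res_affine) auto
  also have "\<dots> = q + 1"
    using card_res_nrm[of "- c"] assms by (simp add: k_minus)
  finally show ?thesis .
qed

lemma nv_prm': "nv prm = inverse (real q)"
  using nv_prm by (simp add: field_simps)

text \<open>Unramifiedness allows a replacement by an element of \<open>k\<close>, and a power of
  \<open>prm\<close> moves its value into the interval from 1/q (excluded) to 1. A value below 1
  there would place it in the ideal generated by \<open>prm\<close>, where values are at most
  1/q.\<close>

lemma nv_discrete:
  assumes "a \<noteq> 0" obtains j :: int where "nv a = real q powi (- j)"
proof -
  have q: "real q > 1" using q_ge_2 by simp
  obtain b where b: "b \<in> k" "b \<noteq> 0" "nv a = nv b"
    using unramified assms by blast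
  define j where "j = - \<lceil>log (real q) (nv b)\<rceil>"
  have pos: "nv b > 0" using b by (simp add: nv_pos_iff)
  have up: "nv b \<le> real q powi (- j)"
  proof -
    have "log (real q) (nv b) \<le> of_int (- j)"
      by (simp add: j_def)
    hence "nv b \<le> real q powr of_int (- j)"
      using q pos by (simp add: log_le_iff)
    thus ?thesis using q powr_real_of_int'[of "real q" "- j"] by simp
  qed
  have lo: "real q powi (- j - 1) < nv b"
  proof -
    have "of_int (- j - 1) < log (real q) (nv b)"
      unfolding j_def by linarith
    hence "real q powr of_int (- j - 1) < nv b"
      using q pos by (simp add: less_log_iff)
    thus ?thesis using q powr_real_of_int'[of "real q" "- j - 1"] by simp
  qed
  define c where "c = b / prm powi j"
  have nvc: "nv c = nv b * real q powi j"
    using q by (simp add: c_def nv_divide nv_power_int nv_prm' power_int_inverse field_simps)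
  have "nv c \<le> 1"
    unfolding nvc using mult_right_mono[OF up, of "real q powi j"] q
    by (simp add: power_int_minus)
  moreover have "nv c > 1 / real q"
  proof -
    have "real q powi (- j - 1) * real q powi j < nv c"
      unfolding nvc using lo q by (intro mult_strict_right_mono) auto
    also have "real q powi (- j - 1) * real q powi j = 1 / real q"
      using q by (simp flip: power_int_add add: power_int_minus field_simps)
    finally show ?thesis .
  qed
  moreover have "nv c \<le> 1 / real q" if "nv c < 1"
  proof -
    have "c \<in> max_ideal nv k"
      using b that by (simp add: max_ideal_def c_def k_divide k_power_int prm_in_k)
    then obtain e where e: "c = prm * e" "nv e \<le> 1"
      unfolding prm_generates(2) val_ring_def by blast
    thus ?thesis
      using q by (simp add: nv_mult nv_prm' field_simps)
  qed
  ultimately have "nv c = 1" by force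
  hence "nv a = real q powi (- j)"
    using b nvc q by (simp add: power_int_minus field_simps)
  thus ?thesis using that by blast
qed

definition vl :: "'a \<Rightarrow> int" where
  "vl a = (THE j. nv a = real q powi (- j))"

lemma q_powi_eq_iff: "real q powi i = real q powi j \<longleftrightarrow> i = j"
  using q_ge_2 power_int_strict_increasing[of i j "real q"] power_int_strict_increasing[of j i "real q"]
  by (cases i j rule: linorder_cases) auto

lemma nv_eq_powi: "a \<noteq> 0 \<Longrightarrow> nv a = real q powi (- vl a)"
  unfolding vl_def by (rule theI') (metis nv_discrete q_powi_eq_iff neg_equal_iff_equal)

lemma vl_eqI: "nv a = real q powi (- j) \<Longrightarrow> vl a = j"
  unfolding vl_def by (rule the_equality) (auto simp: q_powi_eq_iff)

end

section \<open>The distribution of the lower right entry of a Hermitian form\<close>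

text \<open>With Q = q this is the proportion of the orbit of a primitive Hermitian form, of
  determinant valuation \<open>m\<close>, on which the lower right entry has valuation at least
  \<open>c\<close>. The number Q^2 + 1 counts the projective line over the residue field of k', Q +
  1 the isotropic points of a nondegenerate reduction. The step from \<open>m\<close>,
  \<open>c\<close> to m - 2, c - 2 corresponds to dividing the off-diagonal entry by the
  prime.\<close>

fun mu :: "real \<Rightarrow> nat \<Rightarrow> nat \<Rightarrow> real" where
  "mu Q 0 c = (if c = 0 then 1 else (Q + 1) / (Q\<^sup>2 + 1) / Q ^ (c - 1))"
| "mu Q (Suc 0) c = (if c = 0 then 1 else if c = 1 then 1 / (Q\<^sup>2 + 1) else 0)"
| "mu Q (Suc (Suc m)) c = (if c = 0 then 1 else if c \<le> 2 then 1 / (Q\<^sup>2 + 1) else mu Q m (c - 2) / Q\<^sup>2)"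

lemma mu_0 [simp]: "mu Q m 0 = 1"
  by (induction Q m "0::nat" rule: mu.induct) auto

lemma mu_1: "mu Q m (Suc 0) = (if m = 0 then (Q + 1) / (Q\<^sup>2 + 1) else 1 / (Q\<^sup>2 + 1))"
  by (cases "(Q, m, Suc 0)" rule: mu.cases) auto

text \<open>This and the next four lemmas are the ratios of consecutive values of \<open>mu\<close>,
  sorted into the regimes in which \<open>lev0_step\<close> finds them by counting.\<close>

lemma mu_odd:
  assumes "odd c" "c < m" shows "mu Q m (Suc c) = mu Q m c"
  using assms
proof (induction Q m c rule: mu.induct)
  case (3 Q m c)
  show ?case
  proof (cases "c = 1")
    case False
    with 3 have "c \<ge> 3" by (cases c) (auto elim!: oddE)
    hence "Suc c - 2 = Suc (c - 2)" by simp
    with 3 \<open>c \<ge> 3\<close> show ?thesis by simp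
  qed simp
qed auto

lemma mu_even:
  assumes "even c" "0 < c" "c < m" shows "mu Q m (Suc c) = mu Q m c / Q\<^sup>2"
  using assms
proof (induction Q m c rule: mu.induct)
  case (3 Q m c)
  show ?case
  proof (cases "c = 2")
    case True
    with 3 show ?thesis by (simp add: mu_1)
  next
    case False
    with 3 have "c \<ge> 4" by (auto elim!: evenE)
    hence "Suc c - 2 = Suc (c - 2)" by simp
    with 3 \<open>c \<ge> 4\<close> show ?thesis by simp
  qed
qed auto

lemma mu_top_odd: "odd m \<Longrightarrow> mu Q m (Suc m) = 0"
  by (induction Q m "Suc m" rule: mu.induct) (auto simp: Suc_diff_Suc elim!: oddE)

lemma mu_top_even:
  assumes "even m" "0 < m" shows "mu Q m (Suc m) = (Q + 1) / Q\<^sup>2 * mu Q m m"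
  using assms
proof (induction m rule: less_induct)
  case (less m)
  obtain l where l: "m = Suc (Suc l)"
    using less.prems by (metis even_Suc even_zero gr0_implies_Suc not0_implies_Suc)
  show ?case
  proof (cases "l = 0")
    case False
    with less l have "mu Q l (Suc l) = (Q + 1) / Q\<^sup>2 * mu Q l l" by simp
    thus ?thesis using False by (simp add: l)
  qed (simp add: l)
qed

lemma mu_tail:
  assumes "m < c" shows "mu Q m (Suc c) = mu Q m c / Q"
  using assms
proof (induction Q m c rule: mu.induct)
  case (1 Q c)
  then obtain d where "c = Suc d" by (cases c) auto
  thus ?case by simp
next
  case (3 Q m c)
  hence "Suc c - 2 = Suc (c - 2)" by simp
  with 3 show ?case by simp
qed auto

text \<open>For m >= 1 the coefficients are Q, Q + 1, ..., Q + 1, Q, and for m = 0 the polynomial is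
  the constant Q - 1. The unsymmetric formula covers both cases and satisfies a recursion in steps
  of two like that of \<open>mu\<close>.\<close>

definition chi :: "real \<Rightarrow> nat \<Rightarrow> complex \<Rightarrow> complex" where
  "chi Q m U = (of_real Q + U) * (\<Sum>j<m. U ^ j) + (of_real Q - 1) * U ^ m"

lemma chi_Suc_Suc: "chi Q (Suc (Suc m)) U = (of_real Q + U) * (1 + U) + U\<^sup>2 * chi Q m U"
proof -
  have "(\<Sum>j<Suc (Suc m). U ^ j) = 1 + U + U\<^sup>2 * (\<Sum>j<m. U ^ j)"
    unfolding sum.lessThan_Suc_shift by (simp add: sum_distrib_left power2_eq_square mult.assoc)
  thus ?thesis
    unfolding chi_def by (simp add: algebra_simps power2_eq_square)
qed

text \<open>Reversal turns the factor Q + U of the geometric sum into Q U + 1 = (Q + U) - (Q - 1) (1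
  - U). The difference telescopes to (Q - 1) (1 - U^m), which is what exchanges the lone constant
  for the top term. No division by 1 - U occurs, so U = 1 is included.\<close>

lemma chi_reflect:
  assumes "U \<noteq> 0" shows "U ^ m * chi Q m (1 / U) = chi Q m U"
proof -
  define S where "S = (\<Sum>j<m. U ^ j)"
  have rev: "U ^ m * (\<Sum>j<m. (1 / U) ^ j) = U * S"
    unfolding S_def
  proof (induction m)
    case (Suc m)
    have "U ^ Suc m * (\<Sum>j<Suc m. (1 / U) ^ j) = U * (U ^ m * (\<Sum>j<m. (1 / U) ^ j)) + U * (U ^ m * (1 / U) ^ m)"
      by (simp add: algebra_simps)
    also have "U ^ m * (1 / U) ^ m = 1"
      using assms by (simp flip: power_mult_distrib)
    also have "U * (U ^ m * (\<Sum>j<m. (1 / U) ^ j)) + U * 1 = U * (U * (\<Sum>j<m. U ^ j)) + U * 1"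
      by (simp only: Suc)
    also have "\<dots> = U * (\<Sum>j<Suc m. U ^ j)"
      unfolding sum.lessThan_Suc_shift by (simp add: sum_distrib_left algebra_simps)
    finally show ?case .
  qed simp
  have inv: "U ^ m * (1 / U) ^ m = 1"
    using assms by (simp flip: power_mult_distrib)
  have geo: "(1 - U) * S = 1 - U ^ m"
    unfolding S_def by (simp add: one_diff_power_eq)
  have "U ^ m * chi Q m (1 / U)
      = (of_real Q + 1 / U) * (U ^ m * (\<Sum>j<m. (1 / U) ^ j)) + (of_real Q - 1) * (U ^ m * (1 / U) ^ m)"
    by (simp add: chi_def algebra_simps)
  also have "\<dots> = (of_real Q * U + 1) * S + (of_real Q - 1)"
    unfolding rev inv using assms by (simp add: algebra_simps)
  also have "\<dots> = (of_real Q + U) * S - (of_real Q - 1) * ((1 - U) * S) + (of_real Q - 1)"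
    by (simp add: algebra_simps)
  also have "\<dots> = chi Q m U"
    unfolding geo by (simp add: chi_def S_def algebra_simps)
  finally show ?thesis .
qed

lemma norm_chi_le:
  assumes "norm U \<le> R" "1 \<le> R" "1 \<le> Q"
  shows "norm (chi Q m U) \<le> (Q + R) * (real m + 1) * R ^ m"
proof -
  have pow: "norm (U ^ j) \<le> R ^ m" if "j \<le> m" for j
  proof -
    have "norm (U ^ j) \<le> R ^ j"
      using assms by (simp add: norm_power power_mono)
    also have "\<dots> \<le> R ^ m"
      using assms that by (simp add: power_increasing)
    finally show ?thesis .
  qed
  have "norm (\<Sum>j<m. U ^ j) \<le> (\<Sum>j<m. R ^ m)"
    using pow by (intro sum_norm_le) auto
  hence 1: "norm (\<Sum>j<m. U ^ j) \<le> real m * R ^ m" by simp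
  have 2: "norm (of_real Q + U) \<le> Q + R"
    using norm_triangle_ineq[of "of_real Q" U] assms by simp
  have "of_real Q - 1 = (of_real (Q - 1) :: complex)" by simp
  hence 3: "norm (of_real Q - 1 :: complex) \<le> Q + R"
    using assms by (simp only: norm_of_real)
  have "norm (chi Q m U) \<le> norm (of_real Q + U) * norm (\<Sum>j<m. U ^ j) + norm (of_real Q - 1 :: complex) * norm (U ^ m)"
    unfolding chi_def by (metis norm_mult norm_triangle_ineq)
  also have "\<dots> \<le> (Q + R) * (real m * R ^ m) + (Q + R) * R ^ m"
    using 1 2 3 pow[of m] assms by (intro add_mono mult_mono) auto
  finally show ?thesis by (simp add: algebra_simps)
qed

lemma of_real_square_plus_1_nonzero: "(of_real Q)\<^sup>2 + 1 \<noteq> (0::complex)"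
proof -
  have "Q\<^sup>2 + 1 \<noteq> 0"
    using zero_le_power2[of Q] by linarith
  hence "complex_of_real (Q\<^sup>2 + 1) \<noteq> 0"
    by (simp only: of_real_eq_0_iff not_False_eq_True)
  thus ?thesis by simp
qed

text \<open>The differences of \<open>mu\<close> are the proportions with valuation exactly
  \<open>c\<close>. Both sides obey a recursion in steps of two, so the induction starts at m = 0, a
  geometric series, and m = 1, a finite sum. The sign in U = - T / Q anticipates
  \<open>Tq_s_of_z\<close>.\<close>

lemma mu_generating_function:
  assumes "Q > 1" "norm T < 1"
  defines "U \<equiv> - T / of_real Q"
  shows "(\<lambda>c. T ^ c * of_real (mu Q m c - mu Q m (Suc c)))
           sums ((of_real Q - U) * chi Q m U / (((of_real Q)\<^sup>2 + 1) * (1 + U)))"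
  using assms(1,2)
proof (induction m rule: induct_nat_012)
  case 0
  define K where "K = (of_real Q + 1) / ((of_real Q)\<^sup>2 + 1 :: complex)"
  have T: "T = - of_real Q * U" using assms by (simp add: U_def)
  have U: "norm (- U) < 1"
    using assms by (simp add: U_def norm_divide divide_less_eq)
  have nz: "1 + U \<noteq> 0"
    using U by (metis add.inverse_unique less_irrefl norm_minus_cancel norm_one)
  note nz' = of_real_square_plus_1_nonzero[of Q]
  have *: "T ^ Suc c * of_real (mu Q 0 (Suc c) - mu Q 0 (Suc (Suc c))) = K * (of_real Q - 1) * (- U) * (- U) ^ c" for c
  proof -
    have "mu Q 0 (Suc c) - mu Q 0 (Suc (Suc c)) = (Q + 1) / (Q\<^sup>2 + 1) * (Q - 1) / Q ^ Suc c"
    proof -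
      have "A / Q ^ c - A / (Q * Q ^ c) = A * (Q - 1) / (Q * Q ^ c)" for A
        using assms(1) by (simp add: divide_simps) (simp add: algebra_simps)
      from this[of "(Q + 1) / (Q\<^sup>2 + 1)"] show ?thesis by simp
    qed
    hence "T ^ Suc c * of_real (mu Q 0 (Suc c) - mu Q 0 (Suc (Suc c)))
        = T ^ Suc c / of_real Q ^ Suc c * (K * (of_real Q - 1))"
      by (simp add: K_def)
    also have "T ^ Suc c / of_real Q ^ Suc c = (- U) ^ Suc c"
      unfolding U_def by (simp only: minus_divide_left minus_minus power_divide)
    finally show ?thesis by (simp add: mult_ac)
  qed
  have "(\<lambda>c. K * (of_real Q - 1) * (- U) * (- U) ^ c) sums (K * (of_real Q - 1) * (- U) * (1 / (1 - (- U))))"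
    by (intro sums_mult geometric_sums U)
  hence "(\<lambda>c. T ^ Suc c * of_real (mu Q 0 (Suc c) - mu Q 0 (Suc (Suc c)))) sums (K * (of_real Q - 1) * (- U) / (1 + U))"
    unfolding * by simp
  from sums_Suc[OF this]
  have "(\<lambda>c. T ^ c * of_real (mu Q 0 c - mu Q 0 (Suc c))) sums (K * (of_real Q - 1) * (- U) / (1 + U) + (1 - K))"
    by (simp add: K_def)
  also have "K * (of_real Q - 1) * (- U) / (1 + U) + (1 - K) = (of_real Q - U) * chi Q 0 U / (((of_real Q)\<^sup>2 + 1) * (1 + U))"
    using nz nz' by (simp add: K_def chi_def divide_simps) (simp add: algebra_simps power2_eq_square)
  finally show ?case .
next
  case 1
  have T: "T = - of_real Q * U" using assms by (simp add: U_def)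
  have U: "norm (- U) < 1"
    using assms by (simp add: U_def norm_divide divide_less_eq)
  have nz: "1 + U \<noteq> 0"
    using U by (metis add.inverse_unique less_irrefl norm_minus_cancel norm_one)
  note nz' = of_real_square_plus_1_nonzero[of Q]
  have "(\<lambda>c. T ^ c * of_real (mu Q 1 c - mu Q 1 (Suc c))) sums
      (\<Sum>c<2. T ^ c * of_real (mu Q 1 c - mu Q 1 (Suc c)))"
    by (intro sums_finite) auto
  also have "(\<Sum>c<2. T ^ c * of_real (mu Q 1 c - mu Q 1 (Suc c)))
      = (of_real Q - U) * chi Q 1 U / (((of_real Q)\<^sup>2 + 1) * (1 + U))"
    using nz nz' by (simp add: numeral_2_eq_2 T chi_def divide_simps) (simp add: algebra_simps power2_eq_square)
  finally show ?case by simp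
next
  case (ge2 m)
  define \<Phi> where "\<Phi> = (of_real Q - U) * chi Q m U / (((of_real Q)\<^sup>2 + 1) * (1 + U))"
  have T: "T = - of_real Q * U" using assms by (simp add: U_def)
  have Q0: "of_real Q \<noteq> (0::complex)" using assms by simp
  have U: "norm (- U) < 1"
    using assms by (simp add: U_def norm_divide divide_less_eq)
  have nz: "1 + U \<noteq> 0"
    using U by (metis add.inverse_unique less_irrefl norm_minus_cancel norm_one)
  note nz' = of_real_square_plus_1_nonzero[of Q]
  let ?a = "\<lambda>c. T ^ c * of_real (mu Q m c - mu Q m (Suc c))"
  let ?b = "\<lambda>c. T ^ c * of_real (mu Q (Suc (Suc m)) c - mu Q (Suc (Suc m)) (Suc c))"
  have "?a sums \<Phi>"
    using ge2 by (simp add: \<Phi>_def)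
  hence "(\<lambda>c. ?a (Suc c)) sums (\<Phi> - (1 - of_real (mu Q m 1)))"
    using sums_Suc_iff[of ?a] by simp
  hence "(\<lambda>c. U\<^sup>2 * ?a (Suc c)) sums (U\<^sup>2 * (\<Phi> - (1 - of_real (mu Q m 1))))"
    by (rule sums_mult)
  \<comment> \<open>The recursion of \<open>mu\<close> applies to both values in a difference only
    from c = 3 on, since it treats c = 1 and c = 2 separately. Hence the shift by 3 on one side
    against 1 on the other; the first three terms are added afterwards.\<close>
  also have "(\<lambda>c. U\<^sup>2 * ?a (Suc c)) = (\<lambda>c. ?b (c + 3))"
  proof
    fix c
    have "?b (c + 3) = T\<^sup>2 / (of_real Q)\<^sup>2 * ?a (Suc c)"
      by (simp add: numeral_3_eq_3 diff_divide_distrib power2_eq_square algebra_simps)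
    also have "T\<^sup>2 / (of_real Q)\<^sup>2 = U\<^sup>2"
      by (simp add: U_def power_divide)
    finally show "U\<^sup>2 * ?a (Suc c) = ?b (c + 3)" ..
  qed
  finally have "(\<lambda>c. ?b (c + 3)) sums (U\<^sup>2 * (\<Phi> - (1 - of_real (mu Q m 1))))" .
  hence "?b sums (U\<^sup>2 * (\<Phi> - (1 - of_real (mu Q m 1))) + (\<Sum>c<3. ?b c))"
    by (subst (asm) sums_iff_shift)
  also have "(\<Sum>c<3. ?b c) = 1 - 1 / ((of_real Q)\<^sup>2 + 1) + T\<^sup>2 * (1 / ((of_real Q)\<^sup>2 + 1) - of_real (mu Q m 1) / (of_real Q)\<^sup>2)"
    by (simp add: numeral_3_eq_3 numeral_2_eq_2)
  also have "U\<^sup>2 * (\<Phi> - (1 - of_real (mu Q m 1))) + \<dots> = ((of_real Q)\<^sup>2 - U\<^sup>2) / ((of_real Q)\<^sup>2 + 1) + U\<^sup>2 * \<Phi>"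
  proof -
    have "T\<^sup>2 * (1 / ((of_real Q)\<^sup>2 + 1) - of_real (mu Q m 1) / (of_real Q)\<^sup>2)
        = (of_real Q)\<^sup>2 * U\<^sup>2 / ((of_real Q)\<^sup>2 + 1) - U\<^sup>2 * of_real (mu Q m 1)"
      using Q0 by (simp add: T power_mult_distrib right_diff_distrib)
    moreover have "1 - 1 / ((of_real Q)\<^sup>2 + 1) + (of_real Q)\<^sup>2 * U\<^sup>2 / ((of_real Q)\<^sup>2 + 1) - U\<^sup>2
        = ((of_real Q)\<^sup>2 - U\<^sup>2) / ((of_real Q)\<^sup>2 + 1)"
      using nz' by (simp add: divide_simps) (simp add: algebra_simps)
    ultimately show ?thesis by (simp add: algebra_simps)
  qed
  also have "\<dots> = (of_real Q - U) * chi Q (Suc (Suc m)) U / (((of_real Q)\<^sup>2 + 1) * (1 + U))"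
    unfolding chi_Suc_Suc \<Phi>_def using nz nz'
    by (simp add: divide_simps) (simp add: algebra_simps power2_eq_square)
  finally show ?case .
qed

section \<open>Rational continuation and adjacent transpositions\<close>

text \<open>A substitute for holomorphy in several variables: entire along every affine complex
  line. It survives affine substitutions such as permutations and \<open>s_of_z\<close>, and the
  identity theorem of one variable suffices to work with it.\<close>

definition line_entire :: "((nat \<Rightarrow> complex) \<Rightarrow> complex) \<Rightarrow> bool" where
  "line_entire F \<longleftrightarrow> (\<forall>a b. (\<lambda>e. F (\<lambda>i. a i + e * b i)) holomorphic_on UNIV)"

lemma line_entireD: "line_entire F \<Longrightarrow> (\<lambda>e. F (\<lambda>i. a i + e * b i)) holomorphic_on UNIV"
  by (simp add: line_entire_def)

lemma line_entire_const: "line_entire (\<lambda>z. c)"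
  by (simp add: line_entire_def)

lemma line_entire_coord: "line_entire (\<lambda>z. z i)"
  unfolding line_entire_def by (intro allI holomorphic_intros)

lemma line_entire_add: "line_entire F \<Longrightarrow> line_entire G \<Longrightarrow> line_entire (\<lambda>z. F z + G z)"
  unfolding line_entire_def by (intro allI holomorphic_intros) auto

lemma line_entire_diff: "line_entire F \<Longrightarrow> line_entire G \<Longrightarrow> line_entire (\<lambda>z. F z - G z)"
  unfolding line_entire_def by (intro allI holomorphic_intros) auto

lemma line_entire_mult: "line_entire F \<Longrightarrow> line_entire G \<Longrightarrow> line_entire (\<lambda>z. F z * G z)"
  unfolding line_entire_def by (intro allI holomorphic_intros) auto

lemma line_entire_power: "line_entire F \<Longrightarrow> line_entire (\<lambda>z. F z ^ j)"
  unfolding line_entire_def by (intro allI holomorphic_intros) auto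

lemma line_entire_sum: "(\<And>i. i \<in> I \<Longrightarrow> line_entire (F i)) \<Longrightarrow> line_entire (\<lambda>z. \<Sum>i\<in>I. F i z)"
  unfolding line_entire_def by (intro allI holomorphic_intros) auto

lemma line_entire_prod: "(\<And>i. i \<in> I \<Longrightarrow> line_entire (F i)) \<Longrightarrow> line_entire (\<lambda>z. \<Prod>i\<in>I. F i z)"
  unfolding line_entire_def by (intro allI holomorphic_intros) auto

lemma line_entire_powr:
  assumes "line_entire F" "q > 0" shows "line_entire (\<lambda>z. of_nat q powr F z)"
proof -
  have "(\<lambda>z. of_nat q powr F z) = (\<lambda>z. exp (F z * of_real (ln (real q))))"
    using assms by (auto simp: powr_def Ln_of_nat)
  thus ?thesis
    using assms unfolding line_entire_def by (auto intro!: holomorphic_intros)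
qed

lemmas line_entire_intros = line_entire_const line_entire_coord line_entire_add line_entire_diff
  line_entire_mult line_entire_power line_entire_sum line_entire_prod line_entire_powr

lemma line_entire_compose:
  assumes "line_entire F" "\<And>a b. \<exists>c d. \<forall>e. L (\<lambda>i. a i + e * b i) = (\<lambda>i. c i + e * d i)"
  shows "line_entire (\<lambda>z. F (L z))"
  unfolding line_entire_def
proof (intro allI)
  fix a b :: "nat \<Rightarrow> complex"
  obtain c d where "\<And>e. L (\<lambda>i. a i + e * b i) = (\<lambda>i. c i + e * d i)"
    using assms(2) by blast
  thus "(\<lambda>e. F (L (\<lambda>i. a i + e * b i))) holomorphic_on UNIV"
    using line_entireD[OF assms(1), of c d] by simp
qed

lemma line_entire_perm:
  assumes "line_entire F" shows "line_entire (\<lambda>z. F (z \<circ> \<sigma>))"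
  using assms
proof (rule line_entire_compose)
  fix a b :: "nat \<Rightarrow> complex"
  show "\<exists>c d. \<forall>e. (\<lambda>i. a i + e * b i) \<circ> \<sigma> = (\<lambda>i. c i + e * d i)"
    by (intro exI[of _ "a \<circ> \<sigma>"] exI[of _ "b \<circ> \<sigma>"]) auto
qed

lemma s_of_z_line:
  "s_of_z q n (\<lambda>i. a i + e * b i)
     = (\<lambda>i. s_of_z q n a i + e * (if i < n then - b i + b (i + 1) else - b n))"
  by (auto simp: s_of_z_def fun_eq_iff algebra_simps)

lemma line_entire_s_of_z:
  assumes "line_entire F" shows "line_entire (\<lambda>z. F (s_of_z q n z))"
  using assms
proof (rule line_entire_compose)
  fix a b :: "nat \<Rightarrow> complex"
  show "\<exists>c d. \<forall>e. s_of_z q n (\<lambda>i. a i + e * b i) = (\<lambda>i. c i + e * d i)"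
    by (intro exI[of _ "s_of_z q n a"] exI[of _ "\<lambda>i. if i < n then - b i + b (i + 1) else - b n"]
        allI s_of_z_line)
qed

lemma entire_eq_0_of_nhds:
  fixes f :: "complex \<Rightarrow> complex"
  assumes "f holomorphic_on UNIV" "\<forall>\<^sub>F e in nhds 0. f e = 0"
  shows "f w = 0"
proof -
  obtain S where S: "open S" "0 \<in> S" "\<And>e. e \<in> S \<Longrightarrow> f e = 0"
    using assms(2) unfolding eventually_nhds by blast
  show ?thesis
    by (rule analytic_continuation_open[of S UNIV f "\<lambda>_. 0"]) (use S assms in auto)
qed

text \<open>The point \<open>z\<close> is reached at e = 1 on the line from \<open>z0\<close> in
  direction z - z0. The neighbourhood on which the function is known to vanish may depend on the
  line.\<close>

lemma line_entire_eq_0: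
  assumes "line_entire F" "\<And>b. \<forall>\<^sub>F e in nhds 0. F (\<lambda>i. z0 i + e * b i) = 0"
  shows "F z = 0"
  using entire_eq_0_of_nhds[OF line_entireD[OF assms(1), of z0 "\<lambda>i. z i - z0 i"] assms(2), of 1]
  by simp

text \<open>Absence of zero divisors: near \<open>z0\<close> on each line through it
  \<open>F\<close> is nonzero by continuity, so \<open>G\<close> vanishes there. This is the device
  by which denominators are cancelled from identities.\<close>

lemma line_entire_mult_eq_0:
  assumes F: "line_entire F" and G: "line_entire G" and "\<And>z. F z * G z = 0" and nz: "F z0 \<noteq> 0"
  shows "G z = 0"
proof (rule line_entire_eq_0[OF G, of z0])
  fix b
  have "isCont (\<lambda>e. F (\<lambda>i. z0 i + e * b i)) 0"
    using line_entireD[OF F, of z0 b] holomorphic_on_imp_continuous_on continuous_on_interior by fastforce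
  hence "\<forall>\<^sub>F e in at 0. F (\<lambda>i. z0 i + e * b i) \<noteq> 0"
    using nz by (intro tendsto_imp_eventually_ne[where c = "F z0"]) (auto simp: isCont_def)
  hence "\<forall>\<^sub>F e in nhds 0. F (\<lambda>i. z0 i + e * b i) \<noteq> 0"
    using nz by (simp add: eventually_nhds_conv_at)
  thus "\<forall>\<^sub>F e in nhds 0. G (\<lambda>i. z0 i + e * b i) = 0"
    using assms(3) by (auto elim!: eventually_mono)
qed

lemma polynomial_fun_line_entire:
  assumes "polynomial_fun n P" shows "line_entire P"
proof -
  obtain A c where "P = (\<lambda>t. \<Sum>e\<in>A. c e * (\<Prod>i=1..n. t i ^ e i))"
    using assms unfolding polynomial_fun_def by blast
  thus ?thesis by (auto intro!: line_entire_intros)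
qed

lemma polynomial_fun_cong:
  assumes "polynomial_fun n P" "\<And>i. i \<in> {1..n} \<Longrightarrow> s i = t i" shows "P s = P t"
proof -
  obtain A c where P: "P = (\<lambda>t. \<Sum>e\<in>A. c e * (\<Prod>i=1..n. t i ^ e i))"
    using assms unfolding polynomial_fun_def by blast
  show ?thesis
    unfolding P using assms(2) by (intro sum.cong arg_cong[where f = "(*) _"] prod.cong) auto
qed

lemma polynomial_fun_q_power_line_entire:
  assumes "polynomial_fun n P" "q > 0" shows "line_entire (\<lambda>s. P (q_power q s))"
proof -
  obtain A c where "P = (\<lambda>t. \<Sum>e\<in>A. c e * (\<Prod>i=1..n. t i ^ e i))"
    using assms unfolding polynomial_fun_def by blast
  thus ?thesis using assms(2) by (auto intro!: line_entire_intros simp: q_power_def)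
qed

text \<open>Powers of q have nonzero coordinates, and every point with nonzero coordinates in the
  range 1..n is matched there by such powers. Multiplying the polynomial by the product of the
  coordinates yields a point where it is nonzero and that lies off the coordinate
  hyperplanes.\<close>

lemma polynomial_fun_q_power_nonzero:
  assumes "polynomial_fun n P" "q > 1" "P t \<noteq> 0"
  obtains s where "P (q_power q s) \<noteq> 0"
proof -
  have "\<exists>t. (\<Prod>i=1..n. t i) * P t \<noteq> 0"
  proof (rule ccontr)
    assume "\<not> ?thesis"
    hence *: "(\<Prod>i=1..n. t i) * P t = 0" for t by blast
    have "line_entire (\<lambda>t. \<Prod>i=1..n. t i)"
      by (intro line_entire_intros)
    from line_entire_mult_eq_0[OF this polynomial_fun_line_entire[OF assms(1)] *, of "\<lambda>_. 1" t]
    have "P t = 0" by simp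
    with assms show False by simp
  qed
  then obtain t where "(\<Prod>i=1..n. t i) * P t \<noteq> 0"
    by blast
  hence t: "\<And>i. i \<in> {1..n} \<Longrightarrow> t i \<noteq> 0" "P t \<noteq> 0"
    by (auto simp: prod_zero_iff)
  define s where "s i = Ln (t i) / of_real (ln (real q))" for i
  have "q_power q s i = t i" if "i \<in> {1..n}" for i
    using t(1)[OF that] assms(2) by (simp add: q_power_def powr_def s_def Ln_of_nat)
  hence "P (q_power q s) = P t"
    by (intro polynomial_fun_cong[OF assms(1)]) auto
  with t(2) that show ?thesis by metis
qed

text \<open>The system is triangular: z_n is read off from the last equation and each earlier
  coordinate by adding up, which gives minus the tail sums of \<open>c\<close>.\<close>

lemma s_of_z_surj:
  obtains z where "\<And>i. i \<in> {1..n} \<Longrightarrow> s_of_z q n z i = s i"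
proof -
  define c where "c i = (if i < n then s i + 1 - complex_of_real pi * \<i> / complex_of_real (ln (real q))
      else s n + 1 - complex_of_real pi * \<i> / (2 * complex_of_real (ln (real q))))" for i
  define z where "z i = - (\<Sum>j=i..n. c j)" for i
  have "s_of_z q n z i = s i" if i: "i \<in> {1..n}" for i
  proof (cases "i < n")
    case True
    hence "(\<Sum>j=i..n. c j) = c i + (\<Sum>j=i+1..n. c j)"
      using sum.atLeast_Suc_atMost[of i n c] by simp
    thus ?thesis
      using True by (simp add: s_of_z_def z_def c_def[of i])
  next
    case False
    hence "i = n" using i by auto
    thus ?thesis by (simp add: s_of_z_def z_def c_def)
  qed
  thus ?thesis using that by blast
qed

lemma rational_continuation_z_nonzero:
  assumes "rational_continuation q n f P Q" "q > 1"
  obtains z where "Q (q_power q (s_of_z q n z)) \<noteq> 0"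
proof -
  obtain t where "Q t \<noteq> 0" and Q: "polynomial_fun n Q"
    using assms unfolding rational_continuation_def by blast
  then obtain s where s: "Q (q_power q s) \<noteq> 0"
    using polynomial_fun_q_power_nonzero assms(2) by metis
  obtain z where z: "\<And>i. i \<in> {1..n} \<Longrightarrow> s_of_z q n z i = s i"
    using s_of_z_surj by blast
  have "Q (q_power q (s_of_z q n z)) = Q (q_power q s)"
    by (intro polynomial_fun_cong[OF Q]) (simp add: q_power_def z)
  with s that show ?thesis by metis
qed

text \<open>Near s = (1, ..., 1) all real parts are positive and both fractions represent
  \<open>f\<close> wherever they are defined. With both denominators multiplied in, the identity
  holds on that whole neighbourhood, extends everywhere, and the denominators are cancelled
  again.\<close>

lemma rational_continuation_unique:
  assumes 1: "rational_continuation q n f P1 Q1" and 2: "rational_continuation q n f P2 Q2" and "q > 1"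
  shows "P1 (q_power q s) * Q2 (q_power q s) = P2 (q_power q s) * Q1 (q_power q s)"
proof -
  let ?p1 = "\<lambda>s. P1 (q_power q s)" and ?q1 = "\<lambda>s. Q1 (q_power q s)"
  let ?p2 = "\<lambda>s. P2 (q_power q s)" and ?q2 = "\<lambda>s. Q2 (q_power q s)"
  have poly: "polynomial_fun n P1" "polynomial_fun n Q1" "polynomial_fun n P2" "polynomial_fun n Q2"
    and nz: "\<exists>t. Q1 t \<noteq> 0" "\<exists>t. Q2 t \<noteq> 0"
    using 1 2 by (auto simp: rational_continuation_def)
  have le: "line_entire ?p1" "line_entire ?q1" "line_entire ?p2" "line_entire ?q2"
    using poly assms(3) by (auto intro!: polynomial_fun_q_power_line_entire)
  obtain s1 where s1: "?q1 s1 \<noteq> 0"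
    using nz(1) polynomial_fun_q_power_nonzero[OF poly(2) assms(3)] by metis
  obtain s2 where s2: "?q2 s2 \<noteq> 0"
    using nz(2) polynomial_fun_q_power_nonzero[OF poly(4) assms(3)] by metis
  define H where "H = (\<lambda>s. ?q1 s * (?q2 s * (?p1 s * ?q2 s - ?p2 s * ?q1 s)))"
  have H0: "H s = 0" for s
  proof (rule line_entire_eq_0[of H "\<lambda>_. 1"])
    show "line_entire H"
      unfolding H_def using le by (intro line_entire_intros)
    fix b :: "nat \<Rightarrow> complex"
    have "\<forall>\<^sub>F e in nhds 0. \<forall>i\<in>{1..n}. 0 < Re (1 + e * b i)"
    proof (intro eventually_ball_finite ballI)
      fix i
      have "((\<lambda>e. Re (1 + e * b i)) \<longlongrightarrow> Re (1 + 0 * b i)) (nhds 0)"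
        by (intro tendsto_intros filterlim_ident)
      thus "\<forall>\<^sub>F e in nhds 0. 0 < Re (1 + e * b i)"
        by (rule order_tendstoD) simp
    qed simp
    thus "\<forall>\<^sub>F e in nhds 0. H (\<lambda>i. 1 + e * b i) = 0"
    proof eventually_elim
      case (elim e)
      let ?s = "\<lambda>i. 1 + e * b i"
      have "f ?s = ?p1 ?s / ?q1 ?s" if "?q1 ?s \<noteq> 0"
        using 1 that elim unfolding rational_continuation_def by (metis less_imp_le)
      moreover have "f ?s = ?p2 ?s / ?q2 ?s" if "?q2 ?s \<noteq> 0"
        using 2 that elim unfolding rational_continuation_def by (metis less_imp_le)
      ultimately show ?case
        unfolding H_def by (cases "?q1 ?s = 0"; cases "?q2 ?s = 0") (auto simp: frac_eq_eq)
    qed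
  qed
  note * = H0[unfolded H_def]
  have **: "?q2 s * (?p1 s * ?q2 s - ?p2 s * ?q1 s) = 0" for s
    by (rule line_entire_mult_eq_0[OF le(2) _ * s1]) (use le in \<open>intro line_entire_intros\<close>)
  have "?p1 s * ?q2 s - ?p2 s * ?q1 s = 0"
    by (rule line_entire_mult_eq_0[OF le(4) _ ** s2]) (use le in \<open>intro line_entire_intros\<close>)
  thus ?thesis by simp
qed

lemma omega_eq:
  assumes "rational_continuation q n (omega_integral nv cj n M x) P Q" "Q (q_power q s) \<noteq> 0" "q > 1"
  shows "omega nv cj q n M x s = P (q_power q s) / Q (q_power q s)"
  unfolding omega_def
proof (rule the_equality)
  fix w
  assume "\<exists>P Q. rational_continuation q n (omega_integral nv cj n M x) P Q \<and>
            Q (q_power q s) \<noteq> 0 \<and> w = P (q_power q s) / Q (q_power q s)"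
  then obtain P' Q' where *: "rational_continuation q n (omega_integral nv cj n M x) P' Q'"
    "Q' (q_power q s) \<noteq> 0" "w = P' (q_power q s) / Q' (q_power q s)" by blast
  show "w = P (q_power q s) / Q (q_power q s)"
    unfolding *(3) using rational_continuation_unique[OF assms(1) *(1) assms(3), of s] *(2) assms(2)
    by (simp add: frac_eq_eq)
qed (use assms in blast)

section \<open>The factor \<open>G1\<close> and the passage from adjacent transpositions to the
  symmetric group\<close>

definition pairs :: "nat \<Rightarrow> (nat \<times> nat) set" where
  "pairs n = {(i, j). 1 \<le> i \<and> i < j \<and> j \<le> n}"

lemma finite_pairs: "finite (pairs n)"
  by (rule finite_subset[of _ "{..n} \<times> {..n}"]) (auto simp: pairs_def)

text \<open>No integer lies between i and i + 1, so their exchange reverses the order of this one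
  pair only and permutes all the others among themselves.\<close>

lemma prod_pairs_swap:
  fixes h :: "complex \<Rightarrow> complex"
  assumes "1 \<le> i" "i < n"
  defines "\<tau> \<equiv> Transposition.transpose i (Suc i)"
  shows "(\<Prod>(a, b)\<in>pairs n. h (z a - z b)) = h (z i - z (Suc i)) * (\<Prod>(a, b)\<in>pairs n - {(i, Suc i)}. h (z a - z b))"
    and "(\<Prod>(a, b)\<in>pairs n - {(i, Suc i)}. h ((z \<circ> \<tau>) a - (z \<circ> \<tau>) b)) = (\<Prod>(a, b)\<in>pairs n - {(i, Suc i)}. h (z a - z b))"
proof -
  have "(i, Suc i) \<in> pairs n"
    using assms by (auto simp: pairs_def)
  thus "(\<Prod>(a, b)\<in>pairs n. h (z a - z b)) = h (z i - z (Suc i)) * (\<Prod>(a, b)\<in>pairs n - {(i, Suc i)}. h (z a - z b))"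
    by (subst prod.remove[OF finite_pairs]) auto
  have mem: "(\<tau> a, \<tau> b) \<in> pairs n - {(i, Suc i)}" if "(a, b) \<in> pairs n - {(i, Suc i)}" for a b
    using that assms(1,2) by (auto simp: pairs_def \<tau>_def Transposition.transpose_def)
  have inv: "\<tau> (\<tau> a) = a" for a
    by (simp add: \<tau>_def)
  show "(\<Prod>(a, b)\<in>pairs n - {(i, Suc i)}. h ((z \<circ> \<tau>) a - (z \<circ> \<tau>) b)) = (\<Prod>(a, b)\<in>pairs n - {(i, Suc i)}. h (z a - z b))"
    by (rule prod.reindex_bij_witness[where i = "\<lambda>(a, b). (\<tau> a, \<tau> b)" and j = "\<lambda>(a, b). (\<tau> a, \<tau> b)"])
       (use mem inv in \<open>auto simp del: Diff_iff\<close>)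
qed

definition G1_num :: "nat \<Rightarrow> nat \<Rightarrow> (nat \<Rightarrow> complex) \<Rightarrow> complex" where
  "G1_num q n z = (\<Prod>(i, j)\<in>pairs n. 1 + of_nat q powr (z i - z j))"

definition G1_den :: "nat \<Rightarrow> nat \<Rightarrow> (nat \<Rightarrow> complex) \<Rightarrow> complex" where
  "G1_den q n z = (\<Prod>(i, j)\<in>pairs n. 1 - of_nat q powr (z i - z j - 1))"

lemma G1_eq: "G1 q n z = G1_num q n z / G1_den q n z"
  unfolding G1_def G1_num_def G1_den_def pairs_def[symmetric]
  by (simp add: prod_dividef case_prod_unfold)

lemma G1_den_nonzero: "G1_regular q n z \<Longrightarrow> G1_den q n z \<noteq> 0"
  using finite_pairs by (auto simp: G1_den_def G1_regular_def pairs_def)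

lemma line_entire_G1:
  assumes "q > 0" shows "line_entire (G1_num q n)" "line_entire (G1_den q n)"
  unfolding G1_num_def[abs_def] G1_den_def[abs_def] case_prod_unfold
  using assms by (intro line_entire_intros; simp)+

text \<open>Invariance of the quotient A / B under the permutation, written without division so that
  it has a meaning at the zeros of \<open>B\<close>.\<close>

definition cross_rel :: "((nat \<Rightarrow> complex) \<Rightarrow> complex) \<Rightarrow> ((nat \<Rightarrow> complex) \<Rightarrow> complex) \<Rightarrow> (nat \<Rightarrow> nat) \<Rightarrow> bool" where
  "cross_rel A B \<sigma> \<longleftrightarrow> (\<forall>z. A z * B (z \<circ> \<sigma>) = A (z \<circ> \<sigma>) * B z)"

text \<open>Chaining two cross-multiplied relations produces the wanted one times B (z o sigma).
  That factor can be cancelled only as a nonzero function, which is why the functions have to be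
  entire along lines and \<open>B\<close> not identically zero.\<close>

lemma cross_rel_comp:
  assumes "line_entire A" "line_entire B" "B z0 \<noteq> 0" "bij \<sigma>" "cross_rel A B \<sigma>" "cross_rel A B \<tau>"
  shows "cross_rel A B (\<sigma> \<circ> \<tau>)"
  unfolding cross_rel_def
proof
  fix z
  have 1: "B (z \<circ> \<sigma>) * (A z * B (z \<circ> (\<sigma> \<circ> \<tau>)) - A (z \<circ> (\<sigma> \<circ> \<tau>)) * B z) = 0" for z
  proof -
    have "A z * B (z \<circ> \<sigma>) = A (z \<circ> \<sigma>) * B z" "A (z \<circ> \<sigma>) * B (z \<circ> \<sigma> \<circ> \<tau>) = A (z \<circ> \<sigma> \<circ> \<tau>) * B (z \<circ> \<sigma>)"
      using assms(5,6) unfolding cross_rel_def by blast+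
    moreover have "b1 * (a * b2 - a2 * b) = 0" if "a * b1 = a1 * b" "a1 * b2 = a2 * b1"
      for a a1 a2 b b1 b2 :: complex
    proof -
      have "b1 * (a * b2 - a2 * b) = (a * b1) * b2 - (a2 * b1) * b"
        by (simp add: algebra_simps)
      also have "\<dots> = 0"
        unfolding that(1) that(2)[symmetric] by simp
      finally show ?thesis .
    qed
    ultimately show ?thesis unfolding comp_assoc by blast
  qed
  have nz: "B ((z0 \<circ> inv_into UNIV \<sigma>) \<circ> \<sigma>) \<noteq> 0"
    using assms(3,4) by (simp add: comp_assoc bij_is_inj)
  have "A z * B (z \<circ> (\<sigma> \<circ> \<tau>)) - A (z \<circ> (\<sigma> \<circ> \<tau>)) * B z = 0"
    by (rule line_entire_mult_eq_0[where F = "\<lambda>z. B (z \<circ> \<sigma>)", OF _ _ 1 nz])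
       (use assms in \<open>auto intro!: line_entire_intros line_entire_perm\<close>)
  thus "A z * B (z \<circ> (\<sigma> \<circ> \<tau>)) = A (z \<circ> (\<sigma> \<circ> \<tau>)) * B z" by simp
qed

text \<open>The transposition of a and a + d + 1 is the conjugate of the one of a and a + d by the
  adjacent transposition of a + d and a + d + 1, so the distance grows by induction; transpositions
  then generate everything.\<close>

lemma cross_rel_permutes:
  assumes le: "line_entire A" "line_entire B" "B z0 \<noteq> 0"
    and adj: "\<And>i. 1 \<le> i \<Longrightarrow> i < n \<Longrightarrow> cross_rel A B (Transposition.transpose i (Suc i))"
    and "\<sigma> permutes {1..n}"
  shows "cross_rel A B \<sigma>"
proof -
  have transp: "cross_rel A B (Transposition.transpose a (a + d))" if "1 \<le> a" "a + d \<le> n" for a d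
    using that
  proof (induction d)
    case 0
    show ?case by (simp add: cross_rel_def comp_def)
  next
    case (Suc d)
    show ?case
    proof (cases "d = 0")
      case True
      with Suc adj[of a] show ?thesis by simp
    next
      case False
      let ?s = "Transposition.transpose (a + d) (Suc (a + d))"
      let ?t = "Transposition.transpose a (a + d)"
      have "Transposition.transpose a (a + Suc d) = ?s \<circ> (?t \<circ> ?s)"
        using False by (auto simp: fun_eq_iff Transposition.transpose_def)
      moreover have "cross_rel A B (?s \<circ> (?t \<circ> ?s))"
        using Suc adj[of "a + d"] by (intro cross_rel_comp[OF le]) auto
      ultimately show ?thesis by (simp only:)
    qed
  qed
  have transp': "cross_rel A B (Transposition.transpose a b)" if "a \<in> {1..n}" "b \<in> {1..n}" for a b
  proof (cases "a \<le> b")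
    case True
    thus ?thesis using transp[of a "b - a"] that by simp
  next
    case False
    thus ?thesis using transp[of b "a - b"] that by (simp add: transpose_commute)
  qed
  have "finite {1..n}" by simp
  from assms(5) this show ?thesis
  proof (induction rule: permutes_induct)
    case id
    show ?case by (simp add: cross_rel_def comp_def)
  next
    case (swap a b p)
    thus ?case
      using transp' by (intro cross_rel_comp[OF le]) auto
  qed
qed

text \<open>
  The exchange of \<open>z\<^sub>i\<close> and \<open>z\<^bsub>i+1\<^esub>\<close> changes the neighbouring exponents by less than 1; the constant 5 leaves room for
  that and for the power of the determinant lost in the continuation.
\<close>
definition exchange_region :: "nat \<Rightarrow> nat \<Rightarrow> nat \<Rightarrow> (nat \<Rightarrow> complex) set" where
  "exchange_region q n i = {z. \<bar>Re (z i - z (Suc i))\<bar> < 1 \<and> (\<forall>j\<in>{1..n} - {i}. 5 < Re (s_of_z q n z j))}"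

lemma exchange_region_open:
  assumes "z0 \<in> exchange_region q n i"
  shows "\<forall>\<^sub>F e in nhds 0. (\<lambda>j. z0 j + e * b j) \<in> exchange_region q n i"
proof -
  have "((\<lambda>e. \<bar>Re ((z0 i + e * b i) - (z0 (Suc i) + e * b (Suc i)))\<bar>)
      \<longlongrightarrow> \<bar>Re ((z0 i + 0 * b i) - (z0 (Suc i) + 0 * b (Suc i)))\<bar>) (nhds 0)"
    by (intro tendsto_intros filterlim_ident)
  hence 1: "\<forall>\<^sub>F e in nhds 0. \<bar>Re ((z0 i + e * b i) - (z0 (Suc i) + e * b (Suc i)))\<bar> < 1"
    by (rule order_tendstoD) (use assms in \<open>simp add: exchange_region_def\<close>)
  have 2: "\<forall>\<^sub>F e in nhds 0. \<forall>j\<in>{1..n} - {i}. 5 < Re (s_of_z q n (\<lambda>j. z0 j + e * b j) j)"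
  proof (intro eventually_ball_finite ballI)
    fix j assume j: "j \<in> {1..n} - {i}"
    define d where "d = (if j < n then - b j + b (j + 1) else - b n)"
    have "((\<lambda>e. Re (s_of_z q n z0 j + e * d)) \<longlongrightarrow> Re (s_of_z q n z0 j + 0 * d)) (nhds 0)"
      by (intro tendsto_intros filterlim_ident)
    hence "\<forall>\<^sub>F e in nhds 0. 5 < Re (s_of_z q n z0 j + e * d)"
      by (rule order_tendstoD) (use assms j in \<open>auto simp: exchange_region_def\<close>)
    thus "\<forall>\<^sub>F e in nhds 0. 5 < Re (s_of_z q n (\<lambda>j. z0 j + e * b j) j)"
      by (simp add: s_of_z_line d_def)
  qed simp
  show ?thesis
    using eventually_conj[OF 1 2] by (simp add: exchange_region_def)
qed

lemma Re_s_of_z: "Re (s_of_z q n z j) = (if j < n then - Re (z j) + Re (z (j + 1)) - 1 else - Re (z n) - 1)"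
  by (simp add: s_of_z_def Re_divide_of_real)

lemma exchange_region_nonempty:
  assumes "1 \<le> i" "i < n"
  obtains z where "z \<in> exchange_region q n i"
proof
  \<comment> \<open>Steps of 7 give Re s_j = 6 for j other than i and n. The value at i is repeated
    at i + 1, so z_i - z_{i+1} = 0, and the final shift makes z_n = -14, hence Re s_n = 13.\<close>
  let ?z = "\<lambda>j. complex_of_real (7 * (if j \<le> i then real j else real j - 1) - 7 * real n - 7)"
  show "?z \<in> exchange_region q n i"
    using assms by (auto simp: exchange_region_def Re_s_of_z)
qed

lemma line_entire_eq_0_exchange_region:
  assumes "line_entire F" "1 \<le> i" "i < n" "\<And>z. z \<in> exchange_region q n i \<Longrightarrow> F z = 0"
  shows "F z = 0"
proof -
  obtain z0 where "z0 \<in> exchange_region q n i"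
    using exchange_region_nonempty assms by blast
  thus ?thesis
    using eventually_mono[OF exchange_region_open, of z0 q n i _ "\<lambda>e. F (\<lambda>j. z0 j + e * _ j) = 0"] assms(4)
    by (intro line_entire_eq_0[OF assms(1), of z0]) blast
qed

text \<open>The factor of \<open>G1\<close> for the pair (i, i+1) is q (1 + U) / (q - U), exactly
  what the exchange relation lacks for symmetry. Multiplying that relation by both denominators
  removes its provisos, so it holds on the whole region, extends by the identity theorem, and the
  denominators are cancelled.\<close>

theorem functional_equation_of_exchange:
  fixes f :: "(nat \<Rightarrow> complex) \<Rightarrow> complex"
  assumes q: "q > 1" and rc: "rational_continuation q n f P Q"
    and exch: "\<And>i z. 1 \<le> i \<Longrightarrow> i < n \<Longrightarrow> z \<in> exchange_region q n i \<Longrightarrow>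
      (let U = of_nat q powr (z i - z (Suc i)); \<tau> = Transposition.transpose i (Suc i);
           p = (\<lambda>z. P (q_power q (s_of_z q n z))); r = (\<lambda>z. Q (q_power q (s_of_z q n z)))
       in r z \<noteq> 0 \<longrightarrow> r (z \<circ> \<tau>) \<noteq> 0 \<longrightarrow>
          (1 + U) * (of_nat q - 1 / U) * p z * r (z \<circ> \<tau>) = (1 + 1 / U) * (of_nat q - U) * p (z \<circ> \<tau>) * r z)"
    and \<sigma>: "\<sigma> permutes {1..n}"
  shows "cross_rel (\<lambda>z. G1_num q n z * P (q_power q (s_of_z q n z)))
           (\<lambda>z. G1_den q n z * Q (q_power q (s_of_z q n z))) \<sigma>"
proof -
  define p where "p = (\<lambda>z. P (q_power q (s_of_z q n z)))"
  define r where "r = (\<lambda>z. Q (q_power q (s_of_z q n z)))"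
  have poly: "polynomial_fun n P" "polynomial_fun n Q"
    using rc by (auto simp: rational_continuation_def)
  have le: "line_entire p" "line_entire r"
    unfolding p_def r_def using poly q
    by (auto intro!: line_entire_s_of_z[of "\<lambda>s. _ (q_power q s)"] polynomial_fun_q_power_line_entire)
  obtain z1 where z1: "r z1 \<noteq> 0"
    using rational_continuation_z_nonzero[OF rc q] unfolding r_def by blast
  have den_nz: "\<exists>z. G1_den q n z \<noteq> 0"
  proof -
    have "G1_regular q n (\<lambda>_. 0)"
    proof -
      have "of_nat q powr (-1) = (1 / of_nat q :: complex)"
        using q by (simp add: powr_minus_divide)
      thus ?thesis
        using q by (simp add: G1_regular_def)
    qed
    thus ?thesis using G1_den_nonzero by blast
  qed
  have le_G1: "line_entire (G1_num q n)" "line_entire (G1_den q n)"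
    using line_entire_G1 q by auto
  have adj: "cross_rel (\<lambda>z. G1_num q n z * p z) (\<lambda>z. G1_den q n z * r z) (Transposition.transpose i (Suc i))"
    if i: "1 \<le> i" "i < n" for i
  proof -
    define \<tau> where "\<tau> = Transposition.transpose i (Suc i)"
    define U where "U = (\<lambda>z :: nat \<Rightarrow> complex. of_nat q powr (z i - z (Suc i)) :: complex)"
    define V where "V = (\<lambda>z :: nat \<Rightarrow> complex. of_nat q powr (z (Suc i) - z i) :: complex)"
    have V: "V z = 1 / U z" for z
      unfolding U_def V_def by (metis minus_diff_eq powr_minus_divide)
    have le_UV: "line_entire U" "line_entire V"
      unfolding U_def V_def using q by (auto intro!: line_entire_intros)
    have le': "line_entire (\<lambda>z. p (z \<circ> \<tau>))" "line_entire (\<lambda>z. r (z \<circ> \<tau>))"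
      using le by (auto intro: line_entire_perm)
    let ?D = "\<lambda>z. (1 + U z) * (of_nat q - V z) * p z * r (z \<circ> \<tau>) - (1 + V z) * (of_nat q - U z) * p (z \<circ> \<tau>) * r z"
    define H where "H = (\<lambda>z. r z * (r (z \<circ> \<tau>) * ?D z))"
    have "H z = 0" for z
    proof (rule line_entire_eq_0_exchange_region[OF _ i, of H q])
      show "line_entire H"
        unfolding H_def using le le' le_UV by (intro line_entire_intros)
      fix z assume "z \<in> exchange_region q n i"
      from exch[OF i this] show "H z = 0"
        by (auto simp: H_def Let_def U_def V[unfolded U_def] r_def p_def \<tau>_def)
    qed
    note H0 = this[unfolded H_def]
    have H1: "r (z \<circ> \<tau>) * ?D z = 0" for z
      by (rule line_entire_mult_eq_0[OF le(2) _ H0 z1]) (use le le' le_UV in \<open>intro line_entire_intros\<close>)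
    have nz: "r ((z1 \<circ> \<tau>) \<circ> \<tau>) \<noteq> 0"
      using z1 by (simp add: comp_assoc \<tau>_def)
    have D0: "?D z = 0" for z
      by (rule line_entire_mult_eq_0[OF le'(2) _ H1 nz]) (use le le' le_UV in \<open>intro line_entire_intros\<close>)
    show ?thesis
      unfolding cross_rel_def \<tau>_def[symmetric]
    proof
      fix z :: "nat \<Rightarrow> complex"
      have \<tau>i: "(z \<circ> \<tau>) i = z (Suc i)" "(z \<circ> \<tau>) (Suc i) = z i"
        by (auto simp: \<tau>_def)
      define N where "N = (\<Prod>(a, b)\<in>pairs n - {(i, Suc i)}. 1 + of_nat q powr (z a - z b) :: complex)"
      define D where "D = (\<Prod>(a, b)\<in>pairs n - {(i, Suc i)}. 1 - of_nat q powr (z a - z b - 1) :: complex)"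
      have num: "G1_num q n z = (1 + U z) * N" "G1_num q n (z \<circ> \<tau>) = (1 + V z) * N"
        unfolding G1_num_def N_def U_def V_def
        using prod_pairs_swap[OF i, of "\<lambda>w. 1 + of_nat q powr w" z]
          prod_pairs_swap(1)[OF i, of "\<lambda>w. 1 + of_nat q powr w" "z \<circ> \<tau>"] \<tau>i
        by (simp_all add: \<tau>_def)
      have den: "G1_den q n z = (1 - of_nat q powr (z i - z (Suc i) - 1)) * D"
        "G1_den q n (z \<circ> \<tau>) = (1 - of_nat q powr (z (Suc i) - z i - 1)) * D"
        unfolding G1_den_def D_def
        using prod_pairs_swap[OF i, of "\<lambda>w. 1 - of_nat q powr (w - 1)" z]
          prod_pairs_swap(1)[OF i, of "\<lambda>w. 1 - of_nat q powr (w - 1)" "z \<circ> \<tau>"] \<tau>i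
        by (simp_all add: \<tau>_def)
      have sh: "1 - of_nat q powr (z i - z (Suc i) - 1) = (of_nat q - U z) / of_nat q"
        "1 - of_nat q powr (z (Suc i) - z i - 1) = (of_nat q - V z) / of_nat q"
        using q by (simp_all add: U_def V_def powr_diff diff_divide_distrib)
      show "G1_num q n z * p z * (G1_den q n (z \<circ> \<tau>) * r (z \<circ> \<tau>)) = G1_num q n (z \<circ> \<tau>) * p (z \<circ> \<tau>) * (G1_den q n z * r z)"
      proof -
        have "G1_num q n z * p z * (G1_den q n (z \<circ> \<tau>) * r (z \<circ> \<tau>))
            = N * D / of_nat q * ((1 + U z) * (of_nat q - V z) * p z * r (z \<circ> \<tau>))"
          unfolding num den sh by simp
        also have "(1 + U z) * (of_nat q - V z) * p z * r (z \<circ> \<tau>) = (1 + V z) * (of_nat q - U z) * p (z \<circ> \<tau>) * r z"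
          using D0[of z] by simp
        also have "N * D / of_nat q * \<dots> = G1_num q n (z \<circ> \<tau>) * p (z \<circ> \<tau>) * (G1_den q n z * r z)"
          unfolding num den sh by simp
        finally show ?thesis .
      qed
    qed
  qed
  have "\<exists>z0. G1_den q n z0 * r z0 \<noteq> 0"
  proof (rule ccontr)
    assume "\<not> ?thesis"
    hence 0: "r z * G1_den q n z = 0" for z by (auto simp: mult.commute)
    have "G1_den q n z = 0" for z
      by (rule line_entire_mult_eq_0[OF le(2) le_G1(2) 0 z1])
    with den_nz show False by blast
  qed
  then obtain z0 where z0: "G1_den q n z0 * r z0 \<noteq> 0" by blast
  have "cross_rel (\<lambda>z. G1_num q n z * p z) (\<lambda>z. G1_den q n z * r z) \<sigma>"
    by (rule cross_rel_permutes[OF line_entire_mult[OF le_G1(1) le(1)] line_entire_mult[OF le_G1(2) le(2)] z0 adj \<sigma>])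
  thus ?thesis by (simp add: p_def r_def)
qed

section \<open>Binary Hermitian forms and their reductions\<close>

context unramified_quadratic_extension
begin

abbreviation \<epsilon> :: real where "\<epsilon> \<equiv> 1 / real q"

lemma eps_bounds: "0 < \<epsilon>" "\<epsilon> < 1"
  using q_ge_2 by auto

lemma eps_power_less_iff: "\<epsilon> ^ i < \<epsilon> ^ j \<longleftrightarrow> j < i"
  using eps_bounds by (simp add: power_strict_decreasing_iff)

lemma eps_power_le_iff: "\<epsilon> ^ i \<le> \<epsilon> ^ j \<longleftrightarrow> j \<le> i"
  using eps_bounds by (simp add: power_decreasing_iff)

lemma nv_prm_power: "nv (prm ^ j) = \<epsilon> ^ j"
  by (simp add: nv_power nv_prm)

lemma nv_less_eps_iff: "nv a < \<epsilon> ^ c \<longleftrightarrow> nv a \<le> \<epsilon> ^ Suc c"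
proof
  assume less: "nv a < \<epsilon> ^ c"
  show "nv a \<le> \<epsilon> ^ Suc c"
  proof (cases "a = 0")
    case False
    then obtain j where j: "nv a = real q powi (- j)"
      by (rule nv_discrete)
    have eps: "\<epsilon> ^ i = real q powi (- int i)" for i
      by (simp add: power_int_minus field_simps)
    have "- j < - int c"
      using less q_ge_2 unfolding j eps by (metis not_less power_int_increasing of_nat_1 of_nat_le_iff
          one_le_numeral order_trans)
    hence "real q powi (- j) \<le> real q powi (- int (Suc c))"
      using q_ge_2 by (intro power_int_increasing) auto
    thus ?thesis by (simp only: j eps)
  qed (use eps_bounds in simp)
next
  assume "nv a \<le> \<epsilon> ^ Suc c"
  also have "\<dots> < \<epsilon> ^ c" by (simp only: eps_power_less_iff)
  finally show "nv a < \<epsilon> ^ c" .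
qed

lemma nv_less_1_iff: "nv a < 1 \<longleftrightarrow> nv a \<le> \<epsilon>"
  using nv_less_eps_iff[of a 0] by simp

lemma nv_sq_le_even: "(nv b)\<^sup>2 \<le> \<epsilon> ^ (2 * j) \<longleftrightarrow> nv b \<le> \<epsilon> ^ j"
proof -
  have "\<epsilon> ^ (2 * j) = (\<epsilon> ^ j)\<^sup>2"
    by (simp add: power_mult mult.commute)
  thus ?thesis
    using eps_bounds nv_nonneg[of b] by (simp only: power_mono_iff) (simp add: abs_le_square_iff[symmetric])
qed

lemma nv_sq_le_odd:
  assumes "(nv b)\<^sup>2 \<le> \<epsilon> ^ (2 * j + 1)" shows "nv b \<le> \<epsilon> ^ Suc j"
proof (rule ccontr)
  assume "\<not> nv b \<le> \<epsilon> ^ Suc j"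
  hence "\<not> nv b < \<epsilon> ^ j" by (simp only: nv_less_eps_iff not_False_eq_True)
  hence "(\<epsilon> ^ j)\<^sup>2 \<le> (nv b)\<^sup>2"
    using eps_bounds by (intro power_mono) auto
  hence "\<epsilon> ^ (2 * j) \<le> \<epsilon> ^ (2 * j + 1)"
    using assms by (simp add: power_mult[symmetric] mult.commute)
  thus False by (simp only: eps_power_le_iff)
qed

text \<open>The triple (a, b, c) stands for the Hermitian matrix with diagonal a, c and upper right
  entry b. \<open>trn y\<close> is congruence by the lower unipotent matrix with entry y,
  \<open>swp\<close> congruence by the antidiagonal matrix.\<close>

definition trn :: "'a \<Rightarrow> 'a \<times> 'a \<times> 'a \<Rightarrow> 'a \<times> 'a \<times> 'a" where
  "trn y = (\<lambda>(a, b, c). (a, b + cj y * a, c + y * b + cj (y * b) + nrm y * a))"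

definition swp :: "'a \<times> 'a \<times> 'a \<Rightarrow> 'a \<times> 'a \<times> 'a" where
  "swp = (\<lambda>(a, b, c). (c, cj b, a))"

definition scl :: "'a \<Rightarrow> 'a \<times> 'a \<times> 'a \<Rightarrow> 'a \<times> 'a \<times> 'a" where
  "scl s = (\<lambda>(a, b, c). (s * a, s * b, s * c))"

definition dt :: "'a \<times> 'a \<times> 'a \<Rightarrow> 'a" where
  "dt = (\<lambda>(a, b, c). a * c - nrm b)"

definition nm :: "'a \<times> 'a \<times> 'a \<Rightarrow> real" where
  "nm = (\<lambda>(a, b, c). max (nv a) (max (nv b) (nv c)))"

definition herm :: "('a \<times> 'a \<times> 'a) set" where
  "herm = {(a, b, c). a \<in> k \<and> c \<in> k}"

definition lev0 :: "nat \<Rightarrow> nat \<Rightarrow> ('a \<times> 'a \<times> 'a) set" where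
  "lev0 m j = {t \<in> herm. nm t = 1 \<and> nv (dt t) = \<epsilon> ^ m \<and> nv (snd (snd t)) \<le> \<epsilon> ^ j}"

text \<open>Forms of content \<open>e\<close> are reduced to primitive ones by a power of
  \<open>prm\<close>. The scalar lies in \<open>k\<close>, so the scaling commutes with
  \<open>trn\<close> and \<open>swp\<close>, and all counts can be made in
  \<open>lev0\<close>.\<close>

definition lev :: "int \<Rightarrow> nat \<Rightarrow> nat \<Rightarrow> ('a \<times> 'a \<times> 'a) set" where
  "lev e m j = {t. scl (prm powi (- e)) t \<in> lev0 m j}"

lemma nrm_in_k_simps: "cj (nrm y) = nrm y"
  using nrm_in_k cj_fixes by blast

lemma trn_herm: "t \<in> herm \<Longrightarrow> trn y t \<in> herm"
  unfolding herm_def trn_def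
  by (auto simp flip: cj_eq_iff simp: cj_add cj_mult nrm_in_k_simps)

lemma swp_herm: "t \<in> herm \<Longrightarrow> swp t \<in> herm"
  by (auto simp: herm_def swp_def)

lemma trn_uminus:
  assumes "t \<in> herm" shows "trn (- y) (trn y t) = t"
  using assms by (auto simp: herm_def trn_def nrm_def cj_add cj_mult cj_fixes algebra_simps)

lemma dt_trn:
  assumes "t \<in> herm" shows "dt (trn y t) = dt t"
  using assms by (auto simp: herm_def trn_def dt_def nrm_def cj_add cj_mult cj_fixes algebra_simps)

lemma dt_swp: "dt (swp t) = dt t"
  by (auto simp: swp_def dt_def mult.commute split: prod.split)

lemma nm_swp: "nm (swp t) = nm t"
  by (auto simp: swp_def nm_def split: prod.split)

lemma nm_trn_le:
  assumes "nv y \<le> 1" shows "nm (trn y t) \<le> nm t"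
proof -
  obtain a b c where t: "t = (a, b, c)" by (cases t)
  have le: "nv u * nv v \<le> nm t" if "nv u \<le> 1" "nv v \<le> nm t" for u v
    using mult_mono[of "nv u" 1 "nv v" "nm t"] that nv_nonneg by simp
  have abc: "nv a \<le> nm t" "nv b \<le> nm t" "nv c \<le> nm t"
    by (auto simp: t nm_def)
  have "nv (nrm y) \<le> 1"
    using assms nv_nonneg[of y] by (simp add: nv_nrm power_le_one)
  hence "nv (b + cj y * a) \<le> nm t" "nv (c + y * b + cj (y * b) + nrm y * a) \<le> nm t"
    using abc le assms by (auto intro!: nv_add_le simp: nv_mult)
  thus ?thesis
    using abc by (simp add: t trn_def nm_def)
qed

lemma nm_trn:
  assumes "nv y \<le> 1" "t \<in> herm" shows "nm (trn y t) = nm t"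
  using nm_trn_le[of y t] nm_trn_le[of "- y" "trn y t"] assms trn_uminus[of t y] by simp

lemma scl_trn: "s \<in> k \<Longrightarrow> scl s (trn y t) = trn y (scl s t)"
  by (auto simp: scl_def trn_def cj_mult cj_fixes algebra_simps split: prod.split)

lemma scl_swp: "s \<in> k \<Longrightarrow> scl s (swp t) = swp (scl s t)"
  by (auto simp: scl_def swp_def cj_mult cj_fixes split: prod.split)

lemma lev0_trn_base: "t \<in> lev0 m j \<Longrightarrow> nv y \<le> 1 \<Longrightarrow> trn y t \<in> lev0 m 0"
  using nm_trn[of y t] trn_herm[of t y] dt_trn[of t y]
  by (auto simp: lev0_def nm_def split: prod.split_asm)

lemma lev0_swp_base: "t \<in> lev0 m j \<Longrightarrow> swp t \<in> lev0 m 0"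
  using swp_herm[of t] by (auto simp: lev0_def dt_swp nm_swp) (auto simp: nm_def swp_def split: prod.split_asm)

lemma lev0_iff:
  "(a, b, c) \<in> lev0 m j \<longleftrightarrow> a \<in> k \<and> c \<in> k \<and> max (nv a) (max (nv b) (nv c)) = 1 \<and>
     nv (a * c - nrm b) = \<epsilon> ^ m \<and> nv c \<le> \<epsilon> ^ j"
  by (auto simp: lev0_def herm_def nm_def dt_def)

lemma lev0_antimono: "i \<le> j \<Longrightarrow> lev0 m j \<subseteq> lev0 m i"
  unfolding lev0_def using eps_power_le_iff[of j i] by auto

lemma lev0_SucI: "t \<in> lev0 m i \<Longrightarrow> nv (snd (snd t)) \<le> \<epsilon> ^ j \<Longrightarrow> t \<in> lev0 m j"
  by (auto simp: lev0_def)

text \<open>Completing the square. When \<open>a\<close> is a unit, the size of the new lower entry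
  is that of a norm plus the determinant, so the residue counts for norms apply.\<close>

lemma quadratic_identity:
  assumes "a \<in> k"
  shows "a * (c + y * b + cj (y * b) + nrm y * a) = nrm (b + cj y * a) + (a * c - nrm b)"
  using assms by (simp add: nrm_def cj_add cj_mult cj_fixes algebra_simps)

text \<open>The q^2 translates together with the swap represent the points of the projective line
  over the residue field of k', so the count is the number of isotropic points of the reduced form:
  q + 1 when it is nondegenerate, and 1 when it has rank one.\<close>

lemma lev0_count_0:
  assumes "t \<in> lev0 m 0"
  shows "card {y \<in> res. trn y t \<in> lev0 m (Suc 0)} + (if swp t \<in> lev0 m (Suc 0) then 1 else 0)
       = (if m = 0 then q + 1 else 1)"
proof -
  obtain a b c where t: "t = (a, b, c)" by (cases t)
  define D where "D = a * c - nrm b"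
  have abc: "a \<in> k" "c \<in> k" "max (nv a) (max (nv b) (nv c)) = 1" "nv D = \<epsilon> ^ m"
    using assms by (auto simp: t lev0_iff D_def)
  have le: "nv a \<le> 1" "nv b \<le> 1" "nv c \<le> 1"
    using abc(3) by (metis max.cobounded1 max.cobounded2 order_trans)+
  have Dk: "D \<in> k"
    using abc by (simp add: D_def k_diff k_mult nrm_in_k)
  have swp_iff: "swp t \<in> lev0 m (Suc 0) \<longleftrightarrow> nv a < 1"
    using lev0_swp_base[OF assms] by (auto simp: lev0_def nv_less_1_iff swp_def t)
  have iff: "trn y t \<in> lev0 m (Suc 0) \<longleftrightarrow> nv (c + y * b + cj (y * b) + nrm y * a) < 1" if "y \<in> res" for y
    using lev0_trn_base[OF assms nv_res_le[OF that]] by (auto simp: lev0_def nv_less_1_iff trn_def t)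
  hence count: "{y \<in> res. trn y t \<in> lev0 m (Suc 0)} = {y \<in> res. nv (c + y * b + cj (y * b) + nrm y * a) < 1}"
    by blast
  have iff_unit: "nv (c + y * b + cj (y * b) + nrm y * a) < 1 \<longleftrightarrow> nv (nrm (b + cj y * a) + D) < 1"
    if "nv a = 1" for y
    using arg_cong[OF quadratic_identity[OF abc(1), of c y b], of nv] that by (simp add: nv_mult D_def)
  show ?thesis
  proof (cases "m = 0")
    case True
    hence D1: "nv D = 1" using abc by simp
    show ?thesis
    proof (cases "nv a = 1")
      case a1: True
      thus ?thesis
        unfolding count swp_iff using card_res_nrm_affine[OF a1 le(2) Dk D1] True by (simp add: iff_unit)
    next
      case False
      \<comment> \<open>Here the point of the swap is itself isotropic. The off-diagonal entry is
        then a unit, the norm term drops out modulo the maximal ideal, and the remaining trace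
        equation contributes the other q points.\<close>
      hence a: "nv a < 1" using le by simp
      have "nv (a * c) < 1"
        using a le nv_nonneg[of a] mult_mono[of "nv a" "nv a" "nv c" 1] nv_nonneg[of c] by (simp add: nv_mult)
      hence "nv (nrm b) = 1"
        using nv_add_eq[of "a * c" "- D"] D1 nv_minus_commute[of "a * c" "nrm b"] by (simp add: D_def)
      hence b: "nv b = 1"
        using nv_nonneg[of b] by (simp add: nv_nrm power2_eq_1_iff)
      have "nv (c + y * b + cj (y * b) + nrm y * a) < 1 \<longleftrightarrow> nv (c + y * b + cj (y * b)) < 1" if "y \<in> res" for y
      proof -
        have "nv (nrm y * a) < 1"
          using a nv_res_le[OF that] nv_nonneg[of y] nv_nonneg[of a]
            mult_mono[of "(nv y)\<^sup>2" 1 "nv a" "nv a"] by (simp add: nv_mult nv_nrm power_le_one)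
        thus ?thesis
          using nv_add_less[of "c + y * b + cj (y * b)" 1 "nrm y * a"]
            nv_diff_less[of "c + y * b + cj (y * b) + nrm y * a" 1 "nrm y * a"] by auto
      qed
      hence "{y \<in> res. trn y t \<in> lev0 m (Suc 0)} = {y \<in> res. nv (c + y * b + cj (y * b)) < 1}"
        unfolding count by blast
      thus ?thesis
        unfolding swp_iff using card_res_trace[OF b abc(2) le(3)] a True by simp
    qed
  next
    case False
    hence D1: "nv D < 1"
      using abc eps_power_less_iff[of m 0] by simp
    show ?thesis
    proof (cases "nv a = 1")
      case a1: True
      have "nv (nrm (b + cj y * a) + D) < 1 \<longleftrightarrow> nv (b + cj y * a) < 1" for y
      proof -
        have "nv (nrm (b + cj y * a) + D) < 1 \<longleftrightarrow> nv (nrm (b + cj y * a)) < 1"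
          using D1 nv_add_less[of "nrm (b + cj y * a)" 1 D] nv_diff_less[of "nrm (b + cj y * a) + D" 1 D] by auto
        also have "\<dots> \<longleftrightarrow> nv (b + cj y * a) < 1"
          using nv_nonneg[of "b + cj y * a"] by (simp add: nv_nrm abs_square_less_1)
        finally show ?thesis .
      qed
      thus ?thesis
        unfolding count swp_iff using card_res_affine_cj_zero[OF a1 le(2)] a1 False by (simp add: iff_unit)
    next
      case a: False
      \<comment> \<open>Now only \<open>c\<close> survives the reduction, so the swap gives the
        unique isotropic point and no translate contributes.\<close>
      hence a: "nv a < 1" using le by simp
      have "nv (a * c) < 1"
        using a le nv_nonneg[of a] mult_mono[of "nv a" "nv a" "nv c" 1] nv_nonneg[of c] by (simp add: nv_mult)
      hence "nv (nrm b) < 1"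
        using nv_diff_less[of "a * c" 1 D] D1 by (simp add: D_def)
      hence b: "nv b < 1"
        using nv_nonneg[of b] by (simp add: nv_nrm abs_square_less_1)
      hence c: "nv c = 1"
        using abc(3) a by (auto simp: max_def split: if_splits)
      have "\<not> nv (c + y * b + cj (y * b) + nrm y * a) < 1" if "y \<in> res" for y
      proof
        assume *: "nv (c + y * b + cj (y * b) + nrm y * a) < 1"
        have "nv (nrm y * a) < 1" "nv (y * b) < 1"
          using a b nv_res_le[OF that] nv_nonneg[of y] nv_nonneg[of a] nv_nonneg[of b]
            mult_mono[of "(nv y)\<^sup>2" 1 "nv a" "nv a"] mult_mono[of "nv y" 1 "nv b" "nv b"]
          by (simp_all add: nv_mult nv_nrm power_le_one)
        hence "nv (y * b + cj (y * b) + nrm y * a) < 1"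
          by (intro nv_add_less) auto
        hence "nv ((c + y * b + cj (y * b) + nrm y * a) - (y * b + cj (y * b) + nrm y * a)) < 1"
          by (rule nv_diff_less[OF *])
        thus False using c by (simp add: algebra_simps)
      qed
      hence "{y \<in> res. trn y t \<in> lev0 m (Suc 0)} = {}"
        unfolding count by blast
      hence "card {y \<in> res. trn y t \<in> lev0 m (Suc 0)} = 0"
        by (simp only: card.empty)
      thus ?thesis unfolding swp_iff using a False by simp
    qed
  qed
qed

text \<open>The square of the absolute value of \<open>b\<close> jumps by steps of two, which is why odd levels do not branch.\<close>

lemma lev0_facts:
  assumes "(a, b, c) \<in> lev0 m j" "1 \<le> j" "1 \<le> m"
  shows "nv a = 1" "nv (nrm b + (a * c - nrm b)) = nv c"
proof -
  have abc: "a \<in> k" "c \<in> k" "max (nv a) (max (nv b) (nv c)) = 1" "nv (a * c - nrm b) = \<epsilon> ^ m"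
    "nv c \<le> \<epsilon> ^ j"
    using assms(1) by (auto simp: lev0_iff)
  have le: "nv a \<le> 1"
    using abc(3) by (metis max.cobounded1)
  have "\<epsilon> ^ j < 1" "\<epsilon> ^ m < 1"
    using eps_power_less_iff[of j 0] eps_power_less_iff[of m 0] assms by auto
  hence c: "nv c < 1" and D: "nv (a * c - nrm b) < 1"
    using abc by linarith+
  have "nv (a * c) < 1"
    using c le nv_nonneg[of a] mult_mono[of "nv a" 1 "nv c" "nv c"] nv_nonneg[of c] by (simp add: nv_mult)
  hence "nv (nrm b) < 1"
    using nv_diff_less[of "a * c" 1 "a * c - nrm b"] D by simp
  hence b: "nv b < 1"
    using nv_nonneg[of b] by (simp add: nv_nrm abs_square_less_1)
  thus "nv a = 1"
    using abc(3) c by (auto simp: max_def split: if_splits)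
  thus "nv (nrm b + (a * c - nrm b)) = nv c"
    by (simp add: nv_mult)
qed

lemma lev0_nrm_le:
  assumes "(a, b, c) \<in> lev0 m j" "1 \<le> j" "j \<le> m"
  shows "nv (nrm b) \<le> \<epsilon> ^ j"
proof -
  have "nv c \<le> \<epsilon> ^ j" "nv (a * c - nrm b) = \<epsilon> ^ m"
    using assms by (auto simp: lev0_iff)
  moreover have "\<epsilon> ^ m \<le> \<epsilon> ^ j"
    using assms by (simp only: eps_power_le_iff)
  moreover have "nv (a * c) = nv c"
    using lev0_facts(2)[OF assms(1,2)] assms by simp
  ultimately show ?thesis
    using nv_diff_le[of "a * c" "\<epsilon> ^ j" "a * c - nrm b"] by simp
qed

lemma lev0_odd:
  assumes "odd j" "j < m" shows "lev0 m j = lev0 m (Suc j)"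
proof
  show "lev0 m (Suc j) \<subseteq> lev0 m j" by (rule lev0_antimono) simp
  show "lev0 m j \<subseteq> lev0 m (Suc j)"
  proof
    fix t assume t: "t \<in> lev0 m j"
    obtain a b c where abc: "t = (a, b, c)" by (cases t)
    obtain i where i: "j = 2 * i + 1" using assms by (auto elim: oddE)
    have "nv (nrm b) \<le> \<epsilon> ^ j"
      using lev0_nrm_le[of a b c m j] t assms i by (simp add: abc)
    hence "nv b \<le> \<epsilon> ^ Suc i"
      unfolding nv_nrm i by (rule nv_sq_le_odd)
    hence "nv (nrm b) \<le> \<epsilon> ^ Suc j"
      unfolding nv_nrm nv_sq_le_even[symmetric] by (simp add: i)
    moreover have "nv (a * c - nrm b) \<le> \<epsilon> ^ Suc j"
      using t assms eps_power_le_iff[of m "Suc j"] by (auto simp: abc lev0_iff)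
    ultimately have "nv (nrm b + (a * c - nrm b)) \<le> \<epsilon> ^ Suc j"
      by (rule nv_add_le)
    hence "nv c \<le> \<epsilon> ^ Suc j"
      using lev0_facts(2)[of a b c m j] t assms i by (simp add: abc del: power_Suc)
    thus "t \<in> lev0 m (Suc j)"
      by (intro lev0_SucI[OF t]) (simp add: abc)
  qed
qed

text \<open>In a c = N b + dt the norm has even valuation and the determinant odd valuation
  \<open>m\<close>, so no cancellation between them can push the valuation of c beyond
  \<open>m\<close>.\<close>

lemma lev0_top_odd:
  assumes "odd m" "m < j" shows "lev0 m j = {}"
proof -
  have False if t: "(a, b, c) \<in> lev0 m j" for a b c
  proof -
    obtain i where i: "m = 2 * i + 1" using assms by (auto elim: oddE)
    have "(a, b, c) \<in> lev0 m m"
      using t lev0_antimono[of m j m] assms by auto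
    hence "nv (nrm b) \<le> \<epsilon> ^ m"
      by (rule lev0_nrm_le) (use i in auto)
    hence "nv b \<le> \<epsilon> ^ Suc i"
      unfolding nv_nrm i by (rule nv_sq_le_odd)
    hence "nv (nrm b) \<le> \<epsilon> ^ Suc m"
      unfolding nv_nrm nv_sq_le_even[symmetric] by (simp add: i)
    hence less: "nv (nrm b) < nv (a * c - nrm b)"
      using t by (simp add: lev0_iff nv_less_eps_iff del: power_Suc)
    have "nv c = nv (nrm b + (a * c - nrm b))"
      using lev0_facts(2)[OF t] assms i by simp
    also have "\<dots> = \<epsilon> ^ m"
      using nv_add_eq[OF less] t by (simp add: lev0_iff)
    finally show False
      using t assms eps_power_less_iff[of j m] by (auto simp: lev0_iff)
  qed
  thus ?thesis by auto
qed

lemma card_Collect_cong: "(\<And>y. y \<in> A \<Longrightarrow> P y \<longleftrightarrow> P' y) \<Longrightarrow> card {y \<in> A. P y} = card {y \<in> A. P' y}"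
  by (rule arg_cong[of _ _ card]) blast

text \<open>At level 2 j the off-diagonal entry is divisible by the j-th power of the prime and the
  determinant by the power 2 j. Division by these powers turns translation by prm^j y into ordinary
  translation of the quotient \<open>b0\<close>, with \<open>D0\<close> as determinant. This is
  level 0 again, and \<open>D0\<close> is a unit precisely when 2 j = m.\<close>

lemma lev0_step_middle:
  assumes t: "t \<in> lev0 m (2 * j)" and j: "1 \<le> j" "2 * j \<le> m"
  shows "nv y \<le> 1 \<Longrightarrow> trn (prm ^ j * y) t \<in> lev0 m (2 * j)"
    and "card {y \<in> res. trn (prm ^ j * y) t \<in> lev0 m (Suc (2 * j))} = (if 2 * j < m then 1 else q + 1)"
proof -
  obtain a b c where abc: "t = (a, b, c)" by (cases t)
  have t': "(a, b, c) \<in> lev0 m (2 * j)" using t abc by simp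
  have a: "nv a = 1" "a \<in> k"
    using lev0_facts(1)[OF t'] t' j by (auto simp: lev0_iff)
  have c: "c \<in> k" using t' by (simp add: lev0_iff)
  have "nv (nrm b) \<le> \<epsilon> ^ (2 * j)"
    using lev0_nrm_le[OF t'] j by simp
  hence b: "nv b \<le> \<epsilon> ^ j"
    by (simp only: nv_nrm nv_sq_le_even)
  define b0 where "b0 = b / prm ^ j"
  have b_eq: "b = prm ^ j * b0" by (simp add: b0_def)
  have b0: "nv b0 \<le> 1"
    using b eps_bounds by (simp add: b0_def nv_divide nv_prm_power divide_le_eq_1)
  define D0 where "D0 = (a * c - nrm b) / prm ^ (2 * j)"
  have D_eq: "a * c - nrm b = prm ^ (2 * j) * D0" by (simp add: D0_def)
  have D0k: "D0 \<in> k"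
    using a c by (simp add: D0_def k_divide k_diff k_mult nrm_in_k k_power prm_in_k)
  have nvD0: "nv D0 = \<epsilon> ^ (m - 2 * j)"
  proof -
    have "\<epsilon> ^ m = \<epsilon> ^ (m - 2 * j) * \<epsilon> ^ (2 * j)"
      using j by (simp flip: power_add)
    moreover have "nv (a * c - nrm b) = \<epsilon> ^ m"
      using t' by (simp add: lev0_iff)
    ultimately show ?thesis
      using eps_bounds q_pos by (simp add: D0_def nv_divide nv_prm_power del: power_one_over)
  qed
  have nvD0_le: "nv D0 \<le> 1"
    unfolding nvD0 using eps_power_le_iff[of "m - 2 * j" 0] by simp
  have base: "trn (prm ^ j * y) t \<in> lev0 m 0" if "nv y \<le> 1" for y
  proof (rule lev0_trn_base[OF t])
    show "nv (prm ^ j * y) \<le> 1"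
      using that eps_power_le_iff[of j 0] nv_nonneg[of y] mult_mono[of "\<epsilon> ^ j" 1 "nv y" 1]
      by (simp add: nv_mult nv_prm_power)
  qed
  define g where "g y = snd (snd (trn (prm ^ j * y) t))" for y
  have nv_g: "nv (g y) = \<epsilon> ^ (2 * j) * nv (nrm (b0 + cj y * a) + D0)" for y
  proof -
    have cjp: "cj (prm ^ j * y) = prm ^ j * cj y"
      by (simp add: cj_mult cj_fixes k_power prm_in_k)
    have "nv (g y) = nv (a * g y)"
      using a by (simp add: nv_mult)
    also have "a * g y = nrm (b + cj (prm ^ j * y) * a) + (a * c - nrm b)"
      unfolding g_def trn_def abc using quadratic_identity[OF a(2), of c "prm ^ j * y" b] by simp
    also have "b + cj (prm ^ j * y) * a = prm ^ j * (b0 + cj y * a)"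
      unfolding cjp by (simp add: b_eq algebra_simps)
    also have "nrm (prm ^ j * (b0 + cj y * a)) + (a * c - nrm b) = prm ^ (2 * j) * (nrm (b0 + cj y * a) + D0)"
      unfolding D_eq nrm_mult
      by (simp add: nrm_in_k_eq k_power prm_in_k power_mult[symmetric] mult.commute distrib_left)
    finally show ?thesis by (simp add: nv_mult nv_prm_power del: power_one_over)
  qed
  have nvb: "nv (b0 + cj y * a) \<le> 1" if "nv y \<le> 1" for y
    using that a b0 by (intro nv_add_le) (auto simp: nv_mult)
  show "trn (prm ^ j * y) t \<in> lev0 m (2 * j)" if "nv y \<le> 1" for y
  proof (rule lev0_SucI[OF base[OF that]])
    have "nv (nrm (b0 + cj y * a) + D0) \<le> 1"
      using nvb[OF that] nvD0_le nv_nonneg by (intro nv_add_le) (auto simp: nv_nrm power_le_one)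
    hence "nv (g y) \<le> \<epsilon> ^ (2 * j) * 1"
      unfolding nv_g using eps_bounds by (intro mult_left_mono) auto
    thus "nv (snd (snd (trn (prm ^ j * y) t))) \<le> \<epsilon> ^ (2 * j)"
      by (simp add: g_def)
  qed
  have iff: "trn (prm ^ j * y) t \<in> lev0 m (Suc (2 * j)) \<longleftrightarrow> nv (nrm (b0 + cj y * a) + D0) < 1"
    if "y \<in> res" for y
  proof -
    have "trn (prm ^ j * y) t \<in> lev0 m (Suc (2 * j)) \<longleftrightarrow> nv (g y) < \<epsilon> ^ (2 * j)"
      using base[OF nv_res_le[OF that]] by (auto simp: lev0_def g_def nv_less_eps_iff simp del: power_Suc)
    also have "\<dots> \<longleftrightarrow> nv (nrm (b0 + cj y * a) + D0) < 1"
      unfolding nv_g using eps_bounds zero_less_power[of \<epsilon> "2 * j"]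
      by (simp add: mult_less_cancel_left1 not_less del: power_one_over)
    finally show ?thesis .
  qed
  show "card {y \<in> res. trn (prm ^ j * y) t \<in> lev0 m (Suc (2 * j))} = (if 2 * j < m then 1 else q + 1)"
  proof (cases "2 * j < m")
    case True
    hence D0: "nv D0 < 1"
      unfolding nvD0 using eps_power_less_iff[of "m - 2 * j" 0] by simp
    have "nv (nrm (b0 + cj y * a) + D0) < 1 \<longleftrightarrow> nv (b0 + cj y * a) < 1" for y
    proof -
      have "nv (nrm (b0 + cj y * a) + D0) < 1 \<longleftrightarrow> nv (nrm (b0 + cj y * a)) < 1"
        using D0 nv_add_less[of "nrm (b0 + cj y * a)" 1 D0] nv_diff_less[of "nrm (b0 + cj y * a) + D0" 1 D0] by auto
      also have "\<dots> \<longleftrightarrow> nv (b0 + cj y * a) < 1"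
        using nv_nonneg[of "b0 + cj y * a"] by (simp add: nv_nrm abs_square_less_1)
      finally show ?thesis .
    qed
    hence "card {y \<in> res. trn (prm ^ j * y) t \<in> lev0 m (Suc (2 * j))} = card {y \<in> res. nv (b0 + cj y * a) < 1}"
      using iff by (intro card_Collect_cong) simp
    thus ?thesis
      using card_res_affine_cj_zero[OF a(1) b0] True by simp
  next
    case False
    hence "nv D0 = 1" using nvD0 by simp
    hence "card {y \<in> res. nv (nrm (b0 + cj y * a) + D0) < 1} = q + 1"
      using card_res_nrm_affine[OF a(1) b0 D0k] by simp
    moreover have "card {y \<in> res. trn (prm ^ j * y) t \<in> lev0 m (Suc (2 * j))} = card {y \<in> res. nv (nrm (b0 + cj y * a) + D0) < 1}"
      using iff by (intro card_Collect_cong)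
    ultimately show ?thesis using False by simp
  qed
qed

text \<open>Above level 2 l the entry b has valuation exactly l, since the determinant can only come
  from its norm. Translation by prm^(j - l) y moves c by a trace term of valuation at least j, while
  the norm term has valuation at least 2 (j - l) > j and is negligible. What remains is a trace
  equation with q solutions.\<close>

lemma lev0_step_tail:
  assumes t: "t \<in> lev0 (2 * l) j" and j: "2 * l < j"
  shows "nv y \<le> 1 \<Longrightarrow> trn (prm ^ (j - l) * y) t \<in> lev0 (2 * l) j"
    and "card {y \<in> res. trn (prm ^ (j - l) * y) t \<in> lev0 (2 * l) (Suc j)} = q"
proof -
  obtain a b c where abc: "t = (a, b, c)" by (cases t)
  have t': "(a, b, c) \<in> lev0 (2 * l) j" using t abc by simp
  hence ac: "a \<in> k" "c \<in> k" and c: "nv c \<le> \<epsilon> ^ j" and D: "nv (a * c - nrm b) = \<epsilon> ^ (2 * l)"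
    and le: "nv a \<le> 1"
    by (auto simp: lev0_iff)
  have b: "nv b = \<epsilon> ^ l"
  proof -
    have "nv (a * c) \<le> \<epsilon> ^ j"
      using c le nv_nonneg[of a] nv_nonneg[of c] mult_mono[of "nv a" 1 "nv c" "\<epsilon> ^ j"]
      by (simp add: nv_mult del: power_one_over)
    also have "\<dots> < nv (- (a * c - nrm b))"
      unfolding nv_minus D using j by (simp only: eps_power_less_iff)
    finally have "nv (nrm b) = nv (- (a * c - nrm b))"
      using nv_add_eq[of "a * c" "- (a * c - nrm b)"] by simp
    hence "(nv b)\<^sup>2 = \<epsilon> ^ (2 * l)"
      unfolding nv_minus D nv_nrm .
    also have "\<dots> = (\<epsilon> ^ l)\<^sup>2"
      by (simp add: power_mult[symmetric] mult.commute del: power_one_over)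
    finally have "(nv b)\<^sup>2 = (\<epsilon> ^ l)\<^sup>2" .
    thus ?thesis
      using nv_nonneg[of b] eps_bounds by (simp add: power2_eq_iff_nonneg del: power_one_over)
  qed
  define b0 where "b0 = b / prm ^ l"
  have b_eq: "b = prm ^ l * b0" by (simp add: b0_def)
  have b0: "nv b0 = 1"
    using b q_pos by (simp add: b0_def nv_divide nv_prm_power del: power_one_over)
  define c0 where "c0 = c / prm ^ j"
  have c_eq: "c = prm ^ j * c0" by (simp add: c0_def)
  have c0: "nv c0 \<le> 1" "c0 \<in> k"
    using c eps_bounds ac by (simp_all add: c0_def nv_divide nv_prm_power divide_le_eq_1 k_divide k_power prm_in_k)
  define h where "h y = c0 + y * b0 + cj (y * b0)" for y
  define r where "r y = prm ^ (j - 2 * l) * (nrm y * a)" for y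
  have r: "nv (r y) < 1" if "nv y \<le> 1" for y
  proof -
    have "nv (nrm y * a) \<le> 1"
      using that le nv_nonneg[of y] nv_nonneg[of a] mult_mono[of "(nv y)\<^sup>2" 1 "nv a" 1]
      by (simp add: nv_mult nv_nrm power_le_one)
    hence "nv (r y) \<le> \<epsilon> ^ (j - 2 * l)"
      using eps_bounds mult_left_mono[of "nv (nrm y * a)" 1 "\<epsilon> ^ (j - 2 * l)"]
      by (simp add: r_def nv_mult nv_prm_power del: power_one_over)
    also have "\<dots> < 1"
      using j eps_power_less_iff[of "j - 2 * l" 0] by simp
    finally show ?thesis .
  qed
  have g: "snd (snd (trn (prm ^ (j - l) * y) t)) = prm ^ j * (h y + r y)" for y
  proof -
    have p1: "prm ^ j = prm ^ (j - l) * prm ^ l"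
      using j by (simp flip: power_add)
    have p2: "(prm ^ (j - l))\<^sup>2 = prm ^ j * prm ^ (j - 2 * l)"
    proof -
      have "(j - l) * 2 = j + (j - 2 * l)" using j by simp
      thus ?thesis by (simp only: power_mult[symmetric] power_add[symmetric])
    qed
    have 1: "(prm ^ (j - l) * y) * b = prm ^ j * (y * b0)"
      by (simp add: b_eq p1 mult_ac)
    have 2: "cj (prm ^ j * (y * b0)) = prm ^ j * cj (y * b0)"
      by (simp add: cj_mult cj_fixes k_power prm_in_k)
    have 3: "nrm (prm ^ (j - l) * y) = prm ^ j * prm ^ (j - 2 * l) * nrm y"
      by (simp add: nrm_mult nrm_in_k_eq k_power prm_in_k p2)
    show ?thesis
      unfolding abc trn_def h_def r_def prod.case snd_conv 1 2 3 c_eq[symmetric]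
      by (simp add: distrib_left c_eq[symmetric] mult.assoc)
  qed
  have base: "trn (prm ^ (j - l) * y) t \<in> lev0 (2 * l) 0" if "nv y \<le> 1" for y
  proof (rule lev0_trn_base[OF t])
    show "nv (prm ^ (j - l) * y) \<le> 1"
      using that eps_power_le_iff[of "j - l" 0] nv_nonneg[of y] mult_mono[of "\<epsilon> ^ (j - l)" 1 "nv y" 1]
      by (simp add: nv_mult nv_prm_power)
  qed
  show "trn (prm ^ (j - l) * y) t \<in> lev0 (2 * l) j" if "nv y \<le> 1" for y
  proof (rule lev0_SucI[OF base[OF that]])
    have "nv (h y + r y) \<le> 1"
      unfolding h_def using c0 b0 that r[OF that] by (intro nv_add_le) (auto simp: nv_mult)
    thus "nv (snd (snd (trn (prm ^ (j - l) * y) t))) \<le> \<epsilon> ^ j"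
      unfolding g using eps_bounds mult_left_mono[of "nv (h y + r y)" 1 "\<epsilon> ^ j"]
      by (simp add: nv_mult nv_prm_power del: power_one_over)
  qed
  have "trn (prm ^ (j - l) * y) t \<in> lev0 (2 * l) (Suc j) \<longleftrightarrow> nv (c0 + y * b0 + cj (y * b0)) < 1"
    if "y \<in> res" for y
  proof -
    have "trn (prm ^ (j - l) * y) t \<in> lev0 (2 * l) (Suc j) \<longleftrightarrow> nv (prm ^ j * (h y + r y)) < \<epsilon> ^ j"
      using base[OF nv_res_le[OF that]] by (auto simp: lev0_def g nv_less_eps_iff simp del: power_Suc)
    also have "\<dots> \<longleftrightarrow> nv (h y + r y) < 1"
      using eps_bounds zero_less_power[of \<epsilon> j]
      by (simp add: nv_mult nv_prm_power mult_less_cancel_left1 not_less del: power_one_over)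
    also have "\<dots> \<longleftrightarrow> nv (h y) < 1"
      using r[OF nv_res_le[OF that]] nv_add_less[of "h y" 1 "r y"] nv_diff_less[of "h y + r y" 1 "r y"] by auto
    finally show ?thesis by (simp add: h_def)
  qed
  hence "card {y \<in> res. trn (prm ^ (j - l) * y) t \<in> lev0 (2 * l) (Suc j)} = card {y \<in> res. nv (c0 + y * b0 + cj (y * b0)) < 1}"
    by (intro card_Collect_cong)
  thus "card {y \<in> res. trn (prm ^ (j - l) * y) t \<in> lev0 (2 * l) (Suc j)} = q"
    using card_res_trace[OF b0 c0(2,1)] by simp
qed

text \<open>The depth \<open>i\<close> of the translations is adapted to the regime: deep enough to
  preserve level \<open>j\<close>, shallow enough that a fixed number \<open>N\<close> of the q^2
  translates descends from every form. The last clause identifies N / q^2 with the ratio of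
  consecutive values of \<open>mu\<close>.\<close>

lemma lev0_step:
  assumes "1 \<le> j"
  obtains i N where "\<And>t y. t \<in> lev0 m j \<Longrightarrow> nv y \<le> 1 \<Longrightarrow> trn (prm ^ i * y) t \<in> lev0 m j"
    and "\<And>t. t \<in> lev0 m j \<Longrightarrow> card {y \<in> res. trn (prm ^ i * y) t \<in> lev0 m (Suc j)} = N"
    and "(real q)\<^sup>2 * mu (real q) m (Suc j) = real N * mu (real q) m j"
proof -
  have q0: "real q \<noteq> 0" using q_pos by simp
  \<comment> \<open>At depth \<open>j\<close> all terms added to c already have valuation at least
    j. This crude depth serves the two extreme regimes, in which all translates descend or none
    does.\<close>
  have stay: "trn (prm ^ j * y) t \<in> lev0 m j" if t: "t \<in> lev0 m j" and y: "nv y \<le> 1" for t y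
  proof -
    obtain a b c where abc: "t = (a, b, c)" by (cases t)
    have le: "nv a \<le> 1" "nv b \<le> 1" "nv c \<le> \<epsilon> ^ j"
      using t by (auto simp: abc lev0_iff)
    have py: "nv (prm ^ j * y) \<le> \<epsilon> ^ j"
      using y eps_bounds mult_left_mono[of "nv y" 1 "\<epsilon> ^ j"] by (simp add: nv_mult nv_prm_power del: power_one_over)
    have e1: "\<epsilon> ^ j \<le> 1" using eps_power_le_iff[of j 0] by simp
    have "nv (prm ^ j * y * b) \<le> \<epsilon> ^ j"
      using mult_mono[OF py le(2)] nv_nonneg eps_bounds by (simp add: nv_mult del: power_one_over)
    moreover have "nv (nrm (prm ^ j * y) * a) \<le> \<epsilon> ^ j"
    proof -
      have "(nv (prm ^ j * y))\<^sup>2 \<le> \<epsilon> ^ j * 1"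
        unfolding power2_eq_square using py e1 nv_nonneg by (intro mult_mono) auto
      hence "(nv (prm ^ j * y))\<^sup>2 * nv a \<le> (\<epsilon> ^ j * 1) * 1"
        using le nv_nonneg eps_bounds by (intro mult_mono) auto
      thus ?thesis by (simp add: nv_mult[of "nrm _"] nv_nrm del: power_one_over)
    qed
    ultimately have "nv (c + prm ^ j * y * b + cj (prm ^ j * y * b) + nrm (prm ^ j * y) * a) \<le> \<epsilon> ^ j"
      using le(3) by (intro nv_add_le) (auto simp del: power_one_over)
    moreover have "trn (prm ^ j * y) t \<in> lev0 m 0"
      using py e1 by (intro lev0_trn_base[OF t]) linarith
    ultimately show ?thesis
      by (rule_tac lev0_SucI) (assumption, simp add: abc trn_def del: power_one_over)
  qed
  consider "odd j" "j < m" | "even j" "j < m" | "odd m" "m \<le> j" | "even m" "m = j" | "even m" "m < j"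
    by linarith
  thus ?thesis
  proof cases
    case 1
    have "card {y \<in> res. trn (prm ^ j * y) t \<in> lev0 m (Suc j)} = q\<^sup>2" if "t \<in> lev0 m j" for t
    proof -
      have "{y \<in> res. trn (prm ^ j * y) t \<in> lev0 m (Suc j)} = res"
        using stay[OF that] nv_res_le lev0_odd[OF 1] by auto
      thus ?thesis by (simp add: card_res)
    qed
    with that[of j "q\<^sup>2"] stay show ?thesis by (simp add: mu_odd[OF 1])
  next
    case 2
    then obtain i where i: "j = 2 * i" by (auto elim: evenE)
    show ?thesis
      using that[of i 1] lev0_step_middle[of _ m i] 2 assms i mu_even[of j m "real q"] q0 by simp
  next
    case 3
    have empty: "lev0 m (Suc j) = {}"
      using lev0_top_odd[of m "Suc j"] 3 by simp
    have "mu (real q) m (Suc j) = 0"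
      using 3(2)
    proof (induction j rule: dec_induct)
      case base
      show ?case using mu_top_odd 3 by blast
    next
      case (step j)
      thus ?case using mu_tail[of m "Suc j" "real q"] by simp
    qed
    thus ?thesis
      using that[of j 0] stay empty by simp
  next
    case 4
    then obtain i where i: "j = 2 * i" by (auto elim: evenE)
    show ?thesis
      using that[of i "q + 1"] lev0_step_middle[of _ m i] 4 assms i mu_top_even[of m "real q"] q0
      by simp
  next
    case 5
    then obtain l where l: "m = 2 * l" by (auto elim: evenE)
    show ?thesis
      using that[of "j - l" q] lev0_step_tail[of _ l j] 5 l mu_tail[of m j "real q"] q0
      by (simp add: power2_eq_square)
  qed
qed

end

text \<open>Double counting. By invariance of the measure and of \<open>w\<close>, every preimage of
  \<open>C\<close> carries the integral over \<open>C\<close>; each point of \<open>B\<close> lies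
  in exactly \<open>N\<close> of these preimages, and no other point lies in any.\<close>

lemma average_over_translates:
  fixes w :: "'b \<Rightarrow> complex"
  assumes "finite J" and w: "integrable M w" and B: "B \<in> sets M" and C: "C \<in> sets M"
    and g: "\<And>j. j \<in> J \<Longrightarrow> g j \<in> measurable M M" "\<And>j. j \<in> J \<Longrightarrow> distr M M (g j) = M"
    and inv: "\<And>j x. j \<in> J \<Longrightarrow> x \<in> space M \<Longrightarrow> w (g j x) = w x"
    and out: "\<And>j x. j \<in> J \<Longrightarrow> x \<in> space M \<Longrightarrow> g j x \<in> C \<Longrightarrow> x \<in> B"
    and count: "\<And>x. x \<in> B \<Longrightarrow> card {j \<in> J. g j x \<in> C} = N"
  shows "of_nat (card J) * (LINT x:C|M. w x) = of_nat N * (LINT x:B|M. w x)"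
proof -
  have int: "integrable M (\<lambda>x. indicator A x *\<^sub>R w x)" if "A \<in> sets M" for A
    using that w by (intro integrable_mult_indicator)
  have shift: "(LINT x:C|M. w x) = (LINT x|M. indicator C (g j x) *\<^sub>R w x)" if j: "j \<in> J" for j
  proof -
    have "(LINT x:C|M. w x) = (LINT x|distr M M (g j). indicator C x *\<^sub>R w x)"
      by (simp add: g(2)[OF j] set_lebesgue_integral_def)
    also have "\<dots> = (LINT x|M. indicator C (g j x) *\<^sub>R w (g j x))"
      by (rule integral_distr[OF g(1)[OF j]]) (use int[OF C] in auto)
    also have "\<dots> = (LINT x|M. indicator C (g j x) *\<^sub>R w x)"
      by (intro Bochner_Integration.integral_cong) (auto simp: inv[OF j])
    finally show ?thesis .
  qed
  have int': "integrable M (\<lambda>x. indicator C (g j x) *\<^sub>R w x)" if j: "j \<in> J" for j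
  proof -
    have "integrable (distr M M (g j)) (\<lambda>x. indicator C x *\<^sub>R w x)"
      using int[OF C] by (simp add: g(2)[OF j])
    hence "integrable M (\<lambda>x. indicator C (g j x) *\<^sub>R w (g j x))"
      using g(1)[OF j] borel_measurable_integrable[OF int[OF C]] by (subst (asm) integrable_distr_eq) auto
    moreover have "indicator C (g j x) *\<^sub>R w (g j x) = indicator C (g j x) *\<^sub>R w x" if "x \<in> space M" for x
      using inv[OF j that] by simp
    ultimately show ?thesis
      by (simp cong: Bochner_Integration.integrable_cong)
  qed
  have "of_nat (card J) * (LINT x:C|M. w x) = (\<Sum>j\<in>J. (LINT x:C|M. w x))"
    by simp
  also have "\<dots> = (\<Sum>j\<in>J. (LINT x|M. indicator C (g j x) *\<^sub>R w x))"
    by (intro sum.cong refl shift)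
  also have "\<dots> = (LINT x|M. (\<Sum>j\<in>J. indicator C (g j x) *\<^sub>R w x))"
    by (rule Bochner_Integration.integral_sum[symmetric]) (rule int')
  also have "\<dots> = (LINT x|M. of_nat N * (indicator B x *\<^sub>R w x))"
  proof (rule Bochner_Integration.integral_cong)
    fix x assume x: "x \<in> space M"
    have sum: "(\<Sum>j\<in>J. indicator C (g j x) *\<^sub>R w x) = of_nat (card {j \<in> J. g j x \<in> C}) * w x"
    proof -
      have "(\<Sum>j\<in>J. indicator C (g j x) *\<^sub>R w x) = (\<Sum>j\<in>J. if g j x \<in> C then w x else 0)"
        by (intro sum.cong) auto
      also have "\<dots> = (\<Sum>j\<in>{j \<in> J. g j x \<in> C}. w x)"
        by (rule sum.inter_filter[OF assms(1), symmetric])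
      finally show ?thesis by simp
    qed
    show "(\<Sum>j\<in>J. indicator C (g j x) *\<^sub>R w x) = of_nat N * (indicator B x *\<^sub>R w x)"
    proof (cases "x \<in> B")
      case True
      thus ?thesis unfolding sum by (simp add: count)
    next
      case False
      hence "{j \<in> J. g j x \<in> C} = {}" using out[OF _ x] by blast
      thus ?thesis unfolding sum using False by (simp only: card.empty) simp
    qed
  qed simp
  also have "\<dots> = of_nat N * (LINT x:B|M. w x)"
    unfolding set_lebesgue_integral_def by (rule integral_mult_right_zero)
  finally show ?thesis .
qed

lemma integral_eq_of_partition:
  fixes f g :: "'b \<Rightarrow> complex"
  assumes f: "integrable M f" and g: "integrable M g"
    and A: "\<And>i::nat. A i \<in> sets M" and disj: "\<And>i j. i \<noteq> j \<Longrightarrow> A i \<inter> A j = {}"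
    and eq: "\<And>i. (LINT x:A i|M. f x) = (LINT x:A i|M. g x)"
    and zero: "\<And>x. x \<in> space M \<Longrightarrow> x \<notin> (\<Union>i. A i) \<Longrightarrow> f x = 0 \<and> g x = 0"
  shows "integral\<^sup>L M f = integral\<^sup>L M g"
proof -
  have U: "(\<Union>i. A i) \<in> sets M" using A by blast
  have *: "integral\<^sup>L M h = (\<Sum>i. LINT x:A i|M. h x)"
    if "integrable M h" "\<And>x. x \<in> space M \<Longrightarrow> x \<notin> (\<Union>i. A i) \<Longrightarrow> h x = 0" for h :: "'b \<Rightarrow> complex"
  proof -
    have "integral\<^sup>L M h = (LINT x:(\<Union>i. A i)|M. h x)"
      unfolding set_lebesgue_integral_def
      using that(2) by (intro Bochner_Integration.integral_cong) (auto simp: indicator_def)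
    also have "\<dots> = (\<Sum>i. LINT x:A i|M. h x)"
      by (rule lebesgue_integral_countable_add[OF A disj])
         (use that(1) U in \<open>auto simp: set_integrable_def intro: integrable_mult_indicator\<close>)
    finally show ?thesis .
  qed
  show ?thesis
    using *[OF f] *[OF g] zero eq by simp
qed

section \<open>Level sets of arbitrary content, and the invariants of a nondegenerate form\<close>

context unramified_quadratic_extension
begin

lemma nv_powi_prm: "nv (prm powi j) = real q powi (- j)"
  by (simp add: nv_power_int nv_prm' power_int_inverse power_int_minus)

lemma nm_scl: "nm (scl s t) = nv s * nm t"
  by (cases t) (simp add: nm_def scl_def nv_mult max_mult_distrib_left nv_nonneg)

lemma dt_scl: "s \<in> k \<Longrightarrow> dt (scl s t) = s\<^sup>2 * dt t"
  by (cases t) (simp add: dt_def scl_def nrm_mult nrm_in_k_eq algebra_simps power2_eq_square)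

lemma herm_scl:
  assumes "s \<in> k" "s \<noteq> 0" shows "scl s t \<in> herm \<longleftrightarrow> t \<in> herm"
proof -
  have "s * a \<in> k \<longleftrightarrow> a \<in> k" for a
    using assms k_mult[of s a] k_divide[of "s * a" s] by auto
  thus ?thesis by (cases t) (simp add: herm_def scl_def)
qed

lemma lev_iff:
  "t \<in> lev e m j \<longleftrightarrow> t \<in> herm \<and> nm t = real q powi (- e) \<and>
     nv (dt t) = real q powi (- (2 * e + int m)) \<and> nv (snd (snd t)) \<le> real q powi (- (e + int j))"
proof -
  let ?s = "prm powi (- e)"
  have q0: "real q \<noteq> 0" "real q > 0" using q_pos by auto
  have s: "?s \<in> k" "?s \<noteq> 0" "nv ?s = real q powi e"
    by (simp_all add: k_power_int prm_in_k nv_powi_prm)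
  have pos: "real q powi e > 0" using q0 by simp
  have eq1: "real q powi e * u = v \<longleftrightarrow> u = v * real q powi (- e)" for u v
    using pos by (auto simp: power_int_minus field_simps)
  have eq2: "(real q powi e)\<^sup>2 * u = v \<longleftrightarrow> u = v * real q powi (- (2 * e))" for u v
  proof -
    have "(real q powi e)\<^sup>2 = real q powi (2 * e)"
      using q0 by (simp add: power2_eq_square flip: power_int_add)
    moreover have "real q powi (2 * e) > 0" using q0 by simp
    ultimately show ?thesis by (auto simp: power_int_minus field_simps)
  qed
  have le1: "real q powi e * u \<le> v \<longleftrightarrow> u \<le> v * real q powi (- e)" for u v
    using pos by (auto simp: power_int_minus field_simps)
  have eps: "\<epsilon> ^ i = real q powi (- int i)" for i
    by (simp add: power_int_minus field_simps)
  have *: "real q powi (- int i) * real q powi (- a) = real q powi (- (a + int i))" for i a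
  proof -
    have "- (a + int i) = - int i + - a" by simp
    moreover have "real q powi (- int i + - a) = real q powi (- int i) * real q powi (- a)"
      using q0 by (intro power_int_add) simp
    ultimately show ?thesis by (simp only:)
  qed
  have sc: "nv (snd (snd (scl ?s t))) = real q powi e * nv (snd (snd t))"
    by (cases t) (simp add: scl_def nv_mult s(3))
  show ?thesis
    unfolding lev_def lev0_def mem_Collect_eq herm_scl[OF s(1,2)] nm_scl dt_scl[OF s(1)] nv_mult nv_power s(3) sc
      eq1 eq2 le1 eps * by (simp only: mult_1_left)
qed

lemma lev_trn:
  assumes "t \<in> herm"
  shows "trn y t \<in> lev e m j \<longleftrightarrow> trn y (scl (prm powi (- e)) t) \<in> lev0 m j"
  by (simp add: lev_def scl_trn k_power_int prm_in_k)

definition ee :: "'a \<times> 'a \<times> 'a \<Rightarrow> int" where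
  "ee t = (THE e. nm t = real q powi (- e))"

text \<open>For a nondegenerate Hermitian triple the difference is nonnegative, because the
  determinant is bounded by the square of the norm \<open>nm\<close>; \<open>nat\<close> therefore
  loses nothing.\<close>

definition mm :: "'a \<times> 'a \<times> 'a \<Rightarrow> nat" where
  "mm t = nat (vl (dt t) - 2 * ee t)"

lemma ee_eq: "nm t = real q powi (- e) \<Longrightarrow> ee t = e"
  unfolding ee_def by (rule the_equality) (auto simp: q_powi_eq_iff)

lemma lev_ee_mm:
  assumes "t \<in> lev e m j" shows "ee t = e" "mm t = m" "dt t \<noteq> 0" "vl (dt t) = 2 * e + int m"
proof -
  show ee: "ee t = e"
    using assms by (intro ee_eq) (simp add: lev_iff)
  show vl: "vl (dt t) = 2 * e + int m"
    using assms by (intro vl_eqI) (simp add: lev_iff)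
  show "mm t = m" by (simp add: mm_def ee vl)
  have "nv (dt t) > 0"
    using assms q_pos by (simp add: lev_iff)
  thus "dt t \<noteq> 0" by (simp add: nv_pos_iff)
qed

lemma lev_exists:
  assumes "t \<in> herm" "dt t \<noteq> 0"
  shows "t \<in> lev (ee t) (mm t) 0" "nm t = real q powi (- ee t)" "vl (dt t) = 2 * ee t + int (mm t)"
proof -
  obtain a b c where t: "t = (a, b, c)" by (cases t)
  have "a \<noteq> 0 \<or> b \<noteq> 0 \<or> c \<noteq> 0"
    using assms by (auto simp: t dt_def nrm_def)
  obtain e where e: "nm t = real q powi (- e)"
  proof -
    have "nm t \<in> nv ` {a, b, c}"
      by (auto simp: t nm_def max_def)
    then obtain u where u: "nm t = nv u" by blast
    have "u \<noteq> 0"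
    proof
      assume "u = 0"
      hence "nv a \<le> 0" "nv b \<le> 0" "nv c \<le> 0"
        using u by (auto simp: t nm_def)
      thus False using \<open>a \<noteq> 0 \<or> b \<noteq> 0 \<or> c \<noteq> 0\<close> nv_pos_iff[of a] nv_pos_iff[of b] nv_pos_iff[of c] by linarith
    qed
    thus ?thesis using nv_discrete u that by metis
  qed
  have ee: "ee t = e" using e by (rule ee_eq)
  show nm: "nm t = real q powi (- ee t)" using e ee by simp
  have le: "nv a \<le> nm t" "nv b \<le> nm t" "nv c \<le> nm t" by (auto simp: t nm_def)
  have "nv (dt t) \<le> (nm t)\<^sup>2"
  proof -
    have nn: "0 \<le> nm t" using le nv_nonneg[of a] by linarith
    have "nv (a * c) \<le> (nm t)\<^sup>2" "nv (nrm b) \<le> (nm t)\<^sup>2"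
      using le nv_nonneg nn by (auto simp: nv_mult nv_nrm power2_eq_square intro!: mult_mono)
    thus ?thesis unfolding t dt_def by (simp add: nv_diff_le)
  qed
  hence "real q powi (- vl (dt t)) \<le> real q powi (- (2 * e))"
    using nv_eq_powi[OF assms(2)] q_pos by (simp add: e power2_eq_square flip: power_int_add)
  hence ge: "2 * e \<le> vl (dt t)"
    using q_ge_2 power_int_strict_increasing[of "- (2 * e)" "- vl (dt t)" "real q"] by force
  thus vl: "vl (dt t) = 2 * ee t + int (mm t)"
    by (simp add: mm_def ee)
  show "t \<in> lev (ee t) (mm t) 0"
    using assms(1) nv_eq_powi[OF assms(2)] vl nm le(3) by (simp add: lev_iff t)
qed

lemma lev_diff_iff:
  assumes "t \<in> lev e m 0"
  shows "t \<in> lev e m j - lev e m (Suc j) \<longleftrightarrow> snd (snd t) \<noteq> 0 \<and> vl (snd (snd t)) = e + int j"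
proof (cases "snd (snd t) = 0")
  case True
  thus ?thesis using assms q_pos by (simp add: lev_iff)
next
  case False
  have mono: "real q powi (- a) \<le> real q powi (- b) \<longleftrightarrow> b \<le> a" for a b
    using q_ge_2 power_int_strict_increasing[of "- a" "- b" "real q"] power_int_strict_increasing[of "- b" "- a" "real q"]
    by (cases a b rule: linorder_cases) force+
  have "t \<in> lev e m i \<longleftrightarrow> e + int i \<le> vl (snd (snd t))" for i
    using assms nv_eq_powi[OF False] mono[of "vl (snd (snd t))" "e + int i"] by (simp add: lev_iff)
  from this[of j] this[of "Suc j"] show ?thesis using False by auto
qed

end

text \<open>The averaging needs only a finite measure space on which integral unipotents and the
  swap preserve the measure and act on an attached Hermitian triple. The matrices and the Haar
  measure enter later as an instance.\<close>

locale hermitian_action = unramified_quadratic_extension nv p k prm cj + finite_measure M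
  for nv :: "'a::field_char_0 \<Rightarrow> real" and p k prm cj and M :: "'b measure" +
  fixes tr :: "'b \<Rightarrow> 'a \<times> 'a \<times> 'a" and act_u :: "'a \<Rightarrow> 'b \<Rightarrow> 'b" and act_w :: "'b \<Rightarrow> 'b"
  assumes u_meas: "nv y \<le> 1 \<Longrightarrow> act_u y \<in> measurable M M"
    and u_distr: "nv y \<le> 1 \<Longrightarrow> distr M M (act_u y) = M"
    and w_meas: "act_w \<in> measurable M M" and w_distr: "distr M M act_w = M"
    and tr_herm: "x \<in> space M \<Longrightarrow> tr x \<in> herm"
    and tr_u: "nv y \<le> 1 \<Longrightarrow> x \<in> space M \<Longrightarrow> tr (act_u y x) = trn y (tr x)"
    and tr_w: "x \<in> space M \<Longrightarrow> tr (act_w x) = swp (tr x)"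
    and nm_meas: "(\<lambda>x. nm (tr x)) \<in> borel_measurable M"
    and dt_meas: "(\<lambda>x. nv (dt (tr x))) \<in> borel_measurable M"
    and ga_meas: "(\<lambda>x. nv (snd (snd (tr x)))) \<in> borel_measurable M"
begin

definition Lv :: "int \<Rightarrow> nat \<Rightarrow> nat \<Rightarrow> 'b set" where
  "Lv e m j = {x \<in> space M. tr x \<in> lev e m j}"

lemma Lv_sets: "Lv e m j \<in> sets M"
proof -
  have "Lv e m j = {x \<in> space M. nm (tr x) = real q powi (- e)} \<inter>
      {x \<in> space M. nv (dt (tr x)) = real q powi (- (2 * e + int m))} \<inter>
      {x \<in> space M. nv (snd (snd (tr x))) \<le> real q powi (- (e + int j))}"
    using tr_herm by (auto simp: Lv_def lev_iff)
  thus ?thesis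
    using nm_meas dt_meas ga_meas by simp
qed

lemma level_integral_step:
  fixes w :: "'b \<Rightarrow> complex"
  assumes w: "integrable M w" and inv: "\<And>y x. nv y \<le> 1 \<Longrightarrow> x \<in> space M \<Longrightarrow> w (act_u y x) = w x"
    and "1 \<le> j" and IH: "(LINT x:Lv e m j|M. w x) = of_real (mu (real q) m j) * I"
  shows "(LINT x:Lv e m (Suc j)|M. w x) = of_real (mu (real q) m (Suc j)) * I"
proof -
  have "\<exists>i N. (\<forall>t\<in>lev0 m j. \<forall>y. nv y \<le> 1 \<longrightarrow> trn (prm ^ i * y) t \<in> lev0 m j) \<and>
      (\<forall>t\<in>lev0 m j. card {y \<in> res. trn (prm ^ i * y) t \<in> lev0 m (Suc j)} = N) \<and>
      (real q)\<^sup>2 * mu (real q) m (Suc j) = real N * mu (real q) m j"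
    by (rule lev0_step[OF assms(3), of m], intro exI conjI ballI allI impI) assumption+
  then obtain i N where stay: "\<And>t y. t \<in> lev0 m j \<Longrightarrow> nv y \<le> 1 \<Longrightarrow> trn (prm ^ i * y) t \<in> lev0 m j"
    and count: "\<And>t. t \<in> lev0 m j \<Longrightarrow> card {y \<in> res. trn (prm ^ i * y) t \<in> lev0 m (Suc j)} = N"
    and N: "(real q)\<^sup>2 * mu (real q) m (Suc j) = real N * mu (real q) m j"
    by blast
  have py: "nv (prm ^ i * y) \<le> 1" if "nv y \<le> 1" for y
    using that eps_power_le_iff[of i 0] nv_nonneg[of y] mult_mono[of "\<epsilon> ^ i" 1 "nv y" 1]
    by (simp add: nv_mult nv_prm_power)
  have iff: "act_u (prm ^ i * y) x \<in> Lv e m l \<longleftrightarrow> trn (prm ^ i * y) (scl (prm powi (- e)) (tr x)) \<in> lev0 m l"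
    if "y \<in> res" "x \<in> space M" for x y l
    using that py[OF nv_res_le] measurable_space[OF u_meas[OF py[OF nv_res_le]]]
    by (simp add: Lv_def tr_u lev_trn tr_herm)
  have "of_nat (card res) * (LINT x:Lv e m (Suc j)|M. w x) = of_nat N * (LINT x:Lv e m j|M. w x)"
  proof (rule average_over_translates[where g = "\<lambda>y. act_u (prm ^ i * y)"])
    fix y x assume y: "y \<in> res" and x: "x \<in> space M" and C: "act_u (prm ^ i * y) x \<in> Lv e m (Suc j)"
    let ?t = "scl (prm powi (- e)) (tr x)"
    have herm: "?t \<in> herm"
      using tr_herm[OF x] by (simp add: herm_scl k_power_int prm_in_k)
    have "trn (prm ^ i * y) ?t \<in> lev0 m (Suc j)"
      using C iff[OF y x] by simp
    hence "trn (prm ^ i * y) ?t \<in> lev0 m j"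
      using lev0_antimono[of j "Suc j" m] by auto
    \<comment> \<open>The inverse translation has the same depth, so it preserves level j; what
      lands in level j + 1 must therefore have started in level j.\<close>
    hence "trn (prm ^ i * (- y)) (trn (prm ^ i * y) ?t) \<in> lev0 m j"
      using stay[of "trn (prm ^ i * y) ?t" "- y"] nv_res_le[OF y] by simp
    hence "?t \<in> lev0 m j"
      using trn_uminus[OF herm, of "prm ^ i * y"] by simp
    thus "x \<in> Lv e m j" using x by (simp add: Lv_def lev_def)
  next
    fix x assume "x \<in> Lv e m j"
    hence x: "x \<in> space M" "scl (prm powi (- e)) (tr x) \<in> lev0 m j"
      by (auto simp: Lv_def lev_def)
    have "{y \<in> res. act_u (prm ^ i * y) x \<in> Lv e m (Suc j)}
        = {y \<in> res. trn (prm ^ i * y) (scl (prm powi (- e)) (tr x)) \<in> lev0 m (Suc j)}"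
      using iff x by blast
    thus "card {y \<in> res. act_u (prm ^ i * y) x \<in> Lv e m (Suc j)} = N"
      using count[OF x(2)] by simp
  qed (use w inv py nv_res_le u_meas u_distr in \<open>auto simp: finite_res Lv_sets\<close>)
  hence "of_real ((real q)\<^sup>2) * (LINT x:Lv e m (Suc j)|M. w x) = of_real (real N * mu (real q) m j) * I"
    by (simp add: card_res IH)
  also have "\<dots> = of_real ((real q)\<^sup>2) * (of_real (mu (real q) m (Suc j)) * I)"
    unfolding N[symmetric] by simp
  finally show ?thesis
    using q_pos by simp
qed

lemma level_integral_first:
  fixes w :: "'b \<Rightarrow> complex"
  assumes w: "integrable M w" and inv: "\<And>y x. nv y \<le> 1 \<Longrightarrow> x \<in> space M \<Longrightarrow> w (act_u y x) = w x"
    and invw: "\<And>x. x \<in> space M \<Longrightarrow> w (act_w x) = w x"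
  shows "(LINT x:Lv e m (Suc 0)|M. w x) = of_real (mu (real q) m (Suc 0)) * (LINT x:Lv e m 0|M. w x)"
proof -
  \<comment> \<open>\<open>None\<close> is the point at infinity, represented by the swap, so that
    \<open>J\<close> has the q^2 + 1 points of the projective line.\<close>
  define g where "g = (\<lambda>y. case y of None \<Rightarrow> act_w | Some y \<Rightarrow> act_u y)"
  define J where "J = insert None (Some ` res)"
  have card_J: "card J = q\<^sup>2 + 1"
    by (simp add: J_def finite_res card_image card_res)
  have iff: "act_u y x \<in> Lv e m l \<longleftrightarrow> trn y (scl (prm powi (- e)) (tr x)) \<in> lev0 m l"
    if "nv y \<le> 1" "x \<in> space M" for x y l
    using that measurable_space[OF u_meas] by (simp add: Lv_def tr_u lev_trn tr_herm)
  have iffw: "act_w x \<in> Lv e m l \<longleftrightarrow> swp (scl (prm powi (- e)) (tr x)) \<in> lev0 m l"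
    if "x \<in> space M" for x l
    using that measurable_space[OF w_meas] by (simp add: Lv_def tr_w lev_def scl_swp k_power_int prm_in_k)
  have herm: "scl (prm powi (- e)) (tr x) \<in> herm" if "x \<in> space M" for x
    using tr_herm[OF that] by (simp add: herm_scl k_power_int prm_in_k)
  have "of_nat (card J) * (LINT x:Lv e m (Suc 0)|M. w x)
      = of_nat (if m = 0 then q + 1 else 1) * (LINT x:Lv e m 0|M. w x)"
  proof (rule average_over_translates[where g = g])
    fix j x assume j: "j \<in> J" and x: "x \<in> space M" and C: "g j x \<in> Lv e m (Suc 0)"
    let ?t = "scl (prm powi (- e)) (tr x)"
    show "x \<in> Lv e m 0"
    proof (cases j)
      case None
      hence "swp ?t \<in> lev0 m (Suc 0)"
        using C iffw[OF x] by (simp add: g_def)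
      hence "swp (swp ?t) \<in> lev0 m 0"
        by (rule lev0_swp_base)
      moreover have "swp (swp ?t) = ?t" by (cases ?t) (simp add: swp_def)
      ultimately show ?thesis using x by (simp add: Lv_def lev_def)
    next
      case (Some y)
      hence y: "nv y \<le> 1" using j nv_res_le by (auto simp: J_def)
      hence "trn y ?t \<in> lev0 m (Suc 0)"
        using C iff[OF y x] Some by (simp add: g_def)
      hence "trn (- y) (trn y ?t) \<in> lev0 m 0"
        using y by (intro lev0_trn_base) auto
      hence "?t \<in> lev0 m 0"
        using trn_uminus[OF herm[OF x], of y] by simp
      thus ?thesis using x by (simp add: Lv_def lev_def)
    qed
  next
    fix x assume "x \<in> Lv e m 0"
    hence x: "x \<in> space M" "scl (prm powi (- e)) (tr x) \<in> lev0 m 0"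
      by (auto simp: Lv_def lev_def)
    let ?t = "scl (prm powi (- e)) (tr x)"
    have "{j \<in> J. g j x \<in> Lv e m (Suc 0)}
        = (if swp ?t \<in> lev0 m (Suc 0) then {None} else {}) \<union> Some ` {y \<in> res. trn y ?t \<in> lev0 m (Suc 0)}"
      using iff[OF nv_res_le x(1)] iffw[OF x(1)] by (auto simp: J_def g_def)
    hence "card {j \<in> J. g j x \<in> Lv e m (Suc 0)}
        = (if swp ?t \<in> lev0 m (Suc 0) then 1 else 0) + card {y \<in> res. trn y ?t \<in> lev0 m (Suc 0)}"
      by (simp add: card_image finite_res card_insert_if)
    thus "card {j \<in> J. g j x \<in> Lv e m (Suc 0)} = (if m = 0 then q + 1 else 1)"
      using lev0_count_0[OF x(2)] by simp
  qed (use w inv invw nv_res_le u_meas u_distr w_meas w_distr in \<open>auto simp: finite_res Lv_sets J_def g_def\<close>)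
  moreover have "of_nat (card J) = (of_real ((real q)\<^sup>2 + 1) :: complex)"
    by (simp add: card_J)
  moreover have "of_nat (if m = 0 then q + 1 else 1) = (of_real (((real q)\<^sup>2 + 1) * mu (real q) m (Suc 0)) :: complex)"
  proof -
    have "(of_nat q)\<^sup>2 + 1 \<noteq> (0::complex)"
      using of_real_square_plus_1_nonzero[of "real q"] by simp
    thus ?thesis by (simp add: mu_1)
  qed
  moreover have "of_real ((real q)\<^sup>2 + 1) \<noteq> (0::complex)"
    using zero_le_power2[of "real q"] by (simp only: of_real_eq_0_iff)
  ultimately show ?thesis
    by (simp only: of_real_mult mult.assoc mult_cancel_left simp_thms)
qed

text \<open>The fraction \<open>mu\<close> depends neither on the content nor on the invariant
  weight. This independence is what allows the weight to carry all minors other than d_i.\<close>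

lemma level_integral:
  fixes w :: "'b \<Rightarrow> complex"
  assumes w: "integrable M w" and inv: "\<And>y x. nv y \<le> 1 \<Longrightarrow> x \<in> space M \<Longrightarrow> w (act_u y x) = w x"
    and invw: "\<And>x. x \<in> space M \<Longrightarrow> w (act_w x) = w x"
  shows "(LINT x:Lv e m j|M. w x) = of_real (mu (real q) m j) * (LINT x:Lv e m 0|M. w x)"
proof (induction j)
  case (Suc j)
  show ?case
  proof (cases "j = 0")
    case True
    thus ?thesis using level_integral_first[OF w inv invw] by simp
  next
    case False
    thus ?thesis using level_integral_step[OF w inv _ Suc] by simp
  qed
qed simp

text \<open>On the set of forms with given content e and given m, the power of T may be replaced by
  its mean, namely T^e times the generating function of \<open>mu\<close>. Its common factor (q - U)
  / ((q^2 + 1) (1 + U)) does not depend on the class and comes out of the integral.\<close>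

lemma integral_lower_entry:
  fixes T :: complex and w :: "'b \<Rightarrow> complex"
  defines "U \<equiv> - T / of_nat q"
  defines "F \<equiv> (\<lambda>x. if dt (tr x) \<noteq> 0 \<and> snd (snd (tr x)) \<noteq> 0 then w x * T powi vl (snd (snd (tr x))) else 0)"
  defines "G \<equiv> (\<lambda>x. if dt (tr x) \<noteq> 0 then w x * (T powi ee (tr x) * chi (real q) (mm (tr x)) U) else 0)"
  assumes T: "T \<noteq> 0" "norm T < 1"
    and w: "integrable M w" and inv: "\<And>y x. nv y \<le> 1 \<Longrightarrow> x \<in> space M \<Longrightarrow> w (act_u y x) = w x"
    and invw: "\<And>x. x \<in> space M \<Longrightarrow> w (act_w x) = w x"
    and F: "integrable M F" and G: "integrable M G"
  shows "((of_nat q)\<^sup>2 + 1) * (1 + U) * integral\<^sup>L M F = (of_nat q - U) * integral\<^sup>L M G"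
proof -
  \<comment> \<open>An enumeration by natural numbers of all pairs of content and \<open>m\<close>,
    so that countable additivity applies. Degenerate forms lie in no class; both integrands vanish
    there.\<close>
  define A where "A i = (let (a, m) = prod_decode i in Lv (int_decode a) m 0)" for i
  define c where "c = (of_nat q - U) / (((of_nat q)\<^sup>2 + 1) * (1 + U))"
  have Lv_disj: "e = e' \<and> m = m'" if "x \<in> Lv e m j" "x \<in> Lv e' m' j'" for x e e' m m' j j'
    using lev_ee_mm(1,2)[of "tr x" e m j] lev_ee_mm(1,2)[of "tr x" e' m' j'] that by (simp add: Lv_def)
  have A_disj: "A i \<inter> A j = {}" if "i \<noteq> j" for i j
  proof (rule ccontr)
    assume "A i \<inter> A j \<noteq> {}"
    then obtain x where "x \<in> A i" "x \<in> A j" by blast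
    hence "int_decode (fst (prod_decode i)) = int_decode (fst (prod_decode j)) \<and>
        snd (prod_decode i) = snd (prod_decode j)"
      using Lv_disj by (auto simp: A_def Let_def case_prod_unfold)
    hence "prod_decode i = prod_decode j"
      by (simp add: prod_eq_iff int_decode_eq)
    thus False using that by (simp add: prod_decode_eq)
  qed
  have A_cover: "x \<in> (\<Union>i. A i)" if "x \<in> space M" "dt (tr x) \<noteq> 0" for x
  proof -
    have "x \<in> Lv (ee (tr x)) (mm (tr x)) 0"
      using lev_exists(1)[OF tr_herm that(2)] that by (simp add: Lv_def)
    hence "x \<in> A (prod_encode (int_encode (ee (tr x)), mm (tr x)))"
      by (simp add: A_def)
    thus ?thesis by blast
  qed
  have level: "(LINT x:Lv e m 0|M. F x) = (LINT x:Lv e m 0|M. c * G x)" for e m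
  proof -
    define I where "I = (LINT x:Lv e m 0|M. w x)"
    have set_w: "set_integrable M (Lv e m j) w" for j
      unfolding set_integrable_def using w Lv_sets by (intro integrable_mult_indicator)
    let ?B = "\<lambda>j. Lv e m j - Lv e m (Suc j)"
    have B: "x \<in> ?B j \<longleftrightarrow> x \<in> Lv e m 0 \<and> snd (snd (tr x)) \<noteq> 0 \<and> vl (snd (snd (tr x))) = e + int j" for x j
    proof (cases "x \<in> Lv e m 0")
      case True
      thus ?thesis using lev_diff_iff[of "tr x" e m j] by (auto simp: Lv_def)
    next
      case False
      have "Lv e m j \<subseteq> Lv e m 0"
        using lev0_antimono[of 0 j m] by (auto simp: Lv_def lev_def)
      thus ?thesis using False by blast
    qed
    have B_int: "(LINT x:?B j|M. F x) = T powi e * (T ^ j * of_real (mu (real q) m j - mu (real q) m (Suc j))) * I" for j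
    proof -
      have sub: "Lv e m (Suc j) \<subseteq> Lv e m j"
        using lev0_antimono[of j "Suc j" m] by (auto simp: Lv_def lev_def)
      have "(LINT x:?B j|M. F x) = (LINT x:?B j|M. T powi (e + int j) * w x)"
      proof (rule set_lebesgue_integral_cong)
        show "\<forall>x. x \<in> ?B j \<longrightarrow> F x = T powi (e + int j) * w x"
          using B lev_ee_mm(3)[of "tr _" e m 0] by (auto simp: F_def Lv_def simp del: Diff_iff)
      qed (use Lv_sets in auto)
      also have "\<dots> = T powi (e + int j) * (LINT x:?B j|M. w x)"
        by (rule set_integral_mult_right)
      also have "(LINT x:?B j|M. w x) = (LINT x:Lv e m j|M. w x) - (LINT x:Lv e m (Suc j)|M. w x)"
      proof -
        have "(LINT x:Lv e m j|M. w x) = (LINT x:(?B j \<union> Lv e m (Suc j))|M. w x)"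
          using sub by (simp add: Un_absorb2)
        also have "\<dots> = (LINT x:?B j|M. w x) + (LINT x:Lv e m (Suc j)|M. w x)"
        proof (rule set_integral_Un)
          show "set_integrable M (?B j) w"
            unfolding set_integrable_def using w Lv_sets by (intro integrable_mult_indicator) auto
        qed (use set_w in auto)
        finally show ?thesis by simp
      qed
      also have "\<dots> = of_real (mu (real q) m j - mu (real q) m (Suc j)) * I"
      proof -
        have "(LINT x:Lv e m i|M. w x) = of_real (mu (real q) m i) * I" for i
          unfolding I_def by (rule level_integral[OF w inv invw])
        thus ?thesis by (simp add: left_diff_distrib)
      qed
      also have "T powi (e + int j) = T powi e * T ^ j"
        using T by (simp add: power_int_add)
      finally show ?thesis by (simp add: mult_ac)
    qed
    \<comment> \<open>The slices \<open>?B j\<close> exhaust the class except for the points with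
      lower entry 0, where the integrand is 0 by definition.\<close>
    have "(LINT x:Lv e m 0|M. F x) = (LINT x:(\<Union>j. ?B j)|M. F x)"
      unfolding set_lebesgue_integral_def
    proof (rule Bochner_Integration.integral_cong)
      fix x assume x: "x \<in> space M"
      show "indicator (Lv e m 0) x *\<^sub>R F x = indicator (\<Union>j. ?B j) x *\<^sub>R F x"
      proof (cases "x \<in> Lv e m 0 \<and> snd (snd (tr x)) \<noteq> 0")
        case True
        have "nv (snd (snd (tr x))) \<le> real q powi (- e)"
          using True by (simp add: Lv_def lev_iff)
        hence "e \<le> vl (snd (snd (tr x)))"
          using nv_eq_powi[of "snd (snd (tr x))"] True q_ge_2
            power_int_strict_increasing[of "- e" "- vl (snd (snd (tr x)))" "real q"] by force
        hence "x \<in> ?B (nat (vl (snd (snd (tr x))) - e))"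
          using B True by (simp del: Diff_iff)
        hence "x \<in> (\<Union>j. ?B j)" by blast
        thus ?thesis using True by (simp only: indicator_simps)
      next
        case False
        have "x \<notin> ?B j" for j using B False by blast
        hence "x \<notin> (\<Union>j. ?B j)" by blast
        thus ?thesis using False by (cases "x \<in> Lv e m 0") (auto simp: F_def simp del: UN_iff)
      qed
    qed simp
    also have "\<dots> = (\<Sum>j. LINT x:?B j|M. F x)"
    proof (rule lebesgue_integral_countable_add)
      fix i j :: nat assume "i \<noteq> j"
      have False if "x \<in> ?B i" "x \<in> ?B j" for x
        using that(1)[unfolded B] that(2)[unfolded B] \<open>i \<noteq> j\<close> by simp
      thus "?B i \<inter> ?B j = {}" by blast
    next
      show "set_integrable M (\<Union>j. ?B j) F"
        unfolding set_integrable_def using F Lv_sets by (intro integrable_mult_indicator) auto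
    qed (use Lv_sets in auto)
    also have "\<dots> = T powi e * (c * chi (real q) m U) * I"
    proof -
      have q1: "real q > 1" using q_ge_2 by simp
      have "(\<lambda>j. T ^ j * of_real (mu (real q) m j - mu (real q) m (Suc j))) sums (c * chi (real q) m U)"
        using mu_generating_function[OF q1 T(2), of m] by (simp add: U_def c_def)
      hence "(\<lambda>j. T powi e * (T ^ j * of_real (mu (real q) m j - mu (real q) m (Suc j))) * I)
          sums (T powi e * (c * chi (real q) m U) * I)"
        by (intro sums_mult sums_mult2)
      thus ?thesis unfolding B_int by (simp add: sums_iff)
    qed
    also have "\<dots> = (LINT x:Lv e m 0|M. (T powi e * (c * chi (real q) m U)) * w x)"
      by (simp add: I_def)
    also have "\<dots> = (LINT x:Lv e m 0|M. c * G x)"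
    proof (rule set_lebesgue_integral_cong)
      show "\<forall>x. x \<in> Lv e m 0 \<longrightarrow> (T powi e * (c * chi (real q) m U)) * w x = c * G x"
        using lev_ee_mm[of "tr _" e m 0] by (auto simp: G_def Lv_def)
    qed (use Lv_sets in auto)
    finally show ?thesis .
  qed
  have "integral\<^sup>L M F = integral\<^sup>L M (\<lambda>x. c * G x)"
  proof (rule integral_eq_of_partition[where A = A])
    show "integrable M (\<lambda>x. c * G x)" using G by simp
    show "A i \<in> sets M" for i by (simp add: A_def Let_def case_prod_unfold Lv_sets)
    show "(LINT x:A i|M. F x) = (LINT x:A i|M. c * G x)" for i
      unfolding A_def Let_def case_prod_unfold by (rule level)
    show "F x = 0 \<and> c * G x = 0" if "x \<in> space M" "x \<notin> (\<Union>i. A i)" for x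
      using A_cover[OF that(1)] that(2) by (auto simp: F_def G_def simp del: UN_iff)
  qed (use F A_disj in auto)
  hence eq: "integral\<^sup>L M F = c * integral\<^sup>L M G" by simp
  have "norm U < 1"
  proof -
    have "norm U = norm T / real q" by (simp add: U_def norm_divide)
    also have "\<dots> < 1" using T q_ge_2 by (simp add: divide_less_eq)
    finally show ?thesis .
  qed
  hence "1 + U \<noteq> 0"
    by (metis add.inverse_unique less_irrefl norm_minus_cancel norm_one)
  moreover have "(of_nat q)\<^sup>2 + 1 \<noteq> (0::complex)"
    using of_real_square_plus_1_nonzero[of "real q"] by simp
  ultimately show ?thesis
    unfolding eq c_def by simp
qed

end

section \<open>Continuation of the partial integral\<close>

text \<open>Cauchy's inequality turns the uniform bound \<open>B\<close> into a uniform bound B / r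
  for derivatives, hence for difference quotients, and a constant dominates on a finite measure.
  Difference quotients along sequences also supply the measurability of the derivative.\<close>

lemma holomorphic_integral:
  fixes f :: "complex \<Rightarrow> 'b \<Rightarrow> complex"
  assumes "finite_measure M" "open S"
    and hol: "\<And>x. x \<in> space M \<Longrightarrow> (\<lambda>t. f t x) holomorphic_on S"
    and meas: "\<And>t. t \<in> S \<Longrightarrow> f t \<in> borel_measurable M"
    and bound: "\<And>t x. t \<in> S \<Longrightarrow> x \<in> space M \<Longrightarrow> norm (f t x) \<le> B"
  shows "(\<lambda>t. LINT x|M. f t x) holomorphic_on S"
  unfolding holomorphic_on_open[OF assms(2)]
proof
  interpret finite_measure M by fact
  fix t0 assume t0: "t0 \<in> S"
  obtain r0 where r0: "r0 > 0" "ball t0 r0 \<subseteq> S"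
    using assms(2) t0 open_contains_ball by blast
  \<comment> \<open>Half the radius leaves room for a closed disc of radius r around every point of
    the ball, as Cauchy's inequality requires.\<close>
  define r where "r = r0 / 2"
  have r: "r > 0" "ball t0 (2 * r) \<subseteq> S" using r0 by (auto simp: r_def)
  have sub: "ball t0 r \<subseteq> S" using r by (auto simp: subset_iff)
  have cb: "cball u r \<subseteq> S" if "u \<in> ball t0 r" for u
  proof
    fix v assume "v \<in> cball u r"
    hence "dist t0 v < 2 * r"
      using that dist_triangle[of t0 v u] by simp
    thus "v \<in> S" using r(2) by auto
  qed
  define g where "g x = deriv (\<lambda>t. f t x) t0" for x
  have int: "integrable M (f t)" if "t \<in> S" for t
    by (rule integrable_const_bound[of _ B]) (use bound[OF that] meas[OF that] in auto)
  have deriv: "((\<lambda>t. f t x) has_field_derivative deriv (\<lambda>t. f t x) u) (at u)" if "x \<in> space M" "u \<in> S" for x u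
    using holomorphic_derivI[OF hol[OF that(1)] assms(2) that(2)] .
  have deriv_le: "norm (deriv (\<lambda>t. f t x) u) \<le> B / r" if x: "x \<in> space M" and u: "u \<in> ball t0 r" for x u
  proof -
    have "norm ((deriv ^^ 1) (\<lambda>t. f t x) u) \<le> fact 1 * B / r ^ 1"
    proof (rule Cauchy_inequality)
      show "(\<lambda>t. f t x) holomorphic_on ball u r"
        using hol[OF x] cb[OF u] by (meson ball_subset_cball holomorphic_on_subset order_trans)
      show "continuous_on (cball u r) (\<lambda>t. f t x)"
        using hol[OF x] cb[OF u] holomorphic_on_imp_continuous_on holomorphic_on_subset by blast
      show "norm (f v x) \<le> B" if "norm (u - v) = r" for v
        using that cb[OF u] by (intro bound[OF _ x]) (auto simp: dist_norm subset_iff)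
    qed (use r in auto)
    thus ?thesis by simp
  qed
  have lip: "norm (f v x - f t0 x) \<le> B / r * norm (v - t0)" if "x \<in> space M" "v \<in> ball t0 r" for x v
  proof (rule field_differentiable_bound[where S = "ball t0 r" and f' = "deriv (\<lambda>t. f t x)"])
    fix u assume u: "u \<in> ball t0 r"
    show "((\<lambda>t. f t x) has_field_derivative deriv (\<lambda>t. f t x) u) (at u within ball t0 r)"
      using deriv[OF that(1)] u sub by (meson has_field_derivative_at_within subsetD)
  qed (use deriv_le[OF that(1)] that r in auto)
  have "((\<lambda>t. LINT x|M. f t x) has_field_derivative (LINT x|M. g x)) (at t0 within ball t0 r)"
    unfolding has_field_derivative_iff tendsto_at_iff_sequentially
  proof (intro allI impI)
    fix u :: "nat \<Rightarrow> complex" assume u: "\<forall>i. u i \<in> ball t0 r - {t0}" and lim: "u \<longlonglongrightarrow> t0"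
    have uS: "u i \<in> S" and ne: "u i - t0 \<noteq> 0" for i using u sub by auto
    define s where "s i x = (f (u i) x - f t0 x) / (u i - t0)" for i x
    have s_meas: "s i \<in> borel_measurable M" for i
      unfolding s_def using meas[OF uS] meas[OF t0] by measurable
    have s_lim: "(\<lambda>i. s i x) \<longlonglongrightarrow> g x" if "x \<in> space M" for x
    proof -
      have "((\<lambda>y. (f y x - f t0 x) / (y - t0)) \<longlongrightarrow> g x) (at t0)"
        using deriv[OF that t0] by (simp add: has_field_derivative_iff g_def)
      thus ?thesis
        using u lim unfolding tendsto_at_iff_sequentially s_def comp_def by blast
    qed
    have g_meas: "g \<in> borel_measurable M"
      by (rule borel_measurable_LIMSEQ_metric[OF s_meas s_lim])
    have "(\<lambda>i. LINT x|M. s i x) \<longlonglongrightarrow> (LINT x|M. g x)"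
    proof (rule integral_dominated_convergence[where w = "\<lambda>_. B / r"])
      show "AE x in M. norm (s i x) \<le> B / r" for i
      proof (rule AE_I2)
        fix x assume "x \<in> space M"
        from lip[OF this, of "u i"] u have "norm (f (u i) x - f t0 x) \<le> B / r * norm (u i - t0)"
          by simp
        thus "norm (s i x) \<le> B / r"
          using ne[of i] by (simp add: s_def norm_divide pos_divide_le_eq)
      qed
    qed (use s_meas g_meas s_lim in auto)
    moreover have "(LINT x|M. s i x) = ((LINT x|M. f (u i) x) - (LINT x|M. f t0 x)) / (u i - t0)" for i
      unfolding s_def using int[OF uS] int[OF t0] by simp
    ultimately show "((\<lambda>y. ((LINT x|M. f y x) - (LINT x|M. f t0 x)) / (y - t0)) \<circ> u) \<longlonglongrightarrow> (LINT x|M. g x)"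
      by (simp add: comp_def)
  qed
  hence "((\<lambda>t. LINT x|M. f t x) has_field_derivative (LINT x|M. g x)) (at t0)"
    using r by (simp add: at_within_open[of t0 "ball t0 r"])
  thus "\<exists>f'. ((\<lambda>t. LINT x|M. f t x) has_field_derivative f') (at t0)" by blast
qed

text \<open>The condition g 0 = 1 accounts for i = 1, where the left neighbour lies outside the
  index range and stands for the empty minor.\<close>

lemma prod_neighbours:
  fixes g :: "nat \<Rightarrow> 'c::comm_monoid_mult"
  assumes "1 \<le> i" "i < n" "g 0 = 1"
  shows "(\<Prod>j\<in>{1..n} - {i}. if j = i - 1 \<or> j = i + 1 then g j else 1) = g (i - 1) * g (i + 1)"
proof -
  have "(\<Prod>j\<in>{1..n} - {i}. if j = i - 1 \<or> j = i + 1 then g j else 1)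
      = prod g {j \<in> {1..n} - {i}. j = i - 1 \<or> j = i + 1}"
    by (rule prod.inter_filter[symmetric]) simp
  also have "{j \<in> {1..n} - {i}. j = i - 1 \<or> j = i + 1} = (if i = 1 then {} else {i - 1}) \<union> {i + 1}"
    using assms by auto
  also have "prod g \<dots> = g (i - 1) * g (i + 1)"
    using assms by (auto simp: prod.insert_if mult.commute)
  finally show ?thesis .
qed

lemma norm_of_real_powr: "0 \<le> r \<Longrightarrow> norm (complex_of_real r powr s) = r powr Re s"
  by (simp add: norm_powr_real_powr)

lemma borel_measurable_of_real_powr:
  assumes "h \<in> borel_measurable M" "\<And>x. x \<in> space M \<Longrightarrow> 0 \<le> h x"
  shows "(\<lambda>x. complex_of_real (h x) powr s) \<in> borel_measurable M"
proof -
  have "(\<lambda>x. if h x = 0 then 0 else exp (s * complex_of_real (ln (h x)))) \<in> borel_measurable M"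
    using assms(1) by measurable
  moreover have "complex_of_real (h x) powr s = (if h x = 0 then 0 else exp (s * complex_of_real (ln (h x))))"
    if "x \<in> space M" for x
    using assms(2)[OF that] by (auto simp: powr_def Ln_of_real)
  ultimately show ?thesis
    by (simp cong: measurable_cong)
qed

context unramified_quadratic_extension
begin

lemma nv_powr:
  assumes "a \<noteq> 0" shows "complex_of_real (nv a) powr s = (of_nat q powr (- s)) powi vl a"
proof -
  have q0: "q > 0" by (rule q_pos)
  have ln: "ln (nv a) = - (real_of_int (vl a) * ln (real q))"
  proof -
    have "nv a = real q powr real_of_int (- vl a)"
      using q0 by (subst powr_real_of_int') (auto simp: nv_eq_powi[OF assms])
    thus ?thesis using q0 by (simp add: ln_powr)
  qed
  have "complex_of_real (nv a) powr s = exp (s * complex_of_real (ln (nv a)))"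
    using assms nv_pos_iff[of a] by (simp add: powr_def Ln_of_real nv_eq_0_iff)
  also have "s * complex_of_real (ln (nv a)) = of_int (vl a) * (- s * complex_of_real (ln (real q)))"
    by (simp add: ln)
  also have "exp \<dots> = (exp (- s * complex_of_real (ln (real q)))) powi vl a"
    by (rule exp_power_int[symmetric])
  also have "exp (- s * complex_of_real (ln (real q))) = of_nat q powr (- s)"
    using q0 by (simp add: powr_def Ln_of_nat)
  finally show ?thesis .
qed

lemma ee_ge:
  assumes "t \<in> herm" "dt t \<noteq> 0" "nm t \<le> real q ^ j" shows "- int j \<le> ee t"
proof (rule ccontr)
  assume "\<not> - int j \<le> ee t"
  hence "int j < - ee t" by simp
  hence "real q powi (int j) < real q powi (- ee t)"
    using q_ge_2 by (intro power_int_strict_increasing) auto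
  thus False using assms lev_exists(2)[OF assms(1,2)] by simp
qed

text \<open>The trivial bound in the strip: it loses a fixed power of the absolute value of the determinant.\<close>
lemma norm_lower_entry_factor_le:
  assumes t: "t \<in> herm" "dt t \<noteq> 0" "nm t \<le> real q ^ a" and s: "-3 < Re s" "Re s < 1"
  defines "T \<equiv> of_nat q powr (- s)"
  shows "norm (T powi ee t * chi (real q) (mm t) (- T / of_nat q))
      \<le> (real q + (real q)\<^sup>2) * real q ^ (7 * a) * nv (dt t) powr (-3)"
proof -
  let ?Q = "real q" and ?e = "real_of_int (ee t)" and ?m = "real (mm t)"
  have Q: "?Q \<ge> 2" using q_ge_2 by simp
  have e: "- real a \<le> ?e"
  proof -
    have "real_of_int (- int a) \<le> real_of_int (ee t)"
      using ee_ge[OF t] by (simp only: of_int_le_iff)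
    thus ?thesis by simp
  qed
  have normT: "norm T = ?Q powr (- Re s)"
    unfolding T_def using norm_of_real_powr[of ?Q "- s"] by simp
  \<comment> \<open>For e >= 0 the bound - Re s <= 3 gives 3 e. For e < 0 the exponent is at most -
    e = 3 e - 4 e, and e >= - a turns this into 3 e + 4 a.\<close>
  have T1: "norm (T powi ee t) \<le> ?Q powr (3 * ?e + 4 * real a)"
  proof -
    have "norm (T powi ee t) = (?Q powr (- Re s)) powi ee t"
      by (simp add: norm_power_int normT)
    also have "\<dots> = (?Q powr (- Re s)) powr ?e"
      using Q by (intro powr_real_of_int'[symmetric]) auto
    also have "\<dots> = ?Q powr (- Re s * ?e)"
      by (simp add: powr_powr)
    also have "\<dots> \<le> ?Q powr (3 * ?e + 4 * real a)"
    proof (rule powr_mono)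
      show "- Re s * ?e \<le> 3 * ?e + 4 * real a"
      proof (cases "?e \<ge> 0")
        case True
        have "- Re s * ?e \<le> 3 * ?e" using s True by (intro mult_right_mono) auto
        thus ?thesis by simp
      next
        case False
        have "Re s * (- ?e) \<le> 1 * (- ?e)" using s False by (intro mult_right_mono) auto
        thus ?thesis using e by simp
      qed
    qed (use Q in auto)
    finally show ?thesis .
  qed
  have "norm (- T / of_nat q) \<le> ?Q\<^sup>2"
  proof -
    have "norm (- T / of_nat q) = ?Q powr (- Re s) / ?Q"
      by (simp add: norm_divide normT)
    also have "\<dots> \<le> ?Q powr 3 / ?Q"
      using s Q by (intro divide_right_mono powr_mono) auto
    also have "\<dots> = ?Q\<^sup>2"
      using Q powr_realpow[of ?Q 3] by (simp add: power3_eq_cube power2_eq_square)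
    finally show ?thesis .
  qed
  hence "norm (chi ?Q (mm t) (- T / of_nat q)) \<le> (?Q + ?Q\<^sup>2) * (?m + 1) * (?Q\<^sup>2) ^ mm t"
    using Q by (intro norm_chi_le) (auto simp: one_le_power)
  also have "\<dots> \<le> (?Q + ?Q\<^sup>2) * ?Q ^ mm t * (?Q\<^sup>2) ^ mm t"
  proof -
    have "mm t + 1 \<le> 2 ^ mm t" by (metis Suc_eq_plus1 Suc_leI less_exp)
    hence "real (mm t + 1) \<le> real (2 ^ mm t)" by (simp only: of_nat_le_iff)
    hence "?m + 1 \<le> 2 ^ mm t" by simp
    also have "\<dots> \<le> ?Q ^ mm t" using Q by (intro power_mono) auto
    finally show ?thesis using Q by (intro mult_right_mono mult_left_mono) auto
  qed
  also have "\<dots> = (?Q + ?Q\<^sup>2) * ?Q powr (3 * ?m)"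
  proof -
    have "?Q ^ mm t * (?Q\<^sup>2) ^ mm t = ?Q ^ (3 * mm t)"
      by (simp add: power_mult[symmetric] power_add[symmetric])
    also have "\<dots> = ?Q powr (3 * ?m)"
      using Q by (simp add: powr_realpow[symmetric])
    finally show ?thesis by simp
  qed
  finally have T2: "norm (chi ?Q (mm t) (- T / of_nat q)) \<le> (?Q + ?Q\<^sup>2) * ?Q powr (3 * ?m)" .
  have "norm (T powi ee t * chi ?Q (mm t) (- T / of_nat q))
      \<le> ?Q powr (3 * ?e + 4 * real a) * ((?Q + ?Q\<^sup>2) * ?Q powr (3 * ?m))"
    unfolding norm_mult using T1 T2 Q by (intro mult_mono) auto
  also have "\<dots> = (?Q + ?Q\<^sup>2) * ?Q powr (3 * ?e + 4 * real a + 3 * ?m)"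
    by (simp add: powr_add mult_ac)
  \<comment> \<open>Completing 3 e + 3 m to three times the determinant valuation 2 e + m costs 3 e,
    which is at least - 3 a; with the 4 a from before this makes 7 a.\<close>
  also have "\<dots> \<le> (?Q + ?Q\<^sup>2) * ?Q powr (7 * real a + 3 * (2 * ?e + ?m))"
    using Q e by (intro mult_left_mono powr_mono) auto
  also have "?Q powr (7 * real a + 3 * (2 * ?e + ?m)) = ?Q ^ (7 * a) * nv (dt t) powr (-3)"
  proof -
    have "nv (dt t) = ?Q powr (- (2 * ?e + ?m))"
    proof -
      have "nv (dt t) = ?Q powi (- vl (dt t))" by (rule nv_eq_powi[OF t(2)])
      also have "\<dots> = ?Q powr (real_of_int (- vl (dt t)))"
        using Q by (intro powr_real_of_int'[symmetric]) auto
      finally show ?thesis by (simp add: lev_exists(3)[OF t(1,2)])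
    qed
    hence "nv (dt t) powr (-3) = ?Q powr (3 * (2 * ?e + ?m))"
      by (simp add: powr_powr algebra_simps)
    moreover have "?Q ^ (7 * a) = ?Q powr (7 * real a)"
      using Q by (simp add: powr_realpow[symmetric])
    ultimately show ?thesis by (simp add: powr_add)
  qed
  finally show ?thesis by (simp add: mult.assoc)
qed

end

text \<open>One adjacent exchange in abstract form: \<open>Dm j\<close> plays the role of d_j, and
  \<open>tr\<close> is the Schur complement multiplied by d_{i-1}. Because of that factor its
  determinant is d_{i-1} d_{i+1} and its lower entry is d_i, with no division; \<open>Dm 0\<close>
  is 1 so that i = 1 is not special.\<close>

locale exchange_family = hermitian_action nv p k prm cj M tr act_u act_w
  for nv :: "'a::field_char_0 \<Rightarrow> real" and p k prm cj and M :: "'b measure" and tr act_u act_w +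
  fixes n i :: nat and Dm :: "nat \<Rightarrow> 'b \<Rightarrow> 'a"
  assumes i: "1 \<le> i" "i < n"
    and Dm_0: "x \<in> space M \<Longrightarrow> Dm 0 x = 1"
    and Dm_meas: "(\<lambda>x. nv (Dm j x)) \<in> borel_measurable M"
    and Dm_bdd: "\<exists>a. \<forall>j\<le>n. \<forall>x\<in>space M. nv (Dm j x) \<le> real q ^ a"
    and nm_bdd: "\<exists>a. \<forall>x\<in>space M. nm (tr x) \<le> real q ^ a"
    and Dm_u: "j \<le> n \<Longrightarrow> j \<noteq> i \<Longrightarrow> nv y \<le> 1 \<Longrightarrow> x \<in> space M \<Longrightarrow> nv (Dm j (act_u y x)) = nv (Dm j x)"
    and Dm_w: "j \<le> n \<Longrightarrow> j \<noteq> i \<Longrightarrow> x \<in> space M \<Longrightarrow> nv (Dm j (act_w x)) = nv (Dm j x)"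
    and dt_Dm: "x \<in> space M \<Longrightarrow> dt (tr x) = Dm (i - 1) x * Dm (i + 1) x"
    and ga_Dm: "x \<in> space M \<Longrightarrow> Dm (i - 1) x \<noteq> 0 \<Longrightarrow> snd (snd (tr x)) = Dm i x"
begin

definition wt :: "(nat \<Rightarrow> complex) \<Rightarrow> 'b \<Rightarrow> complex" where
  "wt s x = (\<Prod>j\<in>{1..n} - {i}. complex_of_real (nv (Dm j x)) powr s j)"

definition full :: "(nat \<Rightarrow> complex) \<Rightarrow> 'b \<Rightarrow> complex" where
  "full s x = (\<Prod>j=1..n. complex_of_real (nv (Dm j x)) powr s j)"

definition Tq :: "complex \<Rightarrow> complex" where "Tq t = of_nat q powr (- t)"

text \<open>The orbit mean of |d_i|^t, stripped of the factor (q - U) / ((q^2 + 1) (1 + U)). Unlike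
  |d_i|^t it is entire in t at every point, which is what makes the continuation explicit.\<close>

definition fac :: "complex \<Rightarrow> 'b \<Rightarrow> complex" where
  "fac t x = (if dt (tr x) \<noteq> 0 then Tq t powi ee (tr x) * chi (real q) (mm (tr x)) (- Tq t / of_nat q) else 0)"

lemma Tq_nonzero: "Tq t \<noteq> 0"
  using q_pos by (simp add: Tq_def)

lemma full_eq: "full s x = wt s x * complex_of_real (nv (Dm i x)) powr s i"
  unfolding full_def wt_def using i by (subst prod.remove[of _ i]) (auto simp: mult.commute)

lemma wt_meas: "wt s \<in> borel_measurable M"
  unfolding wt_def[abs_def] using Dm_meas nv_nonneg
  by (intro borel_measurable_prod borel_measurable_of_real_powr) auto

lemma full_meas: "full s \<in> borel_measurable M"
  unfolding full_def[abs_def] using Dm_meas nv_nonneg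
  by (intro borel_measurable_prod borel_measurable_of_real_powr) auto

text \<open>The function factors through the countable set of invariants (e, m), with
  \<open>None\<close> for degenerate forms, so it suffices that each class is measurable.\<close>

lemma fac_meas: "fac t \<in> borel_measurable M"
proof -
  define g where "g x = (if dt (tr x) \<noteq> 0 then Some (ee (tr x), mm (tr x)) else None)" for x
  have "g \<in> measurable M (count_space UNIV)"
    unfolding measurable_count_space_eq_countable[OF countableI_type]
  proof (intro conjI ballI)
    fix a :: "(int \<times> nat) option"
    show "g -` {a} \<inter> space M \<in> sets M"
    proof (cases a)
      case None
      have "g -` {None} \<inter> space M = {x \<in> space M. nv (dt (tr x)) = 0}"
        by (auto simp: g_def nv_eq_0_iff split: if_splits)
      thus ?thesis using None dt_meas by simp
    next
      case (Some b)
      obtain e m where b: "b = (e, m)" by (cases b)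
      have "g -` {Some (e, m)} \<inter> space M = Lv e m 0"
      proof (intro equalityI subsetI)
        fix x assume "x \<in> g -` {Some (e, m)} \<inter> space M"
        hence "x \<in> space M" "dt (tr x) \<noteq> 0" "ee (tr x) = e" "mm (tr x) = m"
          by (auto simp: g_def split: if_splits)
        thus "x \<in> Lv e m 0" using lev_exists(1)[OF tr_herm, of x] by (auto simp: Lv_def)
      next
        fix x assume "x \<in> Lv e m 0"
        thus "x \<in> g -` {Some (e, m)} \<inter> space M"
          using lev_ee_mm[of "tr x" e m 0] by (simp add: Lv_def g_def)
      qed
      thus ?thesis using Some b Lv_sets by simp
    qed
  qed simp
  hence "(\<lambda>x. (\<lambda>y. case y of None \<Rightarrow> 0 | Some (e, m) \<Rightarrow> Tq t powi e * chi (real q) m (- Tq t / of_nat q)) (g x))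
      \<in> borel_measurable M"
    by (rule measurable_compose) simp
  moreover have "(\<lambda>x. (\<lambda>y. case y of None \<Rightarrow> 0 | Some (e, m) \<Rightarrow> Tq t powi e * chi (real q) m (- Tq t / of_nat q)) (g x)) = fac t"
    by (auto simp: fac_def g_def fun_eq_iff)
  ultimately show ?thesis by simp
qed

text \<open>The loss of |dt|^(-3) is |d_{i-1}|^(-3) |d_{i+1}|^(-3), and the exponents of these two
  minors are at least 3, so nonnegative powers of bounded quantities remain. The bound is uniform in
  t on the strip, as \<open>holomorphic_integral\<close> needs.\<close>

lemma wt_fac_bounded:
  assumes "\<And>j. j \<in> {1..n} - {i} \<Longrightarrow> 3 \<le> Re (s j)"
  obtains B where "\<And>t x. -3 < Re t \<Longrightarrow> Re t < 1 \<Longrightarrow> x \<in> space M \<Longrightarrow> norm (wt s x * fac t x) \<le> B"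
proof -
  obtain a where a: "\<And>x. x \<in> space M \<Longrightarrow> nm (tr x) \<le> real q ^ a" using nm_bdd by blast
  obtain c where c: "\<And>j x. j \<le> n \<Longrightarrow> x \<in> space M \<Longrightarrow> nv (Dm j x) \<le> real q ^ c" using Dm_bdd by blast
  define \<kappa> where "\<kappa> j = (if j = i - 1 \<or> j = i + 1 then -3 else 0 :: real)" for j
  define K where "K = (real q + (real q)\<^sup>2) * real q ^ (7 * a)"
  define B where "B = K * (\<Prod>j\<in>{1..n} - {i}. (real q ^ c) powr (Re (s j) + \<kappa> j))"
  have K: "K \<ge> 0" by (simp add: K_def)
  have B0: "B \<ge> 0" unfolding B_def using K by (intro mult_nonneg_nonneg prod_nonneg) auto
  have "norm (wt s x * fac t x) \<le> B" if t: "-3 < Re t" "Re t < 1" and x: "x \<in> space M" for t x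
  proof (cases "dt (tr x) = 0 \<or> wt s x = 0")
    case True
    thus ?thesis using B0 by (auto simp: fac_def)
  next
    case False
    have Dnz: "Dm j x \<noteq> 0" if "j \<in> {1..n} - {i}" for j
      using False that nv_eq_0_iff by (auto simp: wt_def)
    have "norm (fac t x) \<le> K * nv (dt (tr x)) powr (-3)"
      using norm_lower_entry_factor_le[OF tr_herm[OF x] _ a[OF x] t] False
      by (simp add: fac_def K_def Tq_def)
    moreover have "norm (wt s x) = (\<Prod>j\<in>{1..n} - {i}. nv (Dm j x) powr Re (s j))"
      by (simp add: wt_def prod_norm[symmetric] norm_of_real_powr nv_nonneg)
    ultimately have "norm (wt s x * fac t x)
        \<le> (\<Prod>j\<in>{1..n} - {i}. nv (Dm j x) powr Re (s j)) * (K * nv (dt (tr x)) powr (-3))"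
      unfolding norm_mult by (intro mult_mono) (auto intro!: prod_nonneg)
    also have "nv (dt (tr x)) powr (-3) = (\<Prod>j\<in>{1..n} - {i}. nv (Dm j x) powr \<kappa> j)"
    proof -
      have "(\<Prod>j\<in>{1..n} - {i}. nv (Dm j x) powr \<kappa> j)
          = (\<Prod>j\<in>{1..n} - {i}. if j = i - 1 \<or> j = i + 1 then nv (Dm j x) powr (-3) else 1)"
        using Dnz by (intro prod.cong) (auto simp: \<kappa>_def nv_eq_0_iff)
      also have "\<dots> = nv (Dm (i - 1) x) powr (-3) * nv (Dm (i + 1) x) powr (-3)"
        by (rule prod_neighbours[OF i]) (simp add: Dm_0[OF x])
      also have "\<dots> = nv (dt (tr x)) powr (-3)"
        by (simp add: dt_Dm[OF x] nv_mult powr_mult nv_nonneg)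
      finally show ?thesis ..
    qed
    also have "(\<Prod>j\<in>{1..n} - {i}. nv (Dm j x) powr Re (s j)) * (K * (\<Prod>j\<in>{1..n} - {i}. nv (Dm j x) powr \<kappa> j))
        = K * (\<Prod>j\<in>{1..n} - {i}. nv (Dm j x) powr (Re (s j) + \<kappa> j))"
      by (simp add: powr_add prod.distrib)
    also have "\<dots> \<le> B"
      unfolding B_def
    proof (intro mult_left_mono prod_mono conjI K)
      fix j assume j: "j \<in> {1..n} - {i}"
      show "nv (Dm j x) powr (Re (s j) + \<kappa> j) \<le> (real q ^ c) powr (Re (s j) + \<kappa> j)"
        using c[of j x] x j assms[OF j] nv_nonneg by (intro powr_mono2) (auto simp: \<kappa>_def)
    qed auto
    finally show ?thesis .
  qed
  thus ?thesis using that by blast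
qed

lemma prod_powr_bounded:
  assumes "J \<subseteq> {1..n}" "\<And>j. j \<in> J \<Longrightarrow> 0 \<le> Re (s j)"
  obtains B where "\<And>x. x \<in> space M \<Longrightarrow> norm (\<Prod>j\<in>J. complex_of_real (nv (Dm j x)) powr s j) \<le> B"
proof -
  obtain c where c: "\<And>j x. j \<le> n \<Longrightarrow> x \<in> space M \<Longrightarrow> nv (Dm j x) \<le> real q ^ c" using Dm_bdd by blast
  have "norm (\<Prod>j\<in>J. complex_of_real (nv (Dm j x)) powr s j) \<le> (\<Prod>j\<in>J. (real q ^ c) powr Re (s j))"
    if x: "x \<in> space M" for x
    unfolding prod_norm[symmetric]
    using assms c x nv_nonneg by (intro prod_mono) (auto simp: norm_of_real_powr intro!: powr_mono2)
  thus ?thesis using that by blast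
qed

lemma wt_integrable:
  assumes "\<And>j. j \<in> {1..n} - {i} \<Longrightarrow> 0 \<le> Re (s j)" shows "integrable M (wt s)"
proof -
  obtain B where "\<And>x. x \<in> space M \<Longrightarrow> norm (wt s x) \<le> B"
    unfolding wt_def using prod_powr_bounded[of "{1..n} - {i}" s] assms by blast
  thus ?thesis by (intro integrable_const_bound[of _ B]) (auto simp: wt_meas)
qed

lemma full_integrable:
  assumes "\<And>j. j \<in> {1..n} \<Longrightarrow> 0 \<le> Re (s j)" shows "integrable M (full s)"
proof -
  obtain B where "\<And>x. x \<in> space M \<Longrightarrow> norm (full s x) \<le> B"
    unfolding full_def using prod_powr_bounded[of "{1..n}" s] assms by blast
  thus ?thesis by (intro integrable_const_bound[of _ B]) (auto simp: full_meas)
qed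

lemma wt_zero_imp:
  assumes "x \<in> space M" "dt (tr x) = 0" shows "wt s x = 0"
proof -
  have "Dm (i - 1) x = 0 \<or> Dm (i + 1) x = 0"
    using assms by (simp add: dt_Dm)
  moreover have "i - 1 \<noteq> 0" if "Dm (i - 1) x = 0"
    using that Dm_0[OF assms(1)] by (metis zero_neq_one)
  ultimately have "\<exists>j\<in>{1..n} - {i}. Dm j x = 0"
  proof (cases "Dm (i - 1) x = 0")
    case True
    with \<open>Dm (i - 1) x = 0 \<Longrightarrow> i - 1 \<noteq> 0\<close> i show ?thesis by (intro bexI[of _ "i - 1"]) auto
  next
    case False
    with \<open>Dm (i - 1) x = 0 \<or> Dm (i + 1) x = 0\<close> i show ?thesis by (intro bexI[of _ "i + 1"]) auto
  qed
  then obtain j where "j \<in> {1..n} - {i}" "Dm j x = 0" by blast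
  thus ?thesis by (auto simp: wt_def intro!: prod_zero bexI[of _ j])
qed

text \<open>Positive real part of s_i gives |T| < 1, so the generating function converges; Re s_i <
  1 keeps the averaged integrand within its bounded strip. The overlap is nonempty, which is all
  that the continuation uses.\<close>

lemma integral_full_eq:
  assumes s: "\<And>j. j \<in> {1..n} - {i} \<Longrightarrow> 3 \<le> Re (s j)" and si: "0 < Re (s i)" "Re (s i) < 1"
  defines "U \<equiv> - Tq (s i) / of_nat q"
  shows "((of_nat q)\<^sup>2 + 1) * (1 + U) * integral\<^sup>L M (full s) = (of_nat q - U) * (LINT x|M. wt s x * fac (s i) x)"
proof -
  let ?T = "Tq (s i)"
  define F where "F = (\<lambda>x. if dt (tr x) \<noteq> 0 \<and> snd (snd (tr x)) \<noteq> 0 then wt s x * ?T powi vl (snd (snd (tr x))) else 0)"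
  define G where "G = (\<lambda>x. if dt (tr x) \<noteq> 0 then wt s x * (?T powi ee (tr x) * chi (real q) (mm (tr x)) U) else 0)"
  have s0: "0 \<le> Re (s j)" if "j \<in> {1..n} - {i}" for j using s[OF that] by simp
  have full_F: "full s x = F x" if x: "x \<in> space M" for x
  proof (cases "dt (tr x) = 0")
    case True
    thus ?thesis using wt_zero_imp[OF x True] by (simp add: full_eq F_def)
  next
    case False
    hence "snd (snd (tr x)) = Dm i x"
      using ga_Dm[OF x] dt_Dm[OF x] by auto
    thus ?thesis
      using False nv_powr[of "Dm i x" "s i"] by (auto simp: full_eq F_def Tq_def)
  qed
  have G_eq: "G = (\<lambda>x. wt s x * fac (s i) x)"
    by (auto simp: G_def fac_def U_def fun_eq_iff)
  obtain B where B: "\<And>t x. -3 < Re t \<Longrightarrow> Re t < 1 \<Longrightarrow> x \<in> space M \<Longrightarrow> norm (wt s x * fac t x) \<le> B"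
    using wt_fac_bounded[of s] s by blast
  have G_int: "integrable M G"
    unfolding G_eq using B si by (intro integrable_const_bound[of _ B]) (auto intro!: borel_measurable_times wt_meas fac_meas)
  have full_int: "integrable M (full s)"
  proof (rule full_integrable)
    show "0 \<le> Re (s j)" if "j \<in> {1..n}" for j
      using s0[of j] si that by (cases "j = i") auto
  qed
  hence F_int: "integrable M F"
    using full_F by (simp cong: Bochner_Integration.integrable_cong)
  have "norm ?T < 1"
  proof -
    have "norm ?T = real q powr (- Re (s i))"
      unfolding Tq_def using norm_of_real_powr[of "real q" "- s i"] by simp
    also have "\<dots> < real q powr 0"
      using q_ge_2 si by (intro powr_less_mono) auto
    finally show ?thesis using q_pos by simp
  qed
  have inv_u: "wt s (act_u y x) = wt s x" if "nv y \<le> 1" "x \<in> space M" for y x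
    unfolding wt_def using Dm_u that by (intro prod.cong) auto
  have inv_w: "wt s (act_w x) = wt s x" if "x \<in> space M" for x
    unfolding wt_def using Dm_w that by (intro prod.cong) auto
  have "((of_nat q)\<^sup>2 + 1) * (1 + U) * integral\<^sup>L M F = (of_nat q - U) * integral\<^sup>L M G"
    unfolding F_def G_def U_def
    by (rule integral_lower_entry[OF Tq_nonzero \<open>norm ?T < 1\<close> wt_integrable[OF s0] inv_u inv_w
          F_int[unfolded F_def] G_int[unfolded G_def U_def]])
  moreover have "integral\<^sup>L M F = integral\<^sup>L M (full s)"
    by (intro Bochner_Integration.integral_cong refl full_F[symmetric])
  ultimately show ?thesis by (simp add: G_eq)
qed

lemma Tq_holomorphic [holomorphic_intros]: "Tq holomorphic_on S"
proof -
  have "Tq = (\<lambda>t. exp (- t * complex_of_real (ln (real q))))"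
    using q_pos by (auto simp: Tq_def powr_def Ln_of_nat)
  thus ?thesis by (auto intro!: holomorphic_intros)
qed

lemma fac_holomorphic: "(\<lambda>t. fac t x) holomorphic_on S"
proof (cases "dt (tr x) = 0")
  case False
  have "(\<lambda>t. Tq t powi ee (tr x) * chi (real q) (mm (tr x)) (- Tq t / of_nat q)) holomorphic_on S"
    unfolding chi_def using Tq_nonzero q_pos by (intro holomorphic_intros) auto
  thus ?thesis using False by (simp add: fac_def)
qed (simp add: fac_def)

text \<open>With the other exponents fixed, both sides are holomorphic in s_i on the connected strip
  from -3 to 1 and agree on the part where the original integral converges.\<close>

lemma continuation:
  assumes rc: "rational_continuation q n (\<lambda>s. integral\<^sup>L M (full s)) P Q"
    and s: "\<And>j. j \<in> {1..n} - {i} \<Longrightarrow> 3 \<le> Re (s j)" and si: "-3 < Re (s i)" "Re (s i) < 1"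
    and nz: "Q (q_power q s) \<noteq> 0"
  defines "U \<equiv> - Tq (s i) / of_nat q"
  shows "((of_nat q)\<^sup>2 + 1) * (1 + U) * P (q_power q s)
       = (of_nat q - U) * (LINT x|M. wt s x * fac (s i) x) * Q (q_power q s)"
proof -
  define st where "st t = s(i := t)" for t
  define S where "S = {t :: complex. -3 < Re t \<and> Re t < 1}"
  define E where "E t = (LINT x|M. wt s x * fac t x)" for t
  define pp where "pp t = P (q_power q (st t))" for t
  define qq where "qq t = Q (q_power q (st t))" for t
  define V where "V t = - Tq t / of_nat q" for t
  \<comment> \<open>The additional factor \<open>qq t\<close> makes the difference vanish also at
    zeros of the denominator, where the fraction says nothing about the integral.\<close>
  define H where "H t = (((of_nat q)\<^sup>2 + 1) * (1 + V t) * pp t - (of_nat q - V t) * E t * qq t) * qq t" for t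
  have S: "S = {t. Re t < 1} \<inter> {t. -3 < Re t}" by (auto simp: S_def)
  have openS: "open S" unfolding S by (intro open_Int open_halfspace_Re_lt open_halfspace_Re_gt)
  have "convex S" unfolding S by (intro convex_Int convex_halfspace_Re_lt convex_halfspace_Re_gt)
  hence connS: "connected S" by (rule convex_connected)
  have poly: "polynomial_fun n P" "polynomial_fun n Q"
    using rc by (auto simp: rational_continuation_def)
  have line: "st t = (\<lambda>j. (s(i := 0)) j + t * (if j = i then 1 else 0))" for t
    by (auto simp: st_def)
  have hol_pq: "pp holomorphic_on S" "qq holomorphic_on S"
    unfolding pp_def[abs_def] qq_def[abs_def] line
    using holomorphic_on_subset[OF line_entireD[OF polynomial_fun_q_power_line_entire[OF poly(1) q_pos]] subset_UNIV]
      holomorphic_on_subset[OF line_entireD[OF polynomial_fun_q_power_line_entire[OF poly(2) q_pos]] subset_UNIV]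
    by simp_all
  obtain B where B: "\<And>t x. -3 < Re t \<Longrightarrow> Re t < 1 \<Longrightarrow> x \<in> space M \<Longrightarrow> norm (wt s x * fac t x) \<le> B"
    using wt_fac_bounded[of s] s by blast
  have hol_E: "E holomorphic_on S"
    unfolding E_def[abs_def]
  proof (rule holomorphic_integral[OF finite_measure_axioms openS])
    show "(\<lambda>t. wt s x * fac t x) holomorphic_on S" for x
      by (intro holomorphic_intros fac_holomorphic)
    show "norm (wt s x * fac t x) \<le> B" if "t \<in> S" "x \<in> space M" for t x
      using B that by (simp add: S_def)
  qed (intro borel_measurable_times wt_meas fac_meas)
  have wt_st: "wt (st t) = wt s" for t
    by (auto simp: wt_def st_def fun_eq_iff intro!: prod.cong)
  have H0: "H t = 0" if t: "0 < Re t" "Re t < 1" for t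
  proof (cases "qq t = 0")
    case False
    have "\<forall>j\<in>{1..n}. 0 \<le> Re (st t j)"
    proof
      fix j assume "j \<in> {1..n}"
      thus "0 \<le> Re (st t j)" using s[of j] t by (cases "j = i") (auto simp: st_def)
    qed
    hence "integral\<^sup>L M (full (st t)) = pp t / qq t"
      using rc False by (simp add: rational_continuation_def pp_def qq_def)
    hence pp: "pp t = integral\<^sup>L M (full (st t)) * qq t"
      using False by simp
    have "((of_nat q)\<^sup>2 + 1) * (1 + V t) * integral\<^sup>L M (full (st t)) = (of_nat q - V t) * E t"
      using integral_full_eq[of "st t"] s t unfolding wt_st by (simp add: st_def V_def E_def)
    hence "(((of_nat q)\<^sup>2 + 1) * (1 + V t) * integral\<^sup>L M (full (st t)) - (of_nat q - V t) * E t) * qq t = 0"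
      by simp
    thus ?thesis
      unfolding H_def pp by (simp only: left_diff_distrib mult.assoc mult_zero_left)
  qed (simp add: H_def)
  have "H (s i) = 0"
  proof (rule analytic_continuation_open[of "{t. 0 < Re t} \<inter> {t. Re t < 1}" S H "\<lambda>_. 0"])
    show "open ({t. 0 < Re t} \<inter> {t. Re t < 1})"
      by (intro open_Int open_halfspace_Re_lt open_halfspace_Re_gt)
    have "complex_of_real (1 / 2) \<in> {t. 0 < Re t} \<inter> {t. Re t < 1}" by simp
    thus "{t. 0 < Re t} \<inter> {t. Re t < 1} \<noteq> {}" by blast
    show "H holomorphic_on S"
      unfolding H_def[abs_def] V_def using q_pos by (intro holomorphic_intros hol_pq hol_E) auto
  qed (use openS connS H0 si in \<open>auto simp: S_def\<close>)
  moreover have "st (s i) = s" by (simp add: st_def)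
  ultimately show ?thesis
    using nz by (simp add: H_def pp_def qq_def E_def V_def U_def)
qed

text \<open>Apart from s_i itself, z_i and z_{i+1} occur only in s_{i-1} and s_{i+1}, and both lose
  the same amount. The weight is therefore multiplied by a power of |d_{i-1} d_{i+1}|, the size of
  the determinant.\<close>

lemma s_of_z_swap:
  assumes "j \<in> {1..n} - {i}"
  shows "s_of_z q n (z \<circ> Transposition.transpose i (Suc i)) j
    = s_of_z q n z j - (if j = i - 1 \<or> j = i + 1 then z i - z (Suc i) else 0)"
proof -
  consider "j + 1 < i" | "j + 1 = i" | "j = i + 1" "j < n" | "j = i + 1" "n = i + 1" | "j > i + 1"
    using assms by fastforce
  thus ?thesis
    using assms i by cases (auto simp: s_of_z_def Transposition.transpose_def algebra_simps)
qed

text \<open>In s_i the shift by -1 contributes a factor q to T and the term pi i / log q a sign, so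
  T = - q U. This is why the generating function was taken at U = - T / q.\<close>

lemma Tq_s_of_z: "- Tq (s_of_z q n z i) / of_nat q = of_nat q powr (z i - z (Suc i))"
proof -
  have ln: "ln (real q) \<noteq> 0" using q_ge_2 by simp
  have q0: "q > 0" by (rule q_pos)
  have "- s_of_z q n z i * complex_of_real (ln (real q))
      = (z i - z (Suc i)) * complex_of_real (ln (real q)) + complex_of_real (ln (real q)) - complex_of_real pi * \<i>"
    using i ln by (simp add: s_of_z_def algebra_simps)
  hence "Tq (s_of_z q n z i) = exp ((z i - z (Suc i)) * complex_of_real (ln (real q)) + complex_of_real (ln (real q)) - complex_of_real pi * \<i>)"
    using q0 by (simp add: Tq_def powr_def Ln_of_nat)
  also have "\<dots> = - (exp ((z i - z (Suc i)) * complex_of_real (ln (real q))) * of_nat q)"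
    using q0 by (simp add: exp_add exp_diff exp_of_real)
  also have "exp ((z i - z (Suc i)) * complex_of_real (ln (real q))) = of_nat q powr (z i - z (Suc i))"
    using q0 by (simp add: powr_def Ln_of_nat)
  finally show ?thesis using q0 by simp
qed

text \<open>The change of the neighbouring exponents multiplies the weight by U^(2 e + m). Passing
  from T = - q U to T' = - q / U costs U^(2 e), and the palindromic \<open>chi\<close> costs U^m, so
  the integrand is unchanged at every point.\<close>

lemma wt_fac_swap:
  fixes z :: "nat \<Rightarrow> complex"
  assumes x: "x \<in> space M"
  defines "z' \<equiv> z \<circ> Transposition.transpose i (Suc i)"
  shows "wt (s_of_z q n z') x * fac (s_of_z q n z' i) x = wt (s_of_z q n z) x * fac (s_of_z q n z i) x"
proof (cases "dt (tr x) = 0")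
  case False
  define u where "u = z i - z (Suc i)"
  define U where "U = (of_nat q powr u :: complex)"
  let ?t = "tr x"
  have q0: "of_nat q \<noteq> (0::complex)" using q_pos by simp
  have U0: "U \<noteq> 0" using q_pos by (simp add: U_def)
  have T: "Tq (s_of_z q n z i) = - of_nat q * U"
    using arg_cong[OF Tq_s_of_z[of z], of "\<lambda>v. - of_nat q * v"] q0 by (simp add: U_def u_def)
  have T': "Tq (s_of_z q n z' i) = - of_nat q / U"
  proof -
    have "- Tq (s_of_z q n z' i) / of_nat q = of_nat q powr (- u)"
      using Tq_s_of_z[of z'] by (simp add: z'_def u_def)
    also have "\<dots> = 1 / U" by (simp add: U_def powr_minus_divide)
    finally have "- Tq (s_of_z q n z' i) / of_nat q = 1 / U" .
    from arg_cong[OF this, of "\<lambda>v. - of_nat q * v"] show ?thesis using q0 by simp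
  qed
  have "wt (s_of_z q n z') x = (\<Prod>j\<in>{1..n} - {i}. complex_of_real (nv (Dm j x)) powr s_of_z q n z j *
      (if j = i - 1 \<or> j = i + 1 then complex_of_real (nv (Dm j x)) powr (- u) else 1))"
    unfolding wt_def
  proof (intro prod.cong refl)
    fix j assume j: "j \<in> {1..n} - {i}"
    show "complex_of_real (nv (Dm j x)) powr s_of_z q n z' j = complex_of_real (nv (Dm j x)) powr s_of_z q n z j *
      (if j = i - 1 \<or> j = i + 1 then complex_of_real (nv (Dm j x)) powr (- u) else 1)"
      unfolding z'_def s_of_z_swap[OF j] u_def by (auto simp: powr_add[symmetric] algebra_simps)
  qed
  also have "\<dots> = wt (s_of_z q n z) x * (complex_of_real (nv (Dm (i - 1) x)) powr (- u) * complex_of_real (nv (Dm (i + 1) x)) powr (- u))"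
    unfolding prod.distrib wt_def using Dm_0[OF x] by (subst prod_neighbours[OF i]) auto
  also have "complex_of_real (nv (Dm (i - 1) x)) powr (- u) * complex_of_real (nv (Dm (i + 1) x)) powr (- u)
      = complex_of_real (nv (dt ?t)) powr (- u)"
    using nv_nonneg by (simp add: dt_Dm[OF x] nv_mult powr_times_real)
  also have "\<dots> = U powi vl (dt ?t)"
    using nv_powr[OF False, of "- u"] by (simp add: U_def)
  also have "vl (dt ?t) = 2 * ee ?t + int (mm ?t)"
    using lev_exists(3)[OF tr_herm[OF x] False] .
  finally have wt': "wt (s_of_z q n z') x = wt (s_of_z q n z) x * U powi (2 * ee ?t + int (mm ?t))" .
  have "U powi (2 * ee ?t + int (mm ?t)) * ((- of_nat q / U) powi ee ?t * chi (real q) (mm ?t) (1 / U))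
      = ((- of_nat q * U) powi ee ?t) * (U ^ mm ?t * chi (real q) (mm ?t) (1 / U))"
  proof -
    have "U powi (2 * ee ?t + int (mm ?t)) = U powi ee ?t * U powi ee ?t * U ^ mm ?t"
    proof -
      have "2 * ee ?t + int (mm ?t) = ee ?t + ee ?t + int (mm ?t)" by simp
      thus ?thesis by (simp only: power_int_add[OF disjI1[OF U0]] power_int_of_nat)
    qed
    moreover have "(- of_nat q / U) powi ee ?t = (- of_nat q) powi ee ?t / U powi ee ?t"
      by (rule power_int_divide_distrib)
    moreover have "(- of_nat q * U) powi ee ?t = (- of_nat q) powi ee ?t * U powi ee ?t"
      by (rule power_int_mult_distrib)
    ultimately show ?thesis using U0 by simp
  qed
  also have "U ^ mm ?t * chi (real q) (mm ?t) (1 / U) = chi (real q) (mm ?t) U"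
    by (rule chi_reflect[OF U0])
  finally show ?thesis
    using False q0 unfolding fac_def T T' wt' by (simp add: mult.assoc)
qed (simp add: fac_def)

text \<open>Within the region Re s_i lies between -2 and 0 both before and after the exchange,
  inside the strip of \<open>continuation\<close>. The two instances involve the same integral
  \<open>E\<close>, and eliminating it leaves the relation between the fractions.\<close>

theorem exchange:
  assumes rc: "rational_continuation q n (\<lambda>s. integral\<^sup>L M (full s)) P Q"
    and z: "z \<in> exchange_region q n i"
  shows "let U = of_nat q powr (z i - z (Suc i)); \<tau> = Transposition.transpose i (Suc i);
           p = (\<lambda>z. P (q_power q (s_of_z q n z))); r = (\<lambda>z. Q (q_power q (s_of_z q n z)))
       in r z \<noteq> 0 \<longrightarrow> r (z \<circ> \<tau>) \<noteq> 0 \<longrightarrow>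
          (1 + U) * (of_nat q - 1 / U) * p z * r (z \<circ> \<tau>) = (1 + 1 / U) * (of_nat q - U) * p (z \<circ> \<tau>) * r z"
proof -
  define \<tau> where "\<tau> = Transposition.transpose i (Suc i)"
  define U where "U = (of_nat q powr (z i - z (Suc i)) :: complex)"
  define E where "E = (LINT x|M. wt (s_of_z q n z) x * fac (s_of_z q n z i) x)"
  let ?p = "\<lambda>z. P (q_power q (s_of_z q n z))" and ?r = "\<lambda>z. Q (q_power q (s_of_z q n z))"
  let ?c = "(of_nat q)\<^sup>2 + 1 :: complex"
  have c0: "?c \<noteq> 0" using of_real_square_plus_1_nonzero[of "real q"] by simp
  have reg: "\<bar>Re (z i) - Re (z (Suc i))\<bar> < 1" "\<And>j. j \<in> {1..n} - {i} \<Longrightarrow> 5 < Re (s_of_z q n z j)"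
    using z by (auto simp: exchange_region_def)
  have E': "(LINT x|M. wt (s_of_z q n (z \<circ> \<tau>)) x * fac (s_of_z q n (z \<circ> \<tau>) i) x) = E"
    unfolding E_def \<tau>_def by (intro Bochner_Integration.integral_cong refl wt_fac_swap)
  have "(1 + U) * (of_nat q - 1 / U) * ?p z * ?r (z \<circ> \<tau>) = (1 + 1 / U) * (of_nat q - U) * ?p (z \<circ> \<tau>) * ?r z"
    if nz: "?r z \<noteq> 0" "?r (z \<circ> \<tau>) \<noteq> 0"
  proof -
    have 1: "?c * (1 + U) * ?p z = (of_nat q - U) * E * ?r z"
      unfolding E_def U_def Tq_s_of_z[symmetric]
    proof (rule continuation[OF rc _ _ _ nz(1)])
      show "3 \<le> Re (s_of_z q n z j)" if "j \<in> {1..n} - {i}" for j using reg(2)[OF that] by simp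
    qed (use reg(1) i in \<open>auto simp: Re_s_of_z\<close>)
    have U': "- Tq (s_of_z q n (z \<circ> \<tau>) i) / of_nat q = 1 / U"
      unfolding Tq_s_of_z by (simp add: \<tau>_def U_def powr_minus_divide[symmetric])
    have 2: "?c * (1 + 1 / U) * ?p (z \<circ> \<tau>) = (of_nat q - 1 / U) * E * ?r (z \<circ> \<tau>)"
      unfolding E'[symmetric] U'[symmetric]
    proof (rule continuation[OF rc _ _ _ nz(2)])
      show "3 \<le> Re (s_of_z q n (z \<circ> \<tau>) j)" if "j \<in> {1..n} - {i}" for j
        unfolding \<tau>_def s_of_z_swap[OF that] using reg(2)[OF that] reg(1) by auto
    qed (use reg(1) i in \<open>auto simp: Re_s_of_z \<tau>_def\<close>)
    have "?c * ((1 + U) * (of_nat q - 1 / U) * ?p z * ?r (z \<circ> \<tau>)) = (?c * (1 + U) * ?p z) * ((of_nat q - 1 / U) * ?r (z \<circ> \<tau>))"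
      by (simp add: mult_ac)
    also have "\<dots> = ((of_nat q - 1 / U) * E * ?r (z \<circ> \<tau>)) * ((of_nat q - U) * ?r z)"
      unfolding 1 by (simp add: mult_ac)
    also have "\<dots> = ?c * ((1 + 1 / U) * (of_nat q - U) * ?p (z \<circ> \<tau>) * ?r z)"
      unfolding 2[symmetric] by (simp add: mult_ac)
    finally show ?thesis using c0 by (simp only: mult_cancel_left simp_thms)
  qed
  thus ?thesis by (simp add: Let_def U_def \<tau>_def)
qed

end

section \<open>Schur complements\<close>

lemma mult_mat_entry:
  assumes "A \<in> carrier_mat m l" "B \<in> carrier_mat l r" "a < m" "b < r"
  shows "(A * B) $$ (a, b) = (\<Sum>c<l. A $$ (a, c) * B $$ (c, b))"
  using assms by (auto simp: scalar_prod_def atLeast0LessThan intro!: sum.cong)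

lemma det_2x2:
  fixes A :: "'a::comm_ring_1 mat"
  assumes "A \<in> carrier_mat 2 2"
  shows "Determinant.det A = A $$ (0, 0) * A $$ (1, 1) - A $$ (0, 1) * A $$ (1, 0)"
proof -
  have d: "Determinant.det (mat_delete A 0 0) = A $$ (1, 1)" "Determinant.det (mat_delete A 1 0) = A $$ (0, 1)"
    using assms by (subst det_single; auto simp: mat_delete_def)+
  have "Determinant.det A = (\<Sum>r<2. A $$ (r, 0) * cofactor A r 0)"
    using laplace_expansion_column[OF assms, of 0] by simp
  also have "\<dots> = A $$ (0, 0) * A $$ (1, 1) - A $$ (0, 1) * A $$ (1, 0)"
    using d by (simp add: numeral_2_eq_2 cofactor_def algebra_simps)
  finally show ?thesis .
qed

text \<open>Schur complement without division: the right factor clears the block below the corner.\<close>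
lemma det_four_block_adj:
  fixes A :: "'a::idom mat"
  assumes A: "A \<in> carrier_mat e e" and B: "B \<in> carrier_mat e f" and C: "C \<in> carrier_mat f e"
    and Z: "Z \<in> carrier_mat f f"
  shows "Determinant.det (four_block_mat A B C Z) * Determinant.det Z ^ e
       = Determinant.det (Determinant.det Z \<cdot>\<^sub>m A - B * (adj_mat Z * C)) * Determinant.det Z"
proof -
  let ?d = "Determinant.det Z" and ?W = "adj_mat Z * C"
  have adj: "adj_mat Z \<in> carrier_mat f f" "Z * adj_mat Z = ?d \<cdot>\<^sub>m 1\<^sub>m f"
    using adj_mat[OF Z] by auto
  have W: "?W \<in> carrier_mat f e" using adj C by simp
  let ?R = "four_block_mat (?d \<cdot>\<^sub>m 1\<^sub>m e) (0\<^sub>m e f) (- ?W) (1\<^sub>m f)"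
  have "four_block_mat A B C Z * ?R
      = four_block_mat (A * (?d \<cdot>\<^sub>m 1\<^sub>m e) + B * (- ?W)) (A * 0\<^sub>m e f + B * 1\<^sub>m f)
          (C * (?d \<cdot>\<^sub>m 1\<^sub>m e) + Z * (- ?W)) (C * 0\<^sub>m e f + Z * 1\<^sub>m f)"
    by (rule mult_four_block_mat[OF A B C Z]) (use W in auto)
  also have "A * (?d \<cdot>\<^sub>m 1\<^sub>m e) + B * (- ?W) = ?d \<cdot>\<^sub>m A - B * ?W"
  proof -
    have "A * (?d \<cdot>\<^sub>m 1\<^sub>m e) = ?d \<cdot>\<^sub>m A"
      using mult_smult_distrib[OF A, of "1\<^sub>m e" e ?d] A by simp
    moreover have "B * (- ?W) = - (B * ?W)"
      by (rule uminus_mult_right_mat) (use B W in auto)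
    ultimately show ?thesis using A B W by (auto simp: minus_add_uminus_mat)
  qed
  also have "A * 0\<^sub>m e f + B * 1\<^sub>m f = B" using A B by simp
  also have "C * (?d \<cdot>\<^sub>m 1\<^sub>m e) + Z * (- ?W) = 0\<^sub>m f e"
  proof -
    have "C * (?d \<cdot>\<^sub>m 1\<^sub>m e) = ?d \<cdot>\<^sub>m C"
      using mult_smult_distrib[OF C, of "1\<^sub>m e" e ?d] C by simp
    moreover have "Z * (- ?W) = - (Z * ?W)"
      by (rule uminus_mult_right_mat) (use Z W in auto)
    moreover have "Z * ?W = ?d \<cdot>\<^sub>m C"
      using assoc_mult_mat[OF Z adj(1) C] adj(2) C mult_smult_assoc_mat[of "1\<^sub>m f" f f C e ?d] by simp
    ultimately show ?thesis using C by (intro eq_matI) auto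
  qed
  also have "C * 0\<^sub>m e f + Z * 1\<^sub>m f = Z" using C Z by simp
  finally have eq: "four_block_mat A B C Z * ?R = four_block_mat (?d \<cdot>\<^sub>m A - B * ?W) B (0\<^sub>m f e) Z" .
  have "Determinant.det (four_block_mat A B C Z) * Determinant.det ?R
      = Determinant.det (four_block_mat A B C Z * ?R)"
    by (rule det_mult[of _ "e + f", symmetric]) (use A Z in auto)
  also have "\<dots> = Determinant.det (?d \<cdot>\<^sub>m A - B * ?W) * ?d"
    unfolding eq using minus_carrier_mat[OF mult_carrier_mat[OF B W], of "?d \<cdot>\<^sub>m A"] B Z
    by (intro det_four_block_mat_lower_left_zero) auto
  also have "Determinant.det ?R = ?d ^ e"
    by (subst det_four_block_mat_upper_right_zero[of _ e _ f]) (use W in auto)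
  finally show ?thesis .
qed

definition corner :: "nat \<Rightarrow> 'a mat \<Rightarrow> 'a mat" where
  "corner j Y = Matrix.mat j j (\<lambda>(a, b). Y $$ (dim_row Y - j + a, dim_col Y - j + b))"

lemma corner_carrier [simp]: "corner j Y \<in> carrier_mat j j"
  by (simp add: corner_def)

lemma corner_dim [simp]: "dim_row (corner j Y) = j" "dim_col (corner j Y) = j"
  by (simp_all add: corner_def)

lemma lower_right_minor_eq: "lower_right_minor j Y = Determinant.det (corner j Y)"
  by (simp add: lower_right_minor_def corner_def)

text \<open>\<open>schur f Y a b\<close> is the Schur complement of the corner of size \<open>f\<close>, multiplied by its determinant.\<close>
definition schur :: "nat \<Rightarrow> 'a::comm_ring_1 mat \<Rightarrow> nat \<Rightarrow> nat \<Rightarrow> 'a" where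
  "schur f Y a b = Determinant.det (corner f Y) * Y $$ (a, b) -
     (\<Sum>r<f. \<Sum>c<f. Y $$ (a, dim_row Y - f + r) * adj_mat (corner f Y) $$ (r, c) * Y $$ (dim_row Y - f + c, b))"

text \<open>Sylvester's determinant identity, obtained from the adjugate and hence valid for a
  singular corner too. The spare factor on both sides is cancelled only where the corner minor is
  nonzero.\<close>

lemma lower_right_minor_schur:
  fixes Y :: "'a::idom mat"
  assumes Y: "Y \<in> carrier_mat N N" and ef: "e + f \<le> N"
  shows "lower_right_minor (e + f) Y * lower_right_minor f Y ^ e
       = Determinant.det (Matrix.mat e e (\<lambda>(a, b). schur f Y (N - e - f + a) (N - e - f + b))) * lower_right_minor f Y"
proof -
  let ?o = "N - e - f"
  define A where "A = Matrix.mat e e (\<lambda>(a, b). Y $$ (?o + a, ?o + b))"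
  define B where "B = Matrix.mat e f (\<lambda>(a, b). Y $$ (?o + a, N - f + b))"
  define C where "C = Matrix.mat f e (\<lambda>(a, b). Y $$ (N - f + a, ?o + b))"
  let ?Z = "corner f Y"
  have car: "A \<in> carrier_mat e e" "B \<in> carrier_mat e f" "C \<in> carrier_mat f e" "?Z \<in> carrier_mat f f"
    by (auto simp: A_def B_def C_def)
  have adj: "adj_mat ?Z \<in> carrier_mat f f" using adj_mat[OF car(4)] by auto
  have dim: "dim_row Y = N" "dim_col Y = N" using Y by auto
  have "corner (e + f) Y = four_block_mat A B C ?Z"
  proof (rule eq_matI)
    fix a b assume "a < dim_row (four_block_mat A B C ?Z)" "b < dim_col (four_block_mat A B C ?Z)"
    hence ab: "a < e + f" "b < e + f" using car by auto
    have "N - (e + f) + a = N - f + (a - e)" if "\<not> a < e" using that ef by simp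
    moreover have "N - (e + f) + b = N - f + (b - e)" if "\<not> b < e" using that ef by simp
    ultimately show "corner (e + f) Y $$ (a, b) = four_block_mat A B C ?Z $$ (a, b)"
      using ab car(1,4) by (auto simp: corner_def A_def B_def C_def dim)
  qed (use car in \<open>auto simp: corner_def\<close>)
  moreover have "Determinant.det ?Z \<cdot>\<^sub>m A - B * (adj_mat ?Z * C) = Matrix.mat e e (\<lambda>(a, b). schur f Y (?o + a) (?o + b))"
  proof (rule eq_matI)
    fix a b assume "a < dim_row (Matrix.mat e e (\<lambda>(a, b). schur f Y (?o + a) (?o + b)))"
      "b < dim_col (Matrix.mat e e (\<lambda>(a, b). schur f Y (?o + a) (?o + b)))"
    hence ab: "a < e" "b < e" by auto
    have "(B * (adj_mat ?Z * C)) $$ (a, b) = (\<Sum>r<f. B $$ (a, r) * (adj_mat ?Z * C) $$ (r, b))"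
      using car adj ab by (intro mult_mat_entry) auto
    also have "\<dots> = (\<Sum>r<f. B $$ (a, r) * (\<Sum>c<f. adj_mat ?Z $$ (r, c) * C $$ (c, b)))"
      using car adj ab by (intro sum.cong refl arg_cong2[where f = "(*)"] mult_mat_entry) auto
    also have "\<dots> = (\<Sum>r<f. \<Sum>c<f. Y $$ (?o + a, N - f + r) * adj_mat ?Z $$ (r, c) * Y $$ (N - f + c, ?o + b))"
      using ab by (simp add: B_def C_def sum_distrib_left mult.assoc)
    finally show "(Determinant.det ?Z \<cdot>\<^sub>m A - B * (adj_mat ?Z * C)) $$ (a, b)
        = Matrix.mat e e (\<lambda>(a, b). schur f Y (?o + a) (?o + b)) $$ (a, b)"
      using ab car adj by (simp add: schur_def A_def dim)
  qed (use car adj in auto)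
  ultimately show ?thesis
    using det_four_block_adj[OF car] by (simp add: lower_right_minor_eq)
qed

context unramified_quadratic_extension
begin

lemma cj_hom: "comm_ring_hom cj"
  by unfold_locales (auto simp: cj_add cj_mult)

lemma conj_transpose_entry: "a < dim_col Y \<Longrightarrow> b < dim_row Y \<Longrightarrow> conj_transpose cj Y $$ (a, b) = cj (Y $$ (b, a))"
  by (simp add: conj_transpose_def)

lemma conj_transpose_carrier [simp]: "Y \<in> carrier_mat m l \<Longrightarrow> conj_transpose cj Y \<in> carrier_mat l m"
  by (simp add: conj_transpose_def)

lemma conj_transpose_mult:
  assumes "Y \<in> carrier_mat m l" "Y' \<in> carrier_mat l r"
  shows "conj_transpose cj (Y * Y') = conj_transpose cj Y' * conj_transpose cj Y"
proof -
  interpret h: comm_ring_hom cj by (rule cj_hom)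
  show ?thesis
    unfolding conj_transpose_def transpose_mult[OF assms]
    using assms by (intro h.mat_hom_mult) auto
qed

lemma det_conj_transpose:
  assumes "Y \<in> carrier_mat m m"
  shows "Determinant.det (conj_transpose cj Y) = cj (Determinant.det Y)"
proof -
  interpret h: comm_ring_hom cj by (rule cj_hom)
  show ?thesis
    using assms by (simp add: conj_transpose_def det_transpose)
qed

lemma conj_transpose_mult_mult_entry:
  assumes "u \<in> carrier_mat N N" "Y \<in> carrier_mat N N" "a < N" "b < N"
  shows "(u * Y * conj_transpose cj u) $$ (a, b) = (\<Sum>c<N. \<Sum>d<N. u $$ (a, c) * Y $$ (c, d) * cj (u $$ (b, d)))"
proof -
  have "(u * Y * conj_transpose cj u) $$ (a, b) = (\<Sum>d<N. (u * Y) $$ (a, d) * conj_transpose cj u $$ (d, b))"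
    using assms by (intro mult_mat_entry) auto
  also have "\<dots> = (\<Sum>d<N. (\<Sum>c<N. u $$ (a, c) * Y $$ (c, d)) * cj (u $$ (b, d)))"
    using assms by (intro sum.cong refl arg_cong2[where f = "(*)"] mult_mat_entry)
      (auto simp: conj_transpose_entry)
  also have "\<dots> = (\<Sum>d<N. \<Sum>c<N. u $$ (a, c) * Y $$ (c, d) * cj (u $$ (b, d)))"
    by (simp add: sum_distrib_right)
  also have "\<dots> = (\<Sum>c<N. \<Sum>d<N. u $$ (a, c) * Y $$ (c, d) * cj (u $$ (b, d)))"
    by (rule sum.swap)
  finally show ?thesis .
qed

lemma nv_det_le_1:
  assumes "Y \<in> carrier_mat m m" "\<And>a b. a < m \<Longrightarrow> b < m \<Longrightarrow> nv (Y $$ (a, b)) \<le> 1"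
  shows "nv (Determinant.det Y) \<le> 1"
  unfolding det_def'[OF assms(1)]
proof (rule nv_sum_le)
  fix \<pi> assume "\<pi> \<in> {\<pi>. \<pi> permutes {0..<m}}"
  hence "\<pi> a < m" if "a < m" for a
    using that permutes_in_image[of \<pi> "{0..<m}" a] by auto
  hence "(\<Prod>a = 0..<m. nv (Y $$ (a, \<pi> a))) \<le> 1"
    using assms(2) nv_nonneg by (intro prod_le_1) auto
  thus "nv (signof \<pi> * (\<Prod>a = 0..<m. Y $$ (a, \<pi> a))) \<le> 1"
    by (simp add: nv_mult nv_prod sign_def)
qed simp

text \<open>The lower rows of \<open>u\<close> vanish to the left of the corner, so the corner of
  the transformed matrix sees only corners.\<close>

lemma corner_conj_transpose_mult_mult:
  assumes u: "u \<in> carrier_mat N N" and Y: "Y \<in> carrier_mat N N" and j: "j \<le> N"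
    and zero: "\<And>a c. N - j \<le> a \<Longrightarrow> a < N \<Longrightarrow> c < N - j \<Longrightarrow> u $$ (a, c) = 0"
  shows "corner j (u * Y * conj_transpose cj u) = corner j u * corner j Y * conj_transpose cj (corner j u)"
proof (rule eq_matI)
  let ?o = "N - j"
  have dims: "dim_row u = N" "dim_col u = N" "dim_row Y = N" "dim_col Y = N" using u Y by auto
  have sum_corner: "(\<Sum>c<N. g c) = (\<Sum>c<j. g (?o + c))" if "\<And>c. c < ?o \<Longrightarrow> g c = 0" for g :: "nat \<Rightarrow> 'a"
  proof -
    have "(\<Sum>c<N. g c) = (\<Sum>c\<in>{?o..<N}. g c)"
      using that by (intro sum.mono_neutral_right) (auto simp: not_le)
    also have "\<dots> = (\<Sum>c<j. g (?o + c))"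
      using j by (intro sum.reindex_bij_witness[of _ "\<lambda>c. ?o + c" "\<lambda>c. c - ?o"]) auto
    finally show ?thesis .
  qed
  fix a b
  assume "a < dim_row (corner j u * corner j Y * conj_transpose cj (corner j u))"
    "b < dim_col (corner j u * corner j Y * conj_transpose cj (corner j u))"
  hence ab: "a < j" "b < j" by (auto simp: corner_def conj_transpose_def)
  have "corner j (u * Y * conj_transpose cj u) $$ (a, b) = (u * Y * conj_transpose cj u) $$ (?o + a, ?o + b)"
    using ab dims by (simp add: corner_def conj_transpose_def)
  also have "\<dots> = (\<Sum>c<N. \<Sum>d<N. u $$ (?o + a, c) * Y $$ (c, d) * cj (u $$ (?o + b, d)))"
    using ab j by (intro conj_transpose_mult_mult_entry[OF u Y]) auto
  also have "\<dots> = (\<Sum>c<j. \<Sum>d<N. u $$ (?o + a, ?o + c) * Y $$ (?o + c, d) * cj (u $$ (?o + b, d)))"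
    using ab j by (intro sum_corner) (simp add: zero)
  also have "\<dots> = (\<Sum>c<j. \<Sum>d<j. u $$ (?o + a, ?o + c) * Y $$ (?o + c, ?o + d) * cj (u $$ (?o + b, ?o + d)))"
    using ab j by (intro sum.cong refl sum_corner) (simp add: zero)
  also have "\<dots> = (\<Sum>c<j. \<Sum>d<j. corner j u $$ (a, c) * corner j Y $$ (c, d) * cj (corner j u $$ (b, d)))"
    using ab dims by (intro sum.cong refl) (simp add: corner_def)
  also have "\<dots> = (corner j u * corner j Y * conj_transpose cj (corner j u)) $$ (a, b)"
    by (rule conj_transpose_mult_mult_entry[symmetric]) (use ab in auto)
  finally show "corner j (u * Y * conj_transpose cj u) $$ (a, b)
      = (corner j u * corner j Y * conj_transpose cj (corner j u)) $$ (a, b)" .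
qed (auto simp: corner_def conj_transpose_def)

text \<open>The corner of \<open>u\<close> is merely integral here, so its determinant is bounded by
  1; equality follows later by applying the same estimate to the inverse.\<close>

lemma nv_lower_right_minor_le:
  assumes u: "u \<in> carrier_mat N N" and Y: "Y \<in> carrier_mat N N" and j: "j \<le> N"
    and zero: "\<And>a c. N - j \<le> a \<Longrightarrow> a < N \<Longrightarrow> c < N - j \<Longrightarrow> u $$ (a, c) = 0"
    and int: "\<And>a b. a < N \<Longrightarrow> b < N \<Longrightarrow> nv (u $$ (a, b)) \<le> 1"
  shows "nv (lower_right_minor j (u * Y * conj_transpose cj u)) \<le> nv (lower_right_minor j Y)"
proof -
  let ?d = "Determinant.det (corner j u)"
  have "lower_right_minor j (u * Y * conj_transpose cj u) = ?d * lower_right_minor j Y * cj ?d"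
  proof -
    have "corner j (u * Y * conj_transpose cj u) = corner j u * corner j Y * conj_transpose cj (corner j u)"
      by (rule corner_conj_transpose_mult_mult[OF u Y j]) (use zero in auto)
    thus ?thesis
      using det_mult[of "corner j u" j "corner j Y"] det_conj_transpose[of "corner j u" j]
        det_mult[OF mult_carrier_mat[OF corner_carrier corner_carrier], of "conj_transpose cj (corner j u)" j u Y]
      by (simp add: lower_right_minor_eq)
  qed
  moreover have "nv ?d \<le> 1"
    using u j int by (intro nv_det_le_1) (auto simp: corner_def)
  hence "nv ?d * nv (lower_right_minor j Y) * nv ?d \<le> 1 * nv (lower_right_minor j Y) * 1"
    using nv_nonneg by (intro mult_mono) auto
  ultimately show ?thesis by (simp add: nv_mult)
qed

text \<open>The adjugate of a Hermitian corner is Hermitian, because conjugate transposition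
  exchanges the two indices of a cofactor; renaming the summation indices does the rest.\<close>

lemma schur_hermitian:
  assumes Y: "Y \<in> carrier_mat N N" and herm: "\<And>a b. a < N \<Longrightarrow> b < N \<Longrightarrow> cj (Y $$ (a, b)) = Y $$ (b, a)"
    and f: "f \<le> N" and ab: "a < N" "b < N"
  shows "cj (schur f Y a b) = schur f Y b a"
proof -
  interpret h: comm_ring_hom cj by (rule cj_hom)
  let ?Z = "corner f Y"
  have dims: "dim_row Y = N" "dim_col Y = N" using Y by auto
  have Zh: "cj (?Z $$ (r, c)) = ?Z $$ (c, r)" if "r < f" "c < f" for r c
    using that f by (simp add: corner_def dims herm)
  have "conj_transpose cj ?Z = ?Z"
    by (rule eq_matI) (auto simp: conj_transpose_def Zh)
  hence detZ: "cj (Determinant.det ?Z) = Determinant.det ?Z"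
    using det_conj_transpose[of ?Z f] by simp
  have adj: "cj (adj_mat ?Z $$ (r, c)) = adj_mat ?Z $$ (c, r)" if rc: "r < f" "c < f" for r c
  proof -
    have md: "conj_transpose cj (mat_delete ?Z c r) = mat_delete ?Z r c"
      using rc by (intro eq_matI) (auto simp: conj_transpose_def mat_delete_def Zh)
    have "cj (Determinant.det (mat_delete ?Z c r)) = Determinant.det (mat_delete ?Z r c)"
      unfolding md[symmetric]
      by (rule det_conj_transpose[symmetric, of _ "f - 1"]) (rule mat_delete_carrier[OF corner_carrier])
    thus ?thesis
      using rc by (simp add: adj_mat_def corner_def cofactor_def cj_mult cj_power add.commute)
  qed
  have "cj (\<Sum>r<f. \<Sum>c<f. Y $$ (a, N - f + r) * adj_mat ?Z $$ (r, c) * Y $$ (N - f + c, b))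
      = (\<Sum>r<f. \<Sum>c<f. cj (Y $$ (a, N - f + r)) * cj (adj_mat ?Z $$ (r, c)) * cj (Y $$ (N - f + c, b)))"
    by (simp only: cj_sum cj_mult)
  also have "\<dots> = (\<Sum>r<f. \<Sum>c<f. Y $$ (N - f + r, a) * adj_mat ?Z $$ (c, r) * Y $$ (b, N - f + c))"
    by (intro sum.cong refl arg_cong2[where f = "(*)"] herm adj) (use ab f in auto)
  finally have "cj (schur f Y a b) = Determinant.det ?Z * Y $$ (b, a) -
      (\<Sum>r<f. \<Sum>c<f. Y $$ (N - f + r, a) * adj_mat ?Z $$ (c, r) * Y $$ (b, N - f + c))"
    unfolding schur_def dims cj_diff by (simp only: cj_mult detZ herm[OF ab])
  also have "(\<Sum>r<f. \<Sum>c<f. Y $$ (N - f + r, a) * adj_mat ?Z $$ (c, r) * Y $$ (b, N - f + c))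
      = (\<Sum>r<f. \<Sum>c<f. Y $$ (b, N - f + r) * adj_mat ?Z $$ (r, c) * Y $$ (N - f + c, a))"
    by (subst sum.swap) (simp add: mult_ac)
  finally show ?thesis by (simp add: schur_def dims)
qed

end

section \<open>The unitary group\<close>

context unramified_quadratic_extension
begin

lemma nv_det_le:
  assumes "Y \<in> carrier_mat m m" "\<And>a b. a < m \<Longrightarrow> b < m \<Longrightarrow> nv (Y $$ (a, b)) \<le> C" "0 \<le> C"
  shows "nv (Determinant.det Y) \<le> C ^ m"
  unfolding det_def'[OF assms(1)]
proof (rule nv_sum_le)
  fix \<pi> assume "\<pi> \<in> {\<pi>. \<pi> permutes {0..<m}}"
  hence "\<pi> a < m" if "a < m" for a
    using that permutes_in_image[of \<pi> "{0..<m}" a] by auto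
  hence "(\<Prod>a = 0..<m. nv (Y $$ (a, \<pi> a))) \<le> (\<Prod>a = 0..<m. C)"
    using assms(2) nv_nonneg by (intro prod_mono) auto
  thus "nv (signof \<pi> * (\<Prod>a = 0..<m. Y $$ (a, \<pi> a))) \<le> C ^ m"
    by (simp add: nv_mult nv_prod sign_def)
qed (use assms in simp)

text \<open>
  A nonzero binary hermitian form over the residue field has an anisotropic vector among the
  representatives of the projective line, so the norm of the triple can be read off the lower entries of its
  translates.
\<close>
lemma nm_eq_lower_entry:
  assumes "t \<in> herm" "dt t \<noteq> 0"
  shows "nm t = nv (snd (snd (swp t))) \<or> (\<exists>y\<in>res. nm t = nv (snd (snd (trn y t))))"
proof (rule ccontr)
  assume neg: "\<not> ?thesis"
  let ?e = "ee t" and ?m = "mm t"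
  define s where "s = prm powi (- ?e)"
  define t0 where "t0 = scl s t"
  have s: "s \<in> k" "s \<noteq> 0" by (simp_all add: s_def k_power_int prm_in_k)
  have t0: "t0 \<in> lev0 ?m 0"
    using lev_exists(1)[OF assms] by (simp add: lev_def t0_def s_def)
  hence nm0: "nv s * nm t = 1"
    by (simp add: lev0_def t0_def nm_scl)
  have pos: "nv s > 0" using s by (simp add: nv_pos_iff)
  have up: "swp t0 \<in> lev0 ?m (Suc 0)"
  proof -
    have "nv (snd (snd (swp t))) \<le> nm t" by (cases t) (simp add: swp_def nm_def)
    hence "nv (snd (snd (swp t))) < nm t" using neg by auto
    hence "nv s * nv (snd (snd (swp t))) < 1"
      using pos nm0 by (metis mult_strict_left_mono)
    moreover have "snd (snd (swp t0)) = s * snd (snd (swp t))"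
      by (cases t) (simp add: t0_def swp_def scl_def)
    ultimately have "nv (snd (snd (swp t0))) < 1" by (simp add: nv_mult)
    thus ?thesis
      using lev0_swp_base[OF t0] by (simp add: lev0_def nv_less_1_iff)
  qed
  have all: "trn y t0 \<in> lev0 ?m (Suc 0)" if y: "y \<in> res" for y
  proof -
    have "nm (trn y t) = nm t" using nm_trn nv_res_le[OF y] assms by blast
    hence "nv (snd (snd (trn y t))) \<le> nm t" by (cases "trn y t") (simp add: nm_def)
    hence "nv (snd (snd (trn y t))) < nm t" using neg y by fastforce
    hence "nv s * nv (snd (snd (trn y t))) < 1"
      using pos nm0 by (metis mult_strict_left_mono)
    moreover have "snd (snd (trn y t0)) = s * snd (snd (trn y t))"
      unfolding t0_def scl_trn[OF s(1), symmetric] by (cases "trn y t") (simp add: scl_def)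
    ultimately have "nv (snd (snd (trn y t0))) < 1" by (simp add: nv_mult)
    thus ?thesis
      using lev0_trn_base[OF t0 nv_res_le[OF y]] by (simp add: lev0_def nv_less_1_iff)
  qed
  have "{y \<in> res. trn y t0 \<in> lev0 ?m (Suc 0)} = res" using all by blast
  hence "q\<^sup>2 + 1 = (if ?m = 0 then q + 1 else 1)"
    using lev0_count_0[OF t0] up by (simp add: card_res)
  moreover have "q\<^sup>2 > q" using q_ge_2 by (simp add: power2_eq_square)
  ultimately show False by (auto split: if_splits)
qed

end

section \<open>Haar measure on \<open>K\<close>, translations by explicit elements, and the minors
  as functions on \<open>K\<close>\<close>

locale haar_setup = unramified_quadratic_extension nv p k prm cj
  for nv :: "'a::field_char_0 \<Rightarrow> real" and p k prm cj +
  fixes n :: nat and M :: "'a mat measure" and x :: "'a mat"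
  assumes haar: "normalized_haar nv (unitary_K nv cj n) M"
    and x_carrier: "x \<in> carrier_mat (2 * n + 1) (2 * n + 1)" and x_herm: "conj_transpose cj x = x"
begin

definition N :: nat where "N = 2 * n + 1"
abbreviation K :: "'a mat set" where "K \<equiv> unitary_K nv cj n"

lemma K_iff:
  "h \<in> K \<longleftrightarrow> h \<in> carrier_mat N N \<and> invertible_mat h \<and>
     conj_transpose cj h * antidiag N * h = antidiag N \<and> (\<forall>a<N. \<forall>b<N. nv (h $$ (a, b)) \<le> 1)"
  unfolding unitary_K_def unitary_G_def val_ring_def N_def by blast

lemma K_carrier: "h \<in> K \<Longrightarrow> h \<in> carrier_mat N N"
  by (simp add: K_iff)

lemma K_nv_le: "h \<in> K \<Longrightarrow> a < N \<Longrightarrow> b < N \<Longrightarrow> nv (h $$ (a, b)) \<le> 1"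
  by (simp add: K_iff)

lemma x_car: "x \<in> carrier_mat N N"
  using x_carrier by (simp add: N_def)

lemmas assocN = assoc_mult_mat[of _ N N _ N _ N]
lemmas carN = mult_carrier_mat[of _ N N _ N] conj_transpose_carrier[of _ N N]

lemma space_M: "space M = K" and emeasure_K: "emeasure M K = 1"
  using haar by (simp_all add: normalized_haar_def)

sublocale finite_measure M
  by (rule finite_measureI) (simp add: space_M emeasure_K)

lemma K_mult:
  assumes u: "u \<in> K" and h: "h \<in> K" shows "u * h \<in> K"
proof -
  let ?J = "antidiag N :: 'a mat"
  have car: "u \<in> carrier_mat N N" "h \<in> carrier_mat N N" using K_carrier u h by auto
  have J: "?J \<in> carrier_mat N N" by (simp add: antidiag_def)
  have uJ: "conj_transpose cj u * ?J * u = ?J" "conj_transpose cj h * ?J * h = ?J"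
    using u h by (simp_all add: K_iff)
  have inv: "invertible_mat u" "invertible_mat h"
    using u h by (simp_all add: K_iff)
  have "conj_transpose cj (u * h) * ?J * (u * h) = conj_transpose cj h * (conj_transpose cj u * ?J * u) * h"
    unfolding conj_transpose_mult[OF car] using car J
    by (simp add: assocN carN)
  hence "conj_transpose cj (u * h) * ?J * (u * h) = ?J"
    by (simp only: uJ)
  moreover have "invertible_mat (u * h)"
  proof -
    obtain v where v: "u * v = 1\<^sub>m N" "v * u = 1\<^sub>m N" "v \<in> carrier_mat N N"
    proof -
      obtain v where "inverts_mat u v" "inverts_mat v u" using inv(1) by (auto simp: invertible_mat_def)
      hence *: "u * v = 1\<^sub>m N" "v * u = 1\<^sub>m (dim_row v)" using car by (auto simp: inverts_mat_def)
      have "dim_col v = N" using arg_cong[OF *(1), of dim_col] by simp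
      moreover have "dim_row v = N" using arg_cong[OF *(2), of dim_col] car by simp
      ultimately show ?thesis using * that[of v] by auto
    qed
    obtain w where w: "h * w = 1\<^sub>m N" "w * h = 1\<^sub>m N" "w \<in> carrier_mat N N"
    proof -
      obtain v where "inverts_mat h v" "inverts_mat v h" using inv(2) by (auto simp: invertible_mat_def)
      hence *: "h * v = 1\<^sub>m N" "v * h = 1\<^sub>m (dim_row v)" using car by (auto simp: inverts_mat_def)
      have "dim_col v = N" using arg_cong[OF *(1), of dim_col] by simp
      moreover have "dim_row v = N" using arg_cong[OF *(2), of dim_col] car by simp
      ultimately show ?thesis using * that[of v] by auto
    qed
    have "(u * h) * (w * v) = u * (h * w) * v" "(w * v) * (u * h) = w * (v * u) * h"
      using car v(3) w(3) by (simp_all add: assocN carN)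
    moreover have "u * (h * w) * v = 1\<^sub>m N" "w * (v * u) * h = 1\<^sub>m N"
      unfolding w(1) v(2) using car v w by simp_all
    ultimately have "(u * h) * (w * v) = 1\<^sub>m N" "(w * v) * (u * h) = 1\<^sub>m N"
      by (simp_all only:)
    thus ?thesis
      using car v w by (auto simp: invertible_mat_def inverts_mat_def intro!: exI[of _ "w * v"])
  qed
  moreover have "nv ((u * h) $$ (a, b)) \<le> 1" if ab: "a < N" "b < N" for a b
  proof -
    have "(u * h) $$ (a, b) = (\<Sum>c<N. u $$ (a, c) * h $$ (c, b))"
      by (rule mult_mat_entry[OF car ab])
    also have "nv \<dots> \<le> 1"
    proof (rule nv_sum_le)
      fix c assume "c \<in> {..<N}"
      thus "nv (u $$ (a, c) * h $$ (c, b)) \<le> 1"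
        using K_nv_le[OF u, of a c] K_nv_le[OF h, of c b] ab nv_nonneg
          mult_mono[of "nv (u $$ (a, c))" 1 "nv (h $$ (c, b))" 1] by (simp add: nv_mult)
    qed simp
    finally show ?thesis .
  qed
  ultimately show ?thesis
    using car by (simp add: K_iff carN)
qed

text \<open>The last clause is the relation J u = v^* J read entrywise, J being the antidiagonal
  matrix, which reverses indices. It expresses unitarity with the inverse at hand, and carrying
  integral inverses along makes the notion symmetric.\<close>

definition inverse_pair :: "'a mat \<Rightarrow> 'a mat \<Rightarrow> bool" where
  "inverse_pair u v \<longleftrightarrow> u \<in> carrier_mat N N \<and> v \<in> carrier_mat N N \<and> u * v = 1\<^sub>m N \<and> v * u = 1\<^sub>m N \<and>
     (\<forall>a<N. \<forall>b<N. nv (u $$ (a, b)) \<le> 1 \<and> nv (v $$ (a, b)) \<le> 1 \<and> u $$ (N - 1 - a, b) = cj (v $$ (N - 1 - b, a)))"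

lemma inverse_pair_sym:
  assumes "inverse_pair u v" shows "inverse_pair v u"
proof -
  have "v $$ (N - 1 - a, b) = cj (u $$ (N - 1 - b, a))" if "a < N" "b < N" for a b
    using assms that cj_cj by (auto simp: inverse_pair_def)
  thus ?thesis using assms by (simp add: inverse_pair_def)
qed

lemma inverse_pair_in_K:
  assumes "inverse_pair u v" shows "u \<in> K"
proof -
  let ?J = "antidiag N :: 'a mat"
  have car: "u \<in> carrier_mat N N" "v \<in> carrier_mat N N" and uv: "u * v = 1\<^sub>m N" "v * u = 1\<^sub>m N"
    using assms by (auto simp: inverse_pair_def)
  have J: "?J \<in> carrier_mat N N" by (simp add: antidiag_def)
  have Ju: "?J * u = conj_transpose cj v * ?J"
  proof (rule eq_matI)
    fix a b assume "a < dim_row (conj_transpose cj v * ?J)" "b < dim_col (conj_transpose cj v * ?J)"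
    hence ab: "a < N" "b < N" using car by (auto simp: conj_transpose_def antidiag_def)
    have "(?J * u) $$ (a, b) = (\<Sum>c<N. ?J $$ (a, c) * u $$ (c, b))"
      by (rule mult_mat_entry[OF J car(1) ab])
    also have "\<dots> = (\<Sum>c<N. if c = N - 1 - a then u $$ (c, b) else 0)"
      using ab by (intro sum.cong) (auto simp: antidiag_def)
    also have "\<dots> = u $$ (N - 1 - a, b)" using ab by simp
    also have "\<dots> = cj (v $$ (N - 1 - b, a))" using assms ab by (simp add: inverse_pair_def)
    also have "\<dots> = (\<Sum>c<N. if c = N - 1 - b then cj (v $$ (c, a)) else 0)" using ab by simp
    also have "\<dots> = (\<Sum>c<N. conj_transpose cj v $$ (a, c) * ?J $$ (c, b))"
      using ab car by (intro sum.cong) (auto simp: antidiag_def conj_transpose_entry)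
    also have "\<dots> = (conj_transpose cj v * ?J) $$ (a, b)"
      by (rule mult_mat_entry[symmetric]) (use car J ab in auto)
    finally show "(?J * u) $$ (a, b) = (conj_transpose cj v * ?J) $$ (a, b)" .
  qed (use car in \<open>auto simp: conj_transpose_def antidiag_def\<close>)
  have one: "conj_transpose cj (1\<^sub>m N) = 1\<^sub>m N"
    by (rule eq_matI) (auto simp: conj_transpose_def)
  have "conj_transpose cj u * ?J * u = conj_transpose cj u * (conj_transpose cj v * ?J)"
    using car J by (simp add: assocN carN Ju)
  also have "\<dots> = conj_transpose cj (v * u) * ?J"
    unfolding conj_transpose_mult[OF car(2,1)] using car J
    by (simp add: assocN carN)
  also have "\<dots> = ?J" using J by (simp add: uv one)
  finally show ?thesis
    using assms car uv by (auto simp: K_iff inverse_pair_def invertible_mat_def inverts_mat_def intro!: exI[of _ v])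
qed

text \<open>
  Invariance of the measure makes translations measurable, because a set that is not measurable has
  measure zero; for null sets pass to the complement.
\<close>
lemma translation:
  assumes "inverse_pair u v"
  shows "(\<lambda>h. u * h) \<in> measurable M M" "distr M M (\<lambda>h. u * h) = M"
proof -
  have uK: "u \<in> K" and vK: "v \<in> K"
    using inverse_pair_in_K assms inverse_pair_sym by blast+
  have car: "u \<in> carrier_mat N N" "v \<in> carrier_mat N N" and uv: "u * v = 1\<^sub>m N" "v * u = 1\<^sub>m N"
    using assms by (auto simp: inverse_pair_def)
  have vu: "v * (u * h) = h" and uv': "u * (v * h) = h" if "h \<in> K" for h
    using K_carrier[OF that] car uv by (simp_all flip: assocN)
  have pre: "(\<lambda>h. u * h) -` A \<inter> space M = (\<lambda>h. v * h) ` A" if "A \<subseteq> K" for A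
  proof (intro equalityI subsetI)
    fix h assume "h \<in> (\<lambda>h. u * h) -` A \<inter> space M"
    thus "h \<in> (\<lambda>h. v * h) ` A" using vu by (intro image_eqI[of _ _ "u * h"]) (auto simp: space_M)
  next
    fix h assume "h \<in> (\<lambda>h. v * h) ` A"
    thus "h \<in> (\<lambda>h. u * h) -` A \<inter> space M"
      using that uv' K_mult[OF vK] by (auto simp: space_M subset_iff)
  qed
  have inv: "emeasure M ((\<lambda>h. v * h) ` A) = emeasure M A" if "A \<in> sets M" for A
    using haar vK that by (simp add: normalized_haar_def)
  have pos: "(\<lambda>h. v * h) ` A \<in> sets M" if "A \<in> sets M" "emeasure M A \<noteq> 0" for A
    using inv[OF that(1)] that(2) emeasure_notin_sets by metis
  have img: "(\<lambda>h. v * h) ` A \<in> sets M" if A: "A \<in> sets M" for A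
  proof (cases "emeasure M A = 0")
    case True
    have sub: "A \<subseteq> K" using sets.sets_into_space[OF A] by (simp add: space_M)
    have "emeasure M (space M - A) = emeasure M (space M) - emeasure M A"
      using A True by (intro emeasure_compl) auto
    hence "emeasure M (space M - A) \<noteq> 0"
      using True by (simp add: space_M emeasure_K)
    hence "(\<lambda>h. v * h) ` (space M - A) \<in> sets M"
      using A by (intro pos) auto
    hence "space M - (\<lambda>h. v * h) ` (space M - A) \<in> sets M" by blast
    moreover have "space M - (\<lambda>h. v * h) ` (space M - A) = (\<lambda>h. v * h) ` A"
    proof -
      have "(\<lambda>h. v * h) ` (space M - A) = (\<lambda>h. u * h) -` (space M - A) \<inter> space M"
        by (rule pre[symmetric]) (auto simp: space_M)
      moreover have "space M - ((\<lambda>h. u * h) -` (space M - A) \<inter> space M) = (\<lambda>h. u * h) -` A \<inter> space M"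
        using K_mult[OF uK] by (auto simp: space_M)
      ultimately show ?thesis using pre[OF sub] by simp
    qed
    ultimately show ?thesis by simp
  next
    case False
    thus ?thesis using A by (rule pos[rotated])
  qed
  show meas: "(\<lambda>h. u * h) \<in> measurable M M"
  proof (rule measurableI)
    show "u * h \<in> space M" if "h \<in> space M" for h using K_mult[OF uK] that by (simp add: space_M)
    show "(\<lambda>h. u * h) -` A \<inter> space M \<in> sets M" if "A \<in> sets M" for A
      using img[OF that] pre[of A] sets.sets_into_space[OF that] by (simp add: space_M)
  qed
  show "distr M M (\<lambda>h. u * h) = M"
  proof (rule measure_eqI)
    fix A assume "A \<in> sets (distr M M (\<lambda>h. u * h))"
    hence A: "A \<in> sets M" by simp
    thus "emeasure (distr M M (\<lambda>h. u * h)) A = emeasure M A"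
      using inv[OF A] pre[of A] sets.sets_into_space[OF A] by (simp add: emeasure_distr[OF meas] space_M)
  qed simp
qed

definition Y :: "'a mat \<Rightarrow> 'a mat" where "Y h = act cj h x"

definition D :: "nat \<Rightarrow> 'a mat \<Rightarrow> 'a" where "D j h = lower_right_minor j (Y h)"

lemma Y_carrier: "h \<in> K \<Longrightarrow> Y h \<in> carrier_mat N N"
  using K_carrier x_car by (simp add: Y_def act_def carN)

lemma Y_entry:
  assumes "h \<in> K" "a < N" "b < N"
  shows "Y h $$ (a, b) = (\<Sum>c<N. \<Sum>d<N. h $$ (a, c) * x $$ (c, d) * cj (h $$ (b, d)))"
  unfolding Y_def act_def by (rule conj_transpose_mult_mult_entry[OF K_carrier[OF assms(1)] x_car assms(2,3)])

lemma x_entry_cj: "a < N \<Longrightarrow> b < N \<Longrightarrow> cj (x $$ (a, b)) = x $$ (b, a)"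
  using conj_transpose_entry[of b x a] x_car x_herm by simp

lemma Y_herm:
  assumes "h \<in> K" "a < N" "b < N" shows "cj (Y h $$ (a, b)) = Y h $$ (b, a)"
proof -
  have "cj (Y h $$ (a, b)) = (\<Sum>c<N. \<Sum>d<N. cj (h $$ (a, c)) * cj (x $$ (c, d)) * h $$ (b, d))"
    unfolding Y_entry[OF assms] by (simp add: cj_sum cj_mult)
  also have "\<dots> = (\<Sum>c<N. \<Sum>d<N. h $$ (b, d) * x $$ (d, c) * cj (h $$ (a, c)))"
    by (intro sum.cong refl) (simp add: x_entry_cj mult_ac)
  also have "\<dots> = (\<Sum>d<N. \<Sum>c<N. h $$ (b, d) * x $$ (d, c) * cj (h $$ (a, c)))"
    by (rule sum.swap)
  also have "\<dots> = Y h $$ (b, a)" unfolding Y_entry[OF assms(1,3,2)] ..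
  finally show ?thesis .
qed

lemma Y_mult:
  assumes "u \<in> K" "h \<in> K" shows "Y (u * h) = u * Y h * conj_transpose cj u"
proof -
  have car: "u \<in> carrier_mat N N" "h \<in> carrier_mat N N" using K_carrier assms by auto
  show ?thesis
    unfolding Y_def act_def conj_transpose_mult[OF car]
    using car x_car by (simp add: assocN carN)
qed

lemma D_bdd: "\<exists>a. \<forall>j\<le>n. \<forall>h\<in>K. nv (D j h) \<le> real q ^ a"
proof -
  have fin: "finite ((\<lambda>(c, d). nv (x $$ (c, d))) ` ({..<N} \<times> {..<N}))" by simp
  define C where "C = Max ((\<lambda>(c, d). nv (x $$ (c, d))) ` ({..<N} \<times> {..<N}))"
  have C: "nv (x $$ (c, d)) \<le> C" if "c < N" "d < N" for c d
    unfolding C_def using that by (intro Max_ge[OF fin]) auto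
  obtain b where b: "C < real q ^ b" using real_arch_pow[of "real q" C] q_ge_2 by auto
  have pos: "real q ^ b \<ge> 1" using q_ge_2 by (intro one_le_power) auto
  have entry: "nv (Y h $$ (a, c)) \<le> real q ^ b" if "h \<in> K" "a < N" "c < N" for h a c
    unfolding Y_entry[OF that]
  proof (intro nv_sum_le)
    fix r s assume "r \<in> {..<N}" "s \<in> {..<N}"
    hence rs: "r < N" "s < N" by auto
    have "nv (h $$ (a, r)) * nv (x $$ (r, s)) * nv (h $$ (c, s)) \<le> 1 * real q ^ b * 1"
      using K_nv_le[OF that(1,2) rs(1)] K_nv_le[OF that(1,3) rs(2)] C[OF rs] b nv_nonneg pos
      by (intro mult_mono) auto
    thus "nv (h $$ (a, r) * x $$ (r, s) * cj (h $$ (c, s))) \<le> real q ^ b"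
      by (simp add: nv_mult)
  qed (use pos in auto)
  have "nv (D j h) \<le> real q ^ (b * n)" if "j \<le> n" "h \<in> K" for j h
  proof -
    have dims: "dim_row (Y h) = N" "dim_col (Y h) = N" using Y_carrier[OF that(2)] by auto
    have "nv (D j h) \<le> (real q ^ b) ^ j"
      unfolding D_def lower_right_minor_eq
    proof (rule nv_det_le[OF corner_carrier])
      fix a c assume "a < j" "c < j"
      thus "nv (corner j (Y h) $$ (a, c)) \<le> real q ^ b"
        using that entry[OF that(2), of "N - j + a" "N - j + c"] by (simp add: corner_def dims N_def)
    qed (use pos in simp)
    also have "\<dots> \<le> (real q ^ b) ^ n" using pos that by (intro power_increasing) auto
    finally show ?thesis by (simp add: power_mult)
  qed
  thus ?thesis by blast
qed

text \<open>The inequality for \<open>u\<close> and the inequality for its inverse, which has the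
  same block of zeros, combine to an equality.\<close>

lemma nv_D_translate:
  assumes uv: "inverse_pair u v" and h: "h \<in> K" and j: "j \<le> N"
    and zero: "\<And>a c. N - j \<le> a \<Longrightarrow> a < N \<Longrightarrow> c < N - j \<Longrightarrow> u $$ (a, c) = 0 \<and> v $$ (a, c) = 0"
  shows "nv (D j (u * h)) = nv (D j h)"
proof -
  have le: "nv (D j (u * h)) \<le> nv (D j h)"
    if "inverse_pair u v" "h \<in> K" "\<And>a c. N - j \<le> a \<Longrightarrow> a < N \<Longrightarrow> c < N - j \<Longrightarrow> u $$ (a, c) = 0" for u v h
    unfolding D_def Y_mult[OF inverse_pair_in_K[OF that(1)] that(2)]
    by (rule nv_lower_right_minor_le[OF K_carrier[OF inverse_pair_in_K[OF that(1)]] Y_carrier[OF that(2)] j])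
       (use that in \<open>auto simp: inverse_pair_def\<close>)
  have "u * h \<in> K" using K_mult[OF inverse_pair_in_K[OF uv] h] .
  moreover have "v * (u * h) = h"
    using uv K_carrier[OF h] by (simp add: inverse_pair_def flip: assocN)
  ultimately have "nv (D j h) \<le> nv (D j (u * h))"
    using le[OF inverse_pair_sym[OF uv], of "u * h"] zero by simp
  moreover have "nv (D j (u * h)) \<le> nv (D j h)" using le[OF uv h] zero by simp
  ultimately show ?thesis by simp
qed

end

section \<open>The copy of GL_2 that distinguishes d_i, and the Hermitian form on which it
  acts\<close>

locale haar_exchange = haar_setup nv p k prm cj n M x
  for nv :: "'a::field_char_0 \<Rightarrow> real" and p k prm cj n M x +
  fixes i :: nat
  assumes i: "1 \<le> i" "i < n"
begin

text \<open>Counted from 0, the corner of size i + 1 begins at row \<open>p0\<close> and the corner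
  of size i - 1 at row p0 + 2, so the form lives on rows \<open>p0\<close> and p0 + 1. Index
  reversal sends them to i and i - 1, which are disjoint from them because i < n.\<close>

definition p0 :: nat where "p0 = 2 * n - i"

lemma index_facts: "Suc p0 < N" "i < p0" "i - 1 < i" "N - 1 - p0 = i" "N - 1 - Suc p0 = i - 1" "N - (i - 1) = p0 + 2"
  "N - i = Suc p0" "N - Suc i = p0" "N - 1 - i = p0" "N - 1 - (i - 1) = Suc p0"
  using i by (auto simp: p0_def N_def)

text \<open>The elementary matrix with entry y in position (p0 + 1, p0); unitarity for the
  antidiagonal form forces the companion entry - cj y in the reflected position (i, i - 1).\<close>

definition umat :: "'a \<Rightarrow> 'a mat" where
  "umat y = Matrix.mat N N (\<lambda>(a, b). (if b = a then 1 else 0) + (if b = p0 then (if a = Suc p0 then y else 0) else 0) +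
     (if b = i - 1 then (if a = i then - cj y else 0) else 0))"

definition tau :: "nat \<Rightarrow> nat" where
  "tau a = (if a = p0 then Suc p0 else if a = Suc p0 then p0 else if a = i then i - 1 else if a = i - 1 then i else a)"

definition wmat :: "'a mat" where
  "wmat = Matrix.mat N N (\<lambda>(a, b). if b = tau a then 1 else 0)"

lemma umat_carrier: "umat y \<in> carrier_mat N N" and wmat_carrier: "wmat \<in> carrier_mat N N"
  by (simp_all add: umat_def wmat_def)

lemma umat_entry:
  "a < N \<Longrightarrow> b < N \<Longrightarrow> umat y $$ (a, b) = (if b = a then 1 else 0) +
     (if b = p0 then (if a = Suc p0 then y else 0) else 0) + (if b = i - 1 then (if a = i then - cj y else 0) else 0)"
  by (simp add: umat_def)

lemma wmat_entry: "a < N \<Longrightarrow> b < N \<Longrightarrow> wmat $$ (a, b) = (if b = tau a then 1 else 0)"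
  by (simp add: wmat_def)

lemma tau_less: "a < N \<Longrightarrow> tau a < N"
  using index_facts(1,2,3) by (auto simp: tau_def)

lemma tau_tau: "tau (tau a) = a"
  using index_facts(1,2,3) i by (auto simp: tau_def)

lemma tau_swaps: "tau p0 = Suc p0" "tau (Suc p0) = p0" "tau i = i - 1" "tau (i - 1) = i"
  using index_facts(1,2,3) i by (auto simp: tau_def)

text \<open>Compatibility with index reversal is the unitarity of the permutation matrix, and it is
  the reason why \<open>tau\<close> must exchange the mirrored pair as well.\<close>

lemma tau_reflect:
  assumes "a < N" shows "tau (N - 1 - a) = N - 1 - tau a"
proof -
  consider "a = p0" | "a = Suc p0" | "a = i" | "a = i - 1" | "a \<notin> {p0, Suc p0, i, i - 1}" by blast
  thus ?thesis
  proof cases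
    case 5
    have refl: "N - 1 - (N - 1 - a) = a" using assms by simp
    have "N - 1 - a \<notin> {p0, Suc p0, i, i - 1}"
    proof
      assume "N - 1 - a \<in> {p0, Suc p0, i, i - 1}"
      hence "N - 1 - (N - 1 - a) \<in> {p0, Suc p0, i, i - 1}"
        using index_facts(4,5,9,10) by (elim insertE emptyE) (simp_all only: insert_iff simp_thms)
      thus False using 5 refl by simp
    qed
    thus ?thesis using 5 by (simp only: tau_def insert_iff empty_iff de_Morgan_disj if_False simp_thms)
  qed (simp_all only: tau_swaps index_facts(4,5,9,10))
qed

lemma sum_umat:
  assumes "a < N"
  shows "(\<Sum>c<N. umat y $$ (a, c) * g c) = g a + (if a = Suc p0 then y * g p0 else 0) + (if a = i then - cj y * g (i - 1) else 0)"
proof -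
  have "(\<Sum>c<N. umat y $$ (a, c) * g c) = (\<Sum>c<N. (if c = a then g c else 0) +
      (if c = p0 then (if a = Suc p0 then y * g c else 0) else 0) + (if c = i - 1 then (if a = i then - cj y * g c else 0) else 0))"
    using assms by (intro sum.cong refl) (auto simp: umat_entry algebra_simps)
  also have "\<dots> = g a + (if a = Suc p0 then y * g p0 else 0) + (if a = i then - cj y * g (i - 1) else 0)"
    using assms index_facts(1,2) by (auto simp: sum.distrib)
  finally show ?thesis .
qed

lemma sum_umat_cj:
  assumes "a < N"
  shows "(\<Sum>c<N. g c * cj (umat y $$ (a, c))) = g a + (if a = Suc p0 then cj y * g p0 else 0) + (if a = i then - y * g (i - 1) else 0)"
proof -
  have "(\<Sum>c<N. g c * cj (umat y $$ (a, c))) = cj (\<Sum>c<N. umat y $$ (a, c) * cj (g c))"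
    by (simp add: cj_sum cj_mult mult.commute)
  also have "\<dots> = g a + (if a = Suc p0 then cj y * g p0 else 0) + (if a = i then - y * g (i - 1) else 0)"
    unfolding sum_umat[OF assms] by (simp add: cj_add cj_mult)
  finally show ?thesis .
qed

lemma umat_inverse: "umat y * umat (- y) = 1\<^sub>m N"
proof (rule eq_matI)
  fix a b assume "a < dim_row (1\<^sub>m N :: 'a mat)" "b < dim_col (1\<^sub>m N :: 'a mat)"
  hence ab: "a < N" "b < N" by auto
  have "(umat y * umat (- y)) $$ (a, b) = (\<Sum>c<N. umat y $$ (a, c) * umat (- y) $$ (c, b))"
    by (rule mult_mat_entry[OF umat_carrier umat_carrier ab])
  also have "\<dots> = (if b = a then 1 else 0)"
    unfolding sum_umat[OF ab(1)] using ab index_facts(1,2,3) by (auto simp: umat_entry)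
  finally show "(umat y * umat (- y)) $$ (a, b) = 1\<^sub>m N $$ (a, b)" using ab by auto
qed (use umat_carrier[of y] umat_carrier[of "- y"] in auto)

lemma wmat_inverse: "wmat * wmat = 1\<^sub>m N"
proof (rule eq_matI)
  fix a b assume "a < dim_row (1\<^sub>m N :: 'a mat)" "b < dim_col (1\<^sub>m N :: 'a mat)"
  hence ab: "a < N" "b < N" by auto
  have "(wmat * wmat) $$ (a, b) = (\<Sum>c<N. wmat $$ (a, c) * wmat $$ (c, b))"
    by (rule mult_mat_entry[OF wmat_carrier wmat_carrier ab])
  also have "\<dots> = (\<Sum>c<N. if c = tau a then wmat $$ (c, b) else 0)"
    using ab by (intro sum.cong refl) (simp add: wmat_entry)
  also have "\<dots> = (if b = a then 1 else 0)"
    using ab tau_less[of a] by (simp add: wmat_entry tau_tau)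
  finally show "(wmat * wmat) $$ (a, b) = 1\<^sub>m N $$ (a, b)" using ab by auto
qed (use wmat_carrier in auto)

lemma umat_pair:
  assumes "nv y \<le> 1" shows "inverse_pair (umat y) (umat (- y))"
proof -
  have "umat y $$ (N - 1 - a, b) = cj (umat (- y) $$ (N - 1 - b, a))" if ab: "a < N" "b < N" for a b
  proof -
    have lt: "N - 1 - a < N" "N - 1 - b < N" using ab by auto
    have e1: "b = N - 1 - a \<longleftrightarrow> a = N - 1 - b" using ab by auto
    \<comment> \<open>Index reversal together with transposition interchanges the two off-diagonal
      positions of \<open>umat\<close>, which is where the entries y and - cj y correspond.\<close>
    have e2: "b = p0 \<and> N - 1 - a = Suc p0 \<longleftrightarrow> a = i - 1 \<and> N - 1 - b = i"
      using ab i unfolding N_def p0_def by linarith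
    have e3: "b = i - 1 \<and> N - 1 - a = i \<longleftrightarrow> a = p0 \<and> N - 1 - b = Suc p0"
      using ab i unfolding N_def p0_def by linarith
    have if2: "(if P then (if R then t else 0) else 0) = (if P \<and> R then t else 0)" for P R and t :: 'a by simp
    have "(if A then 1 else 0) + (if B then y else 0) + (if C then - cj y else 0)
        = cj (if A then 1 else 0) + cj (if C then - y else 0) + cj (if B then - cj (- y) else 0)" for A B C
      by (cases A; cases B; cases C) simp_all
    thus ?thesis
      unfolding umat_entry[OF lt(1) ab(2)] umat_entry[OF lt(2) ab(1)] cj_add if2 e1 e2 e3 .
  qed
  moreover have "nv (umat z $$ (a, b)) \<le> 1" if "nv z \<le> 1" "a < N" "b < N" for z a b
    using that unfolding umat_entry[OF that(2,3)] by (intro nv_add_le) auto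
  ultimately show ?thesis
    using umat_carrier umat_inverse[of y] umat_inverse[of "- y"] assms nv_minus[of y]
    unfolding inverse_pair_def minus_minus by presburger
qed

lemma wmat_pair: "inverse_pair wmat wmat"
proof -
  have "wmat $$ (N - 1 - a, b) = cj (wmat $$ (N - 1 - b, a))" if ab: "a < N" "b < N" for a b
  proof -
    have lt: "N - 1 - a < N" "N - 1 - b < N" using ab by auto
    have "b = tau (N - 1 - a) \<longleftrightarrow> a = tau (N - 1 - b)"
    proof -
      have "b = tau (N - 1 - a) \<longleftrightarrow> b = N - 1 - tau a" using tau_reflect[OF ab(1)] by simp
      also have "\<dots> \<longleftrightarrow> tau a = N - 1 - b" using tau_less[OF ab(1)] ab by auto
      also have "\<dots> \<longleftrightarrow> a = tau (N - 1 - b)" using tau_tau by metis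
      finally show ?thesis .
    qed
    thus ?thesis unfolding wmat_entry[OF lt(1) ab(2)] wmat_entry[OF lt(2) ab(1)] by auto
  qed
  moreover have "nv (wmat $$ (a, b)) \<le> 1" if "a < N" "b < N" for a b
    using that by (simp add: wmat_entry)
  ultimately show ?thesis
    using wmat_carrier wmat_inverse unfolding inverse_pair_def by blast
qed

text \<open>Only the corner of size i separates row \<open>p0\<close> from row p0 + 1. The mirrored
  rows i - 1 and i lie above every corner of size at most n, so their companion entry never
  enters.\<close>

lemma D_umat:
  assumes "nv y \<le> 1" "h \<in> K" "j \<le> n" "j \<noteq> i" shows "nv (D j (umat y * h)) = nv (D j h)"
proof (rule nv_D_translate[OF umat_pair[OF assms(1)] assms(2)])
  show "j \<le> N" using assms by (simp add: N_def)
  fix a c assume ac: "N - j \<le> a" "a < N" "c < N - j"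
  have "c \<noteq> a" "\<not> (c = p0 \<and> a = Suc p0)" "a \<noteq> i" "c < N"
    using ac assms(3,4) i unfolding N_def p0_def by linarith+
  thus "umat y $$ (a, c) = 0 \<and> umat (- y) $$ (a, c) = 0"
    using ac by (auto simp: umat_entry)
qed

lemma D_wmat:
  assumes "h \<in> K" "j \<le> n" "j \<noteq> i" shows "nv (D j (wmat * h)) = nv (D j h)"
proof (rule nv_D_translate[OF wmat_pair assms(1)])
  show "j \<le> N" using assms by (simp add: N_def)
  fix a c assume ac: "N - j \<le> a" "a < N" "c < N - j"
  have "c < a" "\<not> (c = p0 \<and> a = Suc p0)" "a \<noteq> i" "a \<noteq> i - 1" "c < N"
    using ac assms(2,3) i unfolding N_def p0_def by linarith+
  thus "wmat $$ (a, c) = 0 \<and> wmat $$ (a, c) = 0"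
    using ac by (auto simp: wmat_entry tau_def)
qed

lemma Y_umat:
  assumes "nv y \<le> 1" "h \<in> K" "p0 \<le> a" "a < N" "p0 \<le> b" "b < N"
  shows "Y (umat y * h) $$ (a, b) = Y h $$ (a, b) + (if a = Suc p0 then y * Y h $$ (p0, b) else 0) +
     (if b = Suc p0 then cj y * (Y h $$ (a, p0) + (if a = Suc p0 then y * Y h $$ (p0, p0) else 0)) else 0)"
proof -
  have ne: "a \<noteq> i" "b \<noteq> i" using assms index_facts(1,2) by auto
  have "Y (umat y * h) $$ (a, b) = (\<Sum>c<N. \<Sum>d<N. umat y $$ (a, c) * Y h $$ (c, d) * cj (umat y $$ (b, d)))"
    unfolding Y_mult[OF inverse_pair_in_K[OF umat_pair[OF assms(1)]] assms(2)]
    by (rule conj_transpose_mult_mult_entry[OF umat_carrier Y_carrier[OF assms(2)] assms(4,6)])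
  also have "\<dots> = (\<Sum>d<N. \<Sum>c<N. umat y $$ (a, c) * Y h $$ (c, d) * cj (umat y $$ (b, d)))"
    by (rule sum.swap)
  also have "\<dots> = (\<Sum>d<N. (\<Sum>c<N. umat y $$ (a, c) * Y h $$ (c, d)) * cj (umat y $$ (b, d)))"
    by (simp add: sum_distrib_right)
  also have "\<dots> = (\<Sum>d<N. (Y h $$ (a, d) + (if a = Suc p0 then y * Y h $$ (p0, d) else 0)) * cj (umat y $$ (b, d)))"
    unfolding sum_umat[OF assms(4), of y] using ne by simp
  also have "\<dots> = Y h $$ (a, b) + (if a = Suc p0 then y * Y h $$ (p0, b) else 0) +
     (if b = Suc p0 then cj y * (Y h $$ (a, p0) + (if a = Suc p0 then y * Y h $$ (p0, p0) else 0)) else 0)"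
    unfolding sum_umat_cj[OF assms(6), of _ y] using ne by simp
  finally show ?thesis .
qed

lemma Y_wmat:
  assumes "h \<in> K" "a < N" "b < N" shows "Y (wmat * h) $$ (a, b) = Y h $$ (tau a, tau b)"
proof -
  have "Y (wmat * h) $$ (a, b) = (\<Sum>c<N. \<Sum>d<N. wmat $$ (a, c) * Y h $$ (c, d) * cj (wmat $$ (b, d)))"
    unfolding Y_mult[OF inverse_pair_in_K[OF wmat_pair] assms(1)]
    by (rule conj_transpose_mult_mult_entry[OF wmat_carrier Y_carrier[OF assms(1)] assms(2,3)])
  also have "\<dots> = (\<Sum>c<N. if c = tau a then (\<Sum>d<N. if d = tau b then Y h $$ (c, d) else 0) else 0)"
    using assms by (intro sum.cong refl) (auto simp: wmat_entry if_distrib[of cj] if_distrib[of "(*) _"] cong: if_cong)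
  also have "\<dots> = Y h $$ (tau a, tau b)"
    using tau_less assms by simp
  finally show ?thesis .
qed

definition S :: "'a mat \<Rightarrow> nat \<Rightarrow> nat \<Rightarrow> 'a" where "S h a b = schur (i - 1) (Y h) a b"

lemma Y_dims: "h \<in> K \<Longrightarrow> dim_row (Y h) = N" "h \<in> K \<Longrightarrow> dim_col (Y h) = N"
  using Y_carrier by auto

lemma corner_eqI:
  assumes "h \<in> K" "h' \<in> K" "\<And>a b. p0 + 2 \<le> a \<Longrightarrow> a < N \<Longrightarrow> p0 + 2 \<le> b \<Longrightarrow> b < N \<Longrightarrow> Y h $$ (a, b) = Y h' $$ (a, b)"
  shows "corner (i - 1) (Y h) = corner (i - 1) (Y h')"
proof -
  have "p0 + 2 + a < N" if "a < i - 1" for a using that i by (auto simp: p0_def N_def)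
  thus ?thesis
    using assms index_facts(6) by (intro eq_matI) (auto simp: corner_def Y_dims)
qed

text \<open>The unipotent leaves the corner of size i - 1 and its adjugate untouched, and the Schur
  complement is additive in the row and in the column outside that corner. It therefore transforms
  like the two by two block itself.\<close>

lemma S_umat:
  assumes y: "nv y \<le> 1" and h: "h \<in> K" and ab: "a \<in> {p0, Suc p0}" "b \<in> {p0, Suc p0}"
  shows "S (umat y * h) a b = S h a b + (if a = Suc p0 then y * S h p0 b else 0) +
     (if b = Suc p0 then cj y * (S h a p0 + (if a = Suc p0 then y * S h p0 p0 else 0)) else 0)"
proof -
  have uh: "umat y * h \<in> K" by (rule K_mult[OF inverse_pair_in_K[OF umat_pair[OF y]] h])
  have Yu: "Y (umat y * h) $$ (a, b) = Y h $$ (a, b) + (if a = Suc p0 then y * Y h $$ (p0, b) else 0) +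
     (if b = Suc p0 then cj y * (Y h $$ (a, p0) + (if a = Suc p0 then y * Y h $$ (p0, p0) else 0)) else 0)"
    if "p0 \<le> a" "a < N" "p0 \<le> b" "b < N" for a b by (rule Y_umat[OF y h that])
  have cor: "corner (i - 1) (Y (umat y * h)) = corner (i - 1) (Y h)"
    using Yu by (intro corner_eqI[OF uh h]) auto
  have lt: "p0 + 2 + r < N" if "r < i - 1" for r using that i by (auto simp: p0_def N_def)
  have ab': "p0 \<le> a" "a < N" "p0 \<le> b" "b < N" using ab index_facts(1) by auto
  define A where "A r c = adj_mat (corner (i - 1) (Y h)) $$ (r, c)" for r c
  define L where "L a b = (\<Sum>r<i - 1. \<Sum>c<i - 1. Y h $$ (a, p0 + 2 + r) * A r c * Y h $$ (p0 + 2 + c, b))" for a b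
  have SL: "S h a b = Determinant.det (corner (i - 1) (Y h)) * Y h $$ (a, b) - L a b" for a b
    by (simp only: S_def schur_def L_def A_def Y_dims[OF h] index_facts(6))
  have "(\<Sum>r<i - 1. \<Sum>c<i - 1. Y (umat y * h) $$ (a, p0 + 2 + r) * A r c * Y (umat y * h) $$ (p0 + 2 + c, b))
      = (\<Sum>r<i - 1. \<Sum>c<i - 1. Y h $$ (a, p0 + 2 + r) * A r c * Y h $$ (p0 + 2 + c, b) +
          (if a = Suc p0 then y * (Y h $$ (p0, p0 + 2 + r) * A r c * Y h $$ (p0 + 2 + c, b)) else 0) +
          (if b = Suc p0 then cj y * (Y h $$ (a, p0 + 2 + r) * A r c * Y h $$ (p0 + 2 + c, p0) +
             (if a = Suc p0 then y * (Y h $$ (p0, p0 + 2 + r) * A r c * Y h $$ (p0 + 2 + c, p0)) else 0)) else 0))"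
  proof (intro sum.cong refl)
    fix r c assume "r \<in> {..<i - 1}" "c \<in> {..<i - 1}"
    hence rc: "p0 + 2 + r < N" "p0 + 2 + c < N" by (blast intro: lt)+
    have r1: "p0 \<le> p0 + 2 + r" "p0 + 2 + r \<noteq> Suc p0" and c1: "p0 \<le> p0 + 2 + c" "p0 + 2 + c \<noteq> Suc p0"
      by simp_all
    have 1: "Y (umat y * h) $$ (a, p0 + 2 + r) = Y h $$ (a, p0 + 2 + r) + (if a = Suc p0 then y * Y h $$ (p0, p0 + 2 + r) else 0)"
      unfolding Yu[OF ab'(1,2) r1(1) rc(1)] using r1(2) by (simp only: if_False add_0_right)
    have 2: "Y (umat y * h) $$ (p0 + 2 + c, b) = Y h $$ (p0 + 2 + c, b) + (if b = Suc p0 then cj y * Y h $$ (p0 + 2 + c, p0) else 0)"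
      unfolding Yu[OF c1(1) rc(2) ab'(3,4)] using c1(2) by (simp only: if_False add_0_right)
    show "Y (umat y * h) $$ (a, p0 + 2 + r) * A r c * Y (umat y * h) $$ (p0 + 2 + c, b) =
          Y h $$ (a, p0 + 2 + r) * A r c * Y h $$ (p0 + 2 + c, b) +
          (if a = Suc p0 then y * (Y h $$ (p0, p0 + 2 + r) * A r c * Y h $$ (p0 + 2 + c, b)) else 0) +
          (if b = Suc p0 then cj y * (Y h $$ (a, p0 + 2 + r) * A r c * Y h $$ (p0 + 2 + c, p0) +
             (if a = Suc p0 then y * (Y h $$ (p0, p0 + 2 + r) * A r c * Y h $$ (p0 + 2 + c, p0)) else 0)) else 0)"
      unfolding 1 2 by (cases "a = Suc p0"; cases "b = Suc p0") (simp_all add: algebra_simps)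
  qed
  also have "\<dots> = L a b + (if a = Suc p0 then y * L p0 b else 0) +
     (if b = Suc p0 then cj y * (L a p0 + (if a = Suc p0 then y * L p0 p0 else 0)) else 0)"
    unfolding L_def
    by (cases "a = Suc p0"; cases "b = Suc p0") (simp_all add: sum.distrib sum_distrib_left distrib_left)
  finally have L': "(\<Sum>r<i - 1. \<Sum>c<i - 1. Y (umat y * h) $$ (a, p0 + 2 + r) * A r c * Y (umat y * h) $$ (p0 + 2 + c, b))
      = L a b + (if a = Suc p0 then y * L p0 b else 0) +
     (if b = Suc p0 then cj y * (L a p0 + (if a = Suc p0 then y * L p0 p0 else 0)) else 0)" .
  have Yab: "Y (umat y * h) $$ (a, b) = Y h $$ (a, b) + (if a = Suc p0 then y * Y h $$ (p0, b) else 0) +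
     (if b = Suc p0 then cj y * (Y h $$ (a, p0) + (if a = Suc p0 then y * Y h $$ (p0, p0) else 0)) else 0)"
    by (rule Yu[OF ab'])
  have "S (umat y * h) a b = Determinant.det (corner (i - 1) (Y h)) * Y (umat y * h) $$ (a, b) -
      (\<Sum>r<i - 1. \<Sum>c<i - 1. Y (umat y * h) $$ (a, p0 + 2 + r) * A r c * Y (umat y * h) $$ (p0 + 2 + c, b))"
    by (simp only: S_def schur_def A_def Y_dims[OF uh] index_facts(6) cor)
  thus ?thesis
    unfolding L' Yab SL by (cases "a = Suc p0"; cases "b = Suc p0") (simp_all add: algebra_simps)
qed

lemma S_wmat:
  assumes h: "h \<in> K" and ab: "a \<in> {p0, Suc p0}" "b \<in> {p0, Suc p0}"
  shows "S (wmat * h) a b = S h (tau a) (tau b)"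
proof -
  have wh: "wmat * h \<in> K" by (rule K_mult[OF inverse_pair_in_K[OF wmat_pair] h])
  have fix_tau: "tau a = a" if "p0 + 2 \<le> a" for a
    using that index_facts(1,2,3) by (auto simp: tau_def)
  have lt: "p0 + 2 + r < N" if "r < i - 1" for r using that i by (auto simp: p0_def N_def)
  have ab': "a < N" "b < N" using ab index_facts(1,2) by auto
  have cor: "corner (i - 1) (Y (wmat * h)) = corner (i - 1) (Y h)"
    by (intro corner_eqI[OF wh h]) (simp add: Y_wmat[OF h] fix_tau)
  have "(\<Sum>r<i - 1. \<Sum>c<i - 1. Y (wmat * h) $$ (a, p0 + 2 + r) * adj_mat (corner (i - 1) (Y h)) $$ (r, c) * Y (wmat * h) $$ (p0 + 2 + c, b))
      = (\<Sum>r<i - 1. \<Sum>c<i - 1. Y h $$ (tau a, p0 + 2 + r) * adj_mat (corner (i - 1) (Y h)) $$ (r, c) * Y h $$ (p0 + 2 + c, tau b))"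
  proof (intro sum.cong refl)
    fix r c assume "r \<in> {..<i - 1}" "c \<in> {..<i - 1}"
    hence rc: "p0 + 2 + r < N" "p0 + 2 + c < N" by (blast intro: lt)+
    have "tau (p0 + 2 + r) = p0 + 2 + r" "tau (p0 + 2 + c) = p0 + 2 + c" by (rule fix_tau; simp)+
    thus "Y (wmat * h) $$ (a, p0 + 2 + r) * adj_mat (corner (i - 1) (Y h)) $$ (r, c) * Y (wmat * h) $$ (p0 + 2 + c, b)
        = Y h $$ (tau a, p0 + 2 + r) * adj_mat (corner (i - 1) (Y h)) $$ (r, c) * Y h $$ (p0 + 2 + c, tau b)"
      by (simp only: Y_wmat[OF h ab'(1) rc(1)] Y_wmat[OF h rc(2) ab'(2)])
  qed
  thus ?thesis
    by (simp only: S_def schur_def Y_dims[OF h] Y_dims[OF wh] index_facts(6) cor Y_wmat[OF h ab'])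
qed

lemma S_herm:
  assumes "h \<in> K" "a < N" "b < N" shows "cj (S h a b) = S h b a"
  unfolding S_def by (rule schur_hermitian[OF Y_carrier[OF assms(1)] Y_herm[OF assms(1)] _ assms(2,3)])
    (use i in \<open>auto simp: N_def\<close>)

text \<open>The index i is omitted because d_i is the one minor whose size the translations change;
  this makes the set stable under them, unlike the actual domain of integration
  \<open>Om\<close>.\<close>

definition Om' :: "'a mat set" where "Om' = {h \<in> K. \<forall>j\<in>{1..n} - {i}. D j h \<noteq> 0}"

definition Om :: "'a mat set" where "Om = {h \<in> K. \<forall>j\<in>{1..n}. D j h \<noteq> 0}"

definition tr :: "'a mat \<Rightarrow> 'a \<times> 'a \<times> 'a" where
  "tr h = (if h \<in> Om' then (S h p0 p0, S h p0 (Suc p0), S h (Suc p0) (Suc p0)) else (0, 0, 0))"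

text \<open>The value 0 off \<open>Om'\<close> is harmless for the integral, where some minor
  vanishes anyway, and makes measurability accessible: the minors are known to be measurable only
  when cut off outside \<open>Om\<close>. Index 0 keeps the value 1 of the empty minor.\<close>

definition Dm :: "nat \<Rightarrow> 'a mat \<Rightarrow> 'a" where
  "Dm j h = (if h \<in> Om' \<and> j \<le> n then D j h else if j = 0 then 1 else 0)"

lemma D_0: "D 0 h = 1"
  by (simp add: D_def lower_right_minor_eq)

lemma D_lower_nonzero: "h \<in> Om' \<Longrightarrow> D (i - 1) h \<noteq> 0"
proof (cases "i = 1")
  case False
  assume "h \<in> Om'"
  moreover have "i - 1 \<in> {1..n} - {i}" using False i by auto
  ultimately show ?thesis unfolding Om'_def by blast
qed (simp add: D_0)

text \<open>Sylvester's identity for blocks of size 1 and 2, divided by d_{i-1}, which is nonzero on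
  \<open>Om'\<close>.\<close>

lemma S_minors:
  assumes "h \<in> Om'"
  shows "S h (Suc p0) (Suc p0) = D i h"
    and "S h p0 p0 * S h (Suc p0) (Suc p0) - S h p0 (Suc p0) * S h (Suc p0) p0 = D (i - 1) h * D (i + 1) h"
proof -
  have h: "h \<in> K" using assms by (simp add: Om'_def)
  have nz: "D (i - 1) h \<noteq> 0" by (rule D_lower_nonzero[OF assms])
  have "D i h * D (i - 1) h ^ 1 = Determinant.det (Matrix.mat 1 1 (\<lambda>(a, b). S h (Suc p0 + a) (Suc p0 + b))) * D (i - 1) h"
  proof -
    have "1 + (i - 1) = i" "1 + (i - 1) \<le> N" using i by (auto simp: N_def)
    with lower_right_minor_schur[OF Y_carrier[OF h], of 1 "i - 1"] show ?thesis
      unfolding index_facts(10) D_def S_def by (simp only:)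
  qed
  moreover have "Determinant.det (Matrix.mat 1 1 (\<lambda>(a, b). S h (Suc p0 + a) (Suc p0 + b))) = S h (Suc p0) (Suc p0)"
    by (subst det_single) auto
  ultimately show "S h (Suc p0) (Suc p0) = D i h" using nz by simp
  have "2 + (i - 1) = i + 1" "N - 2 - (i - 1) = p0" "2 + (i - 1) \<le> N" using i by (simp_all add: N_def p0_def)
  with lower_right_minor_schur[OF Y_carrier[OF h], of 2 "i - 1"]
  have "D (i + 1) h * D (i - 1) h ^ 2 = Determinant.det (Matrix.mat 2 2 (\<lambda>(a, b). S h (p0 + a) (p0 + b))) * D (i - 1) h"
    unfolding D_def S_def by (simp only:)
  moreover have "Determinant.det (Matrix.mat 2 2 (\<lambda>(a, b). S h (p0 + a) (p0 + b)))
      = S h p0 p0 * S h (Suc p0) (Suc p0) - S h p0 (Suc p0) * S h (Suc p0) p0"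
    by (subst det_2x2) auto
  ultimately show "S h p0 p0 * S h (Suc p0) (Suc p0) - S h p0 (Suc p0) * S h (Suc p0) p0 = D (i - 1) h * D (i + 1) h"
    using nz by (simp add: power2_eq_square mult.commute)
qed

lemma tr_herm: assumes "h \<in> K" shows "tr h \<in> herm"
proof -
  have "p0 < N" using index_facts(1) by simp
  hence "cj (S h p0 p0) = S h p0 p0" "cj (S h (Suc p0) (Suc p0)) = S h (Suc p0) (Suc p0)"
    using S_herm[OF assms] index_facts(1) by auto
  thus ?thesis by (simp add: tr_def herm_def cj_eq_iff)
qed

lemma dt_tr: assumes "h \<in> K" shows "dt (tr h) = Dm (i - 1) h * Dm (i + 1) h"
proof (cases "h \<in> Om'")
  case True
  have "nrm (S h p0 (Suc p0)) = S h p0 (Suc p0) * S h (Suc p0) p0"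
    using S_herm[OF assms, of p0 "Suc p0"] index_facts(1) by (simp add: nrm_def)
  thus ?thesis using True S_minors(2)[OF True] i by (simp add: tr_def dt_def Dm_def)
qed (simp add: tr_def dt_def Dm_def nrm_def)

lemma ga_tr: assumes "h \<in> K" shows "snd (snd (tr h)) = Dm i h"
  using S_minors(1)[of h] i by (auto simp: tr_def Dm_def)

lemma nv_eq_imp_zero_iff: "nv a = nv b \<Longrightarrow> a = 0 \<longleftrightarrow> b = 0"
  by (metis nv_eq_0_iff)

lemma Om'_umat: "nv y \<le> 1 \<Longrightarrow> h \<in> K \<Longrightarrow> umat y * h \<in> Om' \<longleftrightarrow> h \<in> Om'"
  using K_mult[OF inverse_pair_in_K[OF umat_pair], of y h] nv_eq_imp_zero_iff[OF D_umat, of y h] unfolding Om'_def by auto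

lemma Om'_wmat: "h \<in> K \<Longrightarrow> wmat * h \<in> Om' \<longleftrightarrow> h \<in> Om'"
  using K_mult[OF inverse_pair_in_K[OF wmat_pair], of h] nv_eq_imp_zero_iff[OF D_wmat, of h] unfolding Om'_def by auto

lemma tr_umat:
  assumes "nv y \<le> 1" "h \<in> K" shows "tr (umat y * h) = trn y (tr h)"
proof (cases "h \<in> Om'")
  case True
  have cjS: "cj (S h p0 (Suc p0)) = S h (Suc p0) p0" using S_herm[OF assms(2), of p0 "Suc p0"] index_facts(1) by simp
  show ?thesis
    using True Om'_umat[OF assms] S_umat[OF assms]
    by (simp add: tr_def trn_def nrm_def cj_mult cjS algebra_simps)
next
  case False
  thus ?thesis using Om'_umat[OF assms] by (simp add: tr_def trn_def)
qed

lemma tr_wmat: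
  assumes "h \<in> K" shows "tr (wmat * h) = swp (tr h)"
proof (cases "h \<in> Om'")
  case True
  have cjS: "cj (S h p0 (Suc p0)) = S h (Suc p0) p0" using S_herm[OF assms, of p0 "Suc p0"] index_facts(1) by simp
  have t: "tau p0 = Suc p0" "tau (Suc p0) = p0" by (auto simp: tau_def)
  show ?thesis
    using True Om'_wmat[OF assms] S_wmat[OF assms] by (simp add: tr_def swp_def cjS t)
next
  case False
  thus ?thesis using Om'_wmat[OF assms] by (simp add: tr_def swp_def)
qed

lemma Dm_umat: "j \<le> n \<Longrightarrow> j \<noteq> i \<Longrightarrow> nv y \<le> 1 \<Longrightarrow> h \<in> K \<Longrightarrow> nv (Dm j (umat y * h)) = nv (Dm j h)"
  using D_umat[of y h j] Om'_umat[of y h] by (simp add: Dm_def)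

lemma Dm_wmat: "j \<le> n \<Longrightarrow> j \<noteq> i \<Longrightarrow> h \<in> K \<Longrightarrow> nv (Dm j (wmat * h)) = nv (Dm j h)"
  using D_wmat[of h j] Om'_wmat[of h] by (simp add: Dm_def)

definition shifts :: "'a mat set" where "shifts = insert wmat (umat ` res)"

lemma shifts: "finite shifts" "shifts \<noteq> {}"
  by (auto simp: shifts_def finite_res)

lemma shifts_cases:
  assumes "u \<in> shifts" obtains "u = wmat" | y where "u = umat y" "nv y \<le> 1"
  using assms nv_res_le by (auto simp: shifts_def)

lemma shifts_measurable: "u \<in> shifts \<Longrightarrow> (\<lambda>h. u * h) \<in> measurable M M"
  by (erule shifts_cases) (simp_all add: translation(1)[OF wmat_pair] translation(1)[OF umat_pair])

lemma shifts_K: "u \<in> shifts \<Longrightarrow> h \<in> K \<Longrightarrow> u * h \<in> K"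
  by (erule shifts_cases) (simp_all add: K_mult inverse_pair_in_K[OF wmat_pair] inverse_pair_in_K[OF umat_pair])

lemma shifts_Om': "u \<in> shifts \<Longrightarrow> h \<in> K \<Longrightarrow> u * h \<in> Om' \<longleftrightarrow> h \<in> Om'"
  by (erule shifts_cases) (simp_all add: Om'_umat Om'_wmat)

lemma shifts_D: "u \<in> shifts \<Longrightarrow> h \<in> K \<Longrightarrow> j \<le> n \<Longrightarrow> j \<noteq> i \<Longrightarrow> nv (D j (u * h)) = nv (D j h)"
  by (erule shifts_cases) (simp_all add: D_umat D_wmat)

lemma dt_tr_nonzero: assumes "h \<in> Om'" shows "dt (tr h) \<noteq> 0"
proof -
  have "h \<in> K" using assms by (simp add: Om'_def)
  moreover have "i + 1 \<in> {1..n} - {i}" using i by auto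
  hence "D (i + 1) h \<noteq> 0" using assms unfolding Om'_def by blast
  ultimately show ?thesis
    using dt_tr D_lower_nonzero[OF assms] assms i by (simp add: Dm_def)
qed

text \<open>Some translate by a point of the projective line attains the norm of the form in its
  lower entry, and no translate exceeds it. The norm thus becomes a finite maximum of translates of
  |d_i| and inherits its measurability.\<close>

lemma nm_tr:
  assumes h: "h \<in> K" shows "nm (tr h) = Max ((\<lambda>u. nv (Dm i (u * h))) ` shifts)"
proof (cases "h \<in> Om'")
  case True
  have ga: "nv (Dm i (umat y * h)) = nv (snd (snd (trn y (tr h))))" if "nv y \<le> 1" for y
    using ga_tr[OF K_mult[OF inverse_pair_in_K[OF umat_pair[OF that]] h]] tr_umat[OF that h] by simp
  have gw: "nv (Dm i (wmat * h)) = nv (snd (snd (swp (tr h))))"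
    using ga_tr[OF K_mult[OF inverse_pair_in_K[OF wmat_pair] h]] tr_wmat[OF h] by simp
  have le: "nv (Dm i (u * h)) \<le> nm (tr h)" if "u \<in> shifts" for u
    using that
  proof (cases rule: shifts_cases)
    case 1
    have "nv (snd (snd (swp (tr h)))) \<le> nm (swp (tr h))" by (cases "swp (tr h)") (simp add: nm_def)
    thus ?thesis using 1 gw nm_swp by simp
  next
    case (2 y)
    have "nv (snd (snd (trn y (tr h)))) \<le> nm (trn y (tr h))" by (cases "trn y (tr h)") (simp add: nm_def)
    thus ?thesis using 2 ga nm_trn[OF 2(2) tr_herm[OF h]] by simp
  qed
  have "\<exists>u\<in>shifts. nm (tr h) = nv (Dm i (u * h))"
    using nm_eq_lower_entry[OF tr_herm[OF h] dt_tr_nonzero[OF True]] ga nv_res_le gw by (auto simp: shifts_def)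
  thus ?thesis using le shifts by (intro Max_eqI[symmetric]) auto
next
  case False
  have "Dm i (u * h) = 0" if "u \<in> shifts" for u
    using shifts_Om'[OF that h] False i by (simp add: Dm_def)
  hence "(\<lambda>u. nv (Dm i (u * h))) ` shifts = {0}" using shifts by auto
  thus ?thesis using False by (simp add: tr_def nm_def)
qed

lemma Om_subset: "Om \<subseteq> Om'" "Om' \<subseteq> K"
  by (auto simp: Om_def Om'_def)

lemma Om_iff: "h \<in> Om \<longleftrightarrow> h \<in> Om' \<and> D i h \<noteq> 0"
  using i by (auto simp: Om_def Om'_def)

text \<open>A nondegenerate form is anisotropic in some direction, so a point of \<open>Om'\<close>
  has a translate in \<open>Om\<close>, where |d_j| is unchanged for j different from i. This
  extends measurability from \<open>Om\<close> to \<open>Om'\<close>.\<close>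

lemma nv_Dm_eq:
  assumes h: "h \<in> K" and j: "1 \<le> j" "j \<le> n" "j \<noteq> i"
  shows "nv (Dm j h) = Max ((\<lambda>u. if u * h \<in> Om then nv (D j (u * h)) else 0) ` shifts)"
proof (cases "h \<in> Om'")
  case True
  have "nm (tr h) \<noteq> 0"
  proof
    assume "nm (tr h) = 0"
    hence "tr h = (0, 0, 0)"
      using nv_pos_iff[of "fst (tr h)"] nv_pos_iff[of "fst (snd (tr h))"] nv_pos_iff[of "snd (snd (tr h))"]
      by (cases "tr h") (auto simp: nm_def max_def split: if_splits)
    thus False using dt_tr_nonzero[OF True] by (simp add: dt_def nrm_def)
  qed
  moreover have "nm (tr h) \<in> (\<lambda>u. nv (Dm i (u * h))) ` shifts"
    unfolding nm_tr[OF h] using shifts by (intro Max_in) auto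
  ultimately obtain u where u: "u \<in> shifts" "Dm i (u * h) \<noteq> 0" by (auto simp: nv_eq_0_iff)
  hence "u * h \<in> Om"
    using i by (auto simp: Om_iff Dm_def split: if_splits)
  hence mem: "nv (Dm j h) \<in> (\<lambda>u. if u * h \<in> Om then nv (D j (u * h)) else 0) ` shifts"
    using u shifts_D[OF u(1) h] j True by (intro image_eqI[of _ _ u]) (auto simp: Dm_def)
  have le: "(if u * h \<in> Om then nv (D j (u * h)) else 0) \<le> nv (Dm j h)" if "u \<in> shifts" for u
    using shifts_D[OF that h] j True nv_nonneg by (simp add: Dm_def)
  show ?thesis
    by (rule Max_eqI[symmetric, OF _ _ mem]) (use shifts in simp, use le in blast)
next
  case False
  have "u * h \<notin> Om" if "u \<in> shifts" for u
    using shifts_Om'[OF that h] False Om_subset by blast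
  hence "(\<lambda>u. if u * h \<in> Om then nv (D j (u * h)) else 0) ` shifts = {0}" using shifts by auto
  thus ?thesis using False j by (simp add: Dm_def)
qed

lemma Dm_measurable:
  assumes meas: "\<And>j. j \<in> {1..n} \<Longrightarrow> (\<lambda>h. if h \<in> Om then nv (D j h) else 0) \<in> borel_measurable M"
  shows "(\<lambda>h. nv (Dm j h)) \<in> borel_measurable M"
proof -
  consider "j = 0" | "j > n" | "j = i" | "1 \<le> j" "j \<le> n" "j \<noteq> i" by linarith
  thus ?thesis
  proof cases
    case 1
    have "nv (Dm j h) = 1" for h using 1 D_0 by (simp add: Dm_def)
    thus ?thesis by simp
  next
    case 2
    have "nv (Dm j h) = 0" for h using 2 by (simp add: Dm_def)
    thus ?thesis by simp
  next
    case 3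
    have "nv (Dm j h) = (if h \<in> Om then nv (D j h) else 0)" for h
      using 3 i by (auto simp: Om_iff Dm_def)
    thus ?thesis using meas[of j] 3 i by simp
  next
    case 4
    have "(\<lambda>h. Max ((\<lambda>u. if u * h \<in> Om then nv (D j (u * h)) else 0) ` shifts)) \<in> borel_measurable M"
    proof (intro borel_measurable_Max shifts)
      fix u assume "u \<in> shifts"
      from measurable_compose[OF shifts_measurable[OF this] meas[of j]] 4
      show "(\<lambda>h. if u * h \<in> Om then nv (D j (u * h)) else 0) \<in> borel_measurable M" by simp
    qed
    moreover have "(\<lambda>h. nv (Dm j h)) \<in> borel_measurable M \<longleftrightarrow>
        (\<lambda>h. Max ((\<lambda>u. if u * h \<in> Om then nv (D j (u * h)) else 0) ` shifts)) \<in> borel_measurable M"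
      by (rule measurable_cong, rule nv_Dm_eq) (use 4 in \<open>auto simp: space_M\<close>)
    ultimately show ?thesis by blast
  qed
qed

lemma exchange_family:
  assumes meas: "\<And>j. j \<in> {1..n} \<Longrightarrow> (\<lambda>h. if h \<in> Om then nv (D j h) else 0) \<in> borel_measurable M"
  shows "exchange_family nv p k prm cj M tr (\<lambda>y h. umat y * h) (\<lambda>h. wmat * h) n i Dm"
proof -
  note Dm_meas = Dm_measurable[OF meas]
  obtain a where a: "\<And>j h. j \<le> n \<Longrightarrow> h \<in> K \<Longrightarrow> nv (D j h) \<le> real q ^ a" using D_bdd by blast
  have q1: "1 \<le> real q ^ a" using q_ge_2 by (intro one_le_power) auto
  have Dm_le: "nv (Dm j h) \<le> real q ^ a" if "j \<le> n" "h \<in> K" for j h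
    using a[OF that] q1 by (simp add: Dm_def)
  show ?thesis
  proof unfold_locales
    show "(\<lambda>h. nm (tr h)) \<in> borel_measurable M"
    proof -
      have "(\<lambda>h. Max ((\<lambda>u. nv (Dm i (u * h))) ` shifts)) \<in> borel_measurable M"
        by (intro borel_measurable_Max shifts measurable_compose[OF shifts_measurable Dm_meas])
      moreover have "(\<lambda>h. nm (tr h)) \<in> borel_measurable M \<longleftrightarrow>
          (\<lambda>h. Max ((\<lambda>u. nv (Dm i (u * h))) ` shifts)) \<in> borel_measurable M"
        by (rule measurable_cong) (simp add: space_M nm_tr)
      ultimately show ?thesis by blast
    qed
    show "(\<lambda>h. nv (dt (tr h))) \<in> borel_measurable M"
    proof -
      have "(\<lambda>h. nv (Dm (i - 1) h) * nv (Dm (i + 1) h)) \<in> borel_measurable M"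
        by (intro borel_measurable_times Dm_meas)
      moreover have "(\<lambda>h. nv (dt (tr h))) \<in> borel_measurable M \<longleftrightarrow>
          (\<lambda>h. nv (Dm (i - 1) h) * nv (Dm (i + 1) h)) \<in> borel_measurable M"
        by (rule measurable_cong) (simp add: space_M dt_tr nv_mult)
      ultimately show ?thesis by blast
    qed
    show "(\<lambda>h. nv (snd (snd (tr h)))) \<in> borel_measurable M"
    proof -
      have "(\<lambda>h. nv (snd (snd (tr h)))) \<in> borel_measurable M \<longleftrightarrow> (\<lambda>h. nv (Dm i h)) \<in> borel_measurable M"
        by (rule measurable_cong) (simp add: space_M ga_tr)
      thus ?thesis using Dm_meas by blast
    qed
    show "\<exists>a. \<forall>j\<le>n. \<forall>h\<in>space M. nv (Dm j h) \<le> real q ^ a"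
      using Dm_le by (auto simp: space_M)
    show "\<exists>a. \<forall>h\<in>space M. nm (tr h) \<le> real q ^ a"
    proof (intro exI ballI)
      fix h assume "h \<in> space M"
      thus "nm (tr h) \<le> real q ^ a"
        using nm_tr[of h] shifts shifts_K Dm_le[of i] i by (simp add: space_M)
    qed
  qed (use i Dm_meas tr_herm dt_tr ga_tr tr_umat tr_wmat Dm_umat Dm_wmat translation[OF umat_pair] translation[OF wmat_pair]
        in \<open>auto simp: space_M Dm_def D_0\<close>)
qed

text \<open>Outside \<open>Om'\<close> both products vanish: one of the true minors is 0 there, and
  the modified first minor is 0 by definition.\<close>

lemma prod_Dm_eq:
  assumes "h \<in> K"
  shows "(\<Prod>j=1..n. complex_of_real (nv (Dm j h)) powr s j) = (\<Prod>j=1..n. complex_of_real (nv (D j h)) powr s j)"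
proof (cases "h \<in> Om'")
  case True
  thus ?thesis by (intro prod.cong) (auto simp: Dm_def)
next
  case False
  then obtain j where j: "j \<in> {1..n}" "D j h = 0" using assms unfolding Om'_def by blast
  have "Dm 1 h = 0" using False by (simp add: Dm_def)
  hence "(\<Prod>j=1..n. complex_of_real (nv (Dm j h)) powr s j) = 0"
    using i by (intro prod_zero bexI[of _ 1]) auto
  moreover have "(\<Prod>j=1..n. complex_of_real (nv (D j h)) powr s j) = 0"
    using j by (intro prod_zero bexI[of _ j]) auto
  ultimately show ?thesis by (simp only:)
qed

end

section \<open>Return to the spherical function\<close>

context haar_setup
begin

text \<open>The value 0 of \<open>0 powr s\<close> makes the restriction to nonvanishing minors
  automatic.\<close>

lemma omega_integral_eq:
  assumes "1 \<le> n"
  shows "omega_integral nv cj n M x s = (LINT h|M. (\<Prod>j=1..n. complex_of_real (nv (D j h)) powr s j))"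
  unfolding omega_integral_def set_lebesgue_integral_def
proof (rule Bochner_Integration.integral_cong)
  fix h assume "h \<in> space M"
  show "indicat_real {g \<in> space M. \<forall>j\<in>{1..n}. lower_right_minor j (act cj g x) \<noteq> 0} h *\<^sub>R
      (\<Prod>j=1..n. complex_of_real (nv (lower_right_minor j (act cj h x))) powr s j)
      = (\<Prod>j=1..n. complex_of_real (nv (D j h)) powr s j)"
  proof (cases "\<forall>j\<in>{1..n}. D j h \<noteq> 0")
    case True
    thus ?thesis using \<open>h \<in> space M\<close> by (simp add: D_def Y_def)
  next
    case False
    then obtain j where "j \<in> {1..n}" "D j h = 0" by blast
    hence "(\<Prod>j=1..n. complex_of_real (nv (D j h)) powr s j) = 0"
      by (intro prod_zero bexI[of _ j]) auto
    thus ?thesis unfolding D_def Y_def by (simp only: scaleR_zero_right)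
  qed
qed simp

text \<open>
  A nonzero integral forces its integrand to be measurable; comparing the integrands at nearby exponents then gives
  the measurability of the single minors.
\<close>
lemma minors_measurable:
  assumes "1 \<le> n" and rc: "rational_continuation q n (omega_integral nv cj n M x) P Q"
    and nz: "P (q_power q s0) \<noteq> 0" and j: "j \<in> {1..n}"
  shows "(\<lambda>h. if \<forall>j\<in>{1..n}. D j h \<noteq> 0 then nv (D j h) else 0) \<in> borel_measurable M"
proof -
  define f where "f s h = (\<Prod>j=1..n. complex_of_real (nv (D j h)) powr s j)" for s h
  have q1: "q > 1" using q_ge_2 by simp
  have poly: "polynomial_fun n P" "polynomial_fun n Q" and Q: "\<exists>t. Q t \<noteq> 0"
    using rc by (auto simp: rational_continuation_def)
  \<comment> \<open>Where \<open>F\<close> is nonzero in the domain of convergence, the fraction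
    represents the integral and its value is not 0. Since an integral over a non-integrable function
    is 0 by convention, the integrand is then integrable, hence measurable.\<close>
  define F where "F = (\<lambda>s. P (q_power q s) * Q (q_power q s))"
  have le: "line_entire F"
    unfolding F_def using poly q1 by (intro line_entire_mult polynomial_fun_q_power_line_entire) auto
  have "\<exists>s. F s \<noteq> 0"
  proof (rule ccontr)
    assume "\<not> ?thesis"
    hence 0: "P (q_power q s) * Q (q_power q s) = 0" for s by (auto simp: F_def)
    have "Q (q_power q s) = 0" for s
      by (rule line_entire_mult_eq_0[where F = "\<lambda>s. P (q_power q s)" and G = "\<lambda>s. Q (q_power q s)", OF _ _ 0 nz]) (use poly q1 in \<open>auto intro!: polynomial_fun_q_power_line_entire\<close>)
    thus False using Q polynomial_fun_q_power_nonzero[OF poly(2) q1] by metis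
  qed
  have "\<exists>s. (\<forall>j\<in>{1..n}. 0 < Re (s j)) \<and> F s \<noteq> 0"
  proof (rule ccontr)
    assume "\<not> ?thesis"
    hence neg: "F s = 0" if "\<forall>j\<in>{1..n}. 0 < Re (s j)" for s using that by blast
    have "F s = 0" for s
    proof (rule line_entire_eq_0[OF le, of "\<lambda>_. 1"])
      fix b :: "nat \<Rightarrow> complex"
      have "\<forall>\<^sub>F e in nhds 0. \<forall>i\<in>{1..n}. 0 < Re (1 + e * b i)"
      proof (intro eventually_ball_finite ballI)
        fix i
        have "((\<lambda>e. Re (1 + e * b i)) \<longlongrightarrow> Re (1 + 0 * b i)) (nhds 0)"
          by (intro tendsto_intros filterlim_ident)
        thus "\<forall>\<^sub>F e in nhds 0. 0 < Re (1 + e * b i)"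
          by (rule order_tendstoD) simp
      qed simp
      thus "\<forall>\<^sub>F e in nhds 0. F (\<lambda>i. 1 + e * b i) = 0"
        by eventually_elim (rule neg)
    qed
    with \<open>\<exists>s. F s \<noteq> 0\<close> show False by blast
  qed
  then obtain s where s: "\<And>j. j \<in> {1..n} \<Longrightarrow> 0 < Re (s j)" "F s \<noteq> 0" by blast
  have meas: "f s' \<in> borel_measurable M" if s': "\<And>j. j \<in> {1..n} \<Longrightarrow> 0 < Re (s' j)" "F s' \<noteq> 0" for s'
  proof -
    have "omega_integral nv cj n M x s' = P (q_power q s') / Q (q_power q s')"
      using rc s' unfolding rational_continuation_def F_def by (metis less_imp_le mult_zero_right)
    hence "(LINT h|M. f s' h) \<noteq> 0"
      using s'(2) by (simp add: omega_integral_eq[OF assms(1)] f_def F_def)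
    hence "integrable M (f s')" using not_integrable_integral_eq by blast
    thus ?thesis by (rule borel_measurable_integrable)
  qed
  \<comment> \<open>Only the j-th exponent is perturbed, so the quotient of the two integrands has
    absolute value |d_j|^r, and the power 1/r recovers |d_j|. Where some minor vanishes the quotient
    is 0 / 0 = 0, the prescribed value.\<close>
  define b where "b = (\<lambda>l :: nat. if l = j then 1 else 0 :: complex)"
  have "isCont (\<lambda>e. F (\<lambda>l. s l + e * b l)) 0"
    using line_entireD[OF le, of s b] holomorphic_on_imp_continuous_on continuous_on_interior by fastforce
  hence "\<forall>\<^sub>F e in at 0. F (\<lambda>l. s l + e * b l) \<noteq> 0"
    using s(2) by (intro tendsto_imp_eventually_ne[where c = "F s"]) (auto simp: isCont_def)
  then obtain d where d: "d > 0" "\<And>e. e \<noteq> 0 \<Longrightarrow> norm e < d \<Longrightarrow> F (\<lambda>l. s l + e * b l) \<noteq> 0"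
    unfolding eventually_at by (auto simp: dist_norm)
  define r where "r = d / 2"
  have r: "r > 0" "r < d" using d by (auto simp: r_def)
  define s' where "s' = (\<lambda>l. s l + complex_of_real r * b l)"
  have "F s' \<noteq> 0" unfolding s'_def using r by (intro d(2)) auto
  moreover have "0 < Re (s' l)" if "l \<in> {1..n}" for l using s(1)[OF that] r by (auto simp: s'_def b_def)
  ultimately have m': "f s' \<in> borel_measurable M" by (intro meas)
  have m: "f s \<in> borel_measurable M" by (intro meas s)
  have "(\<lambda>h. (norm (f s' h) / norm (f s h)) powr (1 / r)) \<in> borel_measurable M"
    using m m' by measurable
  moreover have "(norm (f s' h) / norm (f s h)) powr (1 / r) = (if \<forall>j\<in>{1..n}. D j h \<noteq> 0 then nv (D j h) else 0)" for h
  proof (cases "\<forall>j\<in>{1..n}. D j h \<noteq> 0")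
    case True
    have nzf: "f s h \<noteq> 0" using True by (simp add: f_def nv_eq_0_iff)
    have "f s' h = f s h * (\<Prod>l=1..n. complex_of_real (nv (D l h)) powr (complex_of_real r * b l))"
      unfolding f_def s'_def prod.distrib[symmetric] by (simp add: powr_add)
    also have "(\<Prod>l=1..n. complex_of_real (nv (D l h)) powr (complex_of_real r * b l))
        = (\<Prod>l=1..n. if l = j then complex_of_real (nv (D l h)) powr complex_of_real r else 1)"
      using True by (intro prod.cong) (auto simp: b_def nv_eq_0_iff)
    also have "\<dots> = complex_of_real (nv (D j h)) powr complex_of_real r"
      using j by simp
    finally have "norm (f s' h) / norm (f s h) = nv (D j h) powr r"
      using nzf nv_nonneg by (simp add: norm_mult norm_of_real_powr)
    thus ?thesis using True r nv_nonneg j by (simp add: powr_powr nv_eq_0_iff)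
  next
    case False
    then obtain l where "l \<in> {1..n}" "D l h = 0" by blast
    hence "f s h = 0" unfolding f_def by (intro prod_zero bexI[of _ l]) auto
    thus ?thesis using False by auto
  qed
  ultimately show ?thesis by simp
qed

text \<open>If the numerator vanishes at all powers of q, both sides are 0. Otherwise the nonzero
  continuation makes the minors measurable, and the abstract exchange applies for each i.\<close>

lemma cross_rel_omega:
  assumes "1 \<le> n" and rc: "rational_continuation q n (omega_integral nv cj n M x) P Q"
    and \<sigma>: "\<sigma> permutes {1..n}"
  shows "cross_rel (\<lambda>z. G1_num q n z * P (q_power q (s_of_z q n z)))
           (\<lambda>z. G1_den q n z * Q (q_power q (s_of_z q n z))) \<sigma>"
proof (cases "\<exists>s. P (q_power q s) \<noteq> 0")
  case False
  thus ?thesis by (simp add: cross_rel_def)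
next
  case True
  then obtain s0 where s0: "P (q_power q s0) \<noteq> 0" by blast
  show ?thesis
  proof (rule functional_equation_of_exchange[OF _ rc _ \<sigma>])
    show "1 < q" using q_ge_2 by simp
    fix i z assume i: "1 \<le> i" "i < n" and z: "z \<in> exchange_region q n i"
    interpret E: haar_exchange nv p k prm cj n M x i
      by unfold_locales (use i in auto)
    have meas: "(\<lambda>h. if h \<in> E.Om then nv (D j h) else 0) \<in> borel_measurable M" if "j \<in> {1..n}" for j
    proof -
      have "(\<lambda>h. if \<forall>j\<in>{1..n}. D j h \<noteq> 0 then nv (D j h) else 0) \<in> borel_measurable M"
        by (rule minors_measurable[OF assms(1) rc s0 that])
      moreover have "(\<lambda>h. if h \<in> E.Om then nv (D j h) else 0) \<in> borel_measurable M \<longleftrightarrow>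
          (\<lambda>h. if \<forall>j\<in>{1..n}. D j h \<noteq> 0 then nv (D j h) else 0) \<in> borel_measurable M"
        by (rule measurable_cong) (simp add: E.Om_def space_M)
      ultimately show ?thesis by blast
    qed
    interpret X: exchange_family nv p k prm cj M E.tr "\<lambda>y h. E.umat y * h" "\<lambda>h. E.wmat * h" n i E.Dm
      by (rule E.exchange_family[OF meas])
    have "omega_integral nv cj n M x = (\<lambda>s. integral\<^sup>L M (X.full s))"
      unfolding fun_eq_iff omega_integral_eq[OF assms(1)] X.full_def[abs_def]
      using E.prod_Dm_eq by (intro allI Bochner_Integration.integral_cong) (auto simp: space_M)
    hence rc': "rational_continuation q n (\<lambda>s. integral\<^sup>L M (X.full s)) P Q" using rc by simp
    show "let U = of_nat q powr (z i - z (Suc i)); \<tau> = Transposition.transpose i (Suc i);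
           p = (\<lambda>z. P (q_power q (s_of_z q n z))); r = (\<lambda>z. Q (q_power q (s_of_z q n z)))
       in r z \<noteq> 0 \<longrightarrow> r (z \<circ> \<tau>) \<noteq> 0 \<longrightarrow>
          (1 + U) * (of_nat q - 1 / U) * p z * r (z \<circ> \<tau>) = (1 + 1 / U) * (of_nat q - U) * p (z \<circ> \<tau>) * r z"
      by (rule X.exchange[OF rc' z])
  qed
qed

end

theorem theorem2p1:
  fixes nv :: "'a::field_char_0 \<Rightarrow> real" and p :: nat and k :: "'a set" and prm :: 'a
    and cj :: "'a \<Rightarrow> 'a" and n q :: nat and M :: "'a mat measure" and x :: "'a mat"
    and \<sigma> :: "nat \<Rightarrow> nat" and z :: "nat \<Rightarrow> complex"
  assumes "unramified_quadratic_extension nv p k prm cj"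
    and "q = residue_card nv k"
    and "n \<ge> 1"
    and "normalized_haar nv (unitary_K nv cj n) M"
    and "x \<in> space_X cj n"
    and "\<sigma> permutes {1..n}"
    and "G1_regular q n z" and "G1_regular q n (z \<circ> \<sigma>)"
    and "omega_regular nv cj q n M x (s_of_z q n z)"
    and "omega_regular nv cj q n M x (s_of_z q n (z \<circ> \<sigma>))"
  shows "G1 q n (z \<circ> \<sigma>) * omega nv cj q n M x (s_of_z q n (z \<circ> \<sigma>))
       = G1 q n z * omega nv cj q n M x (s_of_z q n z)"
proof -
  interpret haar_setup nv p k prm cj n M x
    unfolding haar_setup_def haar_setup_axioms_def
    using assms(1,4,5) by (auto simp: space_X_def unitary_G_def)
  have q: "q > 1" using q_ge_2 assms(2) by simp
  let ?s = "s_of_z q n z" and ?s' = "s_of_z q n (z \<circ> \<sigma>)"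
  let ?f = "omega_integral nv cj n M x"
  obtain P1 Q1 where 1: "rational_continuation q n ?f P1 Q1" "Q1 (q_power q ?s) \<noteq> 0"
    using assms(9) unfolding omega_regular_def by blast
  obtain P2 Q2 where 2: "rational_continuation q n ?f P2 Q2" "Q2 (q_power q ?s') \<noteq> 0"
    using assms(10) unfolding omega_regular_def by blast
  define p1 where "p1 = (\<lambda>z. P1 (q_power q (s_of_z q n z)))"
  define r1 where "r1 = (\<lambda>z. Q1 (q_power q (s_of_z q n z)))"
  define p2 where "p2 = (\<lambda>z. P2 (q_power q (s_of_z q n z)))"
  define r2 where "r2 = (\<lambda>z. Q2 (q_power q (s_of_z q n z)))"
  have poly: "polynomial_fun n P1" "polynomial_fun n Q1" "polynomial_fun n P2" "polynomial_fun n Q2"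
    using 1 2 by (auto simp: rational_continuation_def)
  have le: "line_entire p1" "line_entire r1" "line_entire p2" "line_entire r2"
    unfolding p1_def r1_def p2_def r2_def using poly q
    by (auto intro!: line_entire_s_of_z[of "\<lambda>s. _ (q_power q s)"] polynomial_fun_q_power_line_entire)
  have le_G1: "line_entire (G1_num q n)" "line_entire (G1_den q n)"
    using line_entire_G1 q by auto
  have cross: "G1_num q n z * p1 z * (G1_den q n (z \<circ> \<sigma>) * r1 (z \<circ> \<sigma>))
      = G1_num q n (z \<circ> \<sigma>) * p1 (z \<circ> \<sigma>) * (G1_den q n z * r1 z)" for z
    using cross_rel_omega[OF assms(3) _ assms(6), of P1 Q1] 1(1)
    unfolding assms(2)[symmetric] cross_rel_def p1_def r1_def by blast
  have uniq: "p1 z * r2 z = p2 z * r1 z" for z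
    unfolding p1_def r1_def p2_def r2_def by (rule rational_continuation_unique[OF 1(1) 2(1) q])
  \<comment> \<open>The fraction with nonzero denominator at z may be singular at the permuted
    point, where the second fraction has to be used. The mixed relation follows from the one for the
    first fraction and from uniqueness, after multiplication by the denominator \<open>r1\<close> at
    the permuted point, which is then cancelled.\<close>
  define H where "H = (\<lambda>z. G1_num q n (z \<circ> \<sigma>) * p2 (z \<circ> \<sigma>) * (G1_den q n z * r1 z)
      - G1_num q n z * p1 z * (G1_den q n (z \<circ> \<sigma>) * r2 (z \<circ> \<sigma>)))"
  have H1: "r1 (z \<circ> \<sigma>) * H z = 0" for z
  proof -
    have "r1 (z \<circ> \<sigma>) * H z = G1_num q n (z \<circ> \<sigma>) * (p2 (z \<circ> \<sigma>) * r1 (z \<circ> \<sigma>)) * (G1_den q n z * r1 z)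
        - (G1_num q n z * p1 z * (G1_den q n (z \<circ> \<sigma>) * r1 (z \<circ> \<sigma>))) * r2 (z \<circ> \<sigma>)"
      by (simp add: H_def algebra_simps)
    also have "\<dots> = 0"
      unfolding cross uniq[symmetric] by (simp add: mult_ac)
    finally show ?thesis .
  qed
  have le_H: "line_entire H" "line_entire (\<lambda>z. r1 (z \<circ> \<sigma>))"
    unfolding H_def
    by (intro line_entire_intros le le_G1 line_entire_perm[OF le(2)] line_entire_perm[OF le(3)] line_entire_perm[OF le(4)]
        line_entire_perm[OF le_G1(1)] line_entire_perm[OF le_G1(2)])+
  obtain z1 where z1: "r1 z1 \<noteq> 0"
    using rational_continuation_z_nonzero[OF 1(1) q] unfolding r1_def by blast
  have "bij \<sigma>" using assms(6) by (rule permutes_bij)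
  hence nz: "r1 ((z1 \<circ> inv_into UNIV \<sigma>) \<circ> \<sigma>) \<noteq> 0"
    using z1 by (simp add: comp_assoc bij_is_inj)
  have "H z = 0" by (rule line_entire_mult_eq_0[OF le_H(2,1) H1 nz])
  hence eq: "G1_num q n (z \<circ> \<sigma>) * p2 (z \<circ> \<sigma>) * (G1_den q n z * r1 z)
      = G1_num q n z * p1 z * (G1_den q n (z \<circ> \<sigma>) * r2 (z \<circ> \<sigma>))"
    by (simp add: H_def)
  have den: "G1_den q n z \<noteq> 0" "G1_den q n (z \<circ> \<sigma>) \<noteq> 0"
    using G1_den_nonzero assms(7,8) by auto
  have r: "r1 z \<noteq> 0" "r2 (z \<circ> \<sigma>) \<noteq> 0"
    using 1(2) 2(2) by (auto simp: r1_def r2_def)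
  have om: "omega nv cj q n M x ?s = p1 z / r1 z" "omega nv cj q n M x ?s' = p2 (z \<circ> \<sigma>) / r2 (z \<circ> \<sigma>)"
    using omega_eq[OF 1 q] omega_eq[OF 2 q] by (simp_all only: p1_def r1_def p2_def r2_def)
  show ?thesis
    unfolding om G1_eq times_divide_times_eq using den r eq
    by (subst frac_eq_eq) (auto simp: mult_ac)
qed

end
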